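(* Let $k$ be a perfect field of characteristic $p>0$, $S=k[x_1,\dots,x_N]$, $\mathfrak m=(x_1,\dots,x_N)$ and $R=S_{\mathfrak m}$. Let $f\in\mathfrak m$ be nonzero, and let $\theta\colon F_*S\to S$ be the $S$-module homomorphism $F_*a\mapsto u(F_*(\Delta_1(f^{p-1})a))$. Define an increasing sequence $\{I_n\}_{n\ge 1}$ of ideals of $S$ inductively by $I_1:=(f^{p-1})$ and $I_{n+1}:=\theta(F_*I_n\cap\ker(u))+I_1$. Then $$\operatorname{ht}(R/f)=\inf\{n\mid I_n\nsubseteq \mathfrak m^{[p]}\},$$ where $\inf\emptyset:=\infty$. Furthermore, if $f$ is homogeneous (for the standard grading) and $N\ge 3$, then $$\operatorname{ht}(\operatorname{Proj}(S/f))=\inf\{n\mid I_n\nsubseteq\mathfrak m^{[p]}\}.$$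
   Context: Quasi-$F$-split height: for an $\mathbb F_p$-scheme $X$ and $n\ge1$, let $W_n\mathcal O_X$ be the sheaf of ($p$-typical) Witt vectors of length $n$, $F\colon W_n\mathcal O_X\to F_*W_n\mathcal O_X$ the Frobenius and $R^{n-1}\colon W_n\mathcal O_X\to\mathcal O_X$ the restriction. $X$ is $n$-quasi-$F$-split if there is a $W_n\mathcal O_X$-module homomorphism $\phi\colon F_*W_n\mathcal O_X\to\mathcal O_X$ with $\phi\circ F=R^{n-1}$. The height $\operatorname{ht}(X)$ is the infimum of the $n\ge1$ such that $X$ is $n$-quasi-$F$-split ($\infty$ if none exists); for a ring $B$, $\operatorname{ht}(B):=\operatorname{ht}(\operatorname{Spec}B)$. Notation: for an $S$-module $M$, $F_*M$ is $M$ with $S$-action $a\cdot F_*m=F_*(a^pm)$. $F_*S$ is free over $S$ with basis $\{F_*(x_1^{i_1}\cdots x_N^{i_N})\mid 0\le i_j\le p-1\}$, and $u\in\operatorname{Hom}_S(F_*S,S)$ is the dual basis element of $F_*((x_1\cdots x_N)^{p-1})$. For an ideal $I$, $I^{[p]}$ is the ideal generated by $\{a^p\mid a\in I\}$. The map $\Delta_1\colon S\to S$: for $a\in S$ with monomial decomposition $a=\sum_{i=1}^m M_i$ (each $M_i$ a scalar times a monic monomial, the monic monomials distinct), $\Delta_1(a)$ is defined by $(0,\Delta_1(a))=(a,0)-\sum_i(M_i,0)$ in $W_2(S)$; explicitly $$\Delta_1(a)=\sum_{\substack{0\le\alpha_1,\dots,\alpha_m\le p-1\\ \alpha_1+\cdots+\alpha_m=p}}\frac1p\binom{p}{\alpha_1,\dots,\alpha_m}M_1^{\alpha_1}\cdots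 M_m^{\alpha_m}.$$ *)

theory Defs
  imports
    "HOL-Algebra.Algebra"
    "HOL-Algebra.Algebraic_Closure_Type"
    "HOL-Analysis.Function_Topology"
    "HOL-Library.Poly_Mapping"
    "HOL-Library.Extended_Nat"
    "HOL-Library.Cardinality"
begin

section \<open>Witt vectors of finite length\<close>

text \<open>Integer polynomials in the variables \<open>X 0, X 1, \<dots>\<close> (indexed by \<^const>\<open>Inl\<close>) and
  \<open>Y 0, Y 1, \<dots>\<close> (indexed by \<^const>\<open>Inr\<close>).\<close>

type_synonym witt_poly = "((nat + nat) \<Rightarrow>\<^sub>0 nat) \<Rightarrow>\<^sub>0 int"

definition witt_var :: "nat + nat \<Rightarrow> witt_poly" where
  "witt_var v = Poly_Mapping.single (Poly_Mapping.single v 1) 1"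

definition ghost :: "nat \<Rightarrow> nat \<Rightarrow> (nat \<Rightarrow> witt_poly) \<Rightarrow> witt_poly" where
  "ghost p n s = (\<Sum>i\<le>n. of_nat (p ^ i) * s i ^ (p ^ (n - i)))"

text \<open>By Witt's theorem these polynomials exist for \<open>p\<close> prime; they are unique because the
  ghost map is injective over the torsion-free ring of integer polynomials.\<close>

definition witt_add_poly :: "nat \<Rightarrow> nat \<Rightarrow> witt_poly" where
  "witt_add_poly p = (THE s. \<forall>n. ghost p n s
     = ghost p n (\<lambda>i. witt_var (Inl i)) + ghost p n (\<lambda>i. witt_var (Inr i)))"

definition witt_mult_poly :: "nat \<Rightarrow> nat \<Rightarrow> witt_poly" where
  "witt_mult_poly p = (THE s. \<forall>n. ghost p n s
     = ghost p n (\<lambda>i. witt_var (Inl i)) * ghost p n (\<lambda>i. witt_var (Inr i)))"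

definition witt_poly_eval :: "('a, 'b) ring_scheme \<Rightarrow> (nat + nat \<Rightarrow> 'a) \<Rightarrow> witt_poly \<Rightarrow> 'a" where
  "witt_poly_eval A v P = (\<Oplus>\<^bsub>A\<^esub>m \<in> Poly_Mapping.keys P. [Poly_Mapping.lookup P m] \<cdot>\<^bsub>A\<^esub>
     (\<Otimes>\<^bsub>A\<^esub>i \<in> Poly_Mapping.keys m. v i [^]\<^bsub>A\<^esub> Poly_Mapping.lookup m i))"

definition witt_ring :: "nat \<Rightarrow> nat \<Rightarrow> ('a, 'b) ring_scheme \<Rightarrow> (nat \<Rightarrow> 'a) ring" where
  "witt_ring p n A = \<lparr>
     carrier = (\<Pi>\<^sub>E i\<in>{..<n}. carrier A),
     monoid.mult = (\<lambda>a b. \<lambda>i\<in>{..<n}. witt_poly_eval A (case_sum a b) (witt_mult_poly p i)),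
     one = (\<lambda>i\<in>{..<n}. if i = 0 then \<one>\<^bsub>A\<^esub> else \<zero>\<^bsub>A\<^esub>),
     ring.zero = (\<lambda>i\<in>{..<n}. \<zero>\<^bsub>A\<^esub>),
     add = (\<lambda>a b. \<lambda>i\<in>{..<n}. witt_poly_eval A (case_sum a b) (witt_add_poly p i)) \<rparr>"

definition witt_map :: "nat \<Rightarrow> ('a \<Rightarrow> 'b) \<Rightarrow> (nat \<Rightarrow> 'a) \<Rightarrow> nat \<Rightarrow> 'b" where
  "witt_map n g a = (\<lambda>i\<in>{..<n}. g (a i))"

text \<open>Over a ring of characteristic \<open>p\<close>, the Witt vector Frobenius raises every
  component to the \<open>p\<close>-th power.\<close>

definition witt_frob :: "nat \<Rightarrow> nat \<Rightarrow> ('a, 'b) ring_scheme \<Rightarrow> (nat \<Rightarrow> 'a) \<Rightarrow> nat \<Rightarrow> 'a" where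
  "witt_frob p n A = witt_map n (\<lambda>x. x [^]\<^bsub>A\<^esub> p)"

text \<open>The iterated restriction \<open>R\<^sup>n\<^sup>-\<^sup>1\<close> from length \<open>n\<close> to length \<open>1\<close>.\<close>

definition witt_res :: "(nat \<Rightarrow> 'a) \<Rightarrow> 'a" where
  "witt_res a = a 0"


section \<open>Ringed spaces and quasi-F-split height\<close>

record ('x, 's) ringed_space =
  zariski :: "'x topology"
  sheaf :: "'x set \<Rightarrow> 's ring"
  restr :: "'x set \<Rightarrow> 'x set \<Rightarrow> 's \<Rightarrow> 's"

text \<open>The sheaf of Witt vectors has the sections \<open>witt_ring p n (sheaf Y U)\<close>, with componentwise
  restriction maps. A ring element \<open>a\<close> acts on its Frobenius pushforward as multiplication by
  \<open>F a\<close>, and on the structure sheaf as multiplication by \<open>R\<^sup>n\<^sup>-\<^sup>1 a\<close>. The map \<open>\<psi>\<close> below is a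
  morphism of sheaves of modules, given by its components on open sets.\<close>

definition witt_module_hom ::
  "nat \<Rightarrow> nat \<Rightarrow> ('x, 's) ringed_space \<Rightarrow> ('x set \<Rightarrow> (nat \<Rightarrow> 's) \<Rightarrow> 's) \<Rightarrow> bool" where
  "witt_module_hom p n Y \<psi> \<longleftrightarrow>
     (\<forall>U. openin (zariski Y) U \<longrightarrow>
        (let A = sheaf Y U; W = witt_ring p n A in
          \<psi> U \<in> carrier W \<rightarrow> carrier A \<and>
          (\<forall>a\<in>carrier W. \<forall>b\<in>carrier W. \<psi> U (a \<oplus>\<^bsub>W\<^esub> b) = \<psi> U a \<oplus>\<^bsub>A\<^esub> \<psi> U b) \<and>
          (\<forall>a\<in>carrier W. \<forall>b\<in>carrier W.
             \<psi> U (witt_frob p n A a \<otimes>\<^bsub>W\<^esub> b) = witt_res a \<otimes>\<^bsub>A\<^esub> \<psi> U b) \<and>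
          (\<forall>V. openin (zariski Y) V \<and> V \<subseteq> U \<longrightarrow>
             (\<forall>a\<in>carrier W. \<psi> V (witt_map n (restr Y U V) a) = restr Y U V (\<psi> U a)))))"

definition quasi_F_split :: "nat \<Rightarrow> nat \<Rightarrow> ('x, 's) ringed_space \<Rightarrow> bool" where
  "quasi_F_split p n Y \<longleftrightarrow>
     (\<exists>\<psi>. witt_module_hom p n Y \<psi> \<and>
        (\<forall>U. openin (zariski Y) U \<longrightarrow>
           (\<forall>a\<in>carrier (witt_ring p n (sheaf Y U)).
              \<psi> U (witt_frob p n (sheaf Y U) a) = witt_res a)))"

definition ht :: "nat \<Rightarrow> ('x, 's) ringed_space \<Rightarrow> enat" where
  "ht p Y = Inf {enat n | n. 1 \<le> n \<and> quasi_F_split p n Y}"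


section \<open>Localization, Spec and Proj\<close>

text \<open>The fraction \<open>a / s\<close> in the localization of \<open>A\<close> at the multiplicative set \<open>T\<close>, as an
  equivalence class of pairs.\<close>

definition loc_frac :: "('a, 'b) ring_scheme \<Rightarrow> 'a set \<Rightarrow> 'a \<Rightarrow> 'a \<Rightarrow> ('a \<times> 'a) set" where
  "loc_frac A T a s = {(b, t). b \<in> carrier A \<and> t \<in> T \<and>
     (\<exists>r\<in>T. r \<otimes>\<^bsub>A\<^esub> (a \<otimes>\<^bsub>A\<^esub> t) = r \<otimes>\<^bsub>A\<^esub> (b \<otimes>\<^bsub>A\<^esub> s))}"

definition localization :: "('a, 'b) ring_scheme \<Rightarrow> 'a set \<Rightarrow> ('a \<times> 'a) set ring" where
  "localization A T = \<lparr>
     carrier = {loc_frac A T a s | a s. a \<in> carrier A \<and> s \<in> T},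
     monoid.mult = (\<lambda>x y. \<Union>(a, s)\<in>x. \<Union>(b, t)\<in>y. loc_frac A T (a \<otimes>\<^bsub>A\<^esub> b) (s \<otimes>\<^bsub>A\<^esub> t)),
     one = loc_frac A T \<one>\<^bsub>A\<^esub> \<one>\<^bsub>A\<^esub>,
     ring.zero = loc_frac A T \<zero>\<^bsub>A\<^esub> \<one>\<^bsub>A\<^esub>,
     add = (\<lambda>x y. \<Union>(a, s)\<in>x. \<Union>(b, t)\<in>y.
       loc_frac A T ((a \<otimes>\<^bsub>A\<^esub> t) \<oplus>\<^bsub>A\<^esub> (b \<otimes>\<^bsub>A\<^esub> s)) (s \<otimes>\<^bsub>A\<^esub> t)) \<rparr>"

text \<open>The sheaf of functions with values in the given stalks that locally satisfy \<open>L\<close>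
  (\<open>L V s\<close> will say that \<open>s\<close> is given by a single fraction on \<open>V\<close>).\<close>

definition function_sheaf ::
  "'x topology \<Rightarrow> ('x \<Rightarrow> 's ring) \<Rightarrow> ('x set \<Rightarrow> ('x \<Rightarrow> 's) \<Rightarrow> bool) \<Rightarrow> ('x, 'x \<Rightarrow> 's) ringed_space" where
  "function_sheaf T stalk L = \<lparr>
     zariski = T,
     sheaf = (\<lambda>U. \<lparr>
       carrier = {s \<in> (\<Pi>\<^sub>E x\<in>U. carrier (stalk x)).
         \<forall>x\<in>U. \<exists>V. openin T V \<and> x \<in> V \<and> V \<subseteq> U \<and> L V s},
       monoid.mult = (\<lambda>s t. \<lambda>x\<in>U. s x \<otimes>\<^bsub>stalk x\<^esub> t x),
       one = (\<lambda>x\<in>U. \<one>\<^bsub>stalk x\<^esub>),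
       ring.zero = (\<lambda>x\<in>U. \<zero>\<^bsub>stalk x\<^esub>),
       add = (\<lambda>s t. \<lambda>x\<in>U. s x \<oplus>\<^bsub>stalk x\<^esub> t x) \<rparr>),
     restr = (\<lambda>U V s. restrict s V) \<rparr>"

definition Spec :: "('a, 'b) ring_scheme \<Rightarrow> ('a set, 'a set \<Rightarrow> ('a \<times> 'a) set) ringed_space" where
  "Spec B = function_sheaf
     (topology_generated_by {{P. primeideal P B \<and> h \<notin> P} | h. h \<in> carrier B})
     (\<lambda>P. localization B (carrier B - P))
     (\<lambda>V s. \<exists>a\<in>carrier B. \<exists>h\<in>carrier B. \<forall>P\<in>V. h \<notin> P \<and> s P = loc_frac B (carrier B - P) a h)"

text \<open>In the following, \<open>G d\<close> is the degree \<open>d\<close> component of a graded ring \<open>B\<close>. The stalk at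
  \<open>P\<close> is the degree \<open>0\<close> part of the localization at the homogeneous elements outside \<open>P\<close>.\<close>

definition proj_points :: "('a, 'b) ring_scheme \<Rightarrow> (nat \<Rightarrow> 'a set) \<Rightarrow> 'a set set" where
  "proj_points B G = {P. primeideal P B \<and> P = Idl\<^bsub>B\<^esub> (P \<inter> (\<Union>d. G d)) \<and> (\<exists>d>0. \<not> G d \<subseteq> P)}"

definition proj_stalk ::
  "('a, 'b) ring_scheme \<Rightarrow> (nat \<Rightarrow> 'a set) \<Rightarrow> 'a set \<Rightarrow> ('a \<times> 'a) set ring" where
  "proj_stalk B G P = (localization B ((\<Union>d. G d) - P))
     \<lparr>carrier := {loc_frac B ((\<Union>d. G d) - P) a h | a h d. a \<in> G d \<and> h \<in> G d \<and> h \<notin> P}\<rparr>"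

definition Proj ::
  "('a, 'b) ring_scheme \<Rightarrow> (nat \<Rightarrow> 'a set) \<Rightarrow> ('a set, 'a set \<Rightarrow> ('a \<times> 'a) set) ringed_space" where
  "Proj B G = function_sheaf
     (topology_generated_by {{P \<in> proj_points B G. h \<notin> P} | h. h \<in> (\<Union>d. G d)})
     (proj_stalk B G)
     (\<lambda>V s. \<exists>d. \<exists>a\<in>G d. \<exists>h\<in>G d. \<forall>P\<in>V. h \<notin> P \<and> s P = loc_frac B ((\<Union>d. G d) - P) a h)"


section \<open>The polynomial ring\<close>

text \<open>Polynomials over \<open>'k\<close> in the variables indexed by the finite type \<open>'n\<close>, so that
  \<open>N = CARD('n)\<close>.\<close>

type_synonym ('n, 'k) mpoly = "('n \<Rightarrow>\<^sub>0 nat) \<Rightarrow>\<^sub>0 'k"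

abbreviation S_ring :: "('n, 'k::field) mpoly ring" where
  "S_ring \<equiv> ring_of_type_algebra"

definition mvar :: "'n \<Rightarrow> ('n, 'k::field) mpoly" where
  "mvar j = Poly_Mapping.single (Poly_Mapping.single j 1) 1"

definition max_ideal :: "('n, 'k::field) mpoly set" where
  "max_ideal = Idl\<^bsub>S_ring\<^esub> (range mvar)"

definition frob_power :: "nat \<Rightarrow> ('n, 'k::field) mpoly set \<Rightarrow> ('n, 'k) mpoly set" where
  "frob_power p I = Idl\<^bsub>S_ring\<^esub> {a ^ p | a. a \<in> I}"

definition homogeneous :: "nat \<Rightarrow> ('n::finite, 'k::field) mpoly \<Rightarrow> bool" where
  "homogeneous d f \<longleftrightarrow> (\<forall>m\<in>Poly_Mapping.keys f. (\<Sum>j\<in>UNIV. Poly_Mapping.lookup m j) = d)"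

definition quotient_grading :: "('n::finite, 'k::field) mpoly \<Rightarrow> nat \<Rightarrow> ('n, 'k) mpoly set set" where
  "quotient_grading f d = {PIdl\<^bsub>S_ring\<^esub> f +>\<^bsub>S_ring\<^esub> g | g. homogeneous d g}"


section \<open>The ideals of the criterion\<close>

text \<open>Writing \<open>u (F\<^sub>* a)\<close> as \<open>u a\<close>: \<open>S\<close>-linearity on \<open>F\<^sub>* S\<close> means \<open>u (a\<^sup>p b) = a u(b)\<close>. For
  \<open>'k\<close> perfect of characteristic \<open>p\<close> the monomials below form a basis, so \<open>u\<close> exists and
  is unique.\<close>

definition frob_linear :: "nat \<Rightarrow> (('n, 'k::field) mpoly \<Rightarrow> ('n, 'k) mpoly) \<Rightarrow> bool" where
  "frob_linear p u \<longleftrightarrow> (\<forall>a b. u (a + b) = u a + u b) \<and> (\<forall>a b. u (a ^ p * b) = a * u b)"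

definition u_map :: "nat \<Rightarrow> ('n, 'k::field) mpoly \<Rightarrow> ('n, 'k) mpoly" where
  "u_map p = (THE u. frob_linear p u \<and>
     (\<forall>i. (\<forall>j. Poly_Mapping.lookup i j \<le> p - 1) \<longrightarrow>
        u (Poly_Mapping.single i 1) = (if \<forall>j. Poly_Mapping.lookup i j = p - 1 then 1 else 0)))"

text \<open>The index \<open>m\<close> runs over the exponents of the monomials occurring in \<open>a\<close>. The divisions of
  natural numbers are exact for \<open>p\<close> prime, as all \<open>\<alpha> m < p\<close>.\<close>

definition Delta1 :: "nat \<Rightarrow> ('n, 'k::field) mpoly \<Rightarrow> ('n, 'k) mpoly" where
  "Delta1 p a =
     (\<Sum>\<alpha> | \<alpha> \<in> (\<Pi>\<^sub>E m\<in>Poly_Mapping.keys a. {0..p - 1}) \<and> (\<Sum>m\<in>Poly_Mapping.keys a. \<alpha> m) = p.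
        of_nat ((fact p div (\<Prod>m\<in>Poly_Mapping.keys a. fact (\<alpha> m))) div p) *
        (\<Prod>m\<in>Poly_Mapping.keys a. Poly_Mapping.single m (Poly_Mapping.lookup a m) ^ \<alpha> m))"

definition theta ::
  "nat \<Rightarrow> ('n, 'k::field) mpoly \<Rightarrow> ('n, 'k) mpoly \<Rightarrow> ('n, 'k) mpoly" where
  "theta p f a = u_map p (Delta1 p (f ^ (p - 1)) * a)"

text \<open>The sequence starts at index \<open>1\<close>; the value at \<open>0\<close> is a dummy.\<close>

fun I_seq :: "nat \<Rightarrow> ('n, 'k::field) mpoly \<Rightarrow> nat \<Rightarrow> ('n, 'k) mpoly set" where
  "I_seq p f 0 = {}"
| "I_seq p f (Suc 0) = PIdl\<^bsub>S_ring\<^esub> (f ^ (p - 1))"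
| "I_seq p f (Suc (Suc n)) =
     theta p f ` (I_seq p f (Suc n) \<inter> {a. u_map p a = 0}) <+>\<^bsub>S_ring\<^esub> I_seq p f (Suc 0)"

definition I_height :: "nat \<Rightarrow> ('n, 'k::field) mpoly \<Rightarrow> enat" where
  "I_height p f = Inf {enat n | n. 1 \<le> n \<and> \<not> I_seq p f n \<subseteq> frob_power p max_ideal}"

abbreviation R_ring :: "(('n, 'k::field) mpoly \<times> ('n, 'k) mpoly) set ring" where
  "R_ring \<equiv> localization S_ring (UNIV - max_ideal)"

definition local_quotient ::
  "('n, 'k::field) mpoly \<Rightarrow> (('n, 'k) mpoly \<times> ('n, 'k) mpoly) set set ring" where
  "local_quotient f = R_ring Quot (PIdl\<^bsub>R_ring\<^esub> (loc_frac S_ring (UNIV - max_ideal) f 1))"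

definition graded_quotient :: "('n, 'k::field) mpoly \<Rightarrow> ('n, 'k) mpoly set ring" where
  "graded_quotient f = S_ring Quot (PIdl\<^bsub>S_ring\<^esub> f)"

end

theory Submission
  imports Defs
begin

text \<open>In the Witt vectors of \<open>S\<close> let \<open>\<tau>(a)\<close> be the sum of the Teichmueller lifts of the monomials
  of \<open>a\<close>, and let \<open>D = \<Delta>\<^sub>1(f)\<close>. For a monomial \<open>a\<close> the vector \<open>[f a]\<close> is congruent to
  \<open>\<tau>(f a) + V \<tau>(a\<^sup>p D)\<close> modulo \<open>p\<close> and vectors all of whose components are divisible by \<open>f\<close>.
  A module homomorphism \<open>\<phi>\<close> as in the definition of the height kills \<open>p\<close>, so it is determined by
  the additive maps \<open>\<Lambda>\<^sub>i(a) = \<phi>(V\<^sup>i \<tau>(a))\<close> for \<open>i < n\<close>. These satisfy \<open>\<Lambda>\<^sub>i(c\<^sup>q a) = c \<Lambda>\<^sub>i(a)\<close> for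
  \<open>q = p^(i+1)\<close>, \<open>\<Lambda>\<^sub>i(c\<^sup>p) = 0\<close> for \<open>i \<ge> 1\<close>, \<open>\<Lambda>\<^sub>i(f a) + \<Lambda>\<^sub>i\<^sub>+\<^sub>1(a\<^sup>p D) = 0\<close> and \<open>\<Lambda>\<^sub>0(1) = 1\<close>.
  Duality for the Frobenius gives \<open>\<Lambda>\<^sub>i(a) = u^(i+1)(f^(q-p) g\<^sub>n\<^sub>-\<^sub>i a)\<close>, and since
  \<open>\<Delta>\<^sub>1(f^(p-1))\<close> equals \<open>- f^(p(p-2)) D\<close> up to a \<open>p\<close>-th power, the relations become
  \<open>g\<^sub>j \<in> I\<^sub>j\<close>, \<open>u(g\<^sub>j) = 0\<close> for \<open>j < n\<close> and \<open>g\<^sub>j\<^sub>+\<^sub>1 = \<theta>(g\<^sub>j)\<close> modulo \<open>f^(p-1)\<close>. The condition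
  \<open>\<Lambda>\<^sub>0(1) = 1\<close> can be met exactly if \<open>g\<^sub>n\<close> may be chosen outside \<open>m^[p]\<close>. Conversely the maps \<open>\<Lambda>\<^sub>i\<close>
  built from such a chain define \<open>\<phi>\<close> on Witt vectors by peeling off one component at a time.

  On the spectrum of the local ring the maps \<open>\<Lambda>\<^sub>i\<close> are read off at the closed point. On the
  projective scheme a Witt vector with homogeneous components is divided by powers of a variable to
  give sections over the standard open sets; their images under \<open>\<phi>\<close> glue to an element of \<open>S/f\<close>,
  because three variables suffice to kill the obstruction.\<close>

text \<open>Homomorphisms kill p because their target has characteristic p; as p = V F, the work
  takes place modulo p, where tau is a ring homomorphism from S to W(S)/p. Perfectness of k enters
  here: Teichmueller lifts of scalars add up modulo p because scalars have p-th roots.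

  The obstacle in the forward direction is that values lie in S/f or a localization of it. A
  representing polynomial exists only up to multiplication by polynomials with nonzero constant
  term, and it satisfies u(g) = 0 at first only up to such a multiplier and modulo f. Multipliers
  are absorbed because p-th powers pass through u and theta; the defect modulo f is repaired by
  subtracting a multiple of f^p.

  The exponents p^(i+1) come from linearity over Frobenius images only: a denominator h can be moved
  through a homomorphism only as F[h], which multiplies component i by h^(p^(i+1)). This fixes the
  degrees and denominators used for both schemes. The power f^(q-p) has a similar origin: it
  complements the generator f^(p-1) of I_1 to f^(q-1), the exponent in the description of
  functionals modulo f.\<close>

abbreviation keys :: "('a \<Rightarrow>\<^sub>0 'b::zero) \<Rightarrow> 'a set" where "keys \<equiv> Poly_Mapping.keys"
abbreviation lookup :: "('a \<Rightarrow>\<^sub>0 'b::zero) \<Rightarrow> 'a \<Rightarrow> 'b" where "lookup \<equiv> Poly_Mapping.lookup"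
abbreviation single :: "'a \<Rightarrow> 'b::zero \<Rightarrow> 'a \<Rightarrow>\<^sub>0 'b" where "single \<equiv> Poly_Mapping.single"

abbreviation nprime :: "nat \<Rightarrow> bool" where "nprime \<equiv> normalization_semidom_class.prime"

section \<open>Evaluation of polynomials\<close>

lemma poly_mapping_sum_singles:
  fixes a :: "'m \<Rightarrow>\<^sub>0 'c::comm_monoid_add"
  shows "a = (\<Sum>m\<in>keys a. single m (lookup a m))"
  by (rule poly_mapping_eqI)
     (auto simp: lookup_sum lookup_single when_def in_keys_iff)

lemma poly_mapping_induct_add [case_names zero single add]:
  fixes a :: "'m \<Rightarrow>\<^sub>0 'c::comm_monoid_add"
  assumes "P 0" "\<And>m c. P (single m c)" "\<And>a b. P a \<Longrightarrow> P b \<Longrightarrow> P (a + b)"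
  shows "P a"
proof -
  have "P (\<Sum>m\<in>A. single m (lookup a m))" if "finite A" for A
    using that by induction (use assms in auto)
  thus ?thesis by (subst poly_mapping_sum_singles) simp
qed

text \<open>\<open>\<kappa>\<close> acts on coefficients and \<open>\<phi>\<close> on exponents. The
  two uses are the evaluation of integer polynomials and, in \<open>mpoly_mult_eq_0\<close>, a
  renaming of variables.\<close>

definition pm_hom :: "('c::zero \<Rightarrow> 'b::comm_ring_1) \<Rightarrow> ('m \<Rightarrow> 'b) \<Rightarrow> ('m \<Rightarrow>\<^sub>0 'c) \<Rightarrow> 'b" where
  "pm_hom \<kappa> \<phi> a = (\<Sum>m\<in>keys a. \<kappa> (lookup a m) * \<phi> m)"

lemma pm_hom_superset:
  assumes "finite A" "keys a \<subseteq> A" "\<kappa> 0 = 0"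
  shows "pm_hom \<kappa> \<phi> a = (\<Sum>m\<in>A. \<kappa> (lookup a m) * \<phi> m)"
  unfolding pm_hom_def using assms
  by (intro sum.mono_neutral_left) (auto simp: in_keys_iff)

lemma pm_hom_zero [simp]: "pm_hom \<kappa> \<phi> 0 = 0"
  by (simp add: pm_hom_def)

lemma pm_hom_single: "\<kappa> 0 = 0 \<Longrightarrow> pm_hom \<kappa> \<phi> (single m c) = \<kappa> c * \<phi> m"
  by (subst pm_hom_superset[of "{m}"]) auto

lemma pm_hom_add:
  assumes "\<kappa> 0 = 0" "\<And>x y. \<kappa> (x + y) = \<kappa> x + \<kappa> y"
  shows "pm_hom \<kappa> \<phi> (a + b) = pm_hom \<kappa> \<phi> a + pm_hom \<kappa> \<phi> b"
proof -
  have k: "keys (a + b) \<subseteq> keys a \<union> keys b" by (rule Poly_Mapping.keys_add)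
  have "pm_hom \<kappa> \<phi> c = (\<Sum>m\<in>keys a \<union> keys b. \<kappa> (lookup c m) * \<phi> m)" if "keys c \<subseteq> keys a \<union> keys b" for c
    using that assms(1) by (intro pm_hom_superset) auto
  from this[OF k] this[of a] this[of b] show ?thesis
    by (simp add: lookup_add assms(2) distrib_right sum.distrib)
qed

lemma pm_hom_mult:
  fixes \<phi> :: "'m::comm_monoid_add \<Rightarrow> 'b::comm_ring_1" and \<kappa> :: "'c::comm_ring_1 \<Rightarrow> 'b"
  assumes "\<kappa> 0 = 0" "\<And>x y. \<kappa> (x + y) = \<kappa> x + \<kappa> y" "\<And>x y. \<kappa> (x * y) = \<kappa> x * \<kappa> y"
    "\<And>m n. \<phi> (m + n) = \<phi> m * \<phi> n"
  shows "pm_hom \<kappa> \<phi> (a * b) = pm_hom \<kappa> \<phi> a * pm_hom \<kappa> \<phi> b"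
proof (induction a rule: poly_mapping_induct_add)
  case (single m c)
  show ?case
    by (induction b rule: poly_mapping_induct_add)
       (simp_all add: pm_hom_single pm_hom_add assms distrib_left mult_single mult.assoc mult.left_commute)
qed (simp_all add: pm_hom_add assms distrib_right)

definition mpow :: "('v \<Rightarrow> 'b::comm_monoid_mult) \<Rightarrow> ('v \<Rightarrow>\<^sub>0 nat) \<Rightarrow> 'b" where
  "mpow v m = (\<Prod>i\<in>keys m. v i ^ lookup m i)"

lemma mpow_superset:
  assumes "finite A" "keys m \<subseteq> A"
  shows "mpow v m = (\<Prod>i\<in>A. v i ^ lookup m i)"
  unfolding mpow_def using assms
  by (intro prod.mono_neutral_left) (auto simp: in_keys_iff)

lemma mpow_zero [simp]: "mpow v 0 = 1"
  by (simp add: mpow_def)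

lemma mpow_single [simp]: "mpow v (single i n) = v i ^ n"
  by (subst mpow_superset[of "{i}"]) auto

lemma mpow_add: "mpow v (m + n) = mpow v m * mpow v n"
proof -
  have f: "finite (keys m \<union> keys n)" by simp
  show ?thesis
    using Poly_Mapping.keys_add[of m n]
    by (simp add: mpow_superset[OF f] lookup_add power_add prod.distrib)
qed

lemma mpow_power: 
  fixes v :: "'v \<Rightarrow> 'b::comm_ring_1"
  shows "mpow (\<lambda>i. v i ^ k) m = mpow v m ^ k"
  unfolding mpow_def prod_power_distrib by (simp add: mult.commute flip: power_mult)

definition peval :: "('v \<Rightarrow> 'b::comm_ring_1) \<Rightarrow> (('v \<Rightarrow>\<^sub>0 nat) \<Rightarrow>\<^sub>0 int) \<Rightarrow> 'b" where
  "peval v = pm_hom of_int (mpow v)"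

lemma peval_add [simp]: "peval v (P + Q) = peval v P + peval v Q"
  by (simp add: peval_def pm_hom_add)

lemma peval_mult [simp]: "peval v (P * Q) = peval v P * peval v Q"
  by (simp add: peval_def pm_hom_mult mpow_add)

lemma peval_0 [simp]: "peval v 0 = 0"
  by (simp add: peval_def)

lemma peval_single: "peval v (single m c) = of_int c * mpow v m"
  by (simp add: peval_def pm_hom_single)

lemma peval_1 [simp]: "peval v 1 = 1"
  using peval_single[of v 0 1] by simp

lemma peval_minus [simp]: "peval v (- P) = - peval v P"
  using peval_add[of v P "-P"] by (simp add: eq_neg_iff_add_eq_0 add.commute)

lemma peval_diff [simp]: "peval v (P - Q) = peval v P - peval v Q"
  using peval_add[of v P "-Q"] by simp

lemma peval_power [simp]: "peval v (P ^ n) = peval v P ^ n"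
  by (induction n) auto

lemma peval_sum [simp]: "peval v (sum g A) = (\<Sum>x\<in>A. peval v (g x))"
  by (induction A rule: infinite_finite_induct) auto

lemma peval_of_nat [simp]: "peval v (of_nat n) = of_nat n"
  by (induction n) auto

text \<open>This replaces the passage from W(S) to W(S/f): the Witt operations respect componentwise
  congruence modulo \<open>f\<close>, so no type for S/f has to be formed.\<close>

lemma peval_dvd_cong:
  assumes "\<And>i. d dvd v i - w i"
  shows "d dvd peval v P - peval w P"
proof -
  have m: "d dvd mpow v m - mpow w m" for m
  proof -
    have "d dvd (\<Prod>i\<in>A. v i ^ lookup m i) - (\<Prod>i\<in>A. w i ^ lookup m i)" if "finite A" for A
      using that
    proof induction
      case (insert x F)
      have "d dvd v x ^ lookup m x - w x ^ lookup m x"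
        by (rule dvd_trans[OF assms[of x]]) (auto simp: power_diff_sumr2)
      hence "d dvd (v x ^ lookup m x - w x ^ lookup m x) * (\<Prod>i\<in>F. v i ^ lookup m i)
          + w x ^ lookup m x * ((\<Prod>i\<in>F. v i ^ lookup m i) - (\<Prod>i\<in>F. w i ^ lookup m i))"
        using insert.IH by (intro dvd_add) (auto intro: dvd_mult dvd_mult2)
      thus ?case using insert by (simp add: algebra_simps)
    qed simp
    thus ?thesis by (simp add: mpow_def)
  qed
  have "d dvd (\<Sum>m\<in>keys P. of_int (lookup P m) * (mpow v m - mpow w m))"
    by (intro dvd_sum dvd_mult m)
  thus ?thesis by (simp add: peval_def pm_hom_def algebra_simps sum_subtractf)
qed

definition pvar :: "'v \<Rightarrow> (('v \<Rightarrow>\<^sub>0 nat) \<Rightarrow>\<^sub>0 'c::comm_ring_1)" where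
  "pvar v = single (single v 1) 1"

lemma peval_pvar [simp]: "peval v (pvar i) = v i"
  by (simp add: pvar_def peval_single)

lemma pvar_power: "pvar v ^ n = single (single v n) 1"
  by (induction n) (simp_all add: pvar_def mult_single flip: single_add)

lemma mpow_pvar: "mpow pvar m = single m 1"
  by (induction m rule: poly_mapping_induct_add) (simp_all add: mpow_add mult_single pvar_power)

lemma peval_peval: "peval v (peval w P) = peval (\<lambda>i. peval v (w i)) P"
  for w :: "'v \<Rightarrow> ('u \<Rightarrow>\<^sub>0 nat) \<Rightarrow>\<^sub>0 int"
proof -
  have "peval v (mpow w m) = mpow (\<lambda>i. peval v (w i)) m" for m
  proof -
    have "peval v (\<Prod>i\<in>A. w i ^ lookup m i) = (\<Prod>i\<in>A. peval v (w i) ^ lookup m i)" for A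
      by (induction A rule: infinite_finite_induct) auto
    thus ?thesis by (simp add: mpow_def)
  qed
  moreover have "peval v (of_int c) = of_int c" for c
    using peval_single[of v 0 c] single_of_int[of c, where ?'a = "'u \<Rightarrow>\<^sub>0 nat" and ?'b = int] by simp
  ultimately show ?thesis
    by (subst (2 3) peval_def) (simp add: pm_hom_def)
qed

lemma lookup_of_nat_mult:
  fixes P :: "'m::comm_monoid_add \<Rightarrow>\<^sub>0 'c::comm_ring_1"
  shows "lookup (of_nat n * P) m = of_nat n * lookup P m"
  by (induction n) (simp_all add: lookup_add algebra_simps)

lemma int_poly_torsion_free:
  fixes P Q :: "'m::comm_monoid_add \<Rightarrow>\<^sub>0 int"
  assumes "of_nat n * P = of_nat n * Q" "n > 0"
  shows "P = Q"
proof (rule poly_mapping_eqI)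
  fix m
  have "of_nat n * lookup P m = of_nat n * lookup Q m"
    using assms(1) by (metis lookup_of_nat_mult)
  thus "lookup P m = lookup Q m" using assms(2) by simp
qed

section \<open>Weighted homogeneous polynomials\<close>

definition wdeg :: "('v \<Rightarrow> nat) \<Rightarrow> ('v \<Rightarrow>\<^sub>0 nat) \<Rightarrow> nat" where
  "wdeg wt m = (\<Sum>i\<in>keys m. lookup m i * wt i)"

lemma wdeg_superset:
  assumes "finite A" "keys m \<subseteq> A"
  shows "wdeg wt m = (\<Sum>i\<in>A. lookup m i * wt i)"
  unfolding wdeg_def using assms
  by (intro sum.mono_neutral_left) (auto simp: in_keys_iff)

lemma wdeg_zero [simp]: "wdeg wt 0 = 0"
  by (simp add: wdeg_def)

lemma wdeg_single [simp]: "wdeg wt (single i n) = n * wt i"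
  by (subst wdeg_superset[of "{i}"]) auto

lemma wdeg_add: "wdeg wt (m + n) = wdeg wt m + wdeg wt n"
proof -
  have f: "finite (keys m \<union> keys n)" by simp
  show ?thesis
    using Poly_Mapping.keys_add[of m n]
    by (simp add: wdeg_superset[OF f] lookup_add distrib_right sum.distrib)
qed

text \<open>The weights vary with the use: \<open>d p^j\<close> on the j-th variables of a Witt
  polynomial, all ones for the standard grading, all zeros to treat the affine case as a graded
  one.\<close>

definition whom :: "('v \<Rightarrow> nat) \<Rightarrow> nat \<Rightarrow> (('v \<Rightarrow>\<^sub>0 nat) \<Rightarrow>\<^sub>0 'c::comm_ring_1) \<Rightarrow> bool" where
  "whom wt q P \<longleftrightarrow> (\<forall>m\<in>keys P. wdeg wt m = q)"

lemma whom_0 [simp]: "whom wt q 0"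
  by (simp add: whom_def)

lemma whom_single: "wdeg wt m = q \<Longrightarrow> whom wt q (single m c)"
  by (simp add: whom_def)

lemma whom_1: "whom wt 0 1"
  using whom_single[of wt 0 0 1] by simp

lemma whom_add: "whom wt q P \<Longrightarrow> whom wt q Q \<Longrightarrow> whom wt q (P + Q)"
  using Poly_Mapping.keys_add[of P Q] by (auto simp: whom_def)

lemma whom_uminus: "whom wt q P \<Longrightarrow> whom wt q (- P)"
  by (auto simp: whom_def in_keys_iff)

lemma whom_diff: "whom wt q P \<Longrightarrow> whom wt q Q \<Longrightarrow> whom wt q (P - Q)"
  using whom_add[of wt q P "- Q"] whom_uminus[of wt q Q] by simp

lemma whom_sum: "(\<And>x. x \<in> A \<Longrightarrow> whom wt q (g x)) \<Longrightarrow> whom wt q (sum g A)"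
  by (induction A rule: infinite_finite_induct) (auto intro: whom_add)

lemma whom_mult: "whom wt q P \<Longrightarrow> whom wt r Q \<Longrightarrow> whom wt (q + r) (P * Q)"
  using Poly_Mapping.keys_mult[of P Q] by (fastforce simp: whom_def wdeg_add)

lemma whom_power: "whom wt q P \<Longrightarrow> whom wt (n * q) (P ^ n)"
  by (induction n) (auto intro: whom_mult simp: whom_1)

lemma whom_of_nat_mult: "whom wt q P \<Longrightarrow> whom wt q (of_nat n * P)"
  by (induction n) (auto simp: distrib_right intro: whom_add)

lemma whom_prod:
  "(\<And>x. x \<in> A \<Longrightarrow> whom wt (q x) (g x)) \<Longrightarrow> whom wt (sum q A) (prod g A)"
  by (induction A rule: infinite_finite_induct) (auto intro: whom_mult simp: whom_1)

lemma whom_of_nat_mult_cancel: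
  fixes P :: "('v \<Rightarrow>\<^sub>0 nat) \<Rightarrow>\<^sub>0 int"
  assumes "whom wt q (of_nat n * P)" "n > 0"
  shows "whom wt q P"
  using assms by (auto simp: whom_def in_keys_iff lookup_of_nat_mult)

lemma whom_peval:
  fixes v :: "'v \<Rightarrow> ('u \<Rightarrow>\<^sub>0 nat) \<Rightarrow>\<^sub>0 'c::comm_ring_1"
  assumes "whom wt q P" "\<And>i. whom wt' (wt i) (v i)"
  shows "whom wt' q (peval v P)"
proof -
  have "whom wt' q (of_int c * mpow v m)" if "m \<in> keys P" for m c
  proof -
    have "whom wt' (wdeg wt m) (mpow v m)"
      unfolding mpow_def wdeg_def by (intro whom_prod whom_power assms)
    moreover have "wdeg wt m = q" using assms(1) that by (auto simp: whom_def)
    moreover have "whom wt' 0 (of_int c)"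
      by (metis single_of_int whom_single wdeg_zero)
    ultimately show ?thesis using whom_mult[of wt' 0 "of_int c" q] by simp
  qed
  thus ?thesis unfolding peval_def pm_hom_def by (intro whom_sum)
qed

section \<open>Witt's theorem\<close>

text \<open>The formula of \<open>ghost\<close> over any commutative ring, so that ghost components
  commute with evaluation.\<close>

definition gh :: "nat \<Rightarrow> nat \<Rightarrow> (nat \<Rightarrow> 'a::comm_ring_1) \<Rightarrow> 'a" where
  "gh p n s = (\<Sum>i\<le>n. of_nat (p ^ i) * s i ^ (p ^ (n - i)))"

lemma gh_0 [simp]: "gh p 0 s = s 0"
  by (simp add: gh_def)

lemma gh_last: "gh p n s = (\<Sum>i<n. of_nat (p ^ i) * s i ^ (p ^ (n - i))) + of_nat (p ^ n) * s n"
  by (simp add: gh_def flip: lessThan_Suc_atMost)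

lemma gh_Suc: "gh p (Suc n) s = gh p n (\<lambda>i. s i ^ p) + of_nat (p ^ Suc n) * s (Suc n)"
  unfolding gh_last[of p "Suc n"] unfolding gh_def lessThan_Suc_atMost
  by (auto intro!: sum.cong simp: Suc_diff_le power_mult[symmetric])

lemma peval_gh: "peval v (gh p n s) = gh p n (\<lambda>i. peval v (s i))"
  by (simp add: gh_def flip: of_nat_power)

section \<open>Congruences modulo powers of p for powers and ghost components\<close>

lemma prime_dvd_freshman:
  fixes a b :: "'a::comm_ring_1"
  assumes "nprime p"
  shows "of_nat p dvd (a + b) ^ p - (a ^ p + b ^ p)"
proof -
  have "p > 1" using assms prime_gt_1_nat by blast
  have "(a + b) ^ p = (\<Sum>k\<le>p. of_nat (p choose k) * a ^ k * b ^ (p - k))"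
    by (rule binomial_ring)
  also have "{..p} = insert 0 (insert p {1..<p})" using \<open>p > 1\<close> by auto
  finally have eq: "(a + b) ^ p - (a ^ p + b ^ p) = (\<Sum>k\<in>{1..<p}. of_nat (p choose k) * a ^ k * b ^ (p - k))"
    using \<open>p > 1\<close> by simp
  have "of_nat p dvd (of_nat (p choose k) * a ^ k * b ^ (p - k))" if "k \<in> {1..<p}" for k
    using dvd_choose_prime[of k p] that assms by (auto intro!: dvd_mult2 of_nat_dvd_iff)
  thus ?thesis unfolding eq by (intro dvd_sum) auto
qed

lemma dvd_diff_trans: "d dvd a - b \<Longrightarrow> d dvd b - c \<Longrightarrow> d dvd a - (c::'a::comm_ring_1)"
  using dvd_add[of d "a - b" "b - c"] by simp

lemma dvd_diff_sym: "d dvd a - b \<Longrightarrow> d dvd b - (a::'a::comm_ring_1)"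
  using dvd_minus_iff[of d "a - b"] by simp

lemma dvd_power_diff: "d dvd a - b \<Longrightarrow> d dvd a ^ n - (b::'a::comm_ring_1) ^ n"
  by (auto simp: power_diff_sumr2)

text \<open>In a^p - b^p = (a - b) * s all p summands of s are congruent to b^(p-1) modulo p, so s
  contributes one more factor p.\<close>

lemma dvd_lift_power:
  fixes a b :: "'a::comm_ring_1"
  assumes "of_nat (p ^ Suc k) dvd a - b"
  shows "of_nat (p ^ Suc (Suc k)) dvd a ^ p - b ^ p"
proof -
  have p: "of_nat p dvd a - b"
    using assms by (metis dvd_mult_left of_nat_mult power_Suc)
  have "of_nat p dvd (\<Sum>i<p. b ^ (p - Suc i) * a ^ i) - (\<Sum>i<p. b ^ (p - Suc i) * b ^ i)"
    unfolding sum_subtractf[symmetric] right_diff_distrib[symmetric]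
    by (intro dvd_sum dvd_mult dvd_power_diff p)
  moreover have "(\<Sum>i<p. b ^ (p - Suc i) * b ^ i) = (\<Sum>i<p. b ^ (p - 1))"
    by (intro sum.cong) (auto simp flip: power_add)
  ultimately have "of_nat p dvd (\<Sum>i<p. b ^ (p - Suc i) * a ^ i) - of_nat p * b ^ (p - 1)"
    by simp
  hence "of_nat p dvd (\<Sum>i<p. b ^ (p - Suc i) * a ^ i)"
    by (metis dvd_add_right_iff dvd_triv_left diff_add_cancel add.commute)
  hence "of_nat (p ^ Suc k) * of_nat p dvd (a - b) * (\<Sum>i<p. b ^ (p - Suc i) * a ^ i)"
    by (rule mult_dvd_mono[OF assms])
  thus ?thesis by (simp add: power_diff_sumr2 mult_ac)
qed

lemma dvd_lift_powers:
  fixes a b :: "'a::comm_ring_1"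
  assumes "of_nat p dvd a - b"
  shows "of_nat (p ^ Suc k) dvd a ^ (p ^ k) - b ^ (p ^ k)"
proof (induction k)
  case (Suc k)
  show ?case
    using dvd_lift_power[OF Suc.IH] by (simp add: mult.commute flip: power_mult)
qed (use assms in simp)

text \<open>The i-th summand carries p^i, and taking p^(n-i)-th powers yields n-i+1 further factors
  p by \<open>dvd_lift_powers\<close>.\<close>

lemma gh_cong_dvd:
  fixes a b :: "nat \<Rightarrow> 'a::comm_ring_1"
  assumes "\<And>i. i \<le> n \<Longrightarrow> of_nat p dvd a i - b i"
  shows "of_nat (p ^ Suc n) dvd gh p n a - gh p n b"
proof -
  have "of_nat (p ^ Suc n) dvd of_nat (p ^ i) * (a i ^ p ^ (n - i) - b i ^ p ^ (n - i))" if "i \<le> n" for i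
  proof -
    have "of_nat (p ^ i) * of_nat (p ^ Suc (n - i)) dvd of_nat (p ^ i) * (a i ^ p ^ (n - i) - b i ^ p ^ (n - i))"
      by (intro mult_dvd_mono dvd_refl dvd_lift_powers assms that)
    moreover have "of_nat (p ^ i) * of_nat (p ^ Suc (n - i)) = (of_nat (p ^ Suc n) :: 'a)"
      using that by (simp only: flip: of_nat_mult power_add) (simp flip: power_Suc add: Suc_diff_le)
    ultimately show ?thesis by metis
  qed
  thus ?thesis
    unfolding gh_def sum_subtractf[symmetric] right_diff_distrib[symmetric] by (intro dvd_sum) auto
qed

text \<open>The lift of Frobenius to integer polynomials in which Dwork's criterion is
  phrased.\<close>

definition frobl :: "nat \<Rightarrow> (('v \<Rightarrow>\<^sub>0 nat) \<Rightarrow>\<^sub>0 int) \<Rightarrow> ('v \<Rightarrow>\<^sub>0 nat) \<Rightarrow>\<^sub>0 int" where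
  "frobl p = peval (\<lambda>v. pvar v ^ p)"

text \<open>The p-th power and \<open>frobl\<close> are both additive modulo p and agree on
  monomials with coefficient 1; integer coefficients are reached by adding and subtracting such
  monomials.\<close>

lemma frobl_cong:
  fixes P :: "('v \<Rightarrow>\<^sub>0 nat) \<Rightarrow>\<^sub>0 int"
  assumes "nprime p"
  shows "of_nat p dvd P ^ p - frobl p P"
proof -
  define good where "good \<equiv> \<lambda>P :: ('v \<Rightarrow>\<^sub>0 nat) \<Rightarrow>\<^sub>0 int. of_nat p dvd P ^ p - frobl p P"
  have p0: "p > 0" using assms prime_gt_0_nat by blast
  have add: "good (P + Q)" if "good P" "good Q" for P Q
  proof -
    have "of_nat p dvd (P + Q) ^ p - (P ^ p + Q ^ p) + ((P ^ p - frobl p P) + (Q ^ p - frobl p Q))"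
      using that by (intro dvd_add prime_dvd_freshman assms) (auto simp: good_def)
    thus ?thesis by (simp add: good_def frobl_def algebra_simps)
  qed
  have zero: "good 0" using zero_power[OF p0, where ?'a = "('v \<Rightarrow>\<^sub>0 nat) \<Rightarrow>\<^sub>0 int"] by (simp add: good_def frobl_def)
  have minus: "good (- P)" if "good P" for P
  proof -
    have "of_nat p dvd P ^ p + (- P) ^ p"
      using prime_dvd_freshman[OF assms, of P "- P"] p0 dvd_minus_iff[of "of_nat p" "P ^ p + (- P) ^ p"]
      by (simp only: right_minus zero_power[OF p0] diff_0)
    hence "of_nat p dvd P ^ p + (- P) ^ p - (P ^ p - frobl p P)"
      using that by (rule_tac dvd_diff) (auto simp: good_def)
    thus ?thesis by (simp add: good_def frobl_def)
  qed
  have mono: "good (single m 1)" for m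
    by (simp add: good_def frobl_def peval_single mpow_power mpow_pvar)
  have single: "good (single m c)" for m c
  proof (induction c rule: int_induct[where k = 0])
    case (step1 i)
    thus ?case using add[OF step1(2) mono[of m]] by (simp add: single_add)
  next
    case (step2 i)
    thus ?case using add[OF step2(2) minus[OF mono[of m]]] by (simp add: single_diff)
  qed (simp add: zero)
  have "good P"
    by (induction P rule: poly_mapping_induct_add) (auto intro: zero add single)
  thus ?thesis by (simp add: good_def)
qed

lemma gh_inj:
  fixes s t :: "nat \<Rightarrow> ('v \<Rightarrow>\<^sub>0 nat) \<Rightarrow>\<^sub>0 int"
  assumes "p > 0" "\<And>n. gh p n s = gh p n t"
  shows "s = t"
proof
  fix n show "s n = t n"
  proof (induction n rule: less_induct)
    case (less n)
    have "(\<Sum>i<n. of_nat (p ^ i) * s i ^ (p ^ (n - i))) = (\<Sum>i<n. of_nat (p ^ i) * t i ^ (p ^ (n - i)))"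
      by (intro sum.cong) (auto simp: less)
    hence "of_nat (p ^ n) * s n = of_nat (p ^ n) * t n"
      using assms(2)[of n] by (simp add: gh_last)
    thus ?case by (rule int_poly_torsion_free) (use assms in simp)
  qed
qed

text \<open>Once the earlier components agree modulo p, exchanging them changes the n-th ghost
  component by a multiple of p^(n+1). What remains is p^n times the difference of the n-th
  components, and p^n cancels in the torsion-free ring.\<close>

lemma gh_cong_imp:
  fixes s t :: "nat \<Rightarrow> ('v \<Rightarrow>\<^sub>0 nat) \<Rightarrow>\<^sub>0 int"
  assumes "p > 0" "\<And>n. of_nat (p ^ Suc n) dvd gh p n s - gh p n t"
  shows "of_nat p dvd s n - t n"
proof (induction n rule: less_induct)
  case (less n)
  define s' where "s' = (\<lambda>i. if i < n then t i else s i)"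
  have "of_nat (p ^ Suc n) dvd gh p n s - gh p n s'"
    by (rule gh_cong_dvd) (auto simp: s'_def less)
  hence "of_nat (p ^ Suc n) dvd gh p n s' - gh p n t"
    using dvd_diff[OF assms(2)[of n]] by fastforce
  moreover have "gh p n s' - gh p n t = of_nat (p ^ n) * (s n - t n)"
    by (simp add: gh_last s'_def algebra_simps)
  ultimately obtain c where "of_nat (p ^ n) * (s n - t n) = of_nat (p ^ Suc n) * c"
    by (auto elim: dvdE)
  hence "of_nat (p ^ n) * (s n - t n) = of_nat (p ^ n) * (of_nat p * c)"
    by (simp add: mult_ac)
  from int_poly_torsion_free[OF this] have "s n - t n = of_nat p * c" using assms by simp
  thus ?case by simp
qed

text \<open>Dwork's lemma. Solving for s_n requires that G_n minus the earlier terms be divisible by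
  p^n. These terms form the ghost component n-1 of the p-th powers s_i^p, which modulo p^n is the
  Frobenius lift of G_(n-1).\<close>

lemma dwork:
  fixes G :: "nat \<Rightarrow> ('v \<Rightarrow>\<^sub>0 nat) \<Rightarrow>\<^sub>0 int"
  assumes "nprime p" "\<And>n. of_nat (p ^ Suc n) dvd G (Suc n) - frobl p (G n)"
  shows "\<exists>s. \<forall>n. gh p n s = G n"
proof -
  \<comment> \<open>The equation is demanded only if the earlier ghost components are already right.
    Thus a solution exists for every \<open>f\<close>, as the choice principle requires, and the
    induction at the end discharges the condition.\<close>
  define Q where "Q \<equiv> \<lambda>(f::nat \<Rightarrow> ('v \<Rightarrow>\<^sub>0 nat) \<Rightarrow>\<^sub>0 int) n r.
    (\<forall>k<n. gh p k f = G k) \<longrightarrow> (\<Sum>i<n. of_nat (p ^ i) * f i ^ (p ^ (n - i))) + of_nat (p ^ n) * r = G n"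
  have "\<exists>f. \<forall>n. Q f n (f n)"
  proof (rule dependent_wf_choice)
    show "wf {(x, y). x < (y::nat)}" by (rule wf)
  next
    fix f g :: "nat \<Rightarrow> ('v \<Rightarrow>\<^sub>0 nat) \<Rightarrow>\<^sub>0 int" and n r
    assume "\<And>z. (z, n) \<in> {(x, y). x < y} \<Longrightarrow> f z = g z"
    hence fg: "f z = g z" if "z < n" for z using that by auto
    have "gh p k f = gh p k g" if "k < n" for k
      unfolding gh_def using that by (intro sum.cong) (auto simp: fg)
    moreover have "(\<Sum>i<n. of_nat (p ^ i) * f i ^ (p ^ (n - i))) = (\<Sum>i<n. of_nat (p ^ i) * g i ^ (p ^ (n - i)))"
      by (intro sum.cong) (auto simp: fg)
    ultimately show "Q f n r = Q g n r" by (simp add: Q_def)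
  next
    fix n and f :: "nat \<Rightarrow> ('v \<Rightarrow>\<^sub>0 nat) \<Rightarrow>\<^sub>0 int"
    show "\<exists>r. Q f n r"
    proof (cases "\<forall>k<n. gh p k f = G k")
      case False
      thus ?thesis by (auto simp: Q_def)
    next
      case True
      have "of_nat (p ^ n) dvd G n - (\<Sum>i<n. of_nat (p ^ i) * f i ^ (p ^ (n - i)))"
      proof (cases n)
        case (Suc m)
        have "of_nat (p ^ Suc m) dvd gh p m (\<lambda>i. f i ^ p) - gh p m (\<lambda>i. frobl p (f i))"
          by (intro gh_cong_dvd frobl_cong assms)
        moreover have "gh p m (\<lambda>i. frobl p (f i)) = frobl p (G m)"
          using True Suc by (simp add: frobl_def flip: peval_gh)
        moreover have "gh p m (\<lambda>i. f i ^ p) = (\<Sum>i<n. of_nat (p ^ i) * f i ^ (p ^ (n - i)))"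
          using gh_Suc[of p m f] gh_last[of p "Suc m" f] Suc by simp
        ultimately have "of_nat (p ^ Suc m) dvd (\<Sum>i<n. of_nat (p ^ i) * f i ^ (p ^ (n - i))) - frobl p (G m)"
          by (simp only:)
        hence "of_nat (p ^ Suc m) dvd frobl p (G m) - (\<Sum>i<n. of_nat (p ^ i) * f i ^ (p ^ (n - i)))"
          by (rule dvd_diff_sym)
        from dvd_diff_trans[OF assms(2)[of m] this] show ?thesis by (simp only: Suc)
      qed auto
      then obtain r where "G n - (\<Sum>i<n. of_nat (p ^ i) * f i ^ (p ^ (n - i))) = of_nat (p ^ n) * r"
        by (auto elim: dvdE)
      thus ?thesis by (auto simp: Q_def algebra_simps intro!: exI[of _ r])
    qed
  qed
  then obtain f where f: "Q f n (f n)" for n by blast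
  have "gh p n f = G n" for n
    using f by (induction n rule: less_induct) (simp add: Q_def gh_last)
  thus ?thesis by blast
qed

lemma frobl_gh_pvar:
  "of_nat (p ^ Suc n) dvd gh p (Suc n) (\<lambda>i. pvar (c i)) - frobl p (gh p n (\<lambda>i. pvar (c i)))"
  by (simp add: frobl_def peval_gh gh_Suc del: of_nat_power power_Suc)

lemma ghost_gh: "ghost p n s = gh p n s"
  by (simp add: ghost_def gh_def)

lemma witt_var_pvar: "witt_var v = pvar v"
  by (simp add: witt_var_def pvar_def)

lemma frobl_add: "frobl p (P + Q) = frobl p P + frobl p Q"
  and frobl_mult: "frobl p (P * Q) = frobl p P * frobl p Q"
  and frobl_minus: "frobl p (- P) = - frobl p P"
  by (simp_all add: frobl_def)

lemma witt_add_poly: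
  assumes "nprime p"
  shows "gh p n (witt_add_poly p) = gh p n (\<lambda>i. pvar (Inl i)) + gh p n (\<lambda>i. pvar (Inr i))"
proof -
  have "\<exists>s. \<forall>n. gh p n s = gh p n (\<lambda>i. pvar (Inl i)) + gh p n (\<lambda>i. pvar (Inr i) :: witt_poly)"
    by (rule dwork[OF assms])
       (use dvd_add[OF frobl_gh_pvar[of p _ Inl] frobl_gh_pvar[of p _ Inr]]
         in \<open>simp add: frobl_add algebra_simps del: of_nat_power\<close>)
  then obtain s where s: "\<forall>n. gh p n s = gh p n (\<lambda>i. pvar (Inl i)) + gh p n (\<lambda>i. pvar (Inr i) :: witt_poly)"
    by blast
  have "witt_add_poly p = s"
    unfolding witt_add_poly_def ghost_gh witt_var_pvar
    using s by (intro the_equality gh_inj[of p]) (auto simp: prime_gt_0_nat assms)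
  thus ?thesis using s by blast
qed

lemma witt_mult_poly:
  assumes "nprime p"
  shows "gh p n (witt_mult_poly p) = gh p n (\<lambda>i. pvar (Inl i)) * gh p n (\<lambda>i. pvar (Inr i))"
proof -
  have "\<exists>s. \<forall>n. gh p n s = gh p n (\<lambda>i. pvar (Inl i)) * gh p n (\<lambda>i. pvar (Inr i) :: witt_poly)"
  proof (rule dwork[OF assms])
    fix n
    let ?A = "\<lambda>n. gh p n (\<lambda>i. pvar (Inl i :: nat + nat)) :: witt_poly"
    let ?B = "\<lambda>n. gh p n (\<lambda>i. pvar (Inr i) :: witt_poly) :: witt_poly"
    have "of_nat (p ^ Suc n) dvd (?A (Suc n) - frobl p (?A n)) * ?B (Suc n)
        + frobl p (?A n) * (?B (Suc n) - frobl p (?B n))"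
      by (intro dvd_add dvd_mult2 dvd_mult frobl_gh_pvar)
    thus "of_nat (p ^ Suc n) dvd ?A (Suc n) * ?B (Suc n) - frobl p (?A n * ?B n)"
      by (simp add: frobl_mult algebra_simps)
  qed
  then obtain s where s: "\<forall>n. gh p n s = gh p n (\<lambda>i. pvar (Inl i)) * gh p n (\<lambda>i. pvar (Inr i) :: witt_poly)"
    by blast
  have "witt_mult_poly p = s"
    unfolding witt_mult_poly_def ghost_gh witt_var_pvar
    using s by (intro the_equality gh_inj[of p]) (auto simp: prime_gt_0_nat assms)
  thus ?thesis using s by blast
qed

lemma whom_gh:
  assumes "\<And>i. i \<le> n \<Longrightarrow> whom wt (d * p ^ i) (s i)"
  shows "whom wt (d * p ^ n) (gh p n s)"
proof -
  have "whom wt (d * p ^ n) (of_nat (p ^ i) * s i ^ (p ^ (n - i)))" if "i \<le> n" for i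
    using whom_of_nat_mult[OF whom_power[OF assms[OF that], of "p ^ (n - i)"], of "p ^ i"] that
    by (simp add: mult.left_commute flip: power_add)
  thus ?thesis unfolding gh_def by (intro whom_sum) auto
qed

text \<open>By induction the earlier terms are homogeneous, hence so is p^n s_n, and cancelling p^n
  over the integers does not change the monomials.\<close>

lemma whom_gh_imp:
  fixes s :: "nat \<Rightarrow> ('v \<Rightarrow>\<^sub>0 nat) \<Rightarrow>\<^sub>0 int"
  assumes "p > 0" "\<And>n. whom wt (d * p ^ n) (gh p n s)"
  shows "whom wt (d * p ^ n) (s n)"
proof (induction n rule: less_induct)
  case (less n)
  define t where "t = (\<lambda>i. if i < n then s i else 0)"
  have "whom wt (d * p ^ n) (gh p n t)" by (rule whom_gh) (auto simp: t_def less)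
  hence "whom wt (d * p ^ n) (gh p n s - gh p n t)" by (intro whom_diff assms)
  moreover have "gh p n s - gh p n t = of_nat (p ^ n) * s n"
    by (simp add: gh_last t_def)
  ultimately show ?case
    using assms(1) by (metis whom_of_nat_mult_cancel zero_less_power)
qed

lemma whom_pvar: "whom wt (wt v) (pvar v)"
  by (simp add: pvar_def whom_single)

lemma whom_witt_add_poly:
  assumes "nprime p"
  shows "whom (case_sum (\<lambda>j. d * p ^ j) (\<lambda>j. d * p ^ j)) (d * p ^ n) (witt_add_poly p n)"
  (is "whom ?wt _ _")
proof (rule whom_gh_imp)
  fix n
  have 1: "whom ?wt (d * p ^ i) (pvar (Inl i))" "whom ?wt (d * p ^ i) (pvar (Inr i))" for i
    using whom_pvar[of ?wt "Inl i"] whom_pvar[of ?wt "Inr i"] by simp_all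
  show "whom ?wt (d * p ^ n) (gh p n (witt_add_poly p))"
    unfolding witt_add_poly[OF assms] by (intro whom_add whom_gh 1)
qed (use assms prime_gt_0_nat in auto)

text \<open>The degrees \<open>d\<close> and \<open>e\<close> are independent: the choices (1, 0)
  and (0, 1) give homogeneity in each factor separately, so the two factors can carry different
  denominators.\<close>

lemma whom_witt_mult_poly:
  assumes "nprime p"
  shows "whom (case_sum (\<lambda>j. d * p ^ j) (\<lambda>j. e * p ^ j)) ((d + e) * p ^ n) (witt_mult_poly p n)"
  (is "whom ?wt _ _")
proof (rule whom_gh_imp)
  fix n
  have 1: "whom ?wt (d * p ^ i) (pvar (Inl i))" "whom ?wt (e * p ^ i) (pvar (Inr i))" for i
    using whom_pvar[of ?wt "Inl i"] whom_pvar[of ?wt "Inr i"] by simp_all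
  show "whom ?wt ((d + e) * p ^ n) (gh p n (witt_mult_poly p))"
    unfolding witt_mult_poly[OF assms] distrib_right by (intro whom_mult whom_gh 1)
qed (use assms prime_gt_0_nat in auto)

section \<open>The type of Witt vectors\<close>

lemma hom_peval:
  fixes h :: "'a::comm_ring_1 \<Rightarrow> 'b::comm_ring_1"
  assumes "\<And>x y. h (x + y) = h x + h y" "\<And>x y. h (x * y) = h x * h y" "h 1 = 1"
  shows "h (peval v P) = peval (\<lambda>i. h (v i)) P"
proof -
  have h0: "h 0 = 0" using assms(1)[of 0 0] by simp
  have hm: "h (- x) = - h x" for x using assms(1)[of x "- x"] h0 by (simp add: eq_neg_iff_add_eq_0 add.commute)
  have hn: "h (of_nat n) = of_nat n" for n by (induction n) (simp_all add: assms h0)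
  have hd: "h (x - y) = h x - h y" for x y using assms(1)[of x "- y"] by (simp add: hm)
  have hi: "h (of_int c) = of_int c" for c by (cases c) (simp_all add: assms hm hn hd)
  have hs: "h (sum g A) = (\<Sum>x\<in>A. h (g x))" for g :: "('c \<Rightarrow>\<^sub>0 nat) \<Rightarrow> 'a" and A
    by (induction A rule: infinite_finite_induct) (simp_all add: assms h0)
  have hp: "h (x ^ n) = h x ^ n" for x n by (induction n) (simp_all add: assms)
  have hpr: "h (prod g A) = (\<Prod>x\<in>A. h (g x))" for g :: "'c \<Rightarrow> 'a" and A
    by (induction A rule: infinite_finite_induct) (simp_all add: assms)
  show ?thesis by (simp add: peval_def pm_hom_def hs assms hi mpow_def hpr hp)
qed

definition wadd :: "nat \<Rightarrow> (nat \<Rightarrow> 'a::comm_ring_1) \<Rightarrow> (nat \<Rightarrow> 'a) \<Rightarrow> nat \<Rightarrow> 'a" where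
  "wadd p a b = (\<lambda>i. peval (case_sum a b) (witt_add_poly p i))"

definition wmul :: "nat \<Rightarrow> (nat \<Rightarrow> 'a::comm_ring_1) \<Rightarrow> (nat \<Rightarrow> 'a) \<Rightarrow> nat \<Rightarrow> 'a" where
  "wmul p a b = (\<lambda>i. peval (case_sum a b) (witt_mult_poly p i))"

definition witt_neg_poly :: "nat \<Rightarrow> nat \<Rightarrow> (nat \<Rightarrow>\<^sub>0 nat) \<Rightarrow>\<^sub>0 int" where
  "witt_neg_poly p = (SOME s. \<forall>n. gh p n s = - gh p n pvar)"

definition wneg :: "nat \<Rightarrow> (nat \<Rightarrow> 'a::comm_ring_1) \<Rightarrow> nat \<Rightarrow> 'a" where
  "wneg p a = (\<lambda>i. peval a (witt_neg_poly p i))"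

definition wone :: "nat \<Rightarrow> 'a::comm_ring_1" where
  "wone = (\<lambda>i. if i = 0 then 1 else 0)"

definition wshift :: "(nat \<Rightarrow> 'a::comm_ring_1) \<Rightarrow> nat \<Rightarrow> 'a" where
  "wshift a = (\<lambda>i. if i = 0 then 0 else a (i - 1))"

definition wteich :: "'a::comm_ring_1 \<Rightarrow> nat \<Rightarrow> 'a" where
  "wteich c = (\<lambda>i. if i = 0 then c else 0)"

lemma witt_neg_poly:
  assumes "nprime p"
  shows "gh p n (witt_neg_poly p) = - gh p n pvar"
proof -
  have "\<exists>s. \<forall>n. gh p n s = - gh p n (pvar :: nat \<Rightarrow> (nat \<Rightarrow>\<^sub>0 nat) \<Rightarrow>\<^sub>0 int)"
  proof (rule dwork[OF assms])
    fix n
    have "of_nat (p ^ Suc n) dvd - (gh p (Suc n) pvar - frobl p (gh p n (pvar :: nat \<Rightarrow> (nat \<Rightarrow>\<^sub>0 nat) \<Rightarrow>\<^sub>0 int)))"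
      unfolding dvd_minus_iff using frobl_gh_pvar[of p n id] by simp
    thus "of_nat (p ^ Suc n) dvd - gh p (Suc n) pvar - frobl p (- gh p n (pvar :: nat \<Rightarrow> (nat \<Rightarrow>\<^sub>0 nat) \<Rightarrow>\<^sub>0 int))"
      by (simp only: frobl_minus minus_diff_eq) (simp only: diff_minus_eq_add add.commute uminus_add_conv_diff)
  qed
  from someI_ex[OF this] show ?thesis unfolding witt_neg_poly_def by blast
qed

lemma gh_wadd: "nprime p \<Longrightarrow> gh p n (wadd p a b) = gh p n a + gh p n b"
  unfolding wadd_def peval_gh[symmetric] witt_add_poly by (simp add: peval_gh)

lemma gh_wmul: "nprime p \<Longrightarrow> gh p n (wmul p a b) = gh p n a * gh p n b"
  unfolding wmul_def peval_gh[symmetric] witt_mult_poly by (simp add: peval_gh)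

lemma gh_wneg: "nprime p \<Longrightarrow> gh p n (wneg p a) = - gh p n a"
  unfolding wneg_def peval_gh[symmetric] witt_neg_poly by (simp add: peval_gh)

lemma zero_power_power: "p > 0 \<Longrightarrow> (0::'a::comm_ring_1) ^ (p ^ k) = 0"
  by (intro zero_power zero_less_power)

lemma gh_zero [simp]: "p > 0 \<Longrightarrow> gh p n (\<lambda>i. 0) = 0"
  by (simp add: gh_def zero_power_power)

lemma gh_wteich: "p > 0 \<Longrightarrow> gh p n (wteich c) = c ^ (p ^ n)"
proof -
  assume "p > 0"
  hence "gh p n (wteich c) = (\<Sum>i\<le>n. if i = 0 then c ^ (p ^ n) else 0)"
    unfolding gh_def wteich_def by (intro sum.cong) (auto simp: zero_power_power)
  thus ?thesis by simp
qed

lemma wone_wteich: "wone = wteich 1"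
  by (simp add: wone_def wteich_def)

lemma gh_wone: "p > 0 \<Longrightarrow> gh p n wone = 1"
  by (simp add: wone_wteich gh_wteich)

lemma gh_wshift: "p > 0 \<Longrightarrow> gh p n (wshift a) = (case n of 0 \<Rightarrow> 0 | Suc m \<Rightarrow> of_nat p * gh p m a)"
proof (cases n)
  case (Suc m)
  assume "p > 0"
  have "gh p (Suc m) (wshift a) = (\<Sum>i\<le>Suc m. of_nat (p ^ i) * wshift a i ^ p ^ (Suc m - i))"
    by (simp only: gh_def)
  also have "\<dots> = (\<Sum>i\<le>m. of_nat (p ^ Suc i) * a i ^ p ^ (m - i))"
    using zero_power_power[OF \<open>p > 0\<close>, of "Suc m"] by (subst sum.atMost_Suc_shift) (simp add: wshift_def)
  finally show ?thesis using Suc by (simp add: gh_def sum_distrib_left mult.assoc)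
qed (simp add: wshift_def)

lemma gh_scale: "gh p n (\<lambda>i. c ^ (p ^ i) * w i) = c ^ (p ^ n) * gh p n w"
proof -
  have "of_nat (p ^ i) * (c ^ p ^ i * w i) ^ p ^ (n - i) = c ^ p ^ n * (of_nat (p ^ i) * w i ^ p ^ (n - i))" if "i \<le> n" for i
    using that by (simp add: power_mult_distrib mult_ac flip: power_mult power_add)
  thus ?thesis by (simp add: gh_def sum_distrib_left)
qed

abbreviation ev :: "(('a \<Rightarrow>\<^sub>0 nat) \<Rightarrow>\<^sub>0 int) \<Rightarrow> 'a::comm_ring_1" where "ev \<equiv> peval (\<lambda>x. x)"

text \<open>Every commutative ring is a quotient of a torsion-free one, over which identities of Witt
  vectors can be checked on ghost components.\<close>

lemma ev_wadd: "(\<lambda>i. ev (wadd p s t i)) = wadd p (\<lambda>i. ev (s i)) (\<lambda>i. ev (t i))"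
  by (auto simp: wadd_def peval_peval fun_eq_iff intro!: arg_cong2[where f = peval] split: sum.split)

lemma ev_wmul: "(\<lambda>i. ev (wmul p s t i)) = wmul p (\<lambda>i. ev (s i)) (\<lambda>i. ev (t i))"
  by (auto simp: wmul_def peval_peval fun_eq_iff intro!: arg_cong2[where f = peval] split: sum.split)

lemma ev_wneg: "(\<lambda>i. ev (wneg p s i)) = wneg p (\<lambda>i. ev (s i))"
  by (simp add: wneg_def peval_peval)

lemma ev_wshift: "(\<lambda>i. ev (wshift s i)) = wshift (\<lambda>i. ev (s i))"
  by (auto simp: wshift_def)

lemma ev_wteich: "(\<lambda>i. ev (wteich s i)) = wteich (ev s)"
  by (auto simp: wteich_def)

lemma ev_wone: "(\<lambda>i. ev (wone i)) = wone"
  by (auto simp: wone_def)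

lemmas ev_simps = ev_wadd ev_wmul ev_wneg ev_wshift ev_wteich ev_wone

lemma witt_transfer:
  assumes "p > 0" "\<And>n. gh p n s = gh p n t"
  shows "(\<lambda>i. ev (s i)) = (\<lambda>i. ev (t i))"
  using gh_inj[OF assms] by simp

text \<open>For identities that hold only in characteristic p the lifts need to have ghost
  components congruent modulo p^(n+1): then their components agree modulo p, and p vanishes under
  \<open>ev\<close>.\<close>

lemma witt_transfer_char:
  assumes "p > 0" "\<And>n. of_nat (p ^ Suc n) dvd gh p n s - gh p n t"
    and "of_nat p = (0::'a::comm_ring_1)"
  shows "(\<lambda>i. ev (s i) :: 'a) = (\<lambda>i. ev (t i))"
proof
  fix i
  obtain c where "s i - t i = of_nat p * c"
    using gh_cong_imp[OF assms(1,2), of i] by (auto elim: dvdE)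
  hence "ev (s i) - ev (t i) = of_nat p * (ev c :: 'a)"
    by (metis peval_diff peval_mult peval_of_nat)
  thus "ev (s i) = (ev (t i) :: 'a)" using assms(3) by simp
qed

section \<open>Ring laws and the operators V and F, checked on ghost components\<close>

context
  fixes p :: nat
  assumes p: "nprime p"
begin

lemma p_pos: "p > 0" using p prime_gt_0_nat by blast

lemmas gh_simps = gh_wadd[OF p] gh_wmul[OF p] gh_wneg[OF p] gh_wone[OF p_pos] gh_zero[OF p_pos]
  gh_wteich[OF p_pos] gh_wshift[OF p_pos] gh_scale

lemma wadd_assoc: "wadd p (wadd p a b) c = wadd p a (wadd p b c)"
  using witt_transfer[OF p_pos, of "wadd p (wadd p (\<lambda>i. pvar (a i)) (\<lambda>i. pvar (b i))) (\<lambda>i. pvar (c i))"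
      "wadd p (\<lambda>i. pvar (a i)) (wadd p (\<lambda>i. pvar (b i)) (\<lambda>i. pvar (c i)))"]
  by (simp add: gh_simps ev_simps)

lemma wadd_comm: "wadd p a b = wadd p b a"
  using witt_transfer[OF p_pos, of "wadd p (\<lambda>i. pvar (a i)) (\<lambda>i. pvar (b i))"
      "wadd p (\<lambda>i. pvar (b i)) (\<lambda>i. pvar (a i))"]
  by (simp add: gh_simps ev_simps)

lemma wadd_zero: "wadd p (\<lambda>i. 0) a = a"
  using witt_transfer[OF p_pos, of "wadd p (\<lambda>i. 0) (\<lambda>i. pvar (a i))" "\<lambda>i. pvar (a i)"]
  by (simp add: gh_simps ev_simps)

lemma wadd_neg: "wadd p (wneg p a) a = (\<lambda>i. 0)"
  using witt_transfer[OF p_pos, of "wadd p (wneg p (\<lambda>i. pvar (a i))) (\<lambda>i. pvar (a i))" "\<lambda>i. 0"]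
  by (simp add: gh_simps ev_simps)

lemma wmul_assoc: "wmul p (wmul p a b) c = wmul p a (wmul p b c)"
  using witt_transfer[OF p_pos, of "wmul p (wmul p (\<lambda>i. pvar (a i)) (\<lambda>i. pvar (b i))) (\<lambda>i. pvar (c i))"
      "wmul p (\<lambda>i. pvar (a i)) (wmul p (\<lambda>i. pvar (b i)) (\<lambda>i. pvar (c i)))"]
  by (simp add: gh_simps ev_simps)

lemma wmul_comm: "wmul p a b = wmul p b a"
  using witt_transfer[OF p_pos, of "wmul p (\<lambda>i. pvar (a i)) (\<lambda>i. pvar (b i))"
      "wmul p (\<lambda>i. pvar (b i)) (\<lambda>i. pvar (a i))"]
  by (simp add: gh_simps ev_simps)

lemma wmul_one: "wmul p wone a = a"
  using witt_transfer[OF p_pos, of "wmul p wone (\<lambda>i. pvar (a i))" "\<lambda>i. pvar (a i)"]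
  by (simp add: gh_simps ev_simps)

lemma wmul_distrib: "wmul p (wadd p a b) c = wadd p (wmul p a c) (wmul p b c)"
  using witt_transfer[OF p_pos, of "wmul p (wadd p (\<lambda>i. pvar (a i)) (\<lambda>i. pvar (b i))) (\<lambda>i. pvar (c i))"
      "wadd p (wmul p (\<lambda>i. pvar (a i)) (\<lambda>i. pvar (c i))) (wmul p (\<lambda>i. pvar (b i)) (\<lambda>i. pvar (c i)))"]
  by (simp add: gh_simps ev_simps distrib_right)

lemma wshift_wadd: "wshift (wadd p a b) = wadd p (wshift a) (wshift b)"
  using witt_transfer[OF p_pos, of "wshift (wadd p (\<lambda>i. pvar (a i)) (\<lambda>i. pvar (b i)))"
      "wadd p (wshift (\<lambda>i. pvar (a i))) (wshift (\<lambda>i. pvar (b i)))"]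
  by (simp add: gh_simps ev_simps distrib_left split: nat.splits)

lemma wteich_wmul: "wmul p (wteich c) a = (\<lambda>i. c ^ (p ^ i) * a i)"
  using witt_transfer[OF p_pos, of "wmul p (wteich (pvar c)) (\<lambda>i. pvar (a i))"
      "\<lambda>i. pvar c ^ (p ^ i) * pvar (a i)"]
  by (simp add: gh_simps ev_simps)

lemma wadd_wteich_wshift: "wadd p (wteich (a 0)) (wshift (\<lambda>i. a (Suc i))) = a"
proof -
  have "gh p n (wteich (pvar (a 0))) + gh p n (wshift (\<lambda>i. pvar (a (Suc i)))) = gh p n (\<lambda>i. pvar (a i))" for n
  proof (cases n)
    case (Suc m)
    have "gh p (Suc m) (\<lambda>i. pvar (a i)) = (\<Sum>i\<le>Suc m. of_nat (p ^ i) * pvar (a i) ^ p ^ (Suc m - i))"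
      by (simp only: gh_def)
    also have "\<dots> = pvar (a 0) ^ (p ^ Suc m) + (\<Sum>i\<le>m. of_nat (p ^ Suc i) * pvar (a (Suc i)) ^ p ^ (m - i))"
      by (subst sum.atMost_Suc_shift) simp
    finally have eq: "gh p (Suc m) (\<lambda>i. pvar (a i)) = \<dots>" .
    show ?thesis
      by (simp only: Suc gh_wteich[OF p_pos] gh_wshift[OF p_pos] nat.case eq) (simp add: gh_def sum_distrib_left mult.assoc)
  qed (simp add: wshift_def wteich_def)
  hence "(\<lambda>i. ev (wadd p (wteich (pvar (a 0))) (wshift (\<lambda>i. pvar (a (Suc i)))) i)) = (\<lambda>i. ev (pvar (a i)))"
    by (intro witt_transfer[OF p_pos]) (simp only: gh_wadd[OF p])
  thus ?thesis by (simp add: ev_simps)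
qed

text \<open>The projection formula V(F a * b) = a V b. The ghost components of the two sides differ
  by the last term p^n a_n of the n-th ghost component of \<open>a\<close>, multiplied by p times a
  ghost component of \<open>b\<close>.\<close>

lemma wshift_wmul_char:
  fixes a b :: "nat \<Rightarrow> 'a::comm_ring_1"
  assumes "of_nat p = (0::'a)"
  shows "wshift (wmul p (\<lambda>i. a i ^ p) b) = wmul p a (wshift b)"
proof -
  define A B :: "nat \<Rightarrow> ('a \<Rightarrow>\<^sub>0 nat) \<Rightarrow>\<^sub>0 int" where "A = (\<lambda>i. pvar (a i))" and "B = (\<lambda>i. pvar (b i))"
  have "of_nat (p ^ Suc n) dvd gh p n (wshift (wmul p (\<lambda>i. A i ^ p) B)) - gh p n (wmul p A (wshift B))" for n
  proof (cases n)
    case (Suc m)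
    have "gh p n (wshift (wmul p (\<lambda>i. A i ^ p) B)) - gh p n (wmul p A (wshift B))
        = of_nat (p ^ Suc n) * (- A n * gh p m B)"
      by (simp add: Suc gh_simps del: of_nat_power) (simp add: gh_Suc algebra_simps)
    thus ?thesis by (metis dvd_triv_left)
  next
    case 0
    thus ?thesis using gh_wmul[OF p, of 0 A "wshift B"] by (simp add: wshift_def)
  qed
  from witt_transfer_char[OF p_pos this assms] show ?thesis
    by (simp add: gh_simps ev_simps A_def B_def)
qed

text \<open>This is V 1 = p, with p written as an iterated Witt sum of ones. The ghost components
  are (0, p, p, ...) and (p, p, p, ...), so they differ only at index 0, and there by p.\<close>

lemma wshift_wone_char:
  assumes "of_nat p = (0::'a::comm_ring_1)"
  shows "wshift wone = ((wadd p wone ^^ p) (\<lambda>i. 0) :: nat \<Rightarrow> 'a)"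
proof -
  have g: "gh p n ((wadd p wone ^^ k) (\<lambda>i. 0)) = of_nat k" for n k
    by (induction k) (simp_all add: gh_simps)
  have e: "(\<lambda>i. ev ((wadd p wone ^^ k) (\<lambda>i. 0) i)) = (wadd p wone ^^ k) (\<lambda>i. 0)" for k
    by (induction k) (simp_all add: ev_simps)
  have "of_nat (p ^ Suc n) dvd gh p n (wshift wone) - gh p n ((wadd p wone ^^ p) (\<lambda>i. 0))" for n
    by (simp add: gh_simps g split: nat.split)
  from witt_transfer_char[OF p_pos this assms] show ?thesis
    by (simp add: ev_simps e)
qed

end

text \<open>The fallback 2 is an arbitrary prime: it makes the ring laws of \<open>witt\<close> hold
  for every phantom type, as a class instance must.\<close>

definition wchar :: "'q::semiring_1 itself \<Rightarrow> nat" where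
  "wchar _ = (if nprime CHAR('q) then CHAR('q) else 2)"

lemma wchar_prime: "nprime (wchar TYPE('q::semiring_1))"
  by (simp add: wchar_def)

text \<open>Witt vectors of infinite length. A type cannot depend on the number \<open>p\<close>, which is therefore
  read off from the characteristic of the phantom type argument \<open>'q\<close>.\<close>

typedef ('q, 'a) witt = "UNIV :: (nat \<Rightarrow> 'a) set"
  morphisms wcomp mkW by simp

lemma wcomp_mkW [simp]: "wcomp (mkW a) = a"
  by (simp add: mkW_inverse)

lemma witt_eqI: "(\<And>i. wcomp a i = wcomp b i) \<Longrightarrow> a = b"
  by (metis wcomp_inject ext)

lemma witt_eq_iff: "a = b \<longleftrightarrow> wcomp a = wcomp b"
  by (metis wcomp_inject)

instantiation witt :: (semiring_1, comm_ring_1) comm_ring_1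
begin

definition "(0 :: ('a, 'b) witt) = mkW (\<lambda>i. 0)"
definition "(1 :: ('a, 'b) witt) = mkW wone"
definition "(a :: ('a, 'b) witt) + b = mkW (wadd (wchar TYPE('a)) (wcomp a) (wcomp b))"
definition "(a :: ('a, 'b) witt) * b = mkW (wmul (wchar TYPE('a)) (wcomp a) (wcomp b))"
definition "- (a :: ('a, 'b) witt) = mkW (wneg (wchar TYPE('a)) (wcomp a))"
definition "(a :: ('a, 'b) witt) - b = a + (- b)"

instance
proof
  fix a b c :: "('a, 'b) witt"
  note d = zero_witt_def one_witt_def plus_witt_def times_witt_def uminus_witt_def minus_witt_def
  note p = wchar_prime[where 'q = 'a]
  show "a + b + c = a + (b + c)" by (simp add: d wadd_assoc[OF p])
  show "a + b = b + a" by (simp add: d wadd_comm[OF p, of "wcomp a"])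
  show "0 + a = a" by (simp add: d wadd_zero[OF p] wcomp_inverse)
  show "- a + a = 0" by (simp add: d wadd_neg[OF p])
  show "a - b = a + - b" by (simp add: d)
  show "a * b * c = a * (b * c)" by (simp add: d wmul_assoc[OF p])
  show "a * b = b * a" by (simp add: d wmul_comm[OF p, of "wcomp a"])
  show "1 * a = a" by (simp add: d wmul_one[OF p] wcomp_inverse)
  show "(a + b) * c = a * c + b * c" by (simp add: d wmul_distrib[OF p])
  show "(0::('a, 'b) witt) \<noteq> 1"
    by (auto simp: d mkW_inject wone_def fun_eq_iff intro!: exI[of _ 0])
qed

end

lemma wcomp_0 [simp]: "wcomp 0 i = 0"
  by (simp add: zero_witt_def)

lemma wcomp_1: "wcomp 1 i = (if i = 0 then 1 else 0)"
  by (simp add: one_witt_def wone_def)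

lemma wcomp_add: "wcomp ((a :: ('q::semiring_1, 'a::comm_ring_1) witt) + b) i
    = peval (case_sum (wcomp a) (wcomp b)) (witt_add_poly (wchar TYPE('q)) i)"
  by (simp add: plus_witt_def wadd_def)

lemma wcomp_mult: "wcomp ((a :: ('q::semiring_1, 'a::comm_ring_1) witt) * b) i
    = peval (case_sum (wcomp a) (wcomp b)) (witt_mult_poly (wchar TYPE('q)) i)"
  by (simp add: times_witt_def wmul_def)

lemma wcomp_add_0 [simp]: "wcomp (a + b) 0 = wcomp a 0 + wcomp b 0"
  for a b :: "('q::semiring_1, 'a::comm_ring_1) witt"
  using gh_wadd[OF wchar_prime[where 'q = 'q], of 0 "wcomp a" "wcomp b"] by (simp add: plus_witt_def)

lemma wcomp_mult_0 [simp]: "wcomp (a * b) 0 = wcomp a 0 * wcomp b 0"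
  for a b :: "('q::semiring_1, 'a::comm_ring_1) witt"
  using gh_wmul[OF wchar_prime[where 'q = 'q], of 0 "wcomp a" "wcomp b"] by (simp add: times_witt_def)

lemma wcomp_uminus_0 [simp]: "wcomp (- a) 0 = - wcomp a 0"
  for a :: "('q::semiring_1, 'a::comm_ring_1) witt"
  using gh_wneg[OF wchar_prime[where 'q = 'q], of 0 "wcomp a"] by (simp add: uminus_witt_def)

lemma wcomp_diff_0 [simp]: "wcomp (a - b) 0 = wcomp a 0 - wcomp b 0"
  for a b :: "('q::semiring_1, 'a::comm_ring_1) witt"
  by (simp add: minus_witt_def del: add_uminus_conv_diff)

lemma wcomp_sum_0 [simp]: "wcomp (sum g A) 0 = (\<Sum>x\<in>A. wcomp (g x :: ('q::semiring_1, 'a::comm_ring_1) witt) 0)"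
  by (induction A rule: infinite_finite_induct) auto

definition ver :: "('q, 'a::comm_ring_1) witt \<Rightarrow> ('q, 'a) witt" where
  "ver a = mkW (wshift (wcomp a))"

text \<open>Inverse to \<open>ver\<close> on vectors with component 0 equal to zero; it is not
  additive in general.\<close>

definition unver :: "('q, 'a) witt \<Rightarrow> ('q, 'a) witt" where
  "unver a = mkW (\<lambda>i. wcomp a (Suc i))"

definition teich :: "'a \<Rightarrow> ('q, 'a::comm_ring_1) witt" where
  "teich c = mkW (wteich c)"

definition wfrob :: "('q::semiring_1, 'a::comm_ring_1) witt \<Rightarrow> ('q, 'a) witt" where
  "wfrob a = mkW (\<lambda>i. wcomp a i ^ wchar TYPE('q))"

lemma wcomp_ver: "wcomp (ver a) i = (if i = 0 then 0 else wcomp a (i - 1))"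
  by (simp add: ver_def wshift_def)

lemma wcomp_ver_0 [simp]: "wcomp (ver a) 0 = 0" and wcomp_ver_Suc [simp]: "wcomp (ver a) (Suc i) = wcomp a i"
  by (simp_all add: wcomp_ver)

lemma wcomp_unver [simp]: "wcomp (unver a) i = wcomp a (Suc i)"
  by (simp add: unver_def)

lemma unver_ver [simp]: "unver (ver a) = a"
  by (rule witt_eqI) simp

lemma ver_unver: "wcomp a 0 = 0 \<Longrightarrow> ver (unver a) = a"
  by (rule witt_eqI) (simp add: wcomp_ver)

lemma wcomp_teich: "wcomp (teich c) i = (if i = 0 then c else 0)"
  by (simp add: teich_def wteich_def)

lemma wcomp_teich_0 [simp]: "wcomp (teich c) 0 = c"
  by (simp add: wcomp_teich)

lemma wcomp_frob: "wcomp (wfrob (a :: ('q::semiring_1, 'a::comm_ring_1) witt)) i = wcomp a i ^ wchar TYPE('q)"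
  by (simp add: wfrob_def)

lemma ver_add: "ver (a + b) = ver a + ver b"
  for a b :: "('q::semiring_1, 'a::comm_ring_1) witt"
  by (simp add: ver_def plus_witt_def wshift_wadd[OF wchar_prime])

lemma ver_0 [simp]: "ver 0 = 0"
  by (rule witt_eqI) (simp add: wcomp_ver)

lemma ver_inj: "ver a = ver b \<longleftrightarrow> a = b"
  by (metis unver_ver)

lemma ver_uminus: "ver (- a) = - ver a"
  for a :: "('q::semiring_1, 'a::comm_ring_1) witt"
  by (metis ver_add add.right_inverse ver_0 minus_unique)

lemma ver_diff: "ver (a - b) = ver a - ver b"
  for a b :: "('q::semiring_1, 'a::comm_ring_1) witt"
  using ver_add[of a "- b"] by (simp add: ver_uminus)

lemma teich_mult: "teich c * (a :: ('q::semiring_1, 'a::comm_ring_1) witt)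
    = mkW (\<lambda>i. c ^ (wchar TYPE('q) ^ i) * wcomp a i)"
  by (simp add: teich_def times_witt_def wteich_wmul[OF wchar_prime])

lemma wcomp_teich_mult: "wcomp (teich c * (a :: ('q::semiring_1, 'a::comm_ring_1) witt)) i
    = c ^ (wchar TYPE('q) ^ i) * wcomp a i"
  by (simp add: teich_mult)

lemma teich_teich: "teich (a * b) = teich a * (teich b :: ('q::semiring_1, 'a::comm_ring_1) witt)"
  by (rule witt_eqI) (simp add: wcomp_teich_mult wcomp_teich)

lemma teich_1 [simp]: "teich 1 = 1"
  by (rule witt_eqI) (simp add: wcomp_teich wcomp_1)

lemma teich_0 [simp]: "teich 0 = 0"
  by (rule witt_eqI) (simp add: wcomp_teich)

lemma teich_power: "teich (a ^ n) = (teich a :: ('q::semiring_1, 'a::comm_ring_1) witt) ^ n"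
  by (induction n) (simp_all add: teich_teich)

lemma witt_split: "a = teich (wcomp a 0) + ver (unver a)"
  for a :: "('q::semiring_1, 'a::comm_ring_1) witt"
  by (rule witt_eqI)
    (simp add: plus_witt_def teich_def ver_def unver_def wadd_wteich_wshift[OF wchar_prime])

lemma wfrob_ver: "wfrob (ver a) = ver (wfrob (a :: ('q::semiring_1, 'a::comm_ring_1) witt))"
  by (rule witt_eqI)
    (use prime_gt_0_nat[OF wchar_prime[where 'q = 'q]] in \<open>simp add: wcomp_ver wcomp_frob power_0_left\<close>)

lemma wfrob_teich: "wfrob (teich a) = (teich (a ^ wchar TYPE('q)) :: ('q::semiring_1, 'a::comm_ring_1) witt)"
  by (rule witt_eqI)
    (use prime_gt_0_nat[OF wchar_prime[where 'q = 'q]] in \<open>simp add: wcomp_teich wcomp_frob power_0_left\<close>)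

lemma wcomp_dvd_cong_add:
  fixes a b a' b' :: "('q::semiring_1, 'a::comm_ring_1) witt"
  assumes "\<And>i. d dvd wcomp a i - wcomp a' i" "\<And>i. d dvd wcomp b i - wcomp b' i"
  shows "d dvd wcomp (a + b) i - wcomp (a' + b') i"
  unfolding wcomp_add by (intro peval_dvd_cong) (auto simp: assms split: sum.split)

lemma wcomp_dvd_cong_mult:
  fixes a b a' b' :: "('q::semiring_1, 'a::comm_ring_1) witt"
  assumes "\<And>i. d dvd wcomp a i - wcomp a' i" "\<And>i. d dvd wcomp b i - wcomp b' i"
  shows "d dvd wcomp (a * b) i - wcomp (a' * b') i"
  unfolding wcomp_mult by (intro peval_dvd_cong) (auto simp: assms split: sum.split)

lemma wcomp_dvd_diff:
  fixes a b :: "('q::semiring_1, 'a::comm_ring_1) witt"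
  assumes "\<And>i. d dvd wcomp a i - wcomp b i"
  shows "d dvd wcomp (a - b) i"
proof -
  have "d dvd wcomp (a + (- 1) * b) i - wcomp (b + (- 1) * b) i"
    by (intro wcomp_dvd_cong_add wcomp_dvd_cong_mult assms) auto
  thus ?thesis by simp
qed

section \<open>Witt vectors in characteristic p\<close>

locale witt_char =
  fixes p :: nat and ty :: "('q::semiring_1 \<times> 'a::comm_ring_1) itself"
  assumes prime_p: "nprime p" and charq: "CHAR('q) = p" and chara: "CHAR('a) = p"
begin

lemma wchar_p: "wchar TYPE('q) = p"
  using prime_p charq by (simp add: wchar_def)

lemma of_nat_p: "of_nat p = (0::'a)"
  using chara by (metis of_nat_CHAR)

lemma p_gt_0: "p > 0" using prime_p prime_gt_0_nat by blast

lemma p_ge_2: "p \<ge> 2" using prime_p prime_ge_2_nat by blast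

lemma frob_add: "((x::'a) + y) ^ p = x ^ p + y ^ p"
  by (rule freshmans_dream) (simp_all add: chara prime_p)

lemma ver_wfrob_mult: "ver (wfrob a * b) = a * ver (b :: ('q, 'a) witt)"
  using wshift_wmul_char[OF prime_p of_nat_p, of "wcomp a" "wcomp b"]
  by (simp add: ver_def times_witt_def wfrob_def wchar_p)

lemma ver_1: "ver 1 = (of_nat p :: ('q, 'a) witt)"
proof -
  have "wcomp (of_nat k :: ('q, 'a) witt) = (wadd p wone ^^ k) (\<lambda>i. 0)" for k
  proof (induction k)
    case (Suc k)
    have "of_nat (Suc k) = 1 + (of_nat k :: ('q, 'a) witt)" by simp
    thus ?case by (simp only: plus_witt_def one_witt_def wcomp_mkW wchar_p Suc funpow.simps o_apply)
  qed (simp add: fun_eq_iff)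
  thus ?thesis
    by (simp add: witt_eq_iff ver_def one_witt_def wshift_wone_char[OF prime_p of_nat_p])
qed

lemma ver_wfrob: "ver (wfrob a) = of_nat p * (a :: ('q, 'a) witt)"
  using ver_wfrob_mult[of a 1] by (simp add: ver_1 mult.commute)

lemma p_mult: "of_nat p * (a :: ('q, 'a) witt) = ver (wfrob a)"
  by (simp add: ver_wfrob)

lemma peval_frob: "peval v P ^ p = peval (\<lambda>i. v i ^ p :: 'a) P"
  by (rule hom_peval) (simp_all add: frob_add power_mult_distrib)

lemma wfrob_add: "wfrob (a + b) = wfrob a + wfrob (b :: ('q, 'a) witt)"
proof (rule witt_eqI)
  fix i
  show "wcomp (wfrob (a + b)) i = wcomp (wfrob a + wfrob b) i"
    unfolding wcomp_frob wcomp_add wchar_p peval_frob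
    by (rule arg_cong2[where f = peval]) (auto simp: fun_eq_iff wcomp_frob wchar_p split: sum.split)
qed

lemma wfrob_mult: "wfrob (a * b) = wfrob a * wfrob (b :: ('q, 'a) witt)"
proof (rule witt_eqI)
  fix i
  show "wcomp (wfrob (a * b)) i = wcomp (wfrob a * wfrob b) i"
    unfolding wcomp_frob wcomp_mult wchar_p peval_frob
    by (rule arg_cong2[where f = peval]) (auto simp: fun_eq_iff wcomp_frob wchar_p split: sum.split)
qed

lemma wfrob_1 [simp]: "wfrob 1 = (1 :: ('q, 'a) witt)"
  by (rule witt_eqI) (use p_gt_0 in \<open>simp add: wcomp_frob wcomp_1 wchar_p power_0_left\<close>)

lemma wfrob_0 [simp]: "wfrob 0 = (0 :: ('q, 'a) witt)"
  by (rule witt_eqI) (use p_gt_0 in \<open>simp add: wcomp_frob wchar_p power_0_left\<close>)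

lemma wfrob_uminus: "wfrob (- a) = - wfrob (a :: ('q, 'a) witt)"
  by (metis wfrob_add add.right_inverse wfrob_0 minus_unique)

lemma wfrob_diff: "wfrob (a - b) = wfrob a - wfrob (b :: ('q, 'a) witt)"
  using wfrob_add[of a "- b"] by (simp add: wfrob_uminus)

lemma wfrob_sum: "wfrob (sum g A) = (\<Sum>x\<in>A. wfrob (g x :: ('q, 'a) witt))"
  by (induction A rule: infinite_finite_induct) (auto simp: wfrob_add)

lemma wfrob_power: "wfrob (a ^ n) = wfrob (a :: ('q, 'a) witt) ^ n"
  by (induction n) (auto simp: wfrob_mult)

lemma p_mult_ver: "of_nat p * ver (a :: ('q, 'a) witt) = ver (of_nat p * a)"
  by (simp add: p_mult wfrob_ver)

lemma ver_mult_ver: "ver a * ver b = of_nat p * ver (a * (b :: ('q, 'a) witt))"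
proof -
  have "ver a * ver b = ver (wfrob (ver a) * b)" by (rule ver_wfrob_mult[symmetric])
  also have "\<dots> = of_nat p * ver (a * b)"
    by (simp only: wfrob_ver ver_wfrob p_mult_ver mult.assoc)
  finally show ?thesis .
qed

lemma ver_power: "ver a ^ Suc n = of_nat (p ^ n) * ver (a ^ Suc n :: ('q, 'a) witt)"
proof (induction n)
  case (Suc n)
  have "ver a ^ Suc (Suc n) = ver a * ver a ^ Suc n" by (rule power_Suc)
  also have "\<dots> = of_nat (p ^ n) * (ver a * ver (a ^ Suc n))"
    by (simp only: Suc mult.left_commute)
  also have "\<dots> = of_nat (p ^ Suc n) * ver (a * a ^ Suc n)"
    by (simp only: ver_mult_ver power_Suc of_nat_mult mult_ac)
  also have "a * a ^ Suc n = a ^ Suc (Suc n)" by (rule power_Suc[symmetric])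
  finally show ?case .
qed simp

lemma teich_ver: "teich c * ver a = ver (teich (c ^ p) * (a :: ('q, 'a) witt))"
  by (simp add: wfrob_teich wchar_p flip: ver_wfrob_mult)

lemma dvd_p_iff: "of_nat p dvd (a :: ('q, 'a) witt) \<longleftrightarrow> (\<exists>b. a = ver (wfrob b))"
  by (auto simp: dvd_def p_mult)

text \<open>On the Teichmueller part F is the p-th power. On the part in the image of V both are
  divisible by p: F V = V F = p, and powers of V x from the second on are multiples of p.\<close>

lemma wfrob_cong: "of_nat p dvd a ^ p - wfrob (a :: ('q, 'a) witt)"
proof -
  define t v where "t = (teich (wcomp a 0) :: ('q, 'a) witt)" and "v = ver (unver a)"
  have a: "a = t + v" unfolding t_def v_def by (rule witt_split)
  obtain k where k: "p = Suc (Suc k)" using p_ge_2 by (intro that[of "p - 2"]) simp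
  have t: "wfrob t = t ^ p" by (simp add: t_def wfrob_teich wchar_p teich_power)
  have v: "of_nat p dvd wfrob v" by (auto simp: v_def wfrob_ver dvd_p_iff)
  have "v ^ Suc (Suc k) = of_nat p * (of_nat (p ^ k) * ver (unver a ^ Suc (Suc k)))"
    unfolding v_def ver_power by (simp only: power_Suc of_nat_mult mult.assoc)
  hence vp: "of_nat p dvd v ^ p" unfolding k[symmetric] by simp
  have "of_nat p dvd ((t + v) ^ p - (t ^ p + v ^ p)) + v ^ p - wfrob v"
    by (intro dvd_diff dvd_add v vp prime_dvd_freshman prime_p)
  thus ?thesis by (simp add: a wfrob_add t diff_diff_eq)
qed

end

section \<open>The multinomial theorem\<close>

definition comps :: "'m set \<Rightarrow> nat \<Rightarrow> ('m \<Rightarrow> nat) set" where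
  "comps A n = {\<alpha> \<in> (\<Pi>\<^sub>E m\<in>A. {0..n}). (\<Sum>m\<in>A. \<alpha> m) = n}"

lemma finite_comps: "finite A \<Longrightarrow> finite (comps A n)"
  unfolding comps_def by (rule finite_subset[OF _ finite_PiE[of A "\<lambda>_. {0..n}"]]) auto

lemma comps_insert:
  assumes "finite A" "a \<notin> A"
  shows "bij_betw (\<lambda>(k, \<alpha>). \<alpha>(a := k)) (SIGMA k:{..n}. comps A (n - k)) (comps (insert a A) n)"
proof (rule bij_betw_byWitness[where f' = "\<lambda>\<alpha>. (\<alpha> a, \<alpha>(a := undefined))"])
  have eq: "(\<Sum>m\<in>A. (\<alpha>(a := k)) m) = (\<Sum>m\<in>A. \<alpha> m)" for \<alpha> k
    using assms(2) by (intro sum.cong) auto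
  show "\<forall>x\<in>SIGMA k:{..n}. comps A (n - k). (\<lambda>\<alpha>. (\<alpha> a, \<alpha>(a := undefined))) ((\<lambda>(k, \<alpha>). \<alpha>(a := k)) x) = x"
    using assms by (auto simp: comps_def PiE_def extensional_def)
  show "(\<lambda>(k, \<alpha>). \<alpha>(a := k)) ` (SIGMA k:{..n}. comps A (n - k)) \<subseteq> comps (insert a A) n"
  proof (rule image_subsetI)
    fix z assume z: "z \<in> (SIGMA k:{..n}. comps A (n - k))"
    obtain k \<alpha> where z': "z = (k, \<alpha>)" by (cases z)
    have k: "k \<le> n" and \<alpha>: "\<alpha> \<in> comps A (n - k)" using z z' by auto
    have "\<alpha> m \<le> n" if "m \<in> A" for m
      using \<alpha> that by (force simp: comps_def PiE_def)
    moreover have "\<alpha> m = undefined" if "m \<notin> A" for m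
      using \<alpha> that by (auto simp: comps_def PiE_def extensional_def)
    ultimately have "\<alpha>(a := k) \<in> (\<Pi>\<^sub>E m\<in>insert a A. {0..n})"
      using k by (auto simp: PiE_def extensional_def)
    moreover have "(\<Sum>m\<in>insert a A. (\<alpha>(a := k)) m) = k + (\<Sum>m\<in>A. \<alpha> m)"
      using assms eq[of \<alpha> k] by simp
    moreover have "(\<Sum>m\<in>A. \<alpha> m) = n - k" using \<alpha> by (simp add: comps_def)
    ultimately show "(\<lambda>(k, \<alpha>). \<alpha>(a := k)) z \<in> comps (insert a A) n"
      using k unfolding comps_def z' by (simp only: prod.case mem_Collect_eq) simp
  qed
  show "(\<lambda>\<alpha>. (\<alpha> a, \<alpha>(a := undefined))) ` comps (insert a A) n \<subseteq> (SIGMA k:{..n}. comps A (n - k))"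
  proof (rule image_subsetI)
    fix \<alpha> assume \<alpha>: "\<alpha> \<in> comps (insert a A) n"
    hence s: "\<alpha> a + (\<Sum>m\<in>A. \<alpha> m) = n" using assms by (simp add: comps_def)
    have "\<alpha> m \<le> n - \<alpha> a" if "m \<in> A" for m
      using member_le_sum[of m A \<alpha>] that assms(1) s by auto
    hence "\<alpha>(a := undefined) \<in> (\<Pi>\<^sub>E m\<in>A. {0..n - \<alpha> a})"
      using \<alpha> assms by (auto simp: comps_def PiE_def extensional_def)
    thus "(\<alpha> a, \<alpha>(a := undefined)) \<in> (SIGMA k:{..n}. comps A (n - k))"
      using s eq[of \<alpha> undefined] unfolding comps_def by (simp only: mem_Sigma_iff mem_Collect_eq) auto
  qed
qed auto

text \<open>Divisibility and expansion are proved together: the induction splits off one index by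
  the binomial theorem, and the coefficients multiply correctly because the division of factorials
  is exact.\<close>

lemma multinomial_aux:
  fixes A :: "'m set"
  assumes "finite A"
  shows "\<alpha> \<in> comps A n \<Longrightarrow> (\<Prod>m\<in>A. fact (\<alpha> m)) dvd (fact n :: nat)"
    and "(\<Sum>m\<in>A. x m :: 'a::comm_ring_1) ^ n
      = (\<Sum>\<alpha>\<in>comps A n. of_nat (fact n div (\<Prod>m\<in>A. fact (\<alpha> m))) * (\<Prod>m\<in>A. x m ^ \<alpha> m))"
  using assms
proof (induction A arbitrary: \<alpha> n rule: finite_induct)
  case empty
  { case 1 thus ?case by simp }
  case 2 
  have "comps ({}::'m set) n = (if n = 0 then {\<lambda>_. undefined} else {})" by (auto simp: comps_def)
  thus ?case by (cases "n = 0") (simp_all add: power_0_left)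
next
  case (insert a A)
  have key: "(\<Prod>m\<in>A. fact (\<alpha> m)) * fact k dvd (fact n :: nat) \<and>
      (fact n :: nat) div (fact k * (\<Prod>m\<in>A. fact (\<alpha> m))) = (n choose k) * (fact (n - k) div (\<Prod>m\<in>A. fact (\<alpha> m)))"
    if kn: "k \<le> n" and \<alpha>: "\<alpha> \<in> comps A (n - k)" for k n \<alpha>
  proof -
    obtain c where c: "(fact (n - k) :: nat) = (\<Prod>m\<in>A. fact (\<alpha> m)) * c"
      using insert.IH(1)[OF \<alpha>] by (auto elim: dvdE)
    have pos: "(\<Prod>m\<in>A. fact (\<alpha> m) :: nat) > 0" by (simp add: prod_pos)
    have n: "(fact n :: nat) = (fact k * (\<Prod>m\<in>A. fact (\<alpha> m))) * ((n choose k) * c)"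
      using binomial_fact_lemma[OF kn] c by (simp add: mult_ac)
    have "(fact n :: nat) div (fact k * (\<Prod>m\<in>A. fact (\<alpha> m))) = (n choose k) * c"
      unfolding n using pos by (subst nonzero_mult_div_cancel_left) auto
    moreover have "(fact (n - k) :: nat) div (\<Prod>m\<in>A. fact (\<alpha> m)) = c"
      unfolding c using pos by simp
    moreover have "(\<Prod>m\<in>A. fact (\<alpha> m)) * fact k dvd (fact n :: nat)"
      by (rule dvdI[of _ _ "(n choose k) * c"]) (subst n, simp only: mult_ac)
    ultimately show ?thesis by simp
  qed
  note bij = comps_insert[OF insert.hyps]
  {
    case 1
    hence "\<alpha> \<in> (\<lambda>(k, \<alpha>). \<alpha>(a := k)) ` (SIGMA k:{..n}. comps A (n - k))"
      using bij_betw_imp_surj_on[OF bij[of n]] by simp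
    then obtain k \<beta> where b: "\<alpha> = \<beta>(a := k)" "k \<le> n" "\<beta> \<in> comps A (n - k)"
      by (auto elim!: imageE)
    have "(\<Prod>m\<in>A. fact (\<alpha> m) :: nat) = (\<Prod>m\<in>A. fact (\<beta> m))"
      using b insert.hyps by (intro prod.cong) auto
    thus ?case using key[OF b(2,3)] insert.hyps b(1) by (simp add: mult.commute)
  next
    case 2
    have "(\<Sum>m\<in>insert a A. x m) ^ n = (x a + (\<Sum>m\<in>A. x m)) ^ n"
      using insert.hyps by simp
    also have "\<dots> = (\<Sum>k\<le>n. of_nat (n choose k) * x a ^ k * (\<Sum>m\<in>A. x m) ^ (n - k))"
      by (rule binomial_ring)
    also have "\<dots> = (\<Sum>k\<le>n. \<Sum>\<alpha>\<in>comps A (n - k). of_nat (n choose k) * x a ^ k *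
        (of_nat (fact (n - k) div (\<Prod>m\<in>A. fact (\<alpha> m))) * (\<Prod>m\<in>A. x m ^ \<alpha> m)))"
      unfolding insert.IH(2) sum_distrib_left ..
    also have "\<dots> = (\<Sum>(k, \<alpha>)\<in>(SIGMA k:{..n}. comps A (n - k)). of_nat (n choose k) * x a ^ k *
        (of_nat (fact (n - k) div (\<Prod>m\<in>A. fact (\<alpha> m))) * (\<Prod>m\<in>A. x m ^ \<alpha> m)))"
      by (rule sum.Sigma) (auto simp: finite_comps insert.hyps)
    also have "\<dots> = (\<Sum>z\<in>(SIGMA k:{..n}. comps A (n - k)). (\<lambda>\<alpha>. of_nat (fact n div (\<Prod>m\<in>insert a A. fact (\<alpha> m))) * (\<Prod>m\<in>insert a A. x m ^ \<alpha> m))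
        ((\<lambda>(k, \<alpha>). \<alpha>(a := k)) z))"
    proof (intro sum.cong refl)
      fix z assume z: "z \<in> (SIGMA k:{..n}. comps A (n - k))"
      obtain k \<alpha> where z': "z = (k, \<alpha>)" by (cases z)
      have k: "k \<in> {..n}" and \<alpha>: "\<alpha> \<in> comps A (n - k)" using z z' by auto
      have "(\<Prod>m\<in>A. fact ((\<alpha>(a := k)) m) :: nat) = (\<Prod>m\<in>A. fact (\<alpha> m))"
        "(\<Prod>m\<in>A. x m ^ (\<alpha>(a := k)) m) = (\<Prod>m\<in>A. x m ^ \<alpha> m)"
        using insert.hyps by (auto intro!: prod.cong)
      hence "of_nat (n choose k) * x a ^ k * (of_nat (fact (n - k) div (\<Prod>m\<in>A. fact (\<alpha> m))) * (\<Prod>m\<in>A. x m ^ \<alpha> m)) =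
        of_nat (fact n div (\<Prod>m\<in>insert a A. fact ((\<alpha>(a := k)) m))) * (\<Prod>m\<in>insert a A. x m ^ (\<alpha>(a := k)) m)"
        using key[OF _ \<alpha>] k insert.hyps by (simp add: mult_ac)
      thus "(case z of (k, \<alpha>) \<Rightarrow> of_nat (n choose k) * x a ^ k *
        (of_nat (fact (n - k) div (\<Prod>m\<in>A. fact (\<alpha> m))) * (\<Prod>m\<in>A. x m ^ \<alpha> m))) =
        of_nat (fact n div (\<Prod>m\<in>insert a A. fact ((case z of (k, \<alpha>) \<Rightarrow> \<alpha>(a := k)) m))) *
        (\<Prod>m\<in>insert a A. x m ^ (case z of (k, \<alpha>) \<Rightarrow> \<alpha>(a := k)) m)"
        unfolding z' by (simp only: prod.case)
    qed
    also have "\<dots> = (\<Sum>\<alpha>\<in>comps (insert a A) n. of_nat (fact n div (\<Prod>m\<in>insert a A. fact (\<alpha> m))) * (\<Prod>m\<in>insert a A. x m ^ \<alpha> m))"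
      by (rule sum.reindex_bij_betw[OF bij])
    finally show ?case .
  }
qed

text \<open>A composition of p either puts all of p on one index or has all entries below p. In the
  second case p divides the coefficient, as no factorial in the denominator contains p.\<close>

lemma multinomial_prime:
  fixes A :: "'m set" and x :: "'m \<Rightarrow> 'a::comm_ring_1"
  assumes "finite A" "nprime p"
  shows "(\<Sum>m\<in>A. x m) ^ p = (\<Sum>m\<in>A. x m ^ p) + of_nat p *
    (\<Sum>\<alpha> | \<alpha> \<in> (\<Pi>\<^sub>E m\<in>A. {0..p - 1}) \<and> (\<Sum>m\<in>A. \<alpha> m) = p.
        of_nat ((fact p div (\<Prod>m\<in>A. fact (\<alpha> m))) div p) * (\<Prod>m\<in>A. x m ^ \<alpha> m))"
proof -
  define g where "g = (\<lambda>\<alpha>. of_nat (fact p div (\<Prod>m\<in>A. fact (\<alpha> m))) * (\<Prod>m\<in>A. x m ^ \<alpha> m))"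
  define C1 where "C1 = {\<alpha>. \<alpha> \<in> (\<Pi>\<^sub>E m\<in>A. {0..p - 1}) \<and> (\<Sum>m\<in>A. \<alpha> m) = p}"
  define \<delta> where "\<delta> = (\<lambda>a. \<lambda>m\<in>A. if m = a then p else 0 :: nat)"
  have p1: "p > 1" using assms(2) prime_gt_1_nat by blast
  have sub: "C1 \<subseteq> comps A p" by (force simp: C1_def comps_def PiE_def)
  have rest: "comps A p - C1 = \<delta> ` A"
  proof (intro equalityI subsetI)
    fix \<alpha> assume \<alpha>: "\<alpha> \<in> comps A p - C1"
    then obtain a where a: "a \<in> A" "\<not> \<alpha> a \<le> p - 1" by (auto simp: comps_def C1_def PiE_def Pi_iff)
    have s: "(\<Sum>m\<in>A. \<alpha> m) = p" using \<alpha> by (simp add: comps_def)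
    have s2: "(\<Sum>m\<in>A. \<alpha> m) = \<alpha> a + (\<Sum>m\<in>A - {a}. \<alpha> m)" by (rule sum.remove[OF assms(1) a(1)])
    have "\<alpha> a = p" "(\<Sum>m\<in>A - {a}. \<alpha> m) = 0" using s s2 a(2) by auto
    hence "\<alpha> a = p" "\<forall>m\<in>A - {a}. \<alpha> m = 0" using assms(1) by auto
    moreover have "\<alpha> \<in> extensional A" using \<alpha> by (simp add: comps_def PiE_def)
    ultimately have "\<alpha> = \<delta> a" by (auto simp: \<delta>_def extensional_def fun_eq_iff)
    thus "\<alpha> \<in> \<delta> ` A" using a(1) by blast
  next
    fix \<alpha> assume "\<alpha> \<in> \<delta> ` A"
    then obtain a where a: "a \<in> A" "\<alpha> = \<delta> a" by blast
    have "(\<Sum>m\<in>A. \<delta> a m) = (\<Sum>m\<in>A. if m = a then p else 0)" by (intro sum.cong) (auto simp: \<delta>_def)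
    also have "\<dots> = p" using a assms(1) by simp
    finally have "\<delta> a \<in> comps A p" by (auto simp: comps_def \<delta>_def)
    moreover have "\<delta> a \<notin> C1"
    proof
      assume "\<delta> a \<in> C1"
      hence "\<delta> a a \<in> {0..p - 1}" using a(1) by (auto simp only: C1_def mem_Collect_eq PiE_def Pi_iff)
      thus False using a(1) p1 by (simp add: \<delta>_def)
    qed
    ultimately show "\<alpha> \<in> comps A p - C1" using a by simp
  qed
  have inj: "inj_on \<delta> A"
  proof (rule inj_onI)
    fix a b assume "a \<in> A" "b \<in> A" "\<delta> a = \<delta> b"
    hence "\<delta> a a = \<delta> b a" by simp
    thus "a = b" using \<open>a \<in> A\<close> p1 by (auto simp: \<delta>_def split: if_splits)
  qed
  have gd: "g (\<delta> a) = x a ^ p" if "a \<in> A" for a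
  proof -
    have "(\<Prod>m\<in>A. fact (\<delta> a m) :: nat) = (\<Prod>m\<in>A. if m = a then fact p else 1)"
      by (intro prod.cong) (auto simp: \<delta>_def)
    moreover have "(\<Prod>m\<in>A. x m ^ \<delta> a m) = (\<Prod>m\<in>A. if m = a then x m ^ p else 1)"
      by (intro prod.cong) (auto simp: \<delta>_def)
    ultimately show ?thesis using that assms(1) by (simp add: g_def)
  qed
  have gC: "g \<alpha> = of_nat p * (of_nat ((fact p div (\<Prod>m\<in>A. fact (\<alpha> m))) div p) * (\<Prod>m\<in>A. x m ^ \<alpha> m))"
    if "\<alpha> \<in> C1" for \<alpha>
  proof -
    let ?P = "\<Prod>m\<in>A. fact (\<alpha> m) :: nat"
    have "?P dvd fact p" using multinomial_aux(1)[OF assms(1)] that sub by blast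
    moreover have "\<not> p dvd ?P"
    proof
      assume "p dvd ?P"
      then obtain m where m: "m \<in> A" "p dvd fact (\<alpha> m)"
        using prime_dvd_prod_iff[OF assms(1,2)] by auto
      hence "p \<le> \<alpha> m" using prime_dvd_fact_iff[OF assms(2)] by blast
      moreover have "\<alpha> m \<le> p - 1" using that m(1) by (auto simp: C1_def)
      ultimately show False using p1 by simp
    qed
    moreover have "p dvd fact p" using p1 by (simp add: dvd_fact)
    ultimately have "p dvd fact p div ?P"
      using assms(2) by (metis dvd_mult_div_cancel prime_dvd_mult_iff)
    hence "fact p div ?P = p * (fact p div ?P div p)" by simp
    thus ?thesis unfolding g_def by (metis mult.assoc of_nat_mult)
  qed
  have "(\<Sum>m\<in>A. x m) ^ p = sum g (comps A p)"
    unfolding g_def by (rule multinomial_aux(2)[OF assms(1)])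
  also have "\<dots> = sum g (comps A p - C1) + sum g C1"
    by (rule sum.subset_diff[OF sub finite_comps[OF assms(1)]])
  also have "sum g (comps A p - C1) = (\<Sum>m\<in>A. x m ^ p)"
    unfolding rest sum.reindex[OF inj] by (intro sum.cong) (auto simp: gd)
  also have "sum g C1 = of_nat p * (\<Sum>\<alpha>\<in>C1. of_nat ((fact p div (\<Prod>m\<in>A. fact (\<alpha> m))) div p) * (\<Prod>m\<in>A. x m ^ \<alpha> m))"
    unfolding sum_distrib_left by (intro sum.cong gC refl)
  finally show ?thesis by (simp add: C1_def)
qed

section \<open>The polynomial ring as a domain\<close>

text \<open>Numbering the finitely many variables embeds the ring into polynomials with variables
  indexed by \<open>nat\<close>, where monomials are linearly ordered and products of nonzero
  elements are nonzero.\<close>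

lemma mpoly_mult_eq_0:
  fixes a b :: "('n::finite \<Rightarrow>\<^sub>0 nat) \<Rightarrow>\<^sub>0 'k::field"
  assumes "a * b = 0"
  shows "a = 0 \<or> b = 0"
proof -
  obtain g :: "'n \<Rightarrow> nat" where g: "inj g"
    using finite_imp_inj_to_nat_seg[OF finite[of "UNIV :: 'n set"]] by metis
  define emb where "emb = (\<lambda>m :: 'n \<Rightarrow>\<^sub>0 nat. \<Sum>i\<in>UNIV. single (g i) (lookup m i))"
  have emb_add: "emb (m + n) = emb m + emb n" for m n
    by (simp add: emb_def lookup_add single_add sum.distrib)
  have "lookup (emb m) (g i) = lookup m i" for m i
    using g by (simp add: emb_def lookup_sum lookup_single when_def inj_eq)
  hence emb_inj: "emb m = emb n \<longleftrightarrow> m = n" for m n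
    by (metis poly_mapping_eqI)
  define E where "E = pm_hom (single (0 :: nat \<Rightarrow>\<^sub>0 nat) :: 'k \<Rightarrow> _) (\<lambda>m. single (emb m) 1)"
  have E: "E (a * b) = E a * E b"
    unfolding E_def by (rule pm_hom_mult) (simp_all add: single_add mult_single emb_add)
  have E0: "a = 0" if "E a = 0" for a
  proof (rule poly_mapping_eqI)
    fix m
    have "lookup (E a) (emb m) = lookup a m"
      by (simp add: E_def pm_hom_def mult_single lookup_sum lookup_single when_def emb_inj in_keys_iff)
    thus "lookup a m = lookup 0 m" using that by simp
  qed
  have "E a * E b = 0" using assms E by (simp add: E_def)
  hence "E a = 0 \<or> E b = 0" by simp
  thus ?thesis using E0 by blast
qed

lemma mpoly_cancel:
  fixes a b c :: "('n::finite \<Rightarrow>\<^sub>0 nat) \<Rightarrow>\<^sub>0 'k::field"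
  assumes "a * b = a * c" "a \<noteq> 0"
  shows "b = c"
  using mpoly_mult_eq_0[of a "b - c"] assms by (simp add: right_diff_distrib)

lemma mpoly_power_eq_0:
  fixes a :: "('n::finite \<Rightarrow>\<^sub>0 nat) \<Rightarrow>\<^sub>0 'k::field"
  shows "a ^ n = 0 \<Longrightarrow> a = 0"
  by (induction n) (auto dest: mpoly_mult_eq_0)

lemma mpoly_dvd_cancel:
  fixes a b c :: "('n::finite \<Rightarrow>\<^sub>0 nat) \<Rightarrow>\<^sub>0 'k::field"
  assumes "a * b dvd a * c" "a \<noteq> 0"
  shows "b dvd c"
proof -
  obtain d where "a * c = a * (b * d)" using assms(1) by (auto simp: dvd_def mult.assoc)
  thus ?thesis using mpoly_cancel[OF _ assms(2)] by (metis dvd_triv_left)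
qed

lemma CHAR_mpoly: "CHAR(('n \<Rightarrow>\<^sub>0 nat) \<Rightarrow>\<^sub>0 'k::field) = CHAR('k)"
proof (rule CHAR_eqI)
  have "lookup (of_nat n :: ('n \<Rightarrow>\<^sub>0 nat) \<Rightarrow>\<^sub>0 'k) 0 = of_nat n" for n
    by (simp add: lookup_of_nat)
  moreover have "of_nat n = single (0 :: 'n \<Rightarrow>\<^sub>0 nat) (of_nat n :: 'k)" for n
    by simp
  ultimately show "of_nat CHAR('k) = (0 :: ('n \<Rightarrow>\<^sub>0 nat) \<Rightarrow>\<^sub>0 'k)"
    "\<And>m. of_nat m = (0 :: ('n \<Rightarrow>\<^sub>0 nat) \<Rightarrow>\<^sub>0 'k) \<Longrightarrow> CHAR('k) dvd m"
    by (metis of_nat_CHAR single_zero) (metis \<open>\<And>n. lookup (of_nat n) 0 = of_nat n\<close> lookup_zero of_nat_eq_0_iff_char_dvd)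
qed

type_synonym ('n, 'k) wittS = "('k, ('n, 'k) mpoly) witt"

section \<open>Teichmueller lifts of monomials\<close>

locale perfect_poly =
  fixes p :: nat and ty :: "('n::finite \<times> 'k::field) itself"
  assumes CHARk: "CHAR('k) = p" and p_positive: "p > 0" and surj_frob: "surj (\<lambda>c::'k. c ^ p)"
begin

lemma prime_p: "nprime p"
  using CHARk p_positive by (metis prime_CHAR_semidom)

sublocale witt_char p "TYPE('k \<times> ('n, 'k) mpoly)"
  by unfold_locales (simp_all add: prime_p CHARk CHAR_mpoly)

lemma zero_power_p: "(0::('n, 'k) mpoly) ^ p = 0"
  using p_gt_0 by (rule zero_power)

lemma frob_diff: "((x::('n, 'k) mpoly) - y) ^ p = x ^ p - y ^ p"
  using frob_add[of "x - y" y] by simp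

lemma frob_inj: "x ^ p = y ^ p \<Longrightarrow> x = (y::('n, 'k) mpoly)"
  using frob_diff[of x y] mpoly_power_eq_0[of "x - y" p] by simp

text \<open>Multiplication by p is V F, and F is injective because S is reduced. This allows the
  division by p in \<open>Delta_expansion\<close>.\<close>

lemma of_nat_p_inj: "of_nat p * a = of_nat p * b \<Longrightarrow> a = (b :: ('n, 'k) wittS)"
  by (rule witt_eqI) (metis p_mult ver_inj wcomp_frob wchar_p frob_inj)

definition tau :: "('n, 'k) mpoly \<Rightarrow> ('n, 'k) wittS" where
  "tau a = (\<Sum>m\<in>keys a. teich (single m (lookup a m)))"

lemma tau_superset: "finite A \<Longrightarrow> keys a \<subseteq> A \<Longrightarrow> tau a = (\<Sum>m\<in>A. teich (single m (lookup a m)))"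
  unfolding tau_def by (intro sum.mono_neutral_left) (auto simp: in_keys_iff)

lemma tau_single: "tau (single m c) = teich (single m c)"
  by (subst tau_superset[of "{m}"]) auto

lemma tau_0 [simp]: "tau 0 = 0"
  by (simp add: tau_def)

lemma tau_1 [simp]: "tau 1 = 1"
  using tau_single[of 0 1] by simp

lemma wcomp_tau_0 [simp]: "wcomp (tau a) 0 = a"
  unfolding tau_def by (simp flip: poly_mapping_sum_singles)

text \<open>Write the scalars as p-th powers. The additivity defect \<open>x\<close> of the roots
  has component 0 equal to zero, so F x lies in the image of V F = p; and F x is the defect of the
  given scalars. A monomial is then multiplied on.\<close>

lemma teich_single_add:
  "of_nat p dvd teich (single m (c + d)) - (teich (single m c) + teich (single m d) :: ('n, 'k) wittS)"
proof -
  obtain c' d' where cd: "c = c' ^ p" "d = d' ^ p"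
    using surj_frob by (metis surjD)
  have sp: "single 0 (e ^ p) = (single 0 e :: ('n, 'k) mpoly) ^ p" for e
  proof -
    have "single 0 (e ^ n) = (single 0 e :: ('n, 'k) mpoly) ^ n" for n
    proof (induction n)
      case (Suc n)
      have "single 0 (e ^ Suc n) = (single 0 e * single 0 (e ^ n) :: ('n, 'k) mpoly)" by (simp add: mult_single)
      thus ?case by (simp only: Suc power_Suc)
    qed simp
    thus ?thesis by blast
  qed
  define x where "x = (teich (single 0 (c' + d')) - (teich (single 0 c') + teich (single 0 d')) :: ('n, 'k) wittS)"
  have "wcomp x 0 = 0" by (simp add: x_def single_add)
  hence "wfrob x = ver (wfrob (unver x))" by (metis ver_unver wfrob_ver)
  hence dvd: "of_nat p dvd wfrob x" by (auto simp: dvd_p_iff)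
  have "wfrob x = teich (single 0 (c + d)) - (teich (single 0 c) + teich (single 0 d))"
    by (simp add: x_def wfrob_diff wfrob_add wfrob_teich wchar_p cd single_add sp frob_add)
  hence "teich (single m 1) * wfrob x = teich (single m (c + d)) - (teich (single m c) + teich (single m d))"
    by (simp add: right_diff_distrib distrib_left mult_single flip: teich_teich)
  thus ?thesis using dvd_mult[OF dvd] by metis
qed

lemma tau_add: "of_nat p dvd tau (a + b) - (tau a + tau b)"
proof -
  let ?A = "keys a \<union> keys b"
  have t: "tau c = (\<Sum>m\<in>?A. teich (single m (lookup c m)))" if "keys c \<subseteq> ?A" for c
    using that by (intro tau_superset) auto
  have "tau (a + b) - (tau a + tau b) = (\<Sum>m\<in>?A. teich (single m (lookup a m + lookup b m)) -
      (teich (single m (lookup a m)) + teich (single m (lookup b m))))"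
    using t[OF Poly_Mapping.keys_add] t[of a] t[of b]
    by (simp add: lookup_add sum_subtractf sum.distrib)
  thus ?thesis by (auto intro!: dvd_sum teich_single_add)
qed

text \<open>The defect is recorded as V F z: one level down it becomes F z, on which functionals
  that kill p-th powers vanish.\<close>

lemma tau_add': "\<exists>z. tau (a + b) = tau a + tau b + ver (wfrob z)"
  using tau_add[of a b] by (auto simp: dvd_p_iff algebra_simps)

lemma tau_single_mult: "tau (single m c * a) = teich (single m c) * tau a"
proof (cases "c = 0")
  case False
  have eq: "single m c * a = (\<Sum>n\<in>keys a. single (m + n) (c * lookup a n))"
    by (subst poly_mapping_sum_singles[of a]) (simp add: sum_distrib_left mult_single)
  have l: "lookup (single m c * a) (m + n) = c * lookup a n" for n
    unfolding eq by (simp add: lookup_sum lookup_single when_def in_keys_iff)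
  have k: "keys (single m c * a) \<subseteq> (+) m ` keys a"
    using Poly_Mapping.keys_mult[of "single m c" a] False by auto
  have "tau (single m c * a) = (\<Sum>n\<in>keys a. teich (single (m + n) (c * lookup a n)))"
    by (subst tau_superset[OF _ k]) (simp_all add: sum.reindex l)
  also have "\<dots> = (\<Sum>n\<in>keys a. teich (single m c) * teich (single n (lookup a n)))"
    by (simp add: mult_single flip: teich_teich)
  finally show ?thesis by (simp add: tau_def sum_distrib_left)
qed auto

text \<open>With \<open>tau_add\<close> this makes \<open>tau\<close> a ring homomorphism from S to
  W(S)/p splitting the projection to component 0. Additivity reduces it to a monomial
  \<open>a\<close>, where equality holds exactly.\<close>

lemma tau_mult: "of_nat p dvd tau (a * b) - tau a * tau b"
proof (induction a rule: poly_mapping_induct_add)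
  case (add a a')
  have "of_nat p dvd (tau (a * b + a' * b) - (tau (a * b) + tau (a' * b))) +
     ((tau (a * b) - tau a * tau b) + (tau (a' * b) - tau a' * tau b)) - (tau (a + a') - (tau a + tau a')) * tau b"
    by (intro dvd_add dvd_diff dvd_mult2 tau_add add)
  thus ?case by (simp add: algebra_simps)
qed (simp_all add: tau_single_mult tau_single)

lemma tau_power: "of_nat p dvd tau (a ^ n) - tau a ^ n"
proof (induction n)
  case (Suc n)
  have "of_nat p dvd (tau (a * a ^ n) - tau a * tau (a ^ n)) + tau a * (tau (a ^ n) - tau a ^ n)"
    by (intro dvd_add dvd_mult tau_mult Suc)
  thus ?case by (simp add: algebra_simps)
qed simp

lemma tau_frob: "of_nat p dvd tau (a ^ p) - wfrob (tau a)"
  by (rule dvd_diff_trans[OF tau_power wfrob_cong])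

lemma tau_frob': "\<exists>z. tau (a ^ p) = wfrob (tau a) + ver (wfrob z)"
  using tau_frob[of a] by (auto simp: dvd_p_iff algebra_simps)

text \<open>The vectors tau(c) and [c] differ, but their difference has component 0 equal to zero,
  so F makes it divisible by p. Hence tau(c^p) and [c^p] agree modulo p for every polynomial
  \<open>c\<close>.\<close>

lemma tau_teich_p: "of_nat p dvd tau (c ^ p * a) - teich (c ^ p) * tau a"
proof -
  have "of_nat p dvd wfrob (tau c) - teich (c ^ p)"
  proof -
    have "wcomp (tau c - teich c) 0 = 0" by simp
    hence "wfrob (tau c - teich c) = ver (wfrob (unver (tau c - teich c)))" by (metis ver_unver wfrob_ver)
    thus ?thesis by (auto simp: dvd_p_iff wfrob_diff wfrob_teich wchar_p)
  qed
  hence "of_nat p dvd tau (c ^ p) - teich (c ^ p)" by (rule dvd_diff_trans[OF tau_frob])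
  hence "of_nat p dvd (tau (c ^ p) - teich (c ^ p)) * tau a" by (rule dvd_mult2)
  hence "of_nat p dvd tau (c ^ p) * tau a - teich (c ^ p) * tau a" by (simp add: algebra_simps)
  thus ?thesis by (rule dvd_diff_trans[OF tau_mult])
qed

lemma tau_teich_p': "\<exists>z. tau (c ^ p * a) = teich (c ^ p) * tau a + ver (wfrob z)"
  using tau_teich_p[of c a] by (auto simp: dvd_p_iff algebra_simps)

text \<open>The whole Witt vector of which \<open>Delta1 p a\<close> is component 0, by
  \<open>wcomp_Delta_0\<close>.\<close>

definition Delta :: "('n, 'k) mpoly \<Rightarrow> ('n, 'k) wittS" where
  "Delta a = unver (teich a - tau a)"

lemma ver_Delta: "ver (Delta a) = teich a - tau a"
  unfolding Delta_def by (rule ver_unver) simp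

lemma teich_tau: "teich a = tau a + ver (Delta a)"
  by (simp add: ver_Delta)

text \<open>Describes the image of \<open>tau\<close> modulo p. As a subring containing the
  Teichmueller lifts of monomials, it contains the multinomial sum that lifts
  \<open>Delta1\<close>.\<close>

definition monomial_like :: "('n, 'k) wittS \<Rightarrow> bool" where
  "monomial_like z \<longleftrightarrow> of_nat p dvd z - tau (wcomp z 0)"

lemma monomial_like_add: "monomial_like y \<Longrightarrow> monomial_like z \<Longrightarrow> monomial_like (y + z)"
proof -
  assume "monomial_like y" "monomial_like z"
  hence "of_nat p dvd (y - tau (wcomp y 0)) + (z - tau (wcomp z 0)) -
      (tau (wcomp y 0 + wcomp z 0) - (tau (wcomp y 0) + tau (wcomp z 0)))"
    unfolding monomial_like_def by (rule dvd_diff[OF dvd_add tau_add])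
  thus ?thesis by (simp add: monomial_like_def algebra_simps)
qed

lemma monomial_like_mult: "monomial_like y \<Longrightarrow> monomial_like z \<Longrightarrow> monomial_like (y * z)"
proof -
  assume "monomial_like y" "monomial_like z"
  hence "of_nat p dvd (y - tau (wcomp y 0)) * z + tau (wcomp y 0) * (z - tau (wcomp z 0)) -
      (tau (wcomp y 0 * wcomp z 0) - tau (wcomp y 0) * tau (wcomp z 0))"
    unfolding monomial_like_def by (rule dvd_diff[OF dvd_add[OF dvd_mult2 dvd_mult] tau_mult])
  thus ?thesis by (simp add: monomial_like_def algebra_simps)
qed

lemma monomial_like_1: "monomial_like 1" and monomial_like_0: "monomial_like 0"
  by (simp_all add: monomial_like_def wcomp_1)

lemma monomial_like_teich: "monomial_like (teich (single m c))"
  by (simp add: monomial_like_def tau_single)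

lemma monomial_like_sum: "(\<And>x. x \<in> A \<Longrightarrow> monomial_like (g x)) \<Longrightarrow> monomial_like (sum g A)"
  by (induction A rule: infinite_finite_induct) (auto intro: monomial_like_add monomial_like_0)

lemma monomial_like_prod: "(\<And>x. x \<in> A \<Longrightarrow> monomial_like (g x)) \<Longrightarrow> monomial_like (prod g A)"
  by (induction A rule: infinite_finite_induct) (auto intro: monomial_like_mult monomial_like_1)

lemma monomial_like_power: "monomial_like z \<Longrightarrow> monomial_like (z ^ n)"
  by (induction n) (auto intro: monomial_like_mult monomial_like_1)

lemma monomial_like_of_nat: "monomial_like (of_nat n)"
  by (induction n) (auto intro: monomial_like_add monomial_like_1 monomial_like_0)

lemma wcomp_of_nat_0 [simp]: "wcomp (of_nat n :: ('n, 'k) wittS) 0 = of_nat n"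
  by (induction n) (simp_all add: wcomp_1)

lemma wcomp_prod_0 [simp]: "wcomp (prod g A :: ('n, 'k) wittS) 0 = (\<Prod>x\<in>A. wcomp (g x) 0)"
  by (induction A rule: infinite_finite_induct) (simp_all add: wcomp_1)

lemma wcomp_power_0 [simp]: "wcomp (z ^ n :: ('n, 'k) wittS) 0 = wcomp z 0 ^ n"
  by (induction n) (simp_all add: wcomp_1)

text \<open>The witness is the defining sum of \<open>Delta1\<close> with each monomial replaced by
  its Teichmueller lift.\<close>

lemma tau_power_p: "\<exists>d. monomial_like d \<and> wcomp d 0 = Delta1 p a \<and> tau a ^ p = wfrob (tau a) + of_nat p * d"
proof -
  define d where "d = (\<Sum>\<alpha> | \<alpha> \<in> (\<Pi>\<^sub>E m\<in>keys a. {0..p - 1}) \<and> (\<Sum>m\<in>keys a. \<alpha> m) = p.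
        of_nat ((fact p div (\<Prod>m\<in>keys a. fact (\<alpha> m))) div p) *
        (\<Prod>m\<in>keys a. teich (single m (lookup a m)) ^ \<alpha> m :: ('n, 'k) wittS))"
  have "monomial_like d" unfolding d_def
    by (intro monomial_like_sum monomial_like_mult monomial_like_of_nat monomial_like_prod
        monomial_like_power monomial_like_teich)
  moreover have "wcomp d 0 = Delta1 p a" by (simp add: d_def Delta1_def)
  moreover have "tau a ^ p = wfrob (tau a) + of_nat p * d"
    unfolding tau_def d_def
    by (subst multinomial_prime[OF finite_keys prime_p]) (simp add: wfrob_sum wfrob_teich wchar_p teich_power)
  ultimately show ?thesis by blast
qed

text \<open>Precision p^2 is wanted since a factor p is cancelled afterwards. The terms with k from
  2 on contain (V d)^k = p^(k-1) V(d^k). For k < p the binomial coefficient supplies the second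
  factor p; for k = p it comes from V(d^p), because d^p is F d modulo p.\<close>

lemma power_add_ver_p: "\<exists>y. (t + ver d) ^ p
    = t ^ p + of_nat p * (t ^ (p - 1) * ver d) + of_nat p * (of_nat p * (y :: ('n, 'k) wittS))"
proof -
  let ?v = "ver d"
  have "(?v + t) ^ p = (\<Sum>k\<le>p. of_nat (p choose k) * ?v ^ k * t ^ (p - k))"
    by (rule binomial_ring)
  also have "{..p} = insert 0 (insert 1 {2..p})" using p_ge_2 by auto
  finally have eq: "(t + ?v) ^ p = t ^ p + of_nat p * (t ^ (p - 1) * ?v) +
      (\<Sum>k\<in>{2..p}. of_nat (p choose k) * ?v ^ k * t ^ (p - k))"
    by (simp add: add.commute mult_ac)
  have "of_nat p * of_nat p dvd of_nat (p choose k) * ?v ^ k * t ^ (p - k)" if k2: "k \<in> {2..p}" for k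
  proof -
    obtain j where k: "k = Suc (Suc j)" using k2 by (intro that[of "k - 2"]) auto
    have vk: "?v ^ k = of_nat p * (of_nat (p ^ j) * ver (d ^ k))"
      unfolding k ver_power by (simp only: power_Suc of_nat_mult mult.assoc)
    have "of_nat p * of_nat p dvd of_nat (p choose k) * ?v ^ k"
    proof (cases "k = p")
      case False
      hence "p dvd (p choose k)" using k2 prime_p by (intro dvd_choose_prime) auto
      hence "of_nat p dvd (of_nat (p choose k) :: ('n, 'k) wittS)" by (metis dvd_def of_nat_mult)
      thus ?thesis unfolding vk by (intro mult_dvd_mono) auto
    next
      case True
      obtain w where "d ^ p - wfrob d = of_nat p * w" using wfrob_cong[of d] by (auto elim: dvdE)
      hence "d ^ p = wfrob d + of_nat p * w" by (simp add: algebra_simps)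
      hence "ver (d ^ p) = of_nat p * (d + ver w)" by (simp add: ver_add ver_wfrob distrib_left p_mult_ver)
      hence "of_nat (p choose k) * ?v ^ k = of_nat p * of_nat p * (of_nat (p ^ j) * (d + ver w))"
        unfolding vk using True by (simp add: mult_ac)
      thus ?thesis by (metis dvd_triv_left)
    qed
    thus ?thesis by (rule dvd_mult2)
  qed
  hence "of_nat p * of_nat p dvd (\<Sum>k\<in>{2..p}. of_nat (p choose k) * ?v ^ k * t ^ (p - k))"
    by (intro dvd_sum) auto
  then obtain y where "(\<Sum>k\<in>{2..p}. of_nat (p choose k) * ?v ^ k * t ^ (p - k)) = of_nat p * of_nat p * y"
    by (auto elim: dvdE)
  thus ?thesis unfolding eq by (auto simp: mult.assoc)
qed

lemma power_add_ver: "of_nat p dvd (t + ver d) ^ n - (t ^ n + of_nat n * (t ^ (n - 1) * ver (d :: ('n, 'k) wittS)))"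
proof (induction n)
  case (Suc n)
  have 1: "of_nat p dvd (t + ver d) * ((t + ver d) ^ n - (t ^ n + of_nat n * (t ^ (n - 1) * ver d)))
      + of_nat n * t ^ (n - 1) * (ver d * ver d)"
    by (rule dvd_add[OF dvd_mult[OF Suc] dvd_mult]) (simp only: ver_mult_ver dvd_triv_left)
  have "of_nat n * t ^ n = of_nat n * (t * t ^ (n - 1))" by (cases n) auto
  hence "(t + ver d) * ((t + ver d) ^ n - (t ^ n + of_nat n * (t ^ (n - 1) * ver d)))
      + of_nat n * t ^ (n - 1) * (ver d * ver d) = (t + ver d) ^ Suc n - (t ^ Suc n + of_nat (Suc n) * (t ^ (Suc n - 1) * ver d))"
    by (simp add: algebra_simps)
  thus ?case using 1 by metis
qed simp

text \<open>The projection formula moves tau(a)^n inside V as F(tau(a))^n, and there F(tau(a)) =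
  [a^p] - p Delta(a) is a Teichmueller lift modulo p.\<close>

lemma tau_power_ver_Delta:
  "of_nat p dvd tau a ^ n * ver (Delta a) - ver (teich (a ^ (p * n)) * Delta a)"
proof -
  have "wfrob (tau a) = wfrob (teich a - ver (Delta a))" by (simp add: ver_Delta)
  hence w: "wfrob (tau a) = teich (a ^ p) - of_nat p * Delta a"
    by (simp only: wfrob_diff wfrob_ver ver_wfrob wfrob_teich wchar_p)
  have "of_nat p dvd wfrob (tau a) ^ n - teich (a ^ p) ^ n"
    by (intro dvd_power_diff) (simp add: w)
  then obtain y where "wfrob (tau a) ^ n - teich (a ^ p) ^ n = of_nat p * y" by (auto elim: dvdE)
  hence "wfrob (tau a ^ n) * Delta a - teich (a ^ (p * n)) * Delta a = of_nat p * (y * Delta a)"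
    by (simp add: wfrob_power power_mult flip: left_diff_distrib mult.assoc) (simp add: teich_power)
  hence "ver (wfrob (tau a ^ n) * Delta a) - ver (teich (a ^ (p * n)) * Delta a) = of_nat p * ver (y * Delta a)"
    by (metis ver_diff p_mult_ver)
  thus ?thesis by (simp add: ver_wfrob_mult)
qed

text \<open>Since [a]^p = F[a], the p-th power of [a] = tau(a) + V Delta(a) minus F(tau(a)) equals F
  V Delta(a) = p Delta(a). Expanding the power by the two preceding formulas and cancelling p
  expresses Delta(a) through itself, one level deeper.\<close>

theorem Delta_expansion:
  "of_nat p dvd Delta a - (tau (Delta1 p a) + ver (teich (a ^ (p * (p - 1))) * Delta a))"
proof -
  obtain d where d: "monomial_like d" "wcomp d 0 = Delta1 p a" "tau a ^ p = wfrob (tau a) + of_nat p * d"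
    using tau_power_p by blast
  obtain y where y: "(tau a + ver (Delta a)) ^ p
    = tau a ^ p + of_nat p * (tau a ^ (p - 1) * ver (Delta a)) + of_nat p * (of_nat p * y)"
    using power_add_ver_p by blast
  have "of_nat p * Delta a = wfrob (ver (Delta a))" by (simp add: wfrob_ver ver_wfrob)
  also have "\<dots> = (tau a + ver (Delta a)) ^ p - wfrob (tau a)"
    unfolding ver_Delta by (simp add: wfrob_diff wfrob_teich wchar_p teich_power)
  also have "\<dots> = of_nat p * (d + tau a ^ (p - 1) * ver (Delta a) + of_nat p * y)"
    unfolding y d(3) by (simp add: algebra_simps)
  finally have "Delta a = d + tau a ^ (p - 1) * ver (Delta a) + of_nat p * y"
    by (rule of_nat_p_inj)
  hence "of_nat p dvd Delta a - (d + tau a ^ (p - 1) * ver (Delta a))"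
    by (metis add_diff_cancel_left' dvd_triv_left)
  moreover have "of_nat p dvd d - tau (Delta1 p a)" using d by (simp add: monomial_like_def)
  ultimately have "of_nat p dvd Delta a - (d + tau a ^ (p - 1) * ver (Delta a)) + ((d - tau (Delta1 p a)) +
      (tau a ^ (p - 1) * ver (Delta a) - ver (teich (a ^ (p * (p - 1))) * Delta a)))"
    by (intro dvd_add tau_power_ver_Delta)
  thus ?thesis by (simp add: algebra_simps)
qed

lemma Delta_expansion': "\<exists>z. Delta a = tau (Delta1 p a) + ver (teich (a ^ (p * (p - 1))) * Delta a) + wfrob z"
proof -
  obtain z where "Delta a - (tau (Delta1 p a) + ver (teich (a ^ (p * (p - 1))) * Delta a)) = of_nat p * z"
    using Delta_expansion[of a] by (auto elim: dvdE)
  hence "Delta a = tau (Delta1 p a) + ver (teich (a ^ (p * (p - 1))) * Delta a) + wfrob (ver z)"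
    by (simp add: wfrob_ver ver_wfrob algebra_simps)
  thus ?thesis by blast
qed

lemma wcomp_Delta_0: "wcomp (Delta a) 0 = Delta1 p a"
proof -
  obtain z where "Delta a - (tau (Delta1 p a) + ver (teich (a ^ (p * (p - 1))) * Delta a)) = of_nat p * z"
    using Delta_expansion[of a] by (auto elim: dvdE)
  hence "wcomp (Delta a - (tau (Delta1 p a) + ver (teich (a ^ (p * (p - 1))) * Delta a))) 0 = wcomp (of_nat p * z) 0"
    by simp
  thus ?thesis by (simp add: of_nat_p)
qed

text \<open>Modulo p the expansion of (tau(a) + V Delta(a))^(p-1) stops after the linear term, whose
  coefficient p-1 becomes -1. Stripping V leaves an equation up to some F z, and its component 0
  gives the p-th power \<open>e ^ p\<close>.\<close>

theorem Delta1_power: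
  fixes a :: "('n, 'k) mpoly"
  shows "\<exists>e. Delta1 p (a ^ (p - 1)) = e ^ p - a ^ (p * (p - 2)) * Delta1 p a"
proof -
  have pm: "of_nat (p - 1) = (of_nat p - 1 :: ('n, 'k) wittS)" using p_gt_0 by (simp add: of_nat_diff)
  have "of_nat p dvd (teich (a ^ (p - 1)) - (tau a ^ (p - 1) + of_nat (p - 1) * (tau a ^ (p - 1 - 1) * ver (Delta a))))
      + of_nat p * (tau a ^ (p - 2) * ver (Delta a))
      - (tau (a ^ (p - 1)) - tau a ^ (p - 1)) - (tau a ^ (p - 2) * ver (Delta a) - ver (teich (a ^ (p * (p - 2))) * Delta a))"
    by (rule dvd_diff[OF dvd_diff[OF dvd_add[OF _ dvd_triv_left] tau_power] tau_power_ver_Delta])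
      (use power_add_ver[of "tau a" "Delta a" "p - 1"] in \<open>simp only: teich_power flip: teich_tau\<close>)
  moreover have "p - 1 - 1 = p - 2" by simp
  moreover have "A - (t + (of_nat p - 1) * E) + of_nat p * E - (B - t) - (E - C) = A - B + C"
    for A B C E t :: "('n, 'k) wittS" by (simp add: algebra_simps)
  ultimately have "of_nat p dvd teich (a ^ (p - 1)) - tau (a ^ (p - 1)) + ver (teich (a ^ (p * (p - 2))) * Delta a)"
    by (simp only: pm)
  then obtain z where "ver (Delta (a ^ (p - 1))) + ver (teich (a ^ (p * (p - 2))) * Delta a) = ver (wfrob z)"
    by (auto simp: dvd_p_iff ver_Delta)
  hence "Delta (a ^ (p - 1)) + teich (a ^ (p * (p - 2))) * Delta a = wfrob z"
    by (simp add: ver_inj flip: ver_add)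
  hence "wcomp (Delta (a ^ (p - 1)) + teich (a ^ (p * (p - 2))) * Delta a) 0 = wcomp z 0 ^ p"
    by (simp add: wcomp_frob wchar_p)
  thus ?thesis by (auto simp: wcomp_Delta_0 algebra_simps intro!: exI[of _ "wcomp z 0"])
qed

text \<open>The relation that the values on \<open>V\<^sup>i[f a]\<close> impose on a module homomorphism.\<close>

lemma teich_single_mult_expansion:
  "\<exists>z. teich (single m c * a) = tau (single m c * a) +
    ver (tau (single m c ^ p * Delta1 p a) + ver (teich (single m c ^ p ^ 2 * a ^ (p * (p - 1))) * Delta a) + wfrob z)"
proof -
  obtain z where z: "Delta a = tau (Delta1 p a) + ver (teich (a ^ (p * (p - 1))) * Delta a) + wfrob z"
    using Delta_expansion' by blast
  have sp: "\<exists>m' c'. single m c ^ n = (single m' c' :: ('n, 'k) mpoly)" for n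
  proof (induction n)
    case (Suc n)
    then obtain m' c' where "single m c ^ n = (single m' c' :: ('n, 'k) mpoly)" by blast
    hence "single m c ^ Suc n = (single (m + m') (c * c') :: ('n, 'k) mpoly)" by (simp add: mult_single)
    thus ?case by blast
  next
    case 0
    have "single m c ^ 0 = (single 0 1 :: ('n, 'k) mpoly)" by simp
    thus ?case by blast
  qed
  obtain m' c'' where mp: "single m c ^ p = (single m' c'' :: ('n, 'k) mpoly)" using sp by blast
  have "teich (single m c * a) = teich (single m c) * (tau a + ver (Delta a))"
    by (simp add: teich_teich flip: teich_tau)
  also have "\<dots> = tau (single m c * a) + ver (teich (single m c ^ p) * Delta a)"
    by (simp add: distrib_left teich_ver tau_single_mult)
  also have "teich (single m c ^ p) * Delta a = teich (single m c ^ p) * tau (Delta1 p a) +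
      teich (single m c ^ p) * ver (teich (a ^ (p * (p - 1))) * Delta a) + teich (single m c ^ p) * wfrob z"
    by (subst z) (simp only: distrib_left)
  also have "teich (single m c ^ p) * tau (Delta1 p a) = tau (single m c ^ p * Delta1 p a)"
    unfolding mp by (rule tau_single_mult[symmetric])
  also have "teich (single m c ^ p) * ver (teich (a ^ (p * (p - 1))) * Delta a)
      = ver (teich (single m c ^ p ^ 2 * a ^ (p * (p - 1))) * Delta a)"
    unfolding teich_ver by (simp add: teich_teich power2_eq_square mult.assoc flip: power_mult)
  also have "teich (single m c ^ p) * wfrob z = wfrob (teich (single m c) * z)"
    by (simp add: wfrob_mult wfrob_teich wchar_p)
  finally show ?thesis by blast
qed

end

section \<open>Ideals of the polynomial ring\<close>

lemma ring_of_type_simps [simp]: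
  "carrier ring_of_type_algebra = UNIV"
  "a \<otimes>\<^bsub>ring_of_type_algebra\<^esub> b = a * b"
  "a \<oplus>\<^bsub>ring_of_type_algebra\<^esub> b = a + b"
  "\<one>\<^bsub>ring_of_type_algebra\<^esub> = 1"
  "\<zero>\<^bsub>ring_of_type_algebra\<^esub> = 0"
  by (simp_all add: ring_of_type_algebra_def)

lemma ring_of_type_ideal_iff:
  fixes I :: "'a::comm_ring_1 set"
  shows "ideal I ring_of_type_algebra \<longleftrightarrow> 0 \<in> I \<and> (\<forall>a\<in>I. \<forall>b\<in>I. a + b \<in> I) \<and> (\<forall>a\<in>I. \<forall>b. b * a \<in> I)"
  (is "_ \<longleftrightarrow> ?R")
proof
  assume "ideal I (ring_of_type_algebra :: 'a ring)"
  note id = this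
  show ?R
    using additive_subgroup.zero_closed[OF ideal.axioms(1)[OF id]]
      additive_subgroup.a_closed[OF ideal.axioms(1)[OF id]] ideal.I_l_closed[OF id] by simp
next
  assume R: ?R
  interpret R: ring "ring_of_type_algebra :: 'a ring" by (rule ring_from_type_algebra)
  have inv: "\<ominus>\<^bsub>ring_of_type_algebra\<^esub> x = - x" for x :: 'a
    using R.minus_equality[of "- x" x] by simp
  have neg: "- x \<in> I" if "x \<in> I" for x
    using R that by (metis mult_minus1)
  show "ideal I (ring_of_type_algebra :: 'a ring)"
  proof (rule idealI)
    show "ring (ring_of_type_algebra :: 'a ring)" by (rule ring_from_type_algebra)
    show "subgroup I (add_monoid (ring_of_type_algebra :: 'a ring))"
      by (rule R.add.subgroupI) (use R neg inv in \<open>auto simp: a_inv_def[symmetric]\<close>)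
  qed (use R in \<open>auto simp: mult.commute\<close>)
qed

lemma PIdl_ring_of_type: "PIdl\<^bsub>ring_of_type_algebra\<^esub> (a::'a::comm_ring_1) = {x. a dvd x}"
  by (auto simp: cgenideal_def dvd_def mult.commute)

lemma set_add_ring_of_type: "A <+>\<^bsub>ring_of_type_algebra\<^esub> B = {a + b | a b. a \<in> A \<and> b \<in> (B :: 'a::comm_ring_1 set)}"
  by (auto simp: set_add_defs)

lemma genideal_ring_of_type_minimal:
  fixes I :: "'a::comm_ring_1 set"
  assumes "A \<subseteq> I" "0 \<in> I" "\<And>a b. a \<in> I \<Longrightarrow> b \<in> I \<Longrightarrow> a + b \<in> I" "\<And>a b. a \<in> I \<Longrightarrow> b * a \<in> I"
  shows "Idl\<^bsub>ring_of_type_algebra\<^esub> A \<subseteq> I"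
proof -
  have "ideal I ring_of_type_algebra" using assms by (auto simp: ring_of_type_ideal_iff)
  thus ?thesis using assms(1) by (auto simp: genideal_def)
qed

lemma genideal_ring_of_type:
  fixes A :: "'a::comm_ring_1 set"
  shows "x \<in> A \<Longrightarrow> x \<in> Idl\<^bsub>ring_of_type_algebra\<^esub> A" "0 \<in> Idl\<^bsub>ring_of_type_algebra\<^esub> A"
    "x \<in> Idl\<^bsub>ring_of_type_algebra\<^esub> A \<Longrightarrow> y \<in> Idl\<^bsub>ring_of_type_algebra\<^esub> A \<Longrightarrow> x + y \<in> Idl\<^bsub>ring_of_type_algebra\<^esub> A"
    "x \<in> Idl\<^bsub>ring_of_type_algebra\<^esub> A \<Longrightarrow> z * x \<in> Idl\<^bsub>ring_of_type_algebra\<^esub> A"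
  by (auto simp: genideal_def ring_of_type_ideal_iff)

lemma genideal_ring_of_type_sum:
  fixes A :: "'a::comm_ring_1 set"
  shows "(\<And>i. i \<in> J \<Longrightarrow> g i \<in> Idl\<^bsub>ring_of_type_algebra\<^esub> A) \<Longrightarrow> sum g J \<in> Idl\<^bsub>ring_of_type_algebra\<^esub> A"
  by (induction J rule: infinite_finite_induct) (auto intro: genideal_ring_of_type)

lemma lookup_0_mult:
  fixes a b :: "('n, 'k::field) mpoly"
  shows "lookup (a * b) 0 = lookup a 0 * lookup b 0"
proof -
  have z: "m + n = 0 \<longleftrightarrow> m = 0 \<and> n = 0" for m n :: "'n \<Rightarrow>\<^sub>0 nat"
    by (auto simp: poly_mapping_eq_iff fun_eq_iff lookup_add)
  show ?thesis
  proof (induction a rule: poly_mapping_induct_add)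
    case (single m c)
    show ?case
      by (induction b rule: poly_mapping_induct_add)
        (auto simp: mult_single lookup_single when_def z distrib_left lookup_add)
  qed (simp_all add: distrib_right lookup_add)
qed

lemma max_ideal_eq: "(max_ideal :: ('n, 'k::field) mpoly set) = {a. lookup a 0 = 0}"
proof
  have nz: "single i (Suc 0) \<noteq> 0" for i :: 'n
    by (metis lookup_single_eq lookup_zero nat.distinct(1))
  show "(max_ideal :: ('n, 'k) mpoly set) \<subseteq> {a. lookup a 0 = 0}"
    unfolding max_ideal_def
    by (rule genideal_ring_of_type_minimal) (auto simp: mvar_def lookup_single when_def lookup_add lookup_0_mult nz)
  have single_mem: "single m c \<in> max_ideal" if "m \<noteq> 0" for m and c :: 'k
  proof -
    have "\<exists>i. lookup m i \<noteq> 0" using that poly_mapping_eqI[of m 0] by (metis lookup_zero)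
    then obtain i where i: "lookup m i > 0" by auto
    have "m = (m - single i 1) + single i 1"
      using i by (intro poly_mapping_eqI) (auto simp: lookup_add lookup_minus lookup_single when_def)
    hence "single m c = single (m - single i 1) c * mvar i"
      by (simp add: mvar_def mult_single)
    thus ?thesis unfolding max_ideal_def by (metis genideal_ring_of_type(4) genideal_ring_of_type(1) rangeI)
  qed
  thus "{a :: ('n, 'k) mpoly. lookup a 0 = 0} \<subseteq> max_ideal"
    by (intro subsetI, subst poly_mapping_sum_singles) (auto simp: max_ideal_def in_keys_iff intro!: genideal_ring_of_type_sum single_mem[unfolded max_ideal_def])
qed

section \<open>The trace maps\<close>

definition expo :: "('n::finite \<Rightarrow> nat) \<Rightarrow> 'n \<Rightarrow>\<^sub>0 nat" where
  "expo g = Abs_poly_mapping g"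

lemma lookup_expo [simp]: "lookup (expo g) i = g i"
  by (simp add: expo_def)

lemma expo_eq_iff: "m = expo g \<longleftrightarrow> (\<forall>i. lookup m i = g i)"
  by (auto simp: poly_mapping_eq_iff fun_eq_iff)

context perfect_poly
begin

definition rt :: "nat \<Rightarrow> 'k \<Rightarrow> 'k" where
  "rt e = inv_into UNIV (\<lambda>c. c ^ (p ^ e))"

lemma bij_frob_k: "bij (\<lambda>c::'k. c ^ (p ^ e))"
proof -
  have p: "nprime CHAR('k)" using prime_p CHARk by simp
  have add: "((x::'k) + y) ^ p ^ e = x ^ p ^ e + y ^ p ^ e" for x y
    by (rule freshmans_dream'[OF p]) (simp add: CHARk)
  have "inj (\<lambda>c::'k. c ^ (p ^ e))"
  proof (rule injI)
    fix x y :: 'k assume "x ^ p ^ e = y ^ p ^ e"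
    hence "(x - y) ^ p ^ e = 0" using add[of "x - y" y] by simp
    thus "x = y" by simp
  qed
  moreover have "surj (\<lambda>c::'k. c ^ (p ^ e))"
  proof (induction e)
    case (Suc e)
    have "surj ((\<lambda>c::'k. c ^ p) \<circ> (\<lambda>c. c ^ p ^ e))" by (rule comp_surj[OF Suc surj_frob])
    thus ?case by (simp add: o_def mult.commute flip: power_mult)
  qed simp
  ultimately show ?thesis by (simp add: bij_def)
qed

lemma rt_power [simp]: "rt e c ^ (p ^ e) = c"
  unfolding rt_def using bij_is_surj[OF bij_frob_k[of e]] by (rule surj_f_inv_f)

lemma rt_unique: "c ^ (p ^ e) = d \<Longrightarrow> rt e d = c"
  unfolding rt_def using bij_is_inj[OF bij_frob_k[of e]] by (rule inv_f_eq)

lemma frob_add_k: "((x::'k) + y) ^ p ^ e = x ^ p ^ e + y ^ p ^ e"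
  by (rule freshmans_dream') (simp_all add: CHARk prime_p)

lemma frob_add_S: "((x::('n, 'k) mpoly) + y) ^ p ^ e = x ^ p ^ e + y ^ p ^ e"
  by (rule freshmans_dream') (simp_all add: chara prime_p)

lemma rt_0 [simp]: "rt e 0 = 0"
  using p_gt_0 by (intro rt_unique) simp

lemma rt_add: "rt e (c + d) = rt e c + rt e d"
  by (rule rt_unique) (simp add: frob_add_k)

lemma rt_mult: "rt e (c ^ (p ^ e) * d) = c * rt e d"
  by (rule rt_unique) (simp add: power_mult_distrib)

lemma rt_1 [simp]: "rt e 1 = 1"
  by (rule rt_unique) simp

lemma rt_rt: "rt d (rt e c) = rt (d + e) c"
  by (rule rt_unique[symmetric]) (simp add: power_add power_mult)

text \<open>The iterate \<open>u\<^sup>e\<close> of the trace map, in terms of coefficients.\<close>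

definition U :: "nat \<Rightarrow> ('n, 'k) mpoly \<Rightarrow> ('n, 'k) mpoly" where
  "U e a = Abs_poly_mapping (\<lambda>m. rt e (lookup a (expo (\<lambda>i. p ^ e * lookup m i + (p ^ e - 1)))))"

lemma lookup_U: "lookup (U e a) m = rt e (lookup a (expo (\<lambda>i. p ^ e * lookup m i + (p ^ e - 1))))"
proof -
  let ?h = "\<lambda>m :: 'n \<Rightarrow>\<^sub>0 nat. expo (\<lambda>i. p ^ e * lookup m i + (p ^ e - 1))"
  have "inj ?h"
  proof (intro injI poly_mapping_eqI)
    fix x y :: "'n \<Rightarrow>\<^sub>0 nat" and i assume "?h x = ?h y"
    hence "lookup (?h x) i = lookup (?h y) i" by (rule arg_cong)
    hence "p ^ e * lookup x i = p ^ e * lookup y i" by (simp only: lookup_expo add_right_cancel)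
    thus "lookup x i = lookup y i" using p_gt_0 by simp
  qed
  hence "finite (?h -` keys a)" by (intro finite_vimageI) auto
  moreover have "{m. rt e (lookup a (?h m)) \<noteq> 0} \<subseteq> ?h -` keys a"
    by (auto simp: in_keys_iff)
  ultimately have "finite {m. rt e (lookup a (?h m)) \<noteq> 0}" by (rule rev_finite_subset)
  thus ?thesis by (simp add: U_def)
qed

lemma U_add: "U e (a + b) = U e a + U e b"
  by (rule poly_mapping_eqI) (simp add: lookup_U lookup_add rt_add)

lemma U_0 [simp]: "U e 0 = 0"
  by (rule poly_mapping_eqI) (simp add: lookup_U)

lemma U_uminus: "U e (- a) = - U e a"
  by (metis U_add U_0 add.right_inverse minus_unique)

lemma U_diff: "U e (a - b) = U e a - U e b"
  using U_add[of e a "- b"] by (simp add: U_uminus)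

lemma U_sum: "U e (sum g A) = (\<Sum>x\<in>A. U e (g x))"
  by (induction A rule: infinite_finite_induct) (auto simp: U_add)

lemma q_pos: "p ^ e > 0" using p_gt_0 by simp

lemma top_iff:
  assumes "q > 0"
  shows "x = q * y + (q - 1) \<longleftrightarrow> x mod q = q - 1 \<and> x div q = (y::nat)"
proof
  assume "x = q * y + (q - 1)"
  moreover have "(q * y + (q - 1)) mod q = (q - 1) mod q" by (rule mod_mult_self4)
  moreover have "(q * y + (q - 1)) div q = y" using assms by (intro div_nat_eqI) auto
  ultimately show "x mod q = q - 1 \<and> x div q = y" using assms by simp
next
  assume "x mod q = q - 1 \<and> x div q = y"
  thus "x = q * y + (q - 1)" using mult_div_mod_eq[of q x] by simp
qed

lemma U_single: "U e (single n d) =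
  (if \<forall>i. lookup n i mod p ^ e = p ^ e - 1 then single (expo (\<lambda>i. lookup n i div p ^ e)) (rt e d) else 0)"
proof (rule poly_mapping_eqI)
  fix m :: "'n \<Rightarrow>\<^sub>0 nat"
  have "n = expo (\<lambda>i. p ^ e * lookup m i + (p ^ e - 1)) \<longleftrightarrow>
    (\<forall>i. lookup n i mod p ^ e = p ^ e - 1) \<and> expo (\<lambda>i. lookup n i div p ^ e) = m"
  proof -
    have *: "x = p ^ e * y + (p ^ e - 1) \<longleftrightarrow> x mod p ^ e = p ^ e - 1 \<and> x div p ^ e = y" for x y
      by (rule top_iff[OF q_pos])
    show ?thesis unfolding expo_eq_iff * by (auto simp: poly_mapping_eq_iff fun_eq_iff)
  qed
  thus "lookup (U e (single n d)) m = lookup (if \<forall>i. lookup n i mod p ^ e = p ^ e - 1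
      then single (expo (\<lambda>i. lookup n i div p ^ e)) (rt e d) else 0) m"
    by (auto simp: lookup_U lookup_single when_def)
qed

lemma single_power: "single m c ^ n = (single (expo (\<lambda>i. n * lookup m i)) (c ^ n) :: ('n, 'k) mpoly)"
proof (induction n)
  case 0
  have "expo (\<lambda>i. 0 * lookup m i) = 0" by (intro poly_mapping_eqI) simp
  thus ?case by simp
next
  case (Suc n)
  have "m + expo (\<lambda>i. n * lookup m i) = expo (\<lambda>i. Suc n * lookup m i)"
    by (intro poly_mapping_eqI) (simp add: lookup_add)
  thus ?case by (simp add: Suc mult_single)
qed

lemma U_mult: "U e (a ^ (p ^ e) * b) = a * U e b"
proof (induction a rule: poly_mapping_induct_add)
  case zero
  thus ?case using q_pos[of e] by (simp add: zero_power)
next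
  case (single m c)
  show ?case
  proof (induction b rule: poly_mapping_induct_add)
    case (single n d)
    have "expo (\<lambda>i. lookup (expo (\<lambda>i. p ^ e * lookup m i) + n) i div p ^ e) = m + expo (\<lambda>i. lookup n i div p ^ e)"
      using q_pos[of e] by (intro poly_mapping_eqI) (simp add: lookup_add)
    thus ?case by (simp add: single_power mult_single U_single lookup_add rt_mult)
  qed (simp_all add: distrib_left U_add)
next
  case (add a a')
  thus ?case by (simp add: frob_add_S distrib_right U_add)
qed

section \<open>Dual bases of the Frobenius pushforwards\<close>

definition box :: "nat \<Rightarrow> ('n \<Rightarrow>\<^sub>0 nat) set" where
  "box q = {j. \<forall>i. lookup j i < q}"

lemma finite_box: "finite (box q)"
proof -
  have "box q \<subseteq> expo ` (\<Pi>\<^sub>E i\<in>UNIV. {..<q})"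
  proof
    fix j :: "'n \<Rightarrow>\<^sub>0 nat" assume "j \<in> box q"
    hence "j = expo (lookup j)" "lookup j \<in> (\<Pi>\<^sub>E i\<in>UNIV. {..<q})"
      by (auto simp: box_def expo_eq_iff)
    thus "j \<in> expo ` (\<Pi>\<^sub>E i\<in>UNIV. {..<q})" by blast
  qed
  thus ?thesis by (rule finite_subset) (intro finite_imageI finite_PiE; simp)
qed

text \<open>Multiplying by the complementary monomial before applying \<open>U e\<close> extracts
  the coordinate at x^j, so these monomials give the dual basis under the trace pairing.\<close>

definition cobox :: "nat \<Rightarrow> ('n \<Rightarrow>\<^sub>0 nat) \<Rightarrow> ('n \<Rightarrow>\<^sub>0 nat)" where
  "cobox q j = expo (\<lambda>i. q - 1 - lookup j i)"

lemma mod_eq_top_iff: "j < q \<Longrightarrow> (q - 1 - j + n) mod q = q - 1 \<longleftrightarrow> n mod q = (j::nat)"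
proof -
  assume j: "j < q"
  define r where "r = n mod q"
  have r: "r < q" using j by (simp add: r_def)
  have "(q - 1 - j + n) mod q = (q - 1 - j + r) mod q" by (simp add: r_def mod_add_right_eq)
  also have "\<dots> = (if q - 1 - j + r < q then q - 1 - j + r else q - 1 - j + r - q)"
    using j r by (simp add: mod_if)
  finally show ?thesis using j r unfolding r_def[symmetric] by auto
qed

lemma div_top: "j < q \<Longrightarrow> n mod q = (j::nat) \<Longrightarrow> (q - 1 - j + n) div q = n div q"
proof -
  assume j: "j < q" "n mod q = j"
  have "q - 1 - j + n = (q - 1) + q * (n div q)"
    using j div_mult_mod_eq[of n q] by (simp add: mult.commute)
  moreover have "((q - 1) + q * (n div q)) div q = n div q" using j by (intro div_nat_eqI) auto
  ultimately show ?thesis by simp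
qed

lemma U_cobox_single:
  assumes "j \<in> box (p ^ e)"
  shows "U e (single (cobox (p ^ e) j) 1 * single n d) =
    (if \<forall>i. lookup n i mod p ^ e = lookup j i then single (expo (\<lambda>i. lookup n i div p ^ e)) (rt e d) else 0)"
proof -
  have c: "(\<forall>i. lookup (cobox (p ^ e) j + n) i mod p ^ e = p ^ e - 1) \<longleftrightarrow> (\<forall>i. lookup n i mod p ^ e = lookup j i)"
  proof -
    have "(p ^ e - 1 - lookup j i + lookup n i) mod p ^ e = p ^ e - 1 \<longleftrightarrow> lookup n i mod p ^ e = lookup j i" for i
      by (rule mod_eq_top_iff) (use assms in \<open>simp add: box_def\<close>)
    thus ?thesis by (simp only: cobox_def lookup_add lookup_expo)
  qed
  have "expo (\<lambda>i. lookup (cobox (p ^ e) j + n) i div p ^ e) = expo (\<lambda>i. lookup n i div p ^ e)"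
    if *: "\<forall>i. lookup n i mod p ^ e = lookup j i"
  proof -
    have "(p ^ e - 1 - lookup j i + lookup n i) div p ^ e = lookup n i div p ^ e" for i
      by (rule div_top) (use assms * in \<open>simp_all add: box_def\<close>)
    thus ?thesis by (simp only: cobox_def lookup_add lookup_expo)
  qed
  thus ?thesis unfolding mult_single U_single c by auto
qed

text \<open>The expansion of \<open>a\<close> in the basis of monomials with exponents below p^e,
  with the dual basis computing the coordinates.\<close>

lemma U_reconstruct: "a = (\<Sum>j\<in>box (p ^ e). U e (single (cobox (p ^ e) j) 1 * a) ^ (p ^ e) * single j 1)"
proof (induction a rule: poly_mapping_induct_add)
  case zero
  thus ?case using q_pos[of e] by (simp add: zero_power)
next
  case (single n d)
  define j0 where "j0 = expo (\<lambda>i. lookup n i mod p ^ e)"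
  have j0: "j0 \<in> box (p ^ e)" using q_pos[of e] by (simp add: j0_def box_def)
  have "U e (single (cobox (p ^ e) j) 1 * single n d) ^ (p ^ e) * single j 1 = (if j = j0 then single n d else 0)"
    if "j \<in> box (p ^ e)" for j
  proof -
    have "(\<forall>i. lookup n i mod p ^ e = lookup j i) \<longleftrightarrow> j = j0" by (auto simp: j0_def expo_eq_iff)
    moreover have "expo (\<lambda>i. p ^ e * (lookup n i div p ^ e)) + j0 = n"
      by (intro poly_mapping_eqI) (simp add: lookup_add j0_def)
    ultimately show ?thesis using q_pos[of e] unfolding U_cobox_single[OF that]
      by (simp add: single_power mult_single zero_power)
  qed
  thus ?case using j0 finite_box by simp
next
  case (add a b)
  show ?case
    by (subst add(1), subst add(2)) (simp add: distrib_left U_add frob_add_S distrib_right sum.distrib)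
qed

lemma U_dvd_imp:
  assumes "\<And>j. j \<in> box (p ^ e) \<Longrightarrow> d dvd U e (single (cobox (p ^ e) j) 1 * a)"
  shows "d ^ (p ^ e) dvd a"
  by (subst U_reconstruct[of a e]) (intro dvd_sum dvd_mult2 dvd_power_same assms)

text \<open>An exponent is -1 modulo p^(e+1) exactly if its last digit in base p is p-1 and the
  remaining digits form a number that is -1 modulo p^e.\<close>

lemma U_Suc: "U (Suc e) a = U e (U 1 a)"
proof (induction a rule: poly_mapping_induct_add)
  case (single n d)
  have m: "n mod (p * p ^ e) = p * p ^ e - 1 \<longleftrightarrow> n mod p = p - 1 \<and> (n div p) mod p ^ e = p ^ e - 1" for n
  proof -
    have eq: "n mod (p * p ^ e) = p * (n div p mod p ^ e) + n mod p" by (rule mod_mult2_eq)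
    have lt: "n mod p < p" "n div p mod p ^ e < p ^ e" using p_gt_0 by auto
    have top: "p * p ^ e - 1 = p * (p ^ e - 1) + (p - 1)"
      using p_gt_0 q_pos[of e] by (simp add: algebra_simps)
    have "x = y \<and> r = s" if "p * x + r = p * y + s" "r < p" "s < p" for x y r s
    proof -
      have "(p * x + r) div p = x" using that(2) p_gt_0 by simp
      moreover have "(p * y + s) div p = y" using that(3) p_gt_0 by simp
      ultimately have "x = y" using that(1) by metis
      thus ?thesis using that by simp
    qed
    from this[of "n div p mod p ^ e" "n mod p" "p ^ e - 1" "p - 1"] show ?thesis
      unfolding eq top using lt p_gt_0 by auto
  qed
  show ?case
    by (auto simp: U_single m[unfolded One_nat_def] div_mult2_eq rt_rt)
qed (simp_all add: U_add)

lemma frob_linear_U: "frob_linear p (U 1)"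
  using U_mult[of 1] by (auto simp: frob_linear_def U_add)

lemma u_map_eq: "u_map p = (U 1 :: ('n, 'k) mpoly \<Rightarrow> _)"
  unfolding u_map_def
proof (rule the_equality)
  have small: "n mod p = n" "n div p = 0" if "n \<le> p - 1" for n
    using that p_gt_0 by auto
  have val: "U 1 (single i 1) = (if \<forall>j. lookup i j = p - 1 then 1 else 0)" if "\<forall>j. lookup i j \<le> p - 1" for i :: "'n \<Rightarrow>\<^sub>0 nat"
  proof -
    have "expo (\<lambda>j. lookup i j div p) = 0"
      using small that by (intro poly_mapping_eqI) simp
    thus ?thesis using small that by (simp add: U_single)
  qed
  with frob_linear_U show "frob_linear p (U 1) \<and> (\<forall>i::'n \<Rightarrow>\<^sub>0 nat. (\<forall>j. lookup i j \<le> p - 1) \<longrightarrow>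
        U 1 (single i 1) = (if \<forall>j. lookup i j = p - 1 then 1 else 0))"
    by blast
  fix u :: "('n, 'k) mpoly \<Rightarrow> ('n, 'k) mpoly"
  assume u: "frob_linear p u \<and> (\<forall>i. (\<forall>j. lookup i j \<le> p - 1) \<longrightarrow>
        u (single i 1) = (if \<forall>j. lookup i j = p - 1 then 1 else 0))"
  have eq: "u (single i 1) = U 1 (single i 1)" if "i \<in> box (p ^ 1)" for i
  proof -
    have "lookup i j < p" for j using that by (simp add: box_def)
    hence "lookup i j \<le> p - 1" for j using p_gt_0 by (simp add: less_eq_Suc_le le_diff_conv2)
    thus ?thesis using u val by simp
  qed
  have add: "u (a + b) = u a + u b" and mult: "u (a ^ p * b) = a * u b" for a b
    using u by (auto simp: frob_linear_def)
  have u0: "u 0 = 0" using add[of 0 0] by simp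
  have usum: "u (sum g A) = (\<Sum>x\<in>A. u (g x))" for g :: "('n \<Rightarrow>\<^sub>0 nat) \<Rightarrow> ('n, 'k) mpoly" and A
    by (induction A rule: infinite_finite_induct) (auto simp: add u0)
  show "u = U 1"
  proof
    fix a
    define c where "c = (\<lambda>j. U 1 (single (cobox (p ^ 1) j) 1 * a))"
    have a: "a = (\<Sum>j\<in>box (p ^ 1). c j ^ p * single j 1)" using U_reconstruct[of a 1] by (simp add: c_def)
    have "u a = (\<Sum>j\<in>box (p ^ 1). c j * u (single j 1))" by (subst a) (simp only: usum mult)
    also have "\<dots> = (\<Sum>j\<in>box (p ^ 1). c j * U 1 (single j 1))" by (intro sum.cong) (auto simp: eq)
    also have "\<dots> = U 1 a" by (subst a) (simp add: U_sum U_mult[of 1, simplified])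
    finally show "u a = U 1 a" .
  qed
qed

text \<open>Membership in m^[p] is detected by traces: p-th powers come out of u, which gives one
  inclusion, and the expansion in the dual basis has coordinates in m, which gives the
  other.\<close>

lemma frob_power_max_ideal:
  "frob_power p max_ideal = {g :: ('n, 'k) mpoly. \<forall>a. lookup (U 1 (a * g)) 0 = 0}"
proof
  show "frob_power p max_ideal \<subseteq> {g :: ('n, 'k) mpoly. \<forall>a. lookup (U 1 (a * g)) 0 = 0}"
    unfolding frob_power_def
  proof (rule genideal_ring_of_type_minimal)
    show "{a ^ p |a. a \<in> max_ideal} \<subseteq> {g :: ('n, 'k) mpoly. \<forall>a. lookup (U 1 (a * g)) 0 = 0}"
      using U_mult[of 1] by (auto simp: max_ideal_eq mult.commute[of _ "_ ^ p"] lookup_0_mult)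
  qed (auto simp: distrib_left U_add lookup_add simp flip: mult.assoc)
  show "{g :: ('n, 'k) mpoly. \<forall>a. lookup (U 1 (a * g)) 0 = 0} \<subseteq> frob_power p max_ideal"
  proof
    fix g :: "('n, 'k) mpoly" assume "g \<in> {g. \<forall>a. lookup (U 1 (a * g)) 0 = 0}"
    hence *: "U 1 (a * g) \<in> max_ideal" for a by (simp add: max_ideal_eq)
    have "g = (\<Sum>j\<in>box (p ^ 1). single j 1 * U 1 (single (cobox (p ^ 1) j) 1 * g) ^ p)"
      using U_reconstruct[of g 1] by (simp add: mult.commute)
    also have "\<dots> \<in> frob_power p max_ideal"
      unfolding frob_power_def using * by (intro genideal_ring_of_type_sum genideal_ring_of_type(4) genideal_ring_of_type(1)) blast
    finally show "g \<in> frob_power p max_ideal" .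
  qed
qed

end

section \<open>The ideals of the criterion\<close>

locale hypersurface = perfect_poly p ty
  for p :: nat and ty :: "('n::finite \<times> 'k::field) itself" +
  fixes f :: "('n, 'k) mpoly"
  assumes f_nonzero: "f \<noteq> 0" and f_const: "lookup f 0 = 0"
begin

abbreviation D :: "('n, 'k) mpoly" where "D \<equiv> Delta1 p f"

lemma f_power_nonzero: "f ^ n \<noteq> 0"
  using f_nonzero mpoly_power_eq_0 by blast

lemma theta_eq: "theta p f a = U 1 (Delta1 p (f ^ (p - 1)) * a)"
  by (simp add: theta_def u_map_eq)

lemma theta_add: "theta p f (a + b) = theta p f a + theta p f b"
  by (simp add: theta_eq distrib_left U_add)

lemma theta_mult: "theta p f (c ^ p * a) = c * theta p f a"
  using U_mult[of 1 c "Delta1 p (f ^ (p - 1)) * a"] by (simp add: theta_eq mult.left_commute)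

lemma theta_0 [simp]: "theta p f 0 = 0"
  by (simp add: theta_eq)

text \<open>By \<open>Delta1_power\<close> the factor in theta is e^p - f^(p(p-2)) D. The p-th power
  comes out of u and leaves e u(a) = 0, while f^(p(p-2)) comes out as f^(p-2).\<close>

lemma theta_ker:
  assumes "U 1 a = 0"
  shows "theta p f a = - (f ^ (p - 2) * U 1 (D * a))"
proof -
  obtain e where e: "Delta1 p (f ^ (p - 1)) = e ^ p - f ^ (p * (p - 2)) * D"
    using Delta1_power by blast
  have "theta p f a = U 1 (e ^ (p ^ 1) * a) - U 1 ((f ^ (p - 2)) ^ (p ^ 1) * (D * a))"
    unfolding theta_eq e by (simp add: left_diff_distrib U_diff mult.assoc flip: power_mult) (simp add: mult.commute)
  also have "\<dots> = - (f ^ (p - 2) * U 1 (D * a))"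
    unfolding U_mult assms by simp
  finally show ?thesis .
qed

lemma I_seq_1: "I_seq p f (Suc 0) = {a. f ^ (p - 1) dvd a}"
  by (simp add: PIdl_ring_of_type)

lemma I_seq_Suc: "n \<ge> 1 \<Longrightarrow> a \<in> I_seq p f (Suc n) \<longleftrightarrow>
    (\<exists>b\<in>I_seq p f n. U 1 b = 0 \<and> f ^ (p - 1) dvd a - theta p f b)"
proof (cases n)
  case (Suc m)
  have "a \<in> I_seq p f (Suc (Suc m)) \<longleftrightarrow>
    (\<exists>b c. b \<in> I_seq p f (Suc m) \<and> U 1 b = 0 \<and> f ^ (p - 1) dvd c \<and> a = theta p f b + c)"
    unfolding I_seq.simps(3) set_add_ring_of_type I_seq_1 u_map_eq by auto
  also have "\<dots> \<longleftrightarrow> (\<exists>b\<in>I_seq p f (Suc m). U 1 b = 0 \<and> f ^ (p - 1) dvd a - theta p f b)"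
    by (metis add_diff_cancel_left' add.commute diff_add_cancel)
  finally show ?thesis using Suc by simp
qed simp

text \<open>Multiplying by \<open>c\<close> corresponds to multiplying the preimage under theta by
  c^p, which keeps it in the kernel of u.\<close>

lemma I_seq_closed:
  "n \<ge> 1 \<Longrightarrow> (f ^ (p - 1) dvd a \<longrightarrow> a \<in> I_seq p f n) \<and>
    (a \<in> I_seq p f n \<longrightarrow> b \<in> I_seq p f n \<longrightarrow> a + b \<in> I_seq p f n) \<and> (a \<in> I_seq p f n \<longrightarrow> c * a \<in> I_seq p f n)"
proof (induction n arbitrary: a b c rule: nat_induct_at_least)
  case base
  show ?case by (auto simp: I_seq_1[simplified])
next
  case (Suc n)
  show ?case
  proof (intro conjI impI)
    assume "f ^ (p - 1) dvd a"
    moreover have "0 \<in> I_seq p f n" using Suc.IH by auto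
    ultimately show "a \<in> I_seq p f (Suc n)" using Suc.hyps by (auto simp: I_seq_Suc intro!: bexI[of _ 0])
  next
    assume "a \<in> I_seq p f (Suc n)" "b \<in> I_seq p f (Suc n)"
    then obtain a' b' where "a' \<in> I_seq p f n" "U 1 a' = 0" "f ^ (p - 1) dvd a - theta p f a'"
      "b' \<in> I_seq p f n" "U 1 b' = 0" "f ^ (p - 1) dvd b - theta p f b'"
      using Suc.hyps by (auto simp: I_seq_Suc)
    moreover from this have "f ^ (p - 1) dvd (a - theta p f a') + (b - theta p f b')" by (intro dvd_add)
    ultimately show "a + b \<in> I_seq p f (Suc n)" using Suc
      by (auto simp: I_seq_Suc theta_add U_add algebra_simps intro!: bexI[of _ "a' + b'"])
  next
    assume "a \<in> I_seq p f (Suc n)"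
    then obtain a' where a': "a' \<in> I_seq p f n" "U 1 a' = 0" "f ^ (p - 1) dvd a - theta p f a'"
      using Suc.hyps by (auto simp: I_seq_Suc)
    have "f ^ (p - 1) dvd c * (a - theta p f a')" using a' by (intro dvd_mult)
    moreover have "U 1 (c ^ p * a') = 0" using U_mult[of 1 c a'] a' by simp
    moreover have "c ^ p * a' \<in> I_seq p f n" using Suc a' by blast
    ultimately show "c * a \<in> I_seq p f (Suc n)" using Suc.hyps
      by (auto simp: I_seq_Suc theta_mult right_diff_distrib intro!: bexI[of _ "c ^ p * a'"])
  qed
qed

lemmas I_seq_dvd = I_seq_closed[THEN conjunct1, THEN mp]
  and I_seq_mult = I_seq_closed[THEN conjunct2, THEN conjunct2, THEN mp]

text \<open>The history of a member of I_n. No condition is put on u(g_n): its constant term will be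
  the value at 1.\<close>

definition chain :: "nat \<Rightarrow> (nat \<Rightarrow> ('n, 'k) mpoly) \<Rightarrow> bool" where
  "chain n g \<longleftrightarrow> f ^ (p - 1) dvd g 1 \<and>
    (\<forall>j. 1 \<le> j \<and> j < n \<longrightarrow> U 1 (g j) = 0 \<and> f ^ (p - 1) dvd g (Suc j) - theta p f (g j))"

lemma I_seq_chain: "n \<ge> 1 \<Longrightarrow> a \<in> I_seq p f n \<Longrightarrow> \<exists>g. chain n g \<and> g n = a"
proof (induction n arbitrary: a rule: nat_induct_at_least)
  case base
  thus ?case by (auto simp: chain_def I_seq_1[simplified] intro!: exI[of _ "\<lambda>_. a"])
next
  case (Suc n)
  then obtain b where b: "b \<in> I_seq p f n" "U 1 b = 0" "f ^ (p - 1) dvd a - theta p f b"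
    by (auto simp: I_seq_Suc)
  then obtain g where g: "chain n g" "g n = b" using Suc.IH by blast
  have "chain (Suc n) (g(Suc n := a))"
    using g b Suc.hyps by (auto simp: chain_def less_Suc_eq)
  thus ?case by (intro exI[of _ "g(Suc n := a)"] conjI fun_upd_same)
qed

lemma I_seq_not_subset:
  assumes "n \<ge> 1" "\<not> I_seq p f n \<subseteq> frob_power p max_ideal"
  shows "\<exists>g. chain n g \<and> lookup (U 1 (g n)) 0 \<noteq> 0"
proof -
  obtain a b where "a \<in> I_seq p f n" "lookup (U 1 (b * a)) 0 \<noteq> 0"
    using assms(2) by (auto simp: frob_power_max_ideal)
  moreover from this have "b * a \<in> I_seq p f n" using I_seq_mult assms(1) by blast
  ultimately show ?thesis using I_seq_chain[OF assms(1)] by metis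
qed

definition lam :: "nat \<Rightarrow> (nat \<Rightarrow> ('n, 'k) mpoly) \<Rightarrow> nat \<Rightarrow> ('n, 'k) mpoly \<Rightarrow> ('n, 'k) mpoly" where
  "lam n g i a = (if i < n then U (Suc i) (f ^ (p ^ Suc i - p) * g (n - i) * a) else 0)"

lemma lam_add: "lam n g i (a + b) = lam n g i a + lam n g i b"
  by (simp add: lam_def distrib_left U_add)

lemma lam_mult: "lam n g i (c ^ (p ^ Suc i) * a) = c * lam n g i a"
proof -
  have "U (Suc i) (f ^ (p ^ Suc i - p) * g (n - i) * (c ^ (p ^ Suc i) * a))
      = U (Suc i) (c ^ (p ^ Suc i) * (f ^ (p ^ Suc i - p) * g (n - i) * a))"
    by (simp only: mult_ac)
  also have "\<dots> = c * U (Suc i) (f ^ (p ^ Suc i - p) * g (n - i) * a)" by (rule U_mult)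
  finally show ?thesis unfolding lam_def by simp
qed

lemma p_le_power: "p \<le> p ^ Suc i"
  using q_pos[of i] by simp

lemma power_exponent: "p ^ Suc i - p = p * (p ^ i - 1)"
  by (simp add: right_diff_distrib')

text \<open>Since q - p = p (p^i - 1), the first of the i+1 traces already pulls out everything
  except g_(n-i), and u(g_(n-i)) = 0 for i from 1 on.\<close>

lemma lam_power_p:
  assumes "chain n g" "i \<ge> 1"
  shows "lam n g i (c ^ p) = 0"
proof (cases "i < n")
  case True
  have 0: "U 1 (g (n - i)) = 0" using assms True by (auto simp: chain_def)
  have "U 1 (f ^ (p ^ Suc i - p) * g (n - i) * c ^ p) = U 1 ((f ^ (p ^ i - 1) * c) ^ (p ^ 1) * g (n - i))"
    unfolding power_exponent by (simp add: power_mult_distrib power_mult mult_ac) (simp add: mult.commute flip: power_mult)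
  also have "\<dots> = 0" unfolding U_mult 0 by simp
  finally show ?thesis unfolding lam_def U_Suc[of i] by simp
qed (simp add: lam_def)

text \<open>Write g_(n-i) as f^(p-1) h plus theta of the preceding member. The first part produces
  f^q, which leaves the trace as f; the second produces exactly the negative of the term at level
  i+1.\<close>

lemma lam_relation:
  assumes "chain n g"
  shows "f dvd lam n g i (f * a) + lam n g (Suc i) (a ^ p * D)"
proof (cases "i < n")
  case True
  define q where "q = p ^ Suc i"
  \<comment> \<open>The preceding member of the chain, or 0 at the top level i = n-1, where g_1 is
    itself divisible by f^(p-1).\<close>
  define G where "G = (if Suc i < n then g (n - Suc i) else 0)"
  have qp: "p \<le> q" unfolding q_def by (rule p_le_power)
  have U0: "U 1 G = 0" using assms True by (auto simp: chain_def G_def)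
  have "f ^ (p - 1) dvd g (n - i) - theta p f G"
  proof (cases "Suc i < n")
    case True
    have "n - i = Suc (n - Suc i)" using \<open>i < n\<close> by simp
    thus ?thesis using assms True by (auto simp: chain_def G_def)
  next
    case False
    hence "n - i = 1" using \<open>i < n\<close> by simp
    thus ?thesis using assms False by (auto simp: chain_def G_def)
  qed
  then obtain h where h: "g (n - i) = f ^ (p - 1) * h + theta p f G" by (auto elim!: dvdE simp: algebra_simps)
  define w where "w = U 1 (D * G)"
  have th: "theta p f G = - (f ^ (p - 2) * w)" unfolding w_def by (rule theta_ker[OF U0])
  have "q = q - p + (p - 1) + 1" "q - 1 = q - p + (p - 2) + 1" using qp p_ge_2 by auto
  hence e1: "f ^ (q - p) * f ^ (p - 1) * f = f ^ q" "f ^ (q - p) * f ^ (p - 2) * f = f ^ (q - 1)"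
    by (metis power_add power_one_right)+
  have 1: "lam n g i (f * a) = U (Suc i) (f ^ q * (h * a)) - U (Suc i) (f ^ (q - 1) * (w * a))"
  proof -
    have "f ^ (q - p) * g (n - i) * (f * a) = (f ^ (q - p) * f ^ (p - 1) * f) * (h * a) - (f ^ (q - p) * f ^ (p - 2) * f) * (w * a)"
      unfolding h th by (simp add: algebra_simps)
    thus ?thesis using True unfolding e1 by (simp only: lam_def if_True U_diff flip: q_def)
  qed
  have 2: "lam n g (Suc i) (a ^ p * D) = U (Suc i) (f ^ (q - 1) * (w * a))"
  proof -
    have "lam n g (Suc i) (a ^ p * D) = U (Suc (Suc i)) (f ^ (p * (q - 1)) * G * (a ^ p * D))"
      using power_exponent[of "Suc i"] by (simp add: lam_def G_def q_def)
    also have "f ^ (p * (q - 1)) * G * (a ^ p * D) = (f ^ (q - 1) * a) ^ (p ^ 1) * (D * G)"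
      by (simp add: power_mult_distrib mult_ac flip: power_mult)
    also have "U (Suc (Suc i)) \<dots> = U (Suc i) (f ^ (q - 1) * (w * a))"
      unfolding U_Suc[of "Suc i"] U_mult w_def by (simp add: mult_ac)
    finally show ?thesis .
  qed
  have "lam n g i (f * a) + lam n g (Suc i) (a ^ p * D) = f * U (Suc i) (h * a)"
    unfolding 1 2 q_def U_mult by simp
  thus ?thesis by simp
qed (simp add: lam_def)

end

text \<open>Both the local ring of \<open>S/f\<close> at the origin and \<open>S/f\<close> itself are possible targets \<open>L\<close>.\<close>

locale frac_target = hypersurface p ty f + L: cring L
  for p :: nat and ty :: "('n::finite \<times> 'k::field) itself" and f :: "('n, 'k) mpoly"
    and L :: "('b, 'c) ring_scheme" (structure) +
  fixes \<iota> :: "('n, 'k) mpoly \<Rightarrow> 'b"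
  assumes iota_closed: "\<iota> a \<in> carrier L"
    and iota_add: "\<iota> (a + b) = \<iota> a \<oplus> \<iota> b"
    and iota_mult: "\<iota> (a * b) = \<iota> a \<otimes> \<iota> b"
    and iota_1: "\<iota> 1 = \<one>"
    and iota_f: "\<iota> f = \<zero>"
    and iota_frac: "y \<in> carrier L \<Longrightarrow> \<exists>t a. lookup t 0 \<noteq> 0 \<and> \<iota> t \<otimes> y = \<iota> a"
    and iota_ker: "\<iota> a = \<zero> \<Longrightarrow> \<exists>t. lookup t 0 \<noteq> 0 \<and> f dvd t * a"
begin

lemma iota_0: "\<iota> 0 = \<zero>"
  using iota_add[of 0 0] iota_closed[of 0] L.add.l_cancel_one by fastforce

lemma iota_diff_zero: "\<iota> a = \<iota> b \<Longrightarrow> \<iota> (a - b) = \<zero>"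
  using iota_add[of "a - b" b] iota_closed L.add.r_cancel_one by fastforce

lemma iota_f_mult: "\<iota> (f * a) = \<zero>"
  using iota_closed by (simp add: iota_mult iota_f)

lemma common_denominator:
  assumes "finite B" "\<And>j. j \<in> B \<Longrightarrow> y j \<in> carrier L"
  shows "\<exists>t. lookup t 0 \<noteq> 0 \<and> (\<forall>j\<in>B. \<exists>b. \<iota> t \<otimes> y j = \<iota> b)"
  using assms
proof (induction B rule: finite_induct)
  case empty
  have "lookup 1 (0::'n \<Rightarrow>\<^sub>0 nat) \<noteq> (0::'k)" by simp
  thus ?case by blast
next
  case (insert i B)
  then obtain t where t: "lookup t 0 \<noteq> 0" "\<forall>j\<in>B. \<exists>b. \<iota> t \<otimes> y j = \<iota> b" by auto
  obtain s a where s: "lookup s 0 \<noteq> 0" "\<iota> s \<otimes> y i = \<iota> a" using iota_frac insert.prems by blast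
  have "\<exists>b. \<iota> (s * t) \<otimes> y j = \<iota> b" if j: "j \<in> insert i B" for j
  proof (cases "j = i")
    case True
    have "\<iota> (s * t) \<otimes> y i = \<iota> t \<otimes> (\<iota> s \<otimes> y i)"
      using insert.prems iota_closed by (simp add: iota_mult L.m_ac)
    thus ?thesis using s True by (metis iota_mult)
  next
    case False
    then obtain b where "\<iota> t \<otimes> y j = \<iota> b" using t j by blast
    moreover have "\<iota> (s * t) \<otimes> y j = \<iota> s \<otimes> (\<iota> t \<otimes> y j)"
      using insert.prems iota_closed j by (simp add: iota_mult L.m_ac)
    ultimately show ?thesis by (metis iota_mult)
  qed
  moreover have "lookup (s * t) 0 \<noteq> 0" using s t by (simp add: lookup_0_mult)
  ultimately show ?case by blast
qed

lemma common_kernel: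
  assumes "finite B" "\<And>j. j \<in> B \<Longrightarrow> \<iota> (y j) = \<zero>"
  shows "\<exists>t. lookup t 0 \<noteq> 0 \<and> (\<forall>j\<in>B. f dvd t * y j)"
  using assms
proof (induction B rule: finite_induct)
  case empty
  have "lookup 1 (0::'n \<Rightarrow>\<^sub>0 nat) \<noteq> (0::'k)" by simp
  thus ?case by blast
next
  case (insert i B)
  then obtain t where t: "lookup t 0 \<noteq> 0" "\<forall>j\<in>B. f dvd t * y j" by auto
  obtain s where s: "lookup s 0 \<noteq> 0" "f dvd s * y i" using iota_ker insert.prems by blast
  have "f dvd (s * t) * y j" if "j \<in> insert i B" for j
  proof (cases "j = i")
    case True
    have "f dvd t * (s * y i)" using s by (rule_tac dvd_mult) simp
    thus ?thesis using True by (simp add: mult_ac)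
  next
    case False
    hence "f dvd s * (t * y j)" using t that by (rule_tac dvd_mult) auto
    thus ?thesis by (simp add: mult_ac)
  qed
  moreover have "lookup (s * t) 0 \<noteq> 0" using s t by (simp add: lookup_0_mult)
  ultimately show ?case by blast
qed

text \<open>The coordinates of \<open>H\<close> are traces of its multiples, hence divisible by f up
  to a multiplier; a common multiplier enters \<open>U e\<close> as its p^e-th power.\<close>

lemma U_kernel:
  assumes "\<And>a. \<iota> (U e (a * H)) = \<zero>"
  shows "\<exists>t. lookup t 0 \<noteq> 0 \<and> f ^ (p ^ e) dvd t ^ (p ^ e) * H"
proof -
  obtain t where t: "lookup t 0 \<noteq> 0" "\<forall>j\<in>box (p ^ e). f dvd t * U e (single (cobox (p ^ e) j) 1 * H)"
    using common_kernel[OF finite_box, of "p ^ e" "\<lambda>j. U e (single (cobox (p ^ e) j) 1 * H)"] assms by blast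
  have "f ^ (p ^ e) dvd t ^ (p ^ e) * H"
  proof (rule U_dvd_imp)
    fix j assume "j \<in> box (p ^ e)"
    thus "f dvd U e (single (cobox (p ^ e) j) 1 * (t ^ p ^ e * H))"
      using t(2) by (simp only: mult.left_commute[of _ "t ^ p ^ e"] U_mult)
  qed
  thus ?thesis using t by blast
qed

text \<open>Frobenius duality: a functional is determined by its values on the monomial basis, and
  after multiplication by a common denominator these values are images of polynomials.\<close>

lemma functional_representation:
  fixes \<Lambda> :: "('n, 'k) mpoly \<Rightarrow> 'b"
  assumes "\<And>a. \<Lambda> a \<in> carrier L" "\<And>a b. \<Lambda> (a + b) = \<Lambda> a \<oplus> \<Lambda> b" "\<And>c a. \<Lambda> (c ^ (p ^ e) * a) = \<iota> c \<otimes> \<Lambda> a"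
  shows "\<exists>t G. lookup t 0 \<noteq> 0 \<and> (\<forall>a. \<iota> t \<otimes> \<Lambda> a = \<iota> (U e (G * a)))"
proof -
  obtain t where t: "lookup t 0 \<noteq> 0" "\<forall>j\<in>box (p ^ e). \<exists>b. \<iota> t \<otimes> \<Lambda> (single j 1) = \<iota> b"
    using common_denominator[OF finite_box, of "p ^ e" "\<lambda>j. \<Lambda> (single j 1)"] assms(1) by blast
  then obtain b where b: "\<iota> t \<otimes> \<Lambda> (single j 1) = \<iota> (b j)" if "j \<in> box (p ^ e)" for j by metis
  \<comment> \<open>The combination of the dual basis with the prescribed values as
    coordinates.\<close>
  define G where "G = (\<Sum>j\<in>box (p ^ e). b j ^ (p ^ e) * single (cobox (p ^ e) j) 1)"
  have UG: "U e (G * single j0 1) = b j0" if "j0 \<in> box (p ^ e)" for j0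
  proof -
    have "U e (G * single j0 1) = (\<Sum>j\<in>box (p ^ e). b j * U e (single (cobox (p ^ e) j) 1 * single j0 1))"
      unfolding G_def sum_distrib_right U_sum by (intro sum.cong refl) (simp only: mult.assoc U_mult)
    also have "\<dots> = (\<Sum>j\<in>box (p ^ e). if j = j0 then b j0 else 0)"
    proof (intro sum.cong refl)
      fix j assume j: "j \<in> box (p ^ e)"
      have "(\<forall>i. lookup j0 i mod p ^ e = lookup j i) \<longleftrightarrow> j = j0"
        using that by (auto simp: box_def poly_mapping_eq_iff fun_eq_iff)
      moreover have "expo (\<lambda>i. lookup j0 i div p ^ e) = 0"
        using that by (intro poly_mapping_eqI) (simp add: box_def)
      ultimately show "b j * U e (single (cobox (p ^ e) j) 1 * single j0 1) = (if j = j0 then b j0 else 0)"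
        unfolding U_cobox_single[OF j] by simp
    qed
    also have "\<dots> = b j0" using that finite_box by simp
    finally show ?thesis .
  qed
  define good where "good = {a. \<iota> t \<otimes> \<Lambda> a = \<iota> (U e (G * a))}"
  have \<Lambda>0: "\<Lambda> 0 = \<zero>" using assms(2)[of 0 0] assms(1)[of 0] L.add.l_cancel_one by fastforce
  have good_add: "a + a' \<in> good" if "a \<in> good" "a' \<in> good" for a a'
    using that assms(1) iota_closed by (simp add: good_def assms(2) L.r_distr distrib_left U_add iota_add)
  have good_0: "0 \<in> good" using iota_closed by (simp add: good_def \<Lambda>0 iota_0)
  have good_sum: "sum h A \<in> good" if "\<And>j. j \<in> A \<Longrightarrow> h j \<in> good" for h and A :: "('n \<Rightarrow>\<^sub>0 nat) set"
    using that by (induction A rule: infinite_finite_induct) (auto intro: good_add good_0)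
  have base: "c ^ (p ^ e) * single j 1 \<in> good" if "j \<in> box (p ^ e)" for c j
  proof -
    have "\<iota> t \<otimes> \<Lambda> (c ^ (p ^ e) * single j 1) = \<iota> c \<otimes> (\<iota> t \<otimes> \<Lambda> (single j 1))"
      unfolding assms(3) using assms(1) iota_closed by (simp add: L.m_ac)
    also have "\<dots> = \<iota> (U e (G * (c ^ (p ^ e) * single j 1)))"
      by (simp only: b[OF that] mult.left_commute[of G] U_mult UG[OF that] iota_mult)
    finally show ?thesis by (simp add: good_def)
  qed
  have "a \<in> good" for a
    by (subst U_reconstruct[of a e]) (intro good_sum base)
  thus ?thesis using t(1) unfolding good_def by blast
qed

theorem forward:
  fixes \<Lambda> :: "nat \<Rightarrow> ('n, 'k) mpoly \<Rightarrow> 'b"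
  assumes "n \<ge> 1"
    and closed: "\<And>i a. \<Lambda> i a \<in> carrier L"
    and add: "\<And>i a b. \<Lambda> i (a + b) = \<Lambda> i a \<oplus> \<Lambda> i b"
    and mult: "\<And>i c a. \<Lambda> i (c ^ (p ^ Suc i) * a) = \<iota> c \<otimes> \<Lambda> i a"
    and power: "\<And>i c. i \<ge> 1 \<Longrightarrow> \<Lambda> i (c ^ p) = \<zero>"
    and rel: "\<And>i a. \<Lambda> i (f * a) \<oplus> \<Lambda> (Suc i) (a ^ p * D) = \<zero>"
    and top: "\<And>a. \<Lambda> n a = \<zero>"
    and one: "\<Lambda> 0 1 = \<one>"
  shows "\<not> I_seq p f n \<subseteq> frob_power p max_ideal"
proof -
  \<comment> \<open>One step from level i+1 to level i. The factor c^p in front of \<open>G\<close>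
    collects the multipliers; it keeps G in its ideal and in the kernel of u.\<close>
  have step: "\<exists>t g c. lookup t 0 \<noteq> 0 \<and> f ^ (p - 1) dvd g - theta p f (c ^ p * G) \<and>
      (i \<ge> 1 \<longrightarrow> U 1 g = 0) \<and> (\<forall>a. \<iota> t \<otimes> \<Lambda> i a = \<iota> (U (Suc i) (f ^ (p ^ Suc i - p) * g * a)))"
    if G: "U 1 G = 0" and s: "lookup s 0 \<noteq> 0"
      and sG: "\<And>a. \<iota> s \<otimes> \<Lambda> (Suc i) a = \<iota> (U (Suc (Suc i)) (f ^ (p ^ Suc (Suc i) - p) * G * a))"
    for i s G
  proof -
    define q where "q = p ^ Suc i"
    have qp: "p \<le> q" unfolding q_def by (rule p_le_power)
    define w where "w = U 1 (D * G)"
    obtain r G0 where r: "lookup r 0 \<noteq> 0" and rG0: "\<And>a. \<iota> r \<otimes> \<Lambda> i a = \<iota> (U (Suc i) (G0 * a))"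
      using functional_representation[of "\<Lambda> i" "Suc i", OF closed add mult] by blast
    \<comment> \<open>Encodes the relation between the two levels: the image of U(a H) is s r times
      \<Lambda>_i(f a) + \<Lambda>_(i+1)(a^p D), hence zero.\<close>
    define H where "H = s ^ q * G0 * f + f ^ (q - 1) * r ^ q * w"
    have "\<iota> (U (Suc i) (a * H)) = \<zero>" for a
    proof -
      have "U (Suc i) (a * H) = U (Suc i) (s ^ q * (G0 * (f * a))) + U (Suc i) (r ^ q * (f ^ (q - 1) * (w * a)))"
        unfolding H_def U_add[symmetric] by (simp add: distrib_left mult_ac)
      also have "U (Suc i) (s ^ q * (G0 * (f * a))) = s * U (Suc i) (G0 * (f * a))" unfolding q_def by (rule U_mult)
      also have "U (Suc i) (r ^ q * (f ^ (q - 1) * (w * a))) = r * U (Suc i) (f ^ (q - 1) * (w * a))"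
        unfolding q_def by (rule U_mult)
      also have "U (Suc i) (f ^ (q - 1) * (w * a)) = U (Suc (Suc i)) (f ^ (p ^ Suc (Suc i) - p) * G * (a ^ p * D))"
      proof -
        have "f ^ (p ^ Suc (Suc i) - p) * G * (a ^ p * D) = (f ^ (q - 1) * a) ^ (p ^ 1) * (D * G)"
          unfolding power_exponent[of "Suc i"] q_def
          by (simp add: power_mult_distrib mult_ac flip: power_mult)
        hence "U (Suc (Suc i)) (f ^ (p ^ Suc (Suc i) - p) * G * (a ^ p * D)) = U (Suc i) (f ^ (q - 1) * a * U 1 (D * G))"
          by (simp only: U_Suc[of "Suc i"] U_mult)
        thus ?thesis by (simp add: w_def mult_ac)
      qed
      finally have "\<iota> (U (Suc i) (a * H)) = \<iota> s \<otimes> (\<iota> r \<otimes> \<Lambda> i (f * a)) \<oplus> \<iota> r \<otimes> (\<iota> s \<otimes> \<Lambda> (Suc i) (a ^ p * D))"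
        by (simp only: iota_add iota_mult rG0 sG)
      also have "\<dots> = \<iota> s \<otimes> \<iota> r \<otimes> (\<Lambda> i (f * a) \<oplus> \<Lambda> (Suc i) (a ^ p * D))"
        using closed iota_closed by (simp add: L.r_distr L.m_ac)
      also have "\<dots> = \<zero>" unfolding rel using iota_closed by simp
      finally show ?thesis .
    qed
    from U_kernel[OF this] obtain t1 where t1: "lookup t1 0 \<noteq> 0" "f ^ q dvd t1 ^ q * H"
      unfolding q_def by blast
    have qs: "q - 1 = Suc (q - 2)" "q = Suc (q - 1)" using qp p_ge_2 by auto
    have "t1 ^ q * H = f * ((t1 * s) ^ q * G0 + f ^ (q - 2) * ((t1 * r) ^ q * w))"
      unfolding H_def qs(1) by (simp add: algebra_simps power_mult_distrib)
    hence "f * f ^ (q - 1) dvd f * ((t1 * s) ^ q * G0 + f ^ (q - 2) * ((t1 * r) ^ q * w))"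
      using t1(2) qs(2) by (metis power_Suc)
    hence "f ^ (q - 1) dvd (t1 * s) ^ q * G0 + f ^ (q - 2) * ((t1 * r) ^ q * w)"
      using f_nonzero by (rule mpoly_dvd_cancel)
    then obtain h where h: "(t1 * s) ^ q * G0 = f ^ (q - 1) * h - f ^ (q - 2) * ((t1 * r) ^ q * w)"
      by (auto elim!: dvdE simp: algebra_simps)
    \<comment> \<open>Chosen so that f^(q-p) g0 equals the representing polynomial
      \<open>(t1 * s) ^ q * G0\<close>, while g0 is congruent to theta of a p-th power multiple of G
      modulo f^(p-1).\<close>
    define g0 where "g0 = f ^ (p - 1) * h + theta p f (((t1 * r) ^ q) ^ p * G)"
    have th: "theta p f (((t1 * r) ^ q) ^ p * G) = - (f ^ (p - 2) * ((t1 * r) ^ q * w))"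
      unfolding theta_mult theta_ker[OF G] w_def by (simp add: mult_ac)
    have e1: "f ^ (q - p) * f ^ (p - 1) = f ^ (q - 1)" "f ^ (q - p) * f ^ (p - 2) = f ^ (q - 2)"
      using qp p_ge_2 by (simp_all flip: power_add)
    have g0: "(t1 * s) ^ q * G0 = f ^ (q - p) * g0"
      unfolding h g0_def th e1[symmetric] by (simp add: algebra_simps)
    define t0 where "t0 = t1 * s * r"
    have t0: "\<iota> t0 \<otimes> \<Lambda> i a = \<iota> (U (Suc i) (f ^ (q - p) * g0 * a))" for a
    proof -
      have "\<iota> t0 \<otimes> \<Lambda> i a = \<iota> (t1 * s) \<otimes> (\<iota> r \<otimes> \<Lambda> i a)"
        unfolding t0_def iota_mult[of "t1 * s" r] using closed iota_closed by (simp add: L.m_assoc)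
      also have "\<dots> = \<iota> (t1 * s * U (Suc i) (G0 * a))" by (simp only: rG0 iota_mult)
      also have "t1 * s * U (Suc i) (G0 * a) = U (Suc i) ((t1 * s) ^ q * G0 * a)"
        unfolding q_def mult.assoc[of "(t1 * s) ^ p ^ Suc i"] U_mult ..
      finally show ?thesis unfolding g0 .
    qed
    have t0n: "lookup t0 0 \<noteq> 0" using t1 s r by (simp add: t0_def lookup_0_mult)
    have g0d: "f ^ (p - 1) dvd g0 - theta p f (((t1 * r) ^ q) ^ p * G)" by (simp add: g0_def)
    show ?thesis
    proof (cases "i \<ge> 1")
      case False
      thus ?thesis using t0 t0n g0d unfolding q_def by blast
    next
      case True
      \<comment> \<open>That \<Lambda>_i kills p-th powers means that the functional with kernel
        polynomial \<open>v\<close> vanishes. This makes u(g0) divisible by f up to a multiplier,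
        but not zero.\<close>
      define v where "v = f ^ (p ^ i - 1) * U 1 g0"
      have "\<iota> (U i (c * v)) = \<zero>" for c
      proof -
        have "f ^ (q - p) * g0 * c ^ p = (f ^ (p ^ i - 1) * c) ^ (p ^ 1) * g0"
          unfolding q_def power_exponent[of i] by (simp add: power_mult_distrib mult_ac flip: power_mult)
        hence "U (Suc i) (f ^ (q - p) * g0 * c ^ p) = U i (f ^ (p ^ i - 1) * c * U 1 g0)"
          by (simp only: U_Suc[of i] U_mult)
        hence "U (Suc i) (f ^ (q - p) * g0 * c ^ p) = U i (c * v)"
          by (simp add: v_def mult_ac)
        thus ?thesis using t0[of "c ^ p"] power[OF True, of c] iota_closed by simp
      qed
      from U_kernel[OF this] obtain t2 where t2: "lookup t2 0 \<noteq> 0" "f ^ (p ^ i) dvd t2 ^ (p ^ i) * v" by blast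
      have "f ^ (p ^ i - 1) * f dvd f ^ (p ^ i - 1) * (t2 ^ (p ^ i) * U 1 g0)"
      proof -
        have "f ^ (p ^ i - 1) * f = f ^ (p ^ i)" using q_pos[of i] by (metis Suc_diff_1 power_Suc2)
        thus ?thesis using t2(2) by (simp only: v_def mult.left_commute)
      qed
      hence "f dvd t2 ^ (p ^ i) * U 1 g0" by (rule mpoly_dvd_cancel) (rule f_power_nonzero)
      then obtain y where y: "t2 ^ (p ^ i) * U 1 g0 = f * y" by (auto elim: dvdE)
      define tm where "tm = (single (cobox (p ^ 1) 0) 1 :: ('n, 'k) mpoly)"
      have Utm: "U 1 tm = 1"
      proof -
        have "0 \<in> box (p ^ 1)" using p_gt_0 by (simp add: box_def)
        from U_cobox_single[OF this, of 0 1] have "U 1 tm = single (expo (\<lambda>i. 0)) 1" by (simp add: tm_def)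
        also have "expo (\<lambda>i::'n. 0) = 0" by (intro poly_mapping_eqI) simp
        finally show ?thesis by simp
      qed
      \<comment> \<open>As u(tm) = 1, subtracting (f y)^p tm makes the trace exactly zero. The
        correction is divisible by f^p, so it is invisible modulo f^(p-1), and in the functional it
        contributes a multiple of f.\<close>
      define g where "g = t2 ^ q * g0 - (f * y) ^ (p ^ 1) * tm"
      have "U 1 (t2 ^ q * g0) = U 1 ((t2 ^ (p ^ i)) ^ (p ^ 1) * g0)"
        unfolding q_def by (simp add: mult.commute flip: power_mult)
      hence Ug: "U 1 g = 0" unfolding g_def U_diff U_mult Utm y by simp
      have "f ^ (p - 1) dvd t2 ^ q * (g0 - theta p f (((t1 * r) ^ q) ^ p * G)) - (f * y) ^ (p ^ 1) * tm"
      proof (rule dvd_diff[OF dvd_mult[OF g0d] dvd_mult2])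
        show "f ^ (p - 1) dvd (f * y) ^ (p ^ 1)"
          by (simp add: power_mult_distrib) (intro dvd_mult2 le_imp_power_dvd, simp)
      qed
      also have "t2 ^ q * theta p f (((t1 * r) ^ q) ^ p * G) = theta p f ((t2 ^ q * (t1 * r) ^ q) ^ p * G)"
        by (simp only: power_mult_distrib[of _ _ p] mult.assoc theta_mult)
      hence "t2 ^ q * (g0 - theta p f (((t1 * r) ^ q) ^ p * G)) - (f * y) ^ (p ^ 1) * tm
          = g - theta p f ((t2 ^ q * (t1 * r) ^ q) ^ p * G)"
        by (simp add: g_def right_diff_distrib)
      finally have gd: "f ^ (p - 1) dvd g - theta p f ((t2 ^ q * (t1 * r) ^ q) ^ p * G)" .
      have "\<iota> (t2 * t0) \<otimes> \<Lambda> i a = \<iota> (U (Suc i) (f ^ (q - p) * g * a))" for a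
      proof -
        have e: "f ^ (q - p) * f ^ p = f ^ q" using qp by (simp flip: power_add)
        have "f ^ (q - p) * g * a = t2 ^ q * (f ^ (q - p) * g0 * a) - (f ^ (q - p) * f ^ p) * (y ^ p * tm * a)"
          by (simp add: g_def algebra_simps power_mult_distrib)
        hence "U (Suc i) (f ^ (q - p) * g * a) = t2 * U (Suc i) (f ^ (q - p) * g0 * a) - f * U (Suc i) (y ^ p * tm * a)"
          unfolding e by (simp only: U_diff) (simp only: q_def U_mult)
        hence "t2 * U (Suc i) (f ^ (q - p) * g0 * a) = U (Suc i) (f ^ (q - p) * g * a) + f * U (Suc i) (y ^ p * tm * a)"
          by simp
        moreover have "\<iota> (t2 * t0) \<otimes> \<Lambda> i a = \<iota> (t2 * U (Suc i) (f ^ (q - p) * g0 * a))"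
          unfolding iota_mult using closed iota_closed by (simp add: L.m_assoc t0)
        ultimately show ?thesis using iota_closed by (simp add: iota_add iota_f_mult)
      qed
      moreover have "lookup (t2 * t0) 0 \<noteq> 0" using t2 t0n by (simp add: lookup_0_mult)
      ultimately show ?thesis using gd Ug unfolding q_def by blast
    qed
  qed
  have claim: "\<exists>t g. lookup t 0 \<noteq> 0 \<and> g \<in> I_seq p f j \<and> (j < n \<longrightarrow> U 1 g = 0) \<and>
      (\<forall>a. \<iota> t \<otimes> \<Lambda> (n - j) a = \<iota> (U (Suc (n - j)) (f ^ (p ^ Suc (n - j) - p) * g * a)))"
    if "1 \<le> j" "j \<le> n" for j
    using that
  proof (induction j rule: nat_induct_at_least)
    case base
    \<comment> \<open>The induction starts above the last level: \<Lambda>_n is zero and is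
      represented by G = 0 with multiplier 1.\<close>
    have "\<iota> 1 \<otimes> \<Lambda> (Suc (n - 1)) a = \<iota> (U (Suc (Suc (n - 1))) (f ^ (p ^ Suc (Suc (n - 1)) - p) * 0 * a))" for a
      using \<open>n \<ge> 1\<close> iota_closed by (simp add: top iota_0)
    from step[OF U_0 _ this] obtain t g c where tg: "lookup t 0 \<noteq> 0" "f ^ (p - 1) dvd g - theta p f (c ^ p * 0)"
      "n - 1 \<ge> 1 \<longrightarrow> U 1 g = 0" "\<forall>a. \<iota> t \<otimes> \<Lambda> (n - 1) a = \<iota> (U (Suc (n - 1)) (f ^ (p ^ Suc (n - 1) - p) * g * a))"
      by auto
    have "g \<in> I_seq p f 1" using tg(2) by (intro I_seq_dvd) auto
    thus ?case using tg by (intro exI[of _ t] exI[of _ g]) auto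
  next
    case (Suc j)
    then obtain s G where G: "lookup s 0 \<noteq> 0" "G \<in> I_seq p f j" "U 1 G = 0"
      "\<forall>a. \<iota> s \<otimes> \<Lambda> (n - j) a = \<iota> (U (Suc (n - j)) (f ^ (p ^ Suc (n - j) - p) * G * a))" by auto
    have nj: "n - j = Suc (n - Suc j)" using Suc.prems by simp
    obtain t g c where tg: "lookup t 0 \<noteq> 0" "f ^ (p - 1) dvd g - theta p f (c ^ p * G)"
      "n - Suc j \<ge> 1 \<longrightarrow> U 1 g = 0"
      "\<forall>a. \<iota> t \<otimes> \<Lambda> (n - Suc j) a = \<iota> (U (Suc (n - Suc j)) (f ^ (p ^ Suc (n - Suc j) - p) * g * a))"
      using step[OF G(3,1), of "n - Suc j"] G(4) unfolding nj by blast
    have "c ^ p * G \<in> I_seq p f j" using G Suc by (intro I_seq_mult) auto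
    moreover have "U 1 (c ^ p * G) = 0" using U_mult[of 1 c G] G by simp
    ultimately have "g \<in> I_seq p f (Suc j)" using tg(2) Suc.hyps by (auto simp: I_seq_Suc)
    thus ?case using tg by (intro exI[of _ t] exI[of _ g]) auto
  qed
  obtain t g where tg: "lookup t 0 \<noteq> 0" "g \<in> I_seq p f n"
    "\<forall>a. \<iota> t \<otimes> \<Lambda> 0 a = \<iota> (U 1 (f ^ (p - p) * g * a))"
    using claim[of n] \<open>n \<ge> 1\<close> by auto
  \<comment> \<open>Evaluation at 1. Since f has no constant term, equality modulo f up to a
    multiplier still forces u(g) to have a nonzero constant term.\<close>
  have "\<iota> t = \<iota> (U 1 g)" using tg(3)[rule_format, of 1] one iota_closed by simp
  then obtain r where r: "lookup r 0 \<noteq> 0" "f dvd r * (t - U 1 g)"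
    using iota_ker iota_diff_zero by blast
  then obtain z where "r * (t - U 1 g) = f * z" by (auto elim: dvdE)
  hence "lookup (r * (t - U 1 g)) 0 = 0" by (simp only: lookup_0_mult f_const mult_zero_left)
  hence "lookup (U 1 (1 * g)) 0 \<noteq> 0" using r tg(1) by (simp add: lookup_0_mult lookup_minus)
  hence "g \<notin> frob_power p max_ideal" unfolding frob_power_max_ideal by blast
  thus ?thesis using tg(2) by blast
qed

end

section \<open>Construction of module homomorphisms\<close>

context perfect_poly
begin

primrec Psi :: "nat \<Rightarrow> (nat \<Rightarrow> ('n, 'k) mpoly \<Rightarrow> ('n, 'k) mpoly) \<Rightarrow> ('n, 'k) wittS \<Rightarrow> ('n, 'k) mpoly" where
  "Psi 0 \<Lambda> w = 0"
| "Psi (Suc n) \<Lambda> w = \<Lambda> 0 (wcomp w 0) + Psi n (\<lambda>i. \<Lambda> (Suc i)) (unver (w - tau (wcomp w 0)))"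

definition additive :: "(nat \<Rightarrow> ('n, 'k) mpoly \<Rightarrow> ('n, 'k) mpoly) \<Rightarrow> bool" where
  "additive \<Lambda> \<longleftrightarrow> (\<forall>i a b. \<Lambda> i (a + b) = \<Lambda> i a + \<Lambda> i b)"

lemma additive_shift: "additive \<Lambda> \<Longrightarrow> additive (\<lambda>i. \<Lambda> (Suc i))"
  by (simp add: additive_def)

lemma additive_0: "additive \<Lambda> \<Longrightarrow> \<Lambda> i 0 = 0"
  unfolding additive_def by (metis add_cancel_left_right)

lemma split_tau: "\<exists>b. w = tau (wcomp w 0) + ver b \<and> b = unver (w - tau (wcomp w 0))"
  using ver_unver[of "w - tau (wcomp w 0)"] by (intro exI[of _ "unver (w - tau (wcomp w 0))"]) simp

lemma Psi_eq: "w - tau (wcomp w 0) = ver b \<Longrightarrow>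
    Psi (Suc n) \<Lambda> w = \<Lambda> 0 (wcomp w 0) + Psi n (\<lambda>i. \<Lambda> (Suc i)) b"
  by simp

text \<open>The two claims need each other: tau is additive only up to V F z, so additivity at one
  level uses the vanishing on F z for the shifted functionals. The second claim is conditional
  because \<Lambda>_0 need not kill p-th powers.\<close>

lemma Psi_add_aux:
  assumes "additive \<Lambda>" "\<And>i c. i \<ge> 1 \<Longrightarrow> \<Lambda> i (c ^ p) = 0"
  shows "Psi n \<Lambda> (w + w') = Psi n \<Lambda> w + Psi n \<Lambda> w' \<and>
    ((\<forall>c. \<Lambda> 0 (c ^ p) = 0) \<longrightarrow> Psi n \<Lambda> (wfrob y) = 0)"
  using assms
proof (induction n arbitrary: \<Lambda> w w' y)
  case (Suc n)
  define \<Lambda>' where "\<Lambda>' = (\<lambda>i. \<Lambda> (Suc i))"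
  have IH: "Psi n \<Lambda>' (w + w') = Psi n \<Lambda>' w + Psi n \<Lambda>' w'" "Psi n \<Lambda>' (wfrob y) = 0" for w w' y
    using Suc.IH[of \<Lambda>'] Suc.prems additive_shift[of \<Lambda>] by (auto simp: \<Lambda>'_def)
  have add: "Psi (Suc n) \<Lambda> (w + w') = Psi (Suc n) \<Lambda> w + Psi (Suc n) \<Lambda> w'"
  proof -
    obtain b where b: "w - tau (wcomp w 0) = ver b" by (metis split_tau add_diff_cancel_left')
    obtain b' where b': "w' - tau (wcomp w' 0) = ver b'" by (metis split_tau add_diff_cancel_left')
    obtain z where z: "tau (wcomp w 0 + wcomp w' 0) = tau (wcomp w 0) + tau (wcomp w' 0) + ver (wfrob z)"
      using tau_add' by blast
    have "w + w' - tau (wcomp (w + w') 0) = ver (b + b' - wfrob z)"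
      by (simp add: z ver_add ver_diff flip: b b')
    hence "Psi (Suc n) \<Lambda> (w + w') = \<Lambda> 0 (wcomp w 0 + wcomp w' 0) + Psi n \<Lambda>' (b + b' - wfrob z)"
      unfolding \<Lambda>'_def by (subst Psi_eq) simp_all
    moreover have "Psi n \<Lambda>' (b + b' - wfrob z) = Psi n \<Lambda>' b + Psi n \<Lambda>' b'"
      using IH(1)[of "b + b' - wfrob z" "wfrob z"] IH(1)[of b b'] IH(2) by simp
    moreover have "\<Lambda> 0 (wcomp w 0 + wcomp w' 0) = \<Lambda> 0 (wcomp w 0) + \<Lambda> 0 (wcomp w' 0)"
      using Suc.prems(1) by (simp add: additive_def)
    ultimately show ?thesis
      using Psi_eq[OF b, of n \<Lambda>] Psi_eq[OF b', of n \<Lambda>] by (simp only: \<Lambda>'_def) simp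
  qed
  moreover have "Psi (Suc n) \<Lambda> (wfrob y) = 0" if 0: "\<forall>c. \<Lambda> 0 (c ^ p) = 0"
  proof -
    obtain b where b: "y - tau (wcomp y 0) = ver b" by (metis split_tau add_diff_cancel_left')
    obtain z where z: "tau (wcomp y 0 ^ p) = wfrob (tau (wcomp y 0)) + ver (wfrob z)"
      using tau_frob' by blast
    have "wfrob y - tau (wcomp (wfrob y) 0) = wfrob (y - tau (wcomp y 0)) - ver (wfrob z)"
      by (simp add: wcomp_frob wchar_p z wfrob_diff)
    also have "\<dots> = ver (wfrob (b - z))"
      by (simp add: b wfrob_ver ver_diff wfrob_diff)
    finally have "Psi (Suc n) \<Lambda> (wfrob y) = \<Lambda> 0 (wcomp (wfrob y) 0) + Psi n \<Lambda>' (wfrob (b - z))"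
      unfolding \<Lambda>'_def by (rule Psi_eq)
    thus ?thesis using 0 by (simp add: IH(2) wcomp_frob wchar_p)
  qed
  ultimately show ?case by blast
qed simp

context
  fixes \<Lambda> :: "nat \<Rightarrow> ('n, 'k) mpoly \<Rightarrow> ('n, 'k) mpoly"
  assumes add: "additive \<Lambda>" and power: "\<And>i c. i \<ge> 1 \<Longrightarrow> \<Lambda> i (c ^ p) = 0"
begin

lemma Psi_add: "Psi n \<Lambda> (w + w') = Psi n \<Lambda> w + Psi n \<Lambda> w'"
  using Psi_add_aux[OF add power] by blast

lemma Psi_0: "Psi n \<Lambda> 0 = 0"
  using Psi_add[of n 0 0] by simp

lemma Psi_diff: "Psi n \<Lambda> (w - w') = Psi n \<Lambda> w - Psi n \<Lambda> w'"
  using Psi_add[of n "w - w'" w'] by simp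

lemma Psi_sum: "Psi n \<Lambda> (sum g A) = (\<Sum>x\<in>A. Psi n \<Lambda> (g x))"
  by (induction A rule: infinite_finite_induct) (simp_all add: Psi_0 Psi_add)

lemma Psi_p: "Psi n \<Lambda> (of_nat p * w) = 0"
proof -
  have "Psi n \<Lambda> (of_nat k * w) = of_nat k * Psi n \<Lambda> w" for k
    by (induction k) (simp_all add: Psi_0 Psi_add distrib_right)
  thus ?thesis by (simp add: of_nat_p)
qed

lemma Psi_wfrob: "(\<And>c. \<Lambda> 0 (c ^ p) = 0) \<Longrightarrow> Psi n \<Lambda> (wfrob y) = 0"
  using Psi_add_aux[OF add power] by blast

lemma Psi_ver: "Psi (Suc n) \<Lambda> (ver w) = Psi n (\<lambda>i. \<Lambda> (Suc i)) w"
  using additive_0[OF add] by (subst Psi_eq[of _ w]) simp_all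

lemma Psi_tau: "Psi (Suc n) \<Lambda> (tau a) = \<Lambda> 0 a + Psi n (\<lambda>i. \<Lambda> (Suc i)) 0"
  by (subst Psi_eq[of _ 0]) simp_all

end

text \<open>Moving [x] inside V turns it into [x^p], so the exponent grows by one with each
  component peeled off; \<open>k\<close> counts the levels passed.\<close>

lemma Psi_teich:
  assumes "additive \<Lambda>" "\<And>i c. i \<ge> 1 \<Longrightarrow> \<Lambda> i (c ^ p) = 0"
    and "\<And>i c a. \<Lambda> i (c ^ (p ^ (Suc k + i)) * a) = c * \<Lambda> i a"
  shows "Psi n \<Lambda> (teich (c ^ (p ^ Suc k)) * w) = c * Psi n \<Lambda> w"
  using assms
proof (induction n arbitrary: \<Lambda> k w)
  case (Suc n)
  define \<Lambda>' where "\<Lambda>' = (\<lambda>i. \<Lambda> (Suc i))"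
  have add': "additive \<Lambda>'" and pow': "\<And>i c. \<Lambda>' i (c ^ p) = 0"
    using Suc.prems additive_shift[of \<Lambda>] by (auto simp: \<Lambda>'_def)
  have IH: "Psi n \<Lambda>' (teich (c ^ (p ^ Suc (Suc k))) * w) = c * Psi n \<Lambda>' w" for w
    using Suc.IH[of \<Lambda>' "Suc k"] Suc.prems(3)[of "Suc _"] add' pow' by (simp add: \<Lambda>'_def)
  obtain b where b: "w - tau (wcomp w 0) = ver b" by (metis split_tau add_diff_cancel_left')
  define d where "d = c ^ (p ^ k)"
  have d: "c ^ (p ^ Suc k) = d ^ p" by (simp add: d_def mult.commute flip: power_mult)
  have d2: "c ^ (p ^ Suc (Suc k)) = (d ^ p) ^ p"
    unfolding d[symmetric] by (simp add: mult.commute flip: power_mult)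
  obtain z where z: "tau (d ^ p * wcomp w 0) = teich (d ^ p) * tau (wcomp w 0) + ver (wfrob z)"
    using tau_teich_p' by blast
  have "teich (d ^ p) * w - tau (wcomp (teich (d ^ p) * w) 0) = teich (d ^ p) * (w - tau (wcomp w 0)) - ver (wfrob z)"
    by (simp add: z right_diff_distrib)
  also have "\<dots> = ver (teich ((d ^ p) ^ p) * b - wfrob z)"
    unfolding b by (simp only: teich_ver ver_diff)
  finally have "Psi (Suc n) \<Lambda> (teich (d ^ p) * w) = \<Lambda> 0 (d ^ p * wcomp w 0) + Psi n \<Lambda>' (teich ((d ^ p) ^ p) * b - wfrob z)"
    unfolding \<Lambda>'_def by (subst Psi_eq) simp_all
  also have "Psi n \<Lambda>' (teich ((d ^ p) ^ p) * b - wfrob z) = c * Psi n \<Lambda>' b"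
    using IH[of b] unfolding d2 by (simp add: Psi_diff[OF add' pow'] Psi_wfrob[OF add' pow' pow'])
  also have "\<Lambda> 0 (d ^ p * wcomp w 0) = c * \<Lambda> 0 (wcomp w 0)"
    using Suc.prems(3)[of 0 c "wcomp w 0"] by (simp only: d add_0_right)
  finally show ?case using Psi_eq[OF b, of n \<Lambda>] by (simp only: d \<Lambda>'_def distrib_left)
qed simp

lemma trunc_eq_ver:
  assumes "\<And>i. i < n \<Longrightarrow> wcomp w i = wcomp z i"
  shows "\<exists>y. w = z + (ver ^^ n) (y :: ('n, 'k) wittS)"
  using assms
proof (induction n arbitrary: w z)
  case 0
  show ?case by (rule exI[of _ "w - z"]) simp
next
  case (Suc n)
  obtain y where y: "unver w = unver z + (ver ^^ n) y"
    using Suc.IH[of "unver w" "unver z"] Suc.prems by auto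
  have "w = teich (wcomp w 0) + ver (unver w)" by (rule witt_split)
  also have "\<dots> = (teich (wcomp z 0) + ver (unver z)) + ver ((ver ^^ n) y)"
    using Suc.prems[of 0] by (simp add: y ver_add)
  also have "teich (wcomp z 0) + ver (unver z) = z" by (rule witt_split[symmetric])
  finally show ?case by (intro exI[of _ y]) simp
qed

lemma Psi_ver_power:
  assumes "additive \<Lambda>" "\<And>i c. i \<ge> 1 \<Longrightarrow> \<Lambda> i (c ^ p) = 0"
  shows "Psi n \<Lambda> ((ver ^^ n) y) = 0"
  using assms
proof (induction n arbitrary: \<Lambda>)
  case (Suc n)
  have "Psi n (\<lambda>i. \<Lambda> (Suc i)) ((ver ^^ n) y) = 0"
    by (rule Suc.IH) (use Suc.prems additive_shift in auto)
  thus ?case using Psi_ver[OF Suc.prems, of n "(ver ^^ n) y"] by simp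
qed simp

lemma Psi_trunc:
  assumes "additive \<Lambda>" "\<And>i c. i \<ge> 1 \<Longrightarrow> \<Lambda> i (c ^ p) = 0" "\<And>i. i < n \<Longrightarrow> wcomp w i = wcomp z i"
  shows "Psi n \<Lambda> w = Psi n \<Lambda> z"
  using trunc_eq_ver[OF assms(3)] Psi_add[OF assms(1,2)] Psi_ver_power[OF assms(1,2)] by fastforce

text \<open>Up to a multiple of p, which functionals kill, F y is the Teichmueller lift of y_0^p.
  Linearity over Frobenius images is thus a matter of Teichmueller lifts.\<close>

lemma wfrob_split: "wfrob y = teich (wcomp y 0 ^ p) + of_nat p * unver (y :: ('n, 'k) wittS)"
proof -
  have "wfrob y = wfrob (teich (wcomp y 0)) + wfrob (ver (unver y))"
    by (subst (1) witt_split[of y]) (rule wfrob_add)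
  thus ?thesis by (simp add: wfrob_teich wchar_p wfrob_ver ver_wfrob)
qed

end

context hypersurface
begin

text \<open>This makes the functional well defined modulo f. The expansion of [f m] for a monomial m
  matches the relation between consecutive levels, and everything else is V of vectors with
  components divisible by f, covered by induction on \<open>n\<close>.\<close>

lemma Psi_dvd:
  assumes "additive \<Lambda>" "\<And>i c. i \<ge> 1 \<Longrightarrow> \<Lambda> i (c ^ p) = 0"
    and "\<And>i a. f dvd \<Lambda> i (f * a) + \<Lambda> (Suc i) (a ^ p * D)" "\<And>i a. i \<ge> n \<Longrightarrow> \<Lambda> i a = 0"
    and "\<And>i. f dvd wcomp w i"
  shows "f dvd Psi n \<Lambda> w"
  using assms
proof (induction n arbitrary: \<Lambda> w rule: less_induct)
  case (less n)
  show ?case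
  proof (cases n)
    case (Suc m)
    define \<Lambda>' where "\<Lambda>' = (\<lambda>i. \<Lambda> (Suc i))"
    have add': "additive \<Lambda>'" and pow': "\<And>i c. \<Lambda>' i (c ^ p) = 0"
      using less.prems additive_shift[of \<Lambda>] by (auto simp: \<Lambda>'_def)
    note add = less.prems(1) and pow = less.prems(2)
    have IH: "f dvd Psi m \<Lambda>' x" if "\<And>i. f dvd wcomp x i" for x
      by (rule less.IH) (use Suc add' pow' less.prems(3,4) that in \<open>auto simp: \<Lambda>'_def\<close>)
    have ver: "f dvd Psi n \<Lambda> (ver x)" if "\<And>i. f dvd wcomp x i" for x
      using IH[OF that] Psi_ver[OF add pow, of m x] Suc by (simp add: \<Lambda>'_def)
    obtain a where a: "wcomp w 0 = f * a" using less.prems(5)[of 0] by (auto elim: dvdE)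
    have mono: "f dvd Psi n \<Lambda> (teich (single k c * f))" for k c
    proof -
      obtain z where z: "teich (single k c * f) = tau (single k c * f) +
        ver (tau (single k c ^ p * D) + ver (teich (single k c ^ p ^ 2 * f ^ (p * (p - 1))) * Delta f) + wfrob z)"
        using teich_single_mult_expansion by blast
      define x where "x = teich (single k c ^ p ^ 2 * f ^ (p * (p - 1))) * Delta f"
      have "f dvd wcomp x i" for i
      proof -
        have "p * (p - 1) > 0" using p_ge_2 by simp
        hence "f dvd f ^ (p * (p - 1))" by (intro dvd_power) auto
        hence "f dvd single k c ^ p ^ 2 * f ^ (p * (p - 1))" by (rule dvd_mult)
        hence "f dvd (single k c ^ p ^ 2 * f ^ (p * (p - 1))) ^ p ^ i"
          using q_pos[of i] by (meson dvd_power dvd_trans)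
        thus ?thesis unfolding x_def wcomp_teich_mult wchar_p by (rule dvd_mult2)
      qed
      note x = this
      have "Psi n \<Lambda> (teich (single k c * f)) = \<Lambda> 0 (single k c * f) +
          Psi m \<Lambda>' (tau (single k c ^ p * D) + ver x + wfrob z)"
        unfolding Suc \<Lambda>'_def by (rule Psi_eq[THEN trans]) (simp_all add: z x_def)
      also have "\<dots> = \<Lambda> 0 (f * single k c) + Psi m \<Lambda>' (tau (single k c ^ p * D)) + Psi m \<Lambda>' (ver x)"
        by (simp add: Psi_add[OF add' pow'] Psi_wfrob[OF add' pow' pow'] mult.commute add.assoc)
      also have "Psi m \<Lambda>' (tau (single k c ^ p * D)) = \<Lambda> (Suc 0) (single k c ^ p * D)"
      proof (cases m)
        case 0
        thus ?thesis using less.prems(4)[of "Suc 0"] Suc by simp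
      next
        case (Suc l)
        have "Psi l (\<lambda>i. \<Lambda>' (Suc i)) 0 = 0" by (rule Psi_0) (use additive_shift[OF add'] pow' in auto)
        thus ?thesis using Psi_tau[OF add' pow', of l] Suc by (simp add: \<Lambda>'_def)
      qed
      also have "f dvd \<Lambda> 0 (f * single k c) + \<Lambda> (Suc 0) (single k c ^ p * D) + Psi m \<Lambda>' (ver x)"
      proof (rule dvd_add[OF less.prems(3)])
        show "f dvd Psi m \<Lambda>' (ver x)"
          using x dvd_0_right by (intro IH) (auto simp: wcomp_ver)
      qed
      finally show ?thesis .
    qed
    \<comment> \<open>Writing [a] as tau(a) + V Delta(a) leaves only products of f with monomials at
      level 0; the correction V([f^p] Delta(a)) again has components divisible by f.\<close>
    have "w = teich f * teich a + ver (unver w)"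
      using witt_split[of w] by (simp add: a teich_teich)
    also have "teich f * teich a = (\<Sum>k\<in>keys a. teich (single k (lookup a k) * f)) + ver (teich (f ^ p) * Delta a)"
      unfolding teich_tau[of a] distrib_left teich_ver
      by (simp add: tau_def sum_distrib_left mult.commute flip: teich_teich)
    finally have "Psi n \<Lambda> w = (\<Sum>k\<in>keys a. Psi n \<Lambda> (teich (single k (lookup a k) * f)))
        + Psi n \<Lambda> (ver (teich (f ^ p) * Delta a)) + Psi n \<Lambda> (ver (unver w))"
      by (metis Psi_add[OF add pow] Psi_sum[OF add pow])
    also have "f dvd \<dots>"
    proof (intro dvd_add dvd_sum mono ver)
      fix i
      have "f dvd f ^ p" using p_gt_0 by (intro dvd_power) auto
      hence "f dvd (f ^ p) ^ p ^ i" using q_pos[of i] by (meson dvd_power dvd_trans)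
      thus "f dvd wcomp (teich (f ^ p) * Delta a) i"
        unfolding wcomp_teich_mult wchar_p by (rule dvd_mult2)
      show "f dvd wcomp (unver w) i" using less.prems(5) by simp
    qed
    finally show ?thesis .
  qed simp
qed

theorem psi_exists:
  assumes "n \<ge> 1" "\<not> I_seq p f n \<subseteq> frob_power p max_ideal"
  shows "\<exists>\<Psi> :: ('n, 'k) wittS \<Rightarrow> ('n, 'k) mpoly.
    (\<forall>w z. \<Psi> (w + z) = \<Psi> w + \<Psi> z) \<and>
    (\<forall>y w. \<Psi> (wfrob y * w) = wcomp y 0 * \<Psi> w) \<and>
    (\<forall>w z. (\<forall>i<n. f dvd wcomp w i - wcomp z i) \<longrightarrow> f dvd \<Psi> w - \<Psi> z) \<and>
    (\<forall>w z. (\<forall>i<n. wcomp w i = wcomp z i) \<longrightarrow> \<Psi> w = \<Psi> z) \<and>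
    lookup (\<Psi> 1) 0 \<noteq> 0"
proof -
  obtain g where g: "chain n g" "lookup (U 1 (g n)) 0 \<noteq> 0"
    using I_seq_not_subset[OF assms] by blast
  define \<Psi> where "\<Psi> = Psi n (lam n g)"
  have add: "additive (lam n g)" by (simp add: additive_def lam_add)
  have pow: "\<And>i c. i \<ge> 1 \<Longrightarrow> lam n g i (c ^ p) = 0" by (rule lam_power_p[OF g(1)])
  have mult: "lam n g i (c ^ p ^ (Suc 0 + i) * a) = c * lam n g i a" for i c a
    using lam_mult by simp
  have 1: "\<Psi> (w + z) = \<Psi> w + \<Psi> z" for w z
    unfolding \<Psi>_def by (rule Psi_add[OF add pow])
  have 2: "\<Psi> (wfrob y * w) = wcomp y 0 * \<Psi> w" for y w
  proof -
    have "\<Psi> (wfrob y * w) = \<Psi> (teich (wcomp y 0 ^ p ^ Suc 0) * w) + \<Psi> (of_nat p * (unver y * w))"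
      by (simp add: wfrob_split distrib_right 1 mult.assoc)
    moreover have "\<Psi> (of_nat p * (unver y * w)) = 0" unfolding \<Psi>_def by (rule Psi_p[OF add pow])
    moreover have "\<Psi> (teich (wcomp y 0 ^ p ^ Suc 0) * w) = wcomp y 0 * \<Psi> w"
      unfolding \<Psi>_def by (rule Psi_teich[OF add pow mult])
    ultimately show ?thesis by simp
  qed
  have 3: "\<Psi> w = \<Psi> z" if "\<forall>i<n. wcomp w i = wcomp z i" for w z
    unfolding \<Psi>_def by (rule Psi_trunc[OF add pow]) (use that in auto)
  have 4: "f dvd \<Psi> w - \<Psi> z" if "\<forall>i<n. f dvd wcomp w i - wcomp z i" for w z
  proof -
    \<comment> \<open>The hypothesis concerns the components below n only. Copying the others from
      \<open>z\<close> makes every component of w' - z divisible by f.\<close>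
    define w' where "w' = (mkW (\<lambda>i. if i < n then wcomp w i else wcomp z i) :: ('n, 'k) wittS)"
    have "\<Psi> w = \<Psi> w'" by (rule 3) (simp add: w'_def)
    moreover have "f dvd wcomp (w' - z) i" for i
      by (rule wcomp_dvd_diff) (use that in \<open>simp add: w'_def\<close>)
    hence "f dvd Psi n (lam n g) (w' - z)"
      by (intro Psi_dvd add pow lam_relation[OF g(1)]) (simp_all add: lam_def)
    hence "f dvd Psi n (lam n g) w' - Psi n (lam n g) z"
      using Psi_diff[OF add pow, of n w' z] by metis
    ultimately show ?thesis unfolding \<Psi>_def by simp
  qed
  have "\<Psi> 1 = U 1 (g n)"
  proof -
    obtain m where m: "n = Suc m" using assms(1) by (cases n) auto
    have "Psi m (\<lambda>i. lam n g (Suc i)) 0 = 0"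
      by (rule Psi_0) (use additive_shift[OF add] pow in auto)
    hence "\<Psi> 1 = lam n g 0 1"
      using Psi_tau[OF add pow, of m 1] by (simp add: \<Psi>_def m)
    thus ?thesis using assms(1) by (simp add: lam_def)
  qed
  thus ?thesis using 1 2 3 4 g(2) by (intro exI[of _ \<Psi>]) auto
qed

end

section \<open>Witt polynomials in rings with explicit carrier\<close>

lemma nat_pow_ring_of_type [simp]: "x [^]\<^bsub>ring_of_type_algebra\<^esub> (n::nat) = (x::'a::comm_ring_1) ^ n"
proof -
  interpret cring "ring_of_type_algebra :: 'a ring" by (rule cring_from_type_algebra)
  show ?thesis by (induction n) (simp_all add: mult.commute)
qed

lemma finprod_ring_of_type:
  "finite A \<Longrightarrow> finprod ring_of_type_algebra g A = (\<Prod>i\<in>A. (g i :: 'a::comm_ring_1))"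
proof -
  interpret cring "ring_of_type_algebra :: 'a ring" by (rule cring_from_type_algebra)
  assume "finite A"
  thus ?thesis by (induction A rule: finite_induct) simp_all
qed

lemma finsum_ring_of_type:
  "finite A \<Longrightarrow> finsum ring_of_type_algebra g A = (\<Sum>i\<in>A. (g i :: 'a::comm_ring_1))"
proof -
  interpret cring "ring_of_type_algebra :: 'a ring" by (rule cring_from_type_algebra)
  assume "finite A"
  thus ?thesis by (induction A rule: finite_induct) simp_all
qed

lemma a_inv_ring_of_type [simp]: "\<ominus>\<^bsub>ring_of_type_algebra\<^esub> x = - (x::'a::comm_ring_1)"
proof -
  interpret cring "ring_of_type_algebra :: 'a ring" by (rule cring_from_type_algebra)
  show ?thesis using minus_equality[of "- x" x] by simp
qed

lemma add_pow_ring_of_type: "[(k::int)] \<cdot>\<^bsub>ring_of_type_algebra\<^esub> x = of_int k * (x::'a::comm_ring_1)"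
proof -
  interpret cring "ring_of_type_algebra :: 'a ring" by (rule cring_from_type_algebra)
  have n: "[(n::nat)] \<cdot>\<^bsub>ring_of_type_algebra\<^esub> x = of_nat n * x" for n
    by (induction n) (simp_all add: add.nat_pow_Suc algebra_simps)
  show ?thesis
  proof (cases k)
    case (nonneg n)
    thus ?thesis by (simp add: add_pow_int_ge n)
  next
    case (neg n)
    have "[k] \<cdot>\<^bsub>ring_of_type_algebra\<^esub> x = - ([nat (- k)] \<cdot>\<^bsub>ring_of_type_algebra\<^esub> x)"
      using neg by (subst add_pow_int_lt) simp_all
    also have "nat (- k) = Suc n" using neg by simp
    also have "- ([Suc n] \<cdot>\<^bsub>ring_of_type_algebra\<^esub> x) = - (of_nat (Suc n) * x)" unfolding n ..
    also have "\<dots> = of_int k * x" by (simp only: neg of_int_minus of_int_of_nat_eq mult_minus_left)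
    finally show ?thesis .
  qed
qed

lemma witt_poly_eval_ring_of_type: "witt_poly_eval ring_of_type_algebra v P = peval v P"
  by (simp add: witt_poly_eval_def peval_def pm_hom_def mpow_def finsum_ring_of_type
      finprod_ring_of_type add_pow_ring_of_type)

context ring_hom_cring
begin

lemma hom_nat_pow_cring: "x \<in> carrier R \<Longrightarrow> h (x [^] (n::nat)) = h x [^]\<^bsub>S\<^esub> n"
  by (induction n) simp_all

lemma hom_add_pow: "x \<in> carrier R \<Longrightarrow> h ([(k::int)] \<cdot>\<^bsub>R\<^esub> x) = [k] \<cdot>\<^bsub>S\<^esub> h x"
proof -
  assume x: "x \<in> carrier R"
  have n: "h ([(n::nat)] \<cdot>\<^bsub>R\<^esub> x) = [n] \<cdot>\<^bsub>S\<^esub> h x" for n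
    using x by (induction n) (simp_all add: R.add.nat_pow_Suc S.add.nat_pow_Suc)
  show ?thesis
  proof (cases "k \<ge> 0")
    case True
    thus ?thesis by (simp add: add_pow_int_ge n)
  next
    case False
    thus ?thesis using x by (simp add: add_pow_int_lt n)
  qed
qed

lemma hom_witt_poly_eval:
  assumes "\<And>i. v i \<in> carrier R"
  shows "h (witt_poly_eval R v P) = witt_poly_eval S (\<lambda>i. h (v i)) P"
proof -
  have "h ([(c::int)] \<cdot>\<^bsub>R\<^esub> (\<Otimes>\<^bsub>R\<^esub>i\<in>keys m. v i [^] lookup m i))
      = [c] \<cdot>\<^bsub>S\<^esub> (\<Otimes>\<^bsub>S\<^esub>i\<in>keys m. h (v i) [^]\<^bsub>S\<^esub> lookup m i)" for c and m :: "nat + nat \<Rightarrow>\<^sub>0 nat"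
  proof -
    have "h (\<Otimes>\<^bsub>R\<^esub>i\<in>keys m. v i [^] lookup m i) = (\<Otimes>\<^bsub>S\<^esub>i\<in>keys m. h (v i) [^]\<^bsub>S\<^esub> lookup m i)"
      using assms R.nat_pow_closed[OF assms] S.nat_pow_closed[OF hom_closed[OF assms]]
      by (subst hom_finprod) (auto simp: o_def hom_nat_pow_cring[OF assms] intro!: S.finprod_cong')
    thus ?thesis using R.nat_pow_closed[OF assms] by (subst hom_add_pow) (auto intro!: R.finprod_closed)
  qed
  thus ?thesis using assms unfolding witt_poly_eval_def
    by (subst hom_finsum) (auto simp: o_def intro!: S.finsum_cong' S.add.int_pow_closed R.add.int_pow_closed
        R.finprod_closed S.finprod_closed)
qed

end

lemma (in cring) witt_poly_eval_closed:
  "(\<And>i. v i \<in> carrier R) \<Longrightarrow> witt_poly_eval R v P \<in> carrier R"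
  unfolding witt_poly_eval_def by (auto intro!: finsum_closed add.int_pow_closed finprod_closed)

text \<open>The mechanism for clearing denominators in Witt sums and products: each variable is
  scaled by the power of \<open>c\<close> given by its weight.\<close>

lemma (in cring) witt_poly_eval_scale:
  fixes wt :: "nat + nat \<Rightarrow> nat"
  assumes "whom wt q P" "\<And>i. v i \<in> carrier R" "c \<in> carrier R"
  shows "witt_poly_eval R (\<lambda>i. c [^] wt i \<otimes> v i) P = c [^] q \<otimes> witt_poly_eval R v P"
proof -
  have mono: "(\<Otimes>i\<in>keys m. (c [^] wt i \<otimes> v i) [^] lookup m i) = c [^] wdeg wt m \<otimes> (\<Otimes>i\<in>keys m. v i [^] lookup m i)" for m
  proof -
    have "(\<Otimes>i\<in>A. (c [^] wt i \<otimes> v i) [^] lookup m i) = c [^] (\<Sum>i\<in>A. lookup m i * wt i) \<otimes> (\<Otimes>i\<in>A. v i [^] lookup m i)"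
      if "finite A" for A
      using that
    proof (induction A rule: finite_induct)
      case (insert x A)
      have "(c [^] wt x \<otimes> v x) [^] lookup m x = c [^] (lookup m x * wt x) \<otimes> v x [^] lookup m x"
        using assms by (simp add: nat_pow_distrib nat_pow_pow mult.commute)
      thus ?case using insert assms
        by (simp add: finprod_insert m_ac nat_pow_mult[symmetric] Pi_def)
    qed (use assms in simp)
    thus ?thesis by (simp add: wdeg_def)
  qed
  have "witt_poly_eval R (\<lambda>i. c [^] wt i \<otimes> v i) P = (\<Oplus>m\<in>keys P. c [^] q \<otimes> ([lookup P m] \<cdot> (\<Otimes>i\<in>keys m. v i [^] lookup m i)))"
    unfolding witt_poly_eval_def mono
    using assms by (intro finsum_cong') (auto simp: whom_def add_pow_rdistr_int intro!: m_closed finprod_closed add.int_pow_closed)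
  also have "\<dots> = c [^] q \<otimes> witt_poly_eval R v P"
    unfolding witt_poly_eval_def using assms
    by (intro finsum_rdistr[symmetric]) (auto intro!: finprod_closed add.int_pow_closed)
  finally show ?thesis .
qed

section \<open>Localization\<close>

text \<open>The operations of \<open>localization\<close> are unions over all representatives. Such
  a union is a single class once every choice gives the same class and some choice exists.\<close>

lemma UN_const2:
  assumes "x \<in> A" "y \<in> B" "\<And>a s b t. (a, s) \<in> A \<Longrightarrow> (b, t) \<in> B \<Longrightarrow> F a s b t = C"
  shows "(\<Union>(a, s)\<in>A. \<Union>(b, t)\<in>B. F a s b t) = C"
proof -
  have 1: "(case y of (b, t) \<Rightarrow> F a s b t) = C" if "(a, s) \<in> A" "y \<in> B" for a s y
    using assms(3)[OF that(1)] that(2) by (cases y) simp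
  have 2: "(\<Union>y\<in>B. case y of (b, t) \<Rightarrow> F a s b t) = C" if "(a, s) \<in> A" for a s
  proof -
    have "(\<Union>y\<in>B. case y of (b, t) \<Rightarrow> F a s b t) = (\<Union>y\<in>B. C)" by (rule SUP_cong[OF refl 1[OF that]])
    thus ?thesis using assms(2) by auto
  qed
  have "(case z of (a, s) \<Rightarrow> \<Union>y\<in>B. case y of (b, t) \<Rightarrow> F a s b t) = C" if "z \<in> A" for z
    using 2 that by (cases z) simp
  hence "(\<Union>z\<in>A. case z of (a, s) \<Rightarrow> \<Union>y\<in>B. case y of (b, t) \<Rightarrow> F a s b t) = (\<Union>z\<in>A. C)"
    by (rule SUP_cong[OF refl])
  thus ?thesis using assms(1) by auto
qed

locale mult_subset = cring R for R (structure) +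
  fixes T
  assumes T_sub: "T \<subseteq> carrier R" and T_one: "\<one> \<in> T" and T_mult: "s \<in> T \<Longrightarrow> t \<in> T \<Longrightarrow> s \<otimes> t \<in> T"
begin

abbreviation fr where "fr \<equiv> loc_frac R T"
abbreviation loc where "loc \<equiv> localization R T"

lemma T_carrier [simp]: "t \<in> T \<Longrightarrow> t \<in> carrier R" using T_sub by blast

lemma mem_fr: "a \<in> carrier R \<Longrightarrow> s \<in> T \<Longrightarrow> (a, s) \<in> fr a s"
  using T_one by (auto simp: loc_frac_def)

lemma fr_subset:
  assumes "a \<in> carrier R" "b \<in> carrier R" "s \<in> T" "t \<in> T" "r \<in> T" "r \<otimes> (a \<otimes> t) = r \<otimes> (b \<otimes> s)"
  shows "fr a s \<subseteq> fr b t"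
proof clarify
  fix c u assume "(c, u) \<in> fr a s"
  then obtain r' where c: "c \<in> carrier R" "u \<in> T" "r' \<in> T" "r' \<otimes> (a \<otimes> u) = r' \<otimes> (c \<otimes> s)"
    by (auto simp: loc_frac_def)
  have "(r \<otimes> r' \<otimes> s) \<otimes> (b \<otimes> u) = (r' \<otimes> u) \<otimes> (r \<otimes> (b \<otimes> s))" using assms(1-5) c(1-3) by (simp add: m_ac)
  also have "\<dots> = (r' \<otimes> u) \<otimes> (r \<otimes> (a \<otimes> t))" by (simp only: assms(6))
  also have "\<dots> = (r \<otimes> t) \<otimes> (r' \<otimes> (a \<otimes> u))" using assms(1-5) c(1-3) by (simp add: m_ac)
  also have "\<dots> = (r \<otimes> t) \<otimes> (r' \<otimes> (c \<otimes> s))" by (simp only: c(4))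
  also have "\<dots> = (r \<otimes> r' \<otimes> s) \<otimes> (c \<otimes> t)" using assms(1-5) c(1-3) by (simp add: m_ac)
  finally show "(c, u) \<in> fr b t" using assms c T_mult by (auto simp: loc_frac_def intro!: bexI[of _ "r \<otimes> r' \<otimes> s"])
qed

lemma fr_eqI:
  assumes "a \<in> carrier R" "b \<in> carrier R" "s \<in> T" "t \<in> T" "r \<in> T" "r \<otimes> (a \<otimes> t) = r \<otimes> (b \<otimes> s)"
  shows "fr a s = fr b t"
  using fr_subset[OF assms] fr_subset[of b a t s r] assms by auto

lemma fr_eq_iff:
  assumes "a \<in> carrier R" "b \<in> carrier R" "s \<in> T" "t \<in> T"
  shows "fr a s = fr b t \<longleftrightarrow> (\<exists>r\<in>T. r \<otimes> (a \<otimes> t) = r \<otimes> (b \<otimes> s))"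
proof
  assume "fr a s = fr b t"
  hence "(b, t) \<in> fr a s" using mem_fr[of b t] assms by simp
  thus "\<exists>r\<in>T. r \<otimes> (a \<otimes> t) = r \<otimes> (b \<otimes> s)" by (auto simp: loc_frac_def)
qed (use fr_eqI assms in blast)

lemma fr_simple: "a \<in> carrier R \<Longrightarrow> b \<in> carrier R \<Longrightarrow> s \<in> T \<Longrightarrow> t \<in> T \<Longrightarrow> a \<otimes> t = b \<otimes> s \<Longrightarrow> fr a s = fr b t"
  using fr_eqI[of a b s t \<one>] T_one by simp

lemma mem_frD:
  assumes "(b, t) \<in> fr a s" "a \<in> carrier R" "s \<in> T"
  shows "b \<in> carrier R" "t \<in> T" "fr b t = fr a s"
proof -
  show b: "b \<in> carrier R" "t \<in> T" using assms by (auto simp: loc_frac_def)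
  show "fr b t = fr a s" using assms b by (subst eq_commute, subst fr_eq_iff) (auto simp: loc_frac_def)
qed

lemma loc_mult:
  assumes "a \<in> carrier R" "b \<in> carrier R" "s \<in> T" "t \<in> T"
  shows "fr a s \<otimes>\<^bsub>loc\<^esub> fr b t = fr (a \<otimes> b) (s \<otimes> t)"
proof -
  have "fr (a' \<otimes> b') (s' \<otimes> t') = fr (a \<otimes> b) (s \<otimes> t)"
    if "(a', s') \<in> fr a s" "(b', t') \<in> fr b t" for a' s' b' t'
  proof -
    note a = mem_frD[OF that(1) assms(1,3)] and b = mem_frD[OF that(2) assms(2,4)]
    obtain r where r: "r \<in> T" "r \<otimes> (a' \<otimes> s) = r \<otimes> (a \<otimes> s')" using a assms fr_eq_iff by blast
    obtain q where q: "q \<in> T" "q \<otimes> (b' \<otimes> t) = q \<otimes> (b \<otimes> t')" using b assms fr_eq_iff by blast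
    have "(r \<otimes> q) \<otimes> ((a' \<otimes> b') \<otimes> (s \<otimes> t)) = (r \<otimes> (a' \<otimes> s)) \<otimes> (q \<otimes> (b' \<otimes> t))"
      using a b r(1) q(1) assms by (simp add: m_ac)
    also have "\<dots> = (r \<otimes> q) \<otimes> ((a \<otimes> b) \<otimes> (s' \<otimes> t'))"
      unfolding r(2) q(2) using a b r(1) q(1) assms by (simp add: m_ac)
    finally show ?thesis using a b r(1) q(1) assms T_mult by (intro fr_eqI[of _ _ _ _ "r \<otimes> q"]) auto
  qed
  from UN_const2[OF mem_fr[OF assms(1,3)] mem_fr[OF assms(2,4)] this]
  show ?thesis by (simp add: localization_def)
qed

lemma loc_add:
  assumes "a \<in> carrier R" "b \<in> carrier R" "s \<in> T" "t \<in> T"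
  shows "fr a s \<oplus>\<^bsub>loc\<^esub> fr b t = fr (a \<otimes> t \<oplus> b \<otimes> s) (s \<otimes> t)"
proof -
  have "fr (a' \<otimes> t' \<oplus> b' \<otimes> s') (s' \<otimes> t') = fr (a \<otimes> t \<oplus> b \<otimes> s) (s \<otimes> t)"
    if "(a', s') \<in> fr a s" "(b', t') \<in> fr b t" for a' s' b' t'
  proof -
    note a = mem_frD[OF that(1) assms(1,3)] and b = mem_frD[OF that(2) assms(2,4)]
    obtain r where r: "r \<in> T" "r \<otimes> (a' \<otimes> s) = r \<otimes> (a \<otimes> s')" using a assms fr_eq_iff by blast
    obtain q where q: "q \<in> T" "q \<otimes> (b' \<otimes> t) = q \<otimes> (b \<otimes> t')" using b assms fr_eq_iff by blast
    have "(r \<otimes> q) \<otimes> ((a' \<otimes> t' \<oplus> b' \<otimes> s') \<otimes> (s \<otimes> t))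
        = (q \<otimes> t \<otimes> t') \<otimes> (r \<otimes> (a' \<otimes> s)) \<oplus> (r \<otimes> s \<otimes> s') \<otimes> (q \<otimes> (b' \<otimes> t))"
      using a b r(1) q(1) assms by (simp add: m_ac r_distr l_distr)
    also have "\<dots> = (r \<otimes> q) \<otimes> ((a \<otimes> t \<oplus> b \<otimes> s) \<otimes> (s' \<otimes> t'))"
      unfolding r(2) q(2) using a b r(1) q(1) assms by (simp add: m_ac r_distr l_distr)
    finally show ?thesis using a b r(1) q(1) assms T_mult by (intro fr_eqI[of _ _ _ _ "r \<otimes> q"]) auto
  qed
  from UN_const2[OF mem_fr[OF assms(1,3)] mem_fr[OF assms(2,4)] this]
  show ?thesis by (simp add: localization_def)
qed

lemma loc_carrier: "carrier loc = {fr a s | a s. a \<in> carrier R \<and> s \<in> T}"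
  and loc_one: "\<one>\<^bsub>loc\<^esub> = fr \<one> \<one>" and loc_zero: "\<zero>\<^bsub>loc\<^esub> = fr \<zero> \<one>"
  by (simp_all add: localization_def)

lemma fr_closed: "a \<in> carrier R \<Longrightarrow> s \<in> T \<Longrightarrow> fr a s \<in> carrier loc"
  unfolding loc_carrier by blast

lemma locE:
  assumes "x \<in> carrier loc"
  obtains a s where "x = fr a s" "a \<in> carrier R" "s \<in> T"
  using assms unfolding loc_carrier by blast

lemma loc_cring: "cring loc"
proof (rule cringI)
  show "abelian_group loc"
  proof (rule abelian_groupI)
    fix x assume "x \<in> carrier loc"
    then obtain a s where a: "x = fr a s" "a \<in> carrier R" "s \<in> T" by (rule locE)
    have "fr (\<ominus> a) s \<oplus>\<^bsub>loc\<^esub> x = \<zero>\<^bsub>loc\<^esub>"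
    proof -
      have "fr (\<ominus> a) s \<oplus>\<^bsub>loc\<^esub> x = fr \<zero> (s \<otimes> s)"
        unfolding a(1) using a by (subst loc_add) (simp_all add: l_minus l_neg)
      also have "\<dots> = fr \<zero> \<one>" using a T_one T_mult by (intro fr_simple) simp_all
      finally show ?thesis by (simp add: loc_zero)
    qed
    moreover have "fr (\<ominus> a) s \<in> carrier loc" using a by (intro fr_closed) simp_all
    ultimately show "\<exists>y\<in>carrier loc. y \<oplus>\<^bsub>loc\<^esub> x = \<zero>\<^bsub>loc\<^esub>" by (rule bexI)
  next
    fix x y z assume "x \<in> carrier loc" "y \<in> carrier loc" "z \<in> carrier loc"
    then show "x \<oplus>\<^bsub>loc\<^esub> y \<oplus>\<^bsub>loc\<^esub> z = x \<oplus>\<^bsub>loc\<^esub> (y \<oplus>\<^bsub>loc\<^esub> z)"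
      using T_mult by (elim locE) (simp add: loc_add m_ac a_ac l_distr r_distr)
  next
    fix x y assume "x \<in> carrier loc" "y \<in> carrier loc"
    then show "x \<oplus>\<^bsub>loc\<^esub> y = y \<oplus>\<^bsub>loc\<^esub> x"
      using T_mult by (elim locE) (simp add: loc_add m_ac a_ac)
  next
    fix x y assume "x \<in> carrier loc" "y \<in> carrier loc"
    then show "x \<oplus>\<^bsub>loc\<^esub> y \<in> carrier loc"
      using T_mult by (elim locE) (simp add: loc_add fr_closed)
  next
    show "\<zero>\<^bsub>loc\<^esub> \<in> carrier loc" using T_one by (simp add: loc_zero fr_closed)
  next
    fix x assume "x \<in> carrier loc"
    then show "\<zero>\<^bsub>loc\<^esub> \<oplus>\<^bsub>loc\<^esub> x = x"
      using T_one by (elim locE) (simp add: loc_add loc_zero)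
  qed
  show "comm_monoid loc"
    by (rule comm_monoidI; (elim locE)?) (use T_one T_mult in \<open>simp_all add: fr_closed loc_mult loc_one m_ac\<close>)
  show "(x \<oplus>\<^bsub>loc\<^esub> y) \<otimes>\<^bsub>loc\<^esub> z = x \<otimes>\<^bsub>loc\<^esub> z \<oplus>\<^bsub>loc\<^esub> y \<otimes>\<^bsub>loc\<^esub> z"
    if xyz: "x \<in> carrier loc" "y \<in> carrier loc" "z \<in> carrier loc" for x y z
  proof -
    obtain a s b t c u where e: "x = fr a s" "y = fr b t" "z = fr c u"
      and c: "a \<in> carrier R" "b \<in> carrier R" "c \<in> carrier R" "s \<in> T" "t \<in> T" "u \<in> T"
      using xyz by (metis locE)
    have "(x \<oplus>\<^bsub>loc\<^esub> y) \<otimes>\<^bsub>loc\<^esub> z = fr ((a \<otimes> t \<oplus> b \<otimes> s) \<otimes> c) (s \<otimes> t \<otimes> u)"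
      using c T_mult by (simp add: e loc_add loc_mult)
    also have "\<dots> = fr (a \<otimes> c \<otimes> (t \<otimes> u) \<oplus> b \<otimes> c \<otimes> (s \<otimes> u)) (s \<otimes> u \<otimes> (t \<otimes> u))"
      by (rule fr_simple) (use c T_mult in \<open>simp_all add: m_ac l_distr r_distr\<close>)
    also have "\<dots> = x \<otimes>\<^bsub>loc\<^esub> z \<oplus>\<^bsub>loc\<^esub> y \<otimes>\<^bsub>loc\<^esub> z"
      using c T_mult by (simp add: e loc_add loc_mult)
    finally show ?thesis .
  qed
qed

definition inc where "inc a = fr a \<one>"

lemma inc_hom: "ring_hom_cring R loc inc"
proof -
  interpret L: cring loc by (rule loc_cring)
  show ?thesis
    by (rule ring_hom_cringI[OF is_cring loc_cring], rule ring_hom_memI)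
      (use T_one in \<open>simp_all add: inc_def fr_closed loc_mult loc_add loc_one\<close>)
qed

lemma inc_Units: "s \<in> T \<Longrightarrow> inc s \<in> Units loc"
proof -
  assume s: "s \<in> T"
  interpret L: cring loc by (rule loc_cring)
  have "fr \<one> s \<otimes>\<^bsub>loc\<^esub> inc s = \<one>\<^bsub>loc\<^esub>"
    unfolding inc_def loc_one using s T_one T_mult by (subst loc_mult) (simp_all add: fr_simple)
  moreover have c: "fr \<one> s \<in> carrier loc" "inc s \<in> carrier loc"
    unfolding inc_def using s T_one by (simp_all add: fr_closed)
  ultimately show ?thesis unfolding Units_def using L.m_comm[OF c] by auto
qed

lemma fr_inc: "a \<in> carrier R \<Longrightarrow> s \<in> T \<Longrightarrow> fr a s \<otimes>\<^bsub>loc\<^esub> inc s = inc a"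
proof -
  assume a: "a \<in> carrier R" "s \<in> T"
  have "fr a s \<otimes>\<^bsub>loc\<^esub> inc s = fr (a \<otimes> s) (s \<otimes> \<one>)"
    unfolding inc_def using a T_one by (intro loc_mult) simp_all
  also have "\<dots> = inc a"
    unfolding inc_def by (rule fr_simple) (use a T_one T_mult in simp_all)
  finally show ?thesis .
qed

lemma inc_zero_iff: "a \<in> carrier R \<Longrightarrow> inc a = \<zero>\<^bsub>loc\<^esub> \<longleftrightarrow> (\<exists>r\<in>T. r \<otimes> a = \<zero>)"
  unfolding inc_def loc_zero using T_one by (subst fr_eq_iff) auto

end

section \<open>Spaces of fractions\<close>

lemma (in cring) witt_poly_eval_cong:
  assumes "\<And>m i. m \<in> keys P \<Longrightarrow> i \<in> keys m \<Longrightarrow> v i = w i \<and> w i \<in> carrier R"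
  shows "witt_poly_eval R v P = witt_poly_eval R w P"
proof -
  have "(\<Otimes>i\<in>keys m. v i [^] lookup m i) = (\<Otimes>i\<in>keys m. w i [^] lookup m i)" if "m \<in> keys P" for m
    using assms[OF that] by (intro finprod_cong') auto
  moreover have "(\<Otimes>i\<in>keys m. w i [^] lookup m i) \<in> carrier R" if "m \<in> keys P" for m
    using assms[OF that] by (intro finprod_closed) auto
  ultimately show ?thesis unfolding witt_poly_eval_def
    by (intro finsum_cong') auto
qed

lemma wdeg_ge: "i \<in> keys m \<Longrightarrow> wt i \<le> wdeg wt m"
proof -
  assume i: "i \<in> keys m"
  hence "1 * wt i \<le> lookup m i * wt i" by (intro mult_right_mono) (auto simp: in_keys_iff)
  also have "\<dots> \<le> wdeg wt m" unfolding wdeg_def using i by (intro member_le_sum) auto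
  finally show ?thesis by simp
qed

text \<open>With weight p^j on the j-th variables the i-th polynomial has degree p^i, so an index j
  that occurs satisfies p^j \<le> p^i.\<close>

lemma witt_add_poly_vars:
  assumes "nprime p" "m \<in> keys (witt_add_poly p i)" "v \<in> keys m"
  shows "case_sum id id v \<le> i"
proof -
  have p1: "p > 1" using assms(1) prime_gt_1_nat by blast
  have "(case v of Inl j \<Rightarrow> 1 * p ^ j | Inr j \<Rightarrow> 1 * p ^ j) \<le> 1 * p ^ i"
    using wdeg_ge[OF assms(3)] whom_witt_add_poly[OF assms(1), of 1 i] assms(2) unfolding whom_def by metis
  thus ?thesis using p1 by (auto split: sum.splits)
qed

lemma witt_mult_poly_vars:
  assumes "nprime p" "m \<in> keys (witt_mult_poly p i)" "v \<in> keys m"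
  shows "case_sum id id v \<le> i"
proof -
  have p1: "p > 1" using assms(1) prime_gt_1_nat by blast
  have "(case v of Inl j \<Rightarrow> 1 * p ^ j | Inr j \<Rightarrow> 0 * p ^ j) \<le> (1 + 0) * p ^ i"
    "(case v of Inl j \<Rightarrow> 0 * p ^ j | Inr j \<Rightarrow> 1 * p ^ j) \<le> (0 + 1) * p ^ i"
    using wdeg_ge[OF assms(3)] whom_witt_mult_poly[OF assms(1), of 1 0 i] whom_witt_mult_poly[OF assms(1), of 0 1 i]
      assms(2) unfolding whom_def by metis+
  thus ?thesis using p1 by (auto split: sum.splits)
qed

locale homogeneity =
  fixes hmg :: "nat \<Rightarrow> ('n::finite, 'k::field) mpoly \<Rightarrow> bool"
  assumes hmg_0: "hmg d 0" and hmg_add: "hmg d a \<Longrightarrow> hmg d b \<Longrightarrow> hmg d (a + b)"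
    and hmg_uminus: "hmg d a \<Longrightarrow> hmg d (- a)"
    and hmg_1: "hmg 0 1" and hmg_mult: "hmg d a \<Longrightarrow> hmg e b \<Longrightarrow> hmg (d + e) (a * b)"
begin

lemma hmg_power: "hmg d a \<Longrightarrow> hmg (n * d) (a ^ n)"
  by (induction n) (auto intro: hmg_mult hmg_1)

lemma hmg_sum: "(\<And>x. x \<in> A \<Longrightarrow> hmg d (g x)) \<Longrightarrow> hmg d (sum g A)"
  by (induction A rule: infinite_finite_induct) (auto intro: hmg_add hmg_0)

lemma hmg_prod: "(\<And>x. x \<in> A \<Longrightarrow> hmg (q x) (g x)) \<Longrightarrow> hmg (sum q A) (prod g A)"
  by (induction A rule: infinite_finite_induct) (auto intro: hmg_mult hmg_1)

lemma hmg_of_int: "hmg 0 (of_int c)"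
proof (induction c rule: int_induct[where k = 0])
  case (step2 i)
  thus ?case using hmg_add[OF step2(2) hmg_uminus[OF hmg_1]] by simp
qed (auto intro: hmg_0 hmg_add hmg_1)

lemma hmg_peval:
  assumes "whom wt q P" "\<And>i. hmg (wt i) (v i)"
  shows "hmg q (peval v P)"
proof -
  have "hmg q (of_int c * mpow v m)" if "m \<in> keys P" for m c
  proof -
    have "hmg (wdeg wt m) (mpow v m)"
      unfolding mpow_def wdeg_def by (intro hmg_prod hmg_power assms)
    moreover have "wdeg wt m = q" using assms(1) that by (auto simp: whom_def)
    ultimately show ?thesis using hmg_mult[OF hmg_of_int, of q _ c] by simp
  qed
  thus ?thesis unfolding peval_def pm_hom_def by (intro hmg_sum)
qed

end

text \<open>A common description of \<open>Spec\<close> and \<open>Proj\<close>: \<open>\<iota> P\<close> maps \<open>S\<close> to the localization \<open>L P\<close>, in which the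
  polynomials in \<open>Dn P\<close> become invertible; the stalk \<open>st P\<close> consists of the fractions of degree \<open>0\<close>,
  and \<open>cmp d\<close> is the projection to degree \<open>d\<close>.\<close>

locale frac_space = hypersurface p ty f + homogeneity hmg
  for p :: nat and ty :: "('n::finite \<times> 'k::field) itself" and f :: "('n, 'k) mpoly"
    and hmg :: "nat \<Rightarrow> ('n, 'k) mpoly \<Rightarrow> bool" +
  fixes T :: "'x topology" and st L :: "'x \<Rightarrow> 's ring" and \<iota> :: "'x \<Rightarrow> ('n, 'k) mpoly \<Rightarrow> 's"
    and Dn :: "'x \<Rightarrow> ('n, 'k) mpoly set" and Lp :: "'x set \<Rightarrow> ('x \<Rightarrow> 's) \<Rightarrow> bool"
    and cmp :: "nat \<Rightarrow> ('n, 'k) mpoly \<Rightarrow> ('n, 'k) mpoly"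
  assumes iota_hom: "P \<in> topspace T \<Longrightarrow> ring_hom_cring ring_of_type_algebra (L P) (\<iota> P)"
    and Dn_Units: "P \<in> topspace T \<Longrightarrow> h \<in> Dn P \<Longrightarrow> \<iota> P h \<in> Units (L P)"
    and Dn_1: "P \<in> topspace T \<Longrightarrow> 1 \<in> Dn P"
    and Dn_mult: "P \<in> topspace T \<Longrightarrow> h \<in> Dn P \<Longrightarrow> h' \<in> Dn P \<Longrightarrow> h * h' \<in> Dn P"
    and Dn_hmg: "P \<in> topspace T \<Longrightarrow> h \<in> Dn P \<Longrightarrow> \<exists>d. hmg d h"
    and ker: "P \<in> topspace T \<Longrightarrow> \<iota> P a = \<zero>\<^bsub>L P\<^esub> \<Longrightarrow> \<exists>r\<in>Dn P. f dvd r * a"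
    and iota_f: "P \<in> topspace T \<Longrightarrow> \<iota> P f = \<zero>\<^bsub>L P\<^esub>"
    and st_ops: "monoid.mult (st P) = monoid.mult (L P)" "add (st P) = add (L P)" "\<one>\<^bsub>st P\<^esub> = \<one>\<^bsub>L P\<^esub>" "\<zero>\<^bsub>st P\<^esub> = \<zero>\<^bsub>L P\<^esub>"
    and st_carrier: "P \<in> topspace T \<Longrightarrow> carrier (st P) =
      {y \<in> carrier (L P). \<exists>d a h. hmg d a \<and> hmg d h \<and> h \<in> Dn P \<and> y \<otimes>\<^bsub>L P\<^esub> \<iota> P h = \<iota> P a}"
    and Lp_iff: "V \<subseteq> topspace T \<Longrightarrow> Lp V s \<longleftrightarrow> (\<exists>d a h. hmg d a \<and> hmg d h \<and>
      (\<forall>P\<in>V. h \<in> Dn P \<and> s P \<in> carrier (L P) \<and> s P \<otimes>\<^bsub>L P\<^esub> \<iota> P h = \<iota> P a))"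
    and cmp_add: "cmp d (a + b) = cmp d a + cmp d b"
    and cmp_hmg: "hmg d (cmp d a)"
    and cmp_mult: "hmg e c \<Longrightarrow> cmp (e + d) (c * a) = c * cmp d a"
    and cmp_dvd: "f dvd a \<Longrightarrow> f dvd cmp d a"
begin

abbreviation pts where "pts \<equiv> topspace T"
abbreviation Y where "Y \<equiv> function_sheaf T st Lp"
abbreviation sec where "sec \<equiv> sheaf Y"

definition isf :: "'x \<Rightarrow> 's \<Rightarrow> ('n, 'k) mpoly \<Rightarrow> ('n, 'k) mpoly \<Rightarrow> bool" where
  "isf P y a h \<longleftrightarrow> h \<in> Dn P \<and> y \<in> carrier (L P) \<and> y \<otimes>\<^bsub>L P\<^esub> \<iota> P h = \<iota> P a"

definition fracv :: "'x \<Rightarrow> ('n, 'k) mpoly \<Rightarrow> ('n, 'k) mpoly \<Rightarrow> 's" where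
  "fracv P a h = \<iota> P a \<otimes>\<^bsub>L P\<^esub> inv\<^bsub>L P\<^esub> (\<iota> P h)"

lemma Dn_power: "P \<in> pts \<Longrightarrow> h \<in> Dn P \<Longrightarrow> h ^ n \<in> Dn P"
  by (induction n) (auto intro: Dn_mult Dn_1)

context
  fixes P assumes P: "P \<in> pts"
begin

interpretation I: ring_hom_cring ring_of_type_algebra "L P" "\<iota> P" by (rule iota_hom[OF P])

lemma iota_simps:
  "\<iota> P a \<in> carrier (L P)" "\<iota> P (a + b) = \<iota> P a \<oplus>\<^bsub>L P\<^esub> \<iota> P b" "\<iota> P (a * b) = \<iota> P a \<otimes>\<^bsub>L P\<^esub> \<iota> P b"
  "\<iota> P 1 = \<one>\<^bsub>L P\<^esub>" "\<iota> P 0 = \<zero>\<^bsub>L P\<^esub>" "\<iota> P (a ^ n) = \<iota> P a [^]\<^bsub>L P\<^esub> n" "\<iota> P (- a) = \<ominus>\<^bsub>L P\<^esub> \<iota> P a"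
  using I.hom_closed[of a] I.hom_add[of a b] I.hom_mult[of a b] I.hom_one I.hom_zero
    I.hom_nat_pow_cring[of a n] I.hom_a_inv[of a] by simp_all

lemma L_cring: "cring (L P)" by (rule I.S.is_cring)

lemma isf_fracv: "h \<in> Dn P \<Longrightarrow> isf P (fracv P a h) a h"
  using Dn_Units[OF P] iota_simps by (simp add: isf_def fracv_def I.S.m_assoc)

lemma cancel:
  assumes "h \<in> Dn P" "x \<in> carrier (L P)" "y \<in> carrier (L P)" "x \<otimes>\<^bsub>L P\<^esub> \<iota> P h = y \<otimes>\<^bsub>L P\<^esub> \<iota> P h"
  shows "x = y"
proof -
  have "x = x \<otimes>\<^bsub>L P\<^esub> \<iota> P h \<otimes>\<^bsub>L P\<^esub> inv\<^bsub>L P\<^esub> (\<iota> P h)"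
    using Dn_Units[OF P assms(1)] assms(2) by (simp add: I.S.m_assoc)
  also have "\<dots> = y" unfolding assms(4)
    using Dn_Units[OF P assms(1)] assms(3) by (simp add: I.S.m_assoc)
  finally show ?thesis .
qed

lemma isf_uniq: "isf P y a h \<Longrightarrow> isf P y' a h \<Longrightarrow> y = y'"
  using cancel[of h y y'] by (simp add: isf_def)

lemma isf_scale: "isf P y a h \<Longrightarrow> r \<in> Dn P \<Longrightarrow> isf P y (a * r) (h * r)"
  using Dn_mult[OF P] by (auto simp: isf_def iota_simps simp flip: I.S.m_assoc)

lemma isf_mult: "isf P y a h \<Longrightarrow> isf P y' a' h' \<Longrightarrow> isf P (y \<otimes>\<^bsub>L P\<^esub> y') (a * a') (h * h')"
proof -
  assume a: "isf P y a h" "isf P y' a' h'"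
  hence "y \<in> carrier (L P)" "y' \<in> carrier (L P)" by (auto simp: isf_def)
  hence "y \<otimes>\<^bsub>L P\<^esub> y' \<otimes>\<^bsub>L P\<^esub> (\<iota> P h \<otimes>\<^bsub>L P\<^esub> \<iota> P h') = (y \<otimes>\<^bsub>L P\<^esub> \<iota> P h) \<otimes>\<^bsub>L P\<^esub> (y' \<otimes>\<^bsub>L P\<^esub> \<iota> P h')"
    using iota_simps(1)[of h] iota_simps(1)[of h'] by (simp add: I.S.m_ac)
  thus ?thesis using a Dn_mult[OF P] by (simp add: isf_def iota_simps)
qed

lemma isf_add: "isf P y a h \<Longrightarrow> isf P y' a' h \<Longrightarrow> isf P (y \<oplus>\<^bsub>L P\<^esub> y') (a + a') h"
  by (auto simp: isf_def iota_simps I.S.l_distr)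

lemma isf_uminus: "isf P y a h \<Longrightarrow> isf P (\<ominus>\<^bsub>L P\<^esub> y) (- a) h"
  by (auto simp: isf_def iota_simps I.S.l_minus)

lemma isf_0: "h \<in> Dn P \<Longrightarrow> isf P \<zero>\<^bsub>L P\<^esub> 0 h"
  by (auto simp: isf_def iota_simps)

lemma isf_1: "h \<in> Dn P \<Longrightarrow> isf P \<one>\<^bsub>L P\<^esub> h h"
  by (auto simp: isf_def iota_simps)

lemma isf_power: "isf P y a h \<Longrightarrow> isf P (y [^]\<^bsub>L P\<^esub> (n::nat)) (a ^ n) (h ^ n)"
proof (induction n)
  case 0
  thus ?case using isf_1[OF Dn_1[OF P]] by simp
next
  case (Suc n)
  thus ?case using isf_mult[OF Suc.IH[OF Suc.prems] Suc.prems] by (simp add: mult.commute)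
qed

lemma iota_dvd: "f dvd a - b \<Longrightarrow> \<iota> P a = \<iota> P b"
proof -
  assume "f dvd a - b"
  then obtain c where "a = b + f * c" by (metis add.commute diff_add_cancel dvdE)
  thus ?thesis using iota_simps by (simp add: iota_f[OF P])
qed

lemma isf_eqI:
  assumes "isf P y a h" "isf P y' a' h'" "r \<in> Dn P" "f dvd r * (a * h') - r * (a' * h)"
  shows "y = y'"
proof -
  have "h \<in> Dn P" "h' \<in> Dn P" using assms by (auto simp: isf_def)
  hence "isf P y (a * (h' * r)) (h * (h' * r))" "isf P y' (a' * (h * r)) (h' * (h * r))"
    using assms Dn_mult[OF P] by (auto intro: isf_scale)
  moreover have "\<iota> P (a * (h' * r)) = \<iota> P (a' * (h * r))"
    using assms(4) by (intro iota_dvd) (simp add: mult_ac)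
  moreover have "h' * (h * r) = h * (h' * r)" by (simp add: mult_ac)
  ultimately show ?thesis using cancel[of "h * (h' * r)" y y'] by (auto simp: isf_def)
qed

lemma isf_conv:
  assumes "isf P y a h" "isf P y a' h'"
  shows "\<exists>r\<in>Dn P. f dvd r * (a * h' - a' * h)"
proof (rule ker[OF P])
  have "\<iota> P a \<otimes>\<^bsub>L P\<^esub> \<iota> P h' = y \<otimes>\<^bsub>L P\<^esub> \<iota> P h \<otimes>\<^bsub>L P\<^esub> \<iota> P h'" using assms by (simp add: isf_def)
  also have "\<dots> = y \<otimes>\<^bsub>L P\<^esub> \<iota> P h' \<otimes>\<^bsub>L P\<^esub> \<iota> P h"
  proof -
    have "y \<in> carrier (L P)" using assms by (simp add: isf_def)
    thus ?thesis using iota_simps(1)[of h] iota_simps(1)[of h'] by (simp add: I.S.m_ac)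
  qed
  also have "\<dots> = \<iota> P a' \<otimes>\<^bsub>L P\<^esub> \<iota> P h" using assms by (simp add: isf_def)
  finally have "\<iota> P (a * h') = \<iota> P (a' * h)" by (simp add: iota_simps)
  thus "\<iota> P (a * h' - a' * h) = \<zero>\<^bsub>L P\<^esub>"
    using iota_simps by (simp add: I.S.r_neg flip: add_uminus_conv_diff)
qed

lemma common_ker:
  assumes "finite B" "\<And>j. j \<in> B \<Longrightarrow> \<exists>r\<in>Dn P. f dvd r * y j"
  shows "\<exists>r\<in>Dn P. \<forall>j\<in>B. f dvd r * y j"
  using assms
proof (induction B rule: finite_induct)
  case empty
  show ?case using Dn_1[OF P] by auto
next
  case (insert i B)
  then obtain r s where rs: "r \<in> Dn P" "\<forall>j\<in>B. f dvd r * y j" "s \<in> Dn P" "f dvd s * y i" by blast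
  have "f dvd (r * s) * y j" if "j \<in> insert i B" for j
  proof (cases "j = i")
    case True
    have "f dvd r * (s * y i)" using rs by (rule_tac dvd_mult) simp
    thus ?thesis using True by (simp add: mult_ac)
  next
    case False
    hence "f dvd s * (r * y j)" using rs that by (rule_tac dvd_mult) auto
    thus ?thesis by (simp add: mult_ac)
  qed
  thus ?case using rs Dn_mult[OF P] by blast
qed

text \<open>The denominators A^(p^(j+1)) grow like the weights of the addition polynomials, so the
  i-th component of the sum has denominator A^(p^(i+1)).\<close>

lemma eval_add_scaled:
  assumes "\<And>j. j \<le> i \<Longrightarrow> \<alpha> j \<in> carrier (L P) \<and> \<alpha> j \<otimes>\<^bsub>L P\<^esub> \<iota> P (A ^ (p * p ^ j)) = \<iota> P (wcomp z j)"
    and "\<And>j. j \<le> i \<Longrightarrow> \<beta> j \<in> carrier (L P) \<and> \<beta> j \<otimes>\<^bsub>L P\<^esub> \<iota> P (A ^ (p * p ^ j)) = \<iota> P (wcomp y j)"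
  shows "witt_poly_eval (L P) (case_sum \<alpha> \<beta>) (witt_add_poly p i) \<otimes>\<^bsub>L P\<^esub> \<iota> P (A ^ (p * p ^ i))
      = \<iota> P (wcomp (z + y :: ('n, 'k) wittS) i)"
proof -
  let ?c = "\<iota> P A"
  \<comment> \<open>Components beyond i may lie outside the carrier, as truncated vectors are
    undefined there. They do not occur in the i-th polynomial and are replaced by zero.\<close>
  define v where "v = (\<lambda>x. if case_sum id id x \<le> i then case_sum \<alpha> \<beta> x else \<zero>\<^bsub>L P\<^esub>)"
  define wt where "wt = case_sum (\<lambda>j. p * p ^ j) (\<lambda>j. p * p ^ j)"
  have v: "v x \<in> carrier (L P)" for x using assms by (auto simp: v_def split: sum.split)
  have "witt_poly_eval (L P) (case_sum \<alpha> \<beta>) (witt_add_poly p i) = witt_poly_eval (L P) v (witt_add_poly p i)"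
  proof (rule I.S.witt_poly_eval_cong, rule conjI)
    fix m x assume "m \<in> keys (witt_add_poly p i)" "x \<in> keys m"
    hence "case_sum id id x \<le> i" by (rule witt_add_poly_vars[OF prime_p])
    thus "case_sum \<alpha> \<beta> x = v x" by (simp add: v_def)
  qed (rule v)
  hence "witt_poly_eval (L P) (case_sum \<alpha> \<beta>) (witt_add_poly p i) \<otimes>\<^bsub>L P\<^esub> \<iota> P (A ^ (p * p ^ i))
      = ?c [^]\<^bsub>L P\<^esub> (p * p ^ i) \<otimes>\<^bsub>L P\<^esub> witt_poly_eval (L P) v (witt_add_poly p i)"
    using v by (simp add: iota_simps I.S.m_comm I.S.witt_poly_eval_closed)
  also have "\<dots> = witt_poly_eval (L P) (\<lambda>x. ?c [^]\<^bsub>L P\<^esub> wt x \<otimes>\<^bsub>L P\<^esub> v x) (witt_add_poly p i)"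
    using v whom_witt_add_poly[OF prime_p, of p i]
    by (intro I.S.witt_poly_eval_scale[symmetric]) (auto simp: wt_def iota_simps)
  also have "\<dots> = witt_poly_eval (L P) (\<lambda>x. \<iota> P (case_sum (wcomp z) (wcomp y) x)) (witt_add_poly p i)"
  proof (rule I.S.witt_poly_eval_cong)
    fix m x assume "m \<in> keys (witt_add_poly p i)" "x \<in> keys m"
    hence "case_sum id id x \<le> i" by (rule witt_add_poly_vars[OF prime_p])
    thus "?c [^]\<^bsub>L P\<^esub> wt x \<otimes>\<^bsub>L P\<^esub> v x = \<iota> P (case_sum (wcomp z) (wcomp y) x) \<and>
        \<iota> P (case_sum (wcomp z) (wcomp y) x) \<in> carrier (L P)"
      using assms by (auto simp: v_def wt_def iota_simps I.S.m_comm split: sum.splits)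
  qed
  also have "\<dots> = \<iota> P (witt_poly_eval ring_of_type_algebra (case_sum (wcomp z) (wcomp y)) (witt_add_poly p i))"
    by (rule I.hom_witt_poly_eval[symmetric]) simp
  also have "\<dots> = \<iota> P (wcomp (z + y) i)"
    by (simp add: witt_poly_eval_ring_of_type wcomp_add wchar_p)
  finally show ?thesis .
qed

text \<open>The two denominators are cleared one after the other, using homogeneity in each factor
  separately.\<close>

lemma eval_mult_scaled:
  assumes "\<And>j. j \<le> i \<Longrightarrow> \<alpha> j \<in> carrier (L P) \<and> \<alpha> j \<otimes>\<^bsub>L P\<^esub> \<iota> P (A ^ (p ^ j)) = \<iota> P (wcomp z j)"
    and "\<And>j. j \<le> i \<Longrightarrow> \<beta> j \<in> carrier (L P) \<and> \<beta> j \<otimes>\<^bsub>L P\<^esub> \<iota> P (B ^ (p ^ j)) = \<iota> P (wcomp y j)"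
  shows "witt_poly_eval (L P) (case_sum \<alpha> \<beta>) (witt_mult_poly p i) \<otimes>\<^bsub>L P\<^esub> \<iota> P ((A * B) ^ (p ^ i))
      = \<iota> P (wcomp (z * y :: ('n, 'k) wittS) i)"
proof -
  let ?a = "\<iota> P A" and ?b = "\<iota> P B"
  define v where "v = (\<lambda>x. if case_sum id id x \<le> i then case_sum \<alpha> \<beta> x else \<zero>\<^bsub>L P\<^esub>)"
  define wa where "wa = case_sum (\<lambda>j. 1 * p ^ j) (\<lambda>j. 0 * p ^ j)"
  define wb where "wb = case_sum (\<lambda>j. 0 * p ^ j) (\<lambda>j. 1 * p ^ j)"
  have v: "v x \<in> carrier (L P)" for x using assms by (auto simp: v_def split: sum.split)
  have "witt_poly_eval (L P) (case_sum \<alpha> \<beta>) (witt_mult_poly p i) = witt_poly_eval (L P) v (witt_mult_poly p i)"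
  proof (rule I.S.witt_poly_eval_cong, rule conjI)
    fix m x assume "m \<in> keys (witt_mult_poly p i)" "x \<in> keys m"
    hence "case_sum id id x \<le> i" by (rule witt_mult_poly_vars[OF prime_p])
    thus "case_sum \<alpha> \<beta> x = v x" by (simp add: v_def)
  qed (rule v)
  hence "witt_poly_eval (L P) (case_sum \<alpha> \<beta>) (witt_mult_poly p i) \<otimes>\<^bsub>L P\<^esub> \<iota> P ((A * B) ^ (p ^ i))
      = ?a [^]\<^bsub>L P\<^esub> ((1 + 0) * p ^ i) \<otimes>\<^bsub>L P\<^esub> (?b [^]\<^bsub>L P\<^esub> ((0 + 1) * p ^ i) \<otimes>\<^bsub>L P\<^esub> witt_poly_eval (L P) v (witt_mult_poly p i))"
    using v by (simp add: iota_simps power_mult_distrib I.S.m_ac I.S.witt_poly_eval_closed)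
  also have "\<dots> = ?a [^]\<^bsub>L P\<^esub> ((1 + 0) * p ^ i) \<otimes>\<^bsub>L P\<^esub>
      witt_poly_eval (L P) (\<lambda>x. ?b [^]\<^bsub>L P\<^esub> wb x \<otimes>\<^bsub>L P\<^esub> v x) (witt_mult_poly p i)"
    using v whom_witt_mult_poly[OF prime_p, of 0 1 i]
    by (subst I.S.witt_poly_eval_scale[of wb "(0 + 1) * p ^ i"]) (auto simp only: wb_def iota_simps)
  also have "\<dots> = witt_poly_eval (L P) (\<lambda>x. ?a [^]\<^bsub>L P\<^esub> wa x \<otimes>\<^bsub>L P\<^esub> (?b [^]\<^bsub>L P\<^esub> wb x \<otimes>\<^bsub>L P\<^esub> v x)) (witt_mult_poly p i)"
    using v whom_witt_mult_poly[OF prime_p, of 1 0 i]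
    by (intro I.S.witt_poly_eval_scale[of wa, symmetric]) (auto simp only: wa_def iota_simps intro!: I.S.m_closed I.S.nat_pow_closed)
  also have "\<dots> = witt_poly_eval (L P) (\<lambda>x. \<iota> P (case_sum (wcomp z) (wcomp y) x)) (witt_mult_poly p i)"
  proof (rule I.S.witt_poly_eval_cong)
    fix m x assume "m \<in> keys (witt_mult_poly p i)" "x \<in> keys m"
    hence x: "case_sum id id x \<le> i" by (rule witt_mult_poly_vars[OF prime_p])
    show "?a [^]\<^bsub>L P\<^esub> wa x \<otimes>\<^bsub>L P\<^esub> (?b [^]\<^bsub>L P\<^esub> wb x \<otimes>\<^bsub>L P\<^esub> v x) = \<iota> P (case_sum (wcomp z) (wcomp y) x) \<and>
        \<iota> P (case_sum (wcomp z) (wcomp y) x) \<in> carrier (L P)"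
      using assms x by (cases x) (simp_all add: v_def wa_def wb_def iota_simps I.S.m_comm)
  qed
  also have "\<dots> = \<iota> P (witt_poly_eval ring_of_type_algebra (case_sum (wcomp z) (wcomp y)) (witt_mult_poly p i))"
    by (rule I.hom_witt_poly_eval[symmetric]) simp
  also have "\<dots> = \<iota> P (wcomp (z * y) i)"
    by (simp add: witt_poly_eval_ring_of_type wcomp_mult wchar_p)
  finally show ?thesis .
qed

end

end

section \<open>Sections and Witt vectors over open sets\<close>

context frac_space
begin

lemma sec_carrier:
  assumes "openin T V"
  shows "s \<in> carrier (sec V) \<longleftrightarrow> s \<in> extensional V \<and> (\<forall>P\<in>V. \<exists>W d a h. openin T W \<and> P \<in> W \<and> W \<subseteq> V \<and>
    hmg d a \<and> hmg d h \<and> (\<forall>Q\<in>W. isf Q (s Q) a h))" (is "_ \<longleftrightarrow> ?R")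
proof -
  have sub: "W \<subseteq> pts" if "W \<subseteq> V" for W using that openin_subset[OF assms] by blast
  have lp: "Lp W s \<longleftrightarrow> (\<exists>d a h. hmg d a \<and> hmg d h \<and> (\<forall>Q\<in>W. isf Q (s Q) a h))" if "W \<subseteq> V" for W
    unfolding Lp_iff[OF sub[OF that]] isf_def ..
  have lp2: "(\<exists>W. openin T W \<and> P \<in> W \<and> W \<subseteq> V \<and> Lp W s) \<longleftrightarrow> (\<exists>W d a h. openin T W \<and> P \<in> W \<and> W \<subseteq> V \<and>
    hmg d a \<and> hmg d h \<and> (\<forall>Q\<in>W. isf Q (s Q) a h))" for P
  proof
    assume "\<exists>W. openin T W \<and> P \<in> W \<and> W \<subseteq> V \<and> Lp W s"
    then obtain W where W: "openin T W" "P \<in> W" "W \<subseteq> V" "Lp W s" by blast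
    from W(4) obtain d a h where "hmg d a" "hmg d h" "\<forall>Q\<in>W. isf Q (s Q) a h" unfolding lp[OF W(3)] by blast
    thus "\<exists>W d a h. openin T W \<and> P \<in> W \<and> W \<subseteq> V \<and> hmg d a \<and> hmg d h \<and> (\<forall>Q\<in>W. isf Q (s Q) a h)"
      using W by blast
  next
    assume "\<exists>W d a h. openin T W \<and> P \<in> W \<and> W \<subseteq> V \<and> hmg d a \<and> hmg d h \<and> (\<forall>Q\<in>W. isf Q (s Q) a h)"
    then obtain W d a h where W: "openin T W" "P \<in> W" "W \<subseteq> V" "hmg d a" "hmg d h" "\<forall>Q\<in>W. isf Q (s Q) a h"
      by blast
    hence "Lp W s" unfolding lp[OF W(3)] by blast
    thus "\<exists>W. openin T W \<and> P \<in> W \<and> W \<subseteq> V \<and> Lp W s" using W by blast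
  qed
  have "s \<in> carrier (sec V) \<longleftrightarrow> s \<in> (\<Pi>\<^sub>E x\<in>V. carrier (st x)) \<and> (\<forall>x\<in>V. \<exists>W. openin T W \<and> x \<in> W \<and> W \<subseteq> V \<and> Lp W s)"
    by (simp add: function_sheaf_def)
  also have "\<dots> \<longleftrightarrow> s \<in> (\<Pi>\<^sub>E x\<in>V. carrier (st x)) \<and> (\<forall>P\<in>V. \<exists>W d a h. openin T W \<and> P \<in> W \<and> W \<subseteq> V \<and>
    hmg d a \<and> hmg d h \<and> (\<forall>Q\<in>W. isf Q (s Q) a h))"
    unfolding lp2 ..
  also have "\<dots> \<longleftrightarrow> ?R"
  proof -
    define loc where "loc \<longleftrightarrow> (\<forall>P\<in>V. \<exists>W d a h. openin T W \<and> P \<in> W \<and> W \<subseteq> V \<and> hmg d a \<and> hmg d h \<and> (\<forall>Q\<in>W. isf Q (s Q) a h))"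
    have 1: "s \<in> extensional V" if "s \<in> (\<Pi>\<^sub>E x\<in>V. carrier (st x))" using that by (simp add: PiE_def)
    have 2: "s \<in> (\<Pi>\<^sub>E x\<in>V. carrier (st x))" if l: loc and e: "s \<in> extensional V"
    proof -
      have "s P \<in> carrier (st P)" if P: "P \<in> V" for P
      proof -
        have "\<exists>W d a h. openin T W \<and> P \<in> W \<and> W \<subseteq> V \<and> hmg d a \<and> hmg d h \<and> (\<forall>Q\<in>W. isf Q (s Q) a h)"
          using l P unfolding loc_def by (rule bspec)
        then obtain W d a h where W: "P \<in> W" "hmg d a" "hmg d h" "\<forall>Q\<in>W. isf Q (s Q) a h" by blast
        have "P \<in> pts" using sub[of V] P by blast
        from st_carrier[OF this] show ?thesis using W unfolding isf_def by blast
      qed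
      thus ?thesis using e unfolding PiE_def Pi_def by blast
    qed
    show ?thesis unfolding loc_def[symmetric] using 1 2 by blast
  qed
  finally show ?thesis .
qed

lemma secE:
  assumes "openin T V" "s \<in> carrier (sec V)" "P \<in> V"
  obtains W d a h where "openin T W" "P \<in> W" "W \<subseteq> V" "hmg d a" "hmg d h" "\<And>Q. Q \<in> W \<Longrightarrow> isf Q (s Q) a h"
proof -
  have "\<forall>P\<in>V. \<exists>W d a h. openin T W \<and> P \<in> W \<and> W \<subseteq> V \<and> hmg d a \<and> hmg d h \<and> (\<forall>Q\<in>W. isf Q (s Q) a h)"
    using assms(2) unfolding sec_carrier[OF assms(1)] by (rule conjunct2)
  from bspec[OF this assms(3)] show thesis using that by (elim exE conjE) simp
qed

lemma secI:
  assumes "openin T V" "s \<in> extensional V"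
    "\<And>P. P \<in> V \<Longrightarrow> \<exists>W d a h. openin T W \<and> P \<in> W \<and> W \<subseteq> V \<and> hmg d a \<and> hmg d h \<and> (\<forall>Q\<in>W. isf Q (s Q) a h)"
  shows "s \<in> carrier (sec V)"
  unfolding sec_carrier[OF assms(1)] using assms(2,3) by (rule_tac conjI) simp_all

lemma sec_mult: "s \<otimes>\<^bsub>sec V\<^esub> t = (\<lambda>P\<in>V. s P \<otimes>\<^bsub>L P\<^esub> t P)"
  and sec_add: "s \<oplus>\<^bsub>sec V\<^esub> t = (\<lambda>P\<in>V. s P \<oplus>\<^bsub>L P\<^esub> t P)"
  and sec_one: "\<one>\<^bsub>sec V\<^esub> = (\<lambda>P\<in>V. \<one>\<^bsub>L P\<^esub>)"
  and sec_zero: "\<zero>\<^bsub>sec V\<^esub> = (\<lambda>P\<in>V. \<zero>\<^bsub>L P\<^esub>)"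
  by (simp_all add: function_sheaf_def st_ops)

lemma pts_of: "openin T V \<Longrightarrow> P \<in> V \<Longrightarrow> P \<in> pts"
  using openin_subset by blast

lemma sec_closed: "openin T V \<Longrightarrow> s \<in> carrier (sec V) \<Longrightarrow> P \<in> V \<Longrightarrow> s P \<in> carrier (L P)"
  by (erule secE) (auto simp: isf_def)

lemma sec_family:
  assumes V: "openin T V" and "finite J" "\<And>j. j \<in> J \<Longrightarrow> s j \<in> carrier (sec V)" and P: "P \<in> V"
  shows "\<exists>W d h a. openin T W \<and> P \<in> W \<and> W \<subseteq> V \<and> hmg d h \<and> (\<forall>Q\<in>W. h \<in> Dn Q) \<and>
    (\<forall>j\<in>J. hmg d (a j) \<and> (\<forall>Q\<in>W. isf Q (s j Q) (a j) h))"
  using assms(2,3)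
proof (induction J rule: finite_induct)
  case empty
  show ?case using V P hmg_1 Dn_1 pts_of[OF V] by (intro exI[of _ V] exI[of _ 0] exI[of _ 1]) auto
next
  case (insert i J)
  then obtain W d h a where W: "openin T W" "P \<in> W" "W \<subseteq> V" "hmg d h" "\<forall>Q\<in>W. h \<in> Dn Q"
    "\<forall>j\<in>J. hmg d (a j) \<and> (\<forall>Q\<in>W. isf Q (s j Q) (a j) h)" by auto
  have "s i \<in> carrier (sec V)" using insert.prems by blast
  then obtain W' d' b h' where W': "openin T W'" "P \<in> W'" "W' \<subseteq> V" "hmg d' b" "hmg d' h'"
    "\<And>Q. Q \<in> W' \<Longrightarrow> isf Q (s i Q) b h'" using P by (rule secE[OF V]) blast
  define c where "c = (\<lambda>j. if j = i then b * h else a j * h')"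
  have D': "\<forall>Q\<in>W'. h' \<in> Dn Q" using W' by (auto simp: isf_def)
  have "hmg (d + d') (c j) \<and> (\<forall>Q\<in>W \<inter> W'. isf Q (s j Q) (c j) (h * h'))" if "j \<in> insert i J" for j
  proof (cases "j = i")
    case True
    have "hmg (d' + d) (b * h)" using W W' by (intro hmg_mult)
    moreover have "isf Q (s i Q) (b * h) (h' * h)" if "Q \<in> W \<inter> W'" for Q
      using that W W' pts_of[OF W(1)] by (intro isf_scale) auto
    ultimately show ?thesis using True by (simp add: c_def mult.commute add.commute)
  next
    case False
    hence j: "j \<in> J" using that by simp
    have "hmg (d + d') (a j * h')" using W W' j by (intro hmg_mult) auto
    moreover have "isf Q (s j Q) (a j * h') (h * h')" if "Q \<in> W \<inter> W'" for Q
      using that W W' D' j pts_of[OF W(1)] by (intro isf_scale) auto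
    ultimately show ?thesis using False by (simp add: c_def)
  qed
  moreover have "hmg (d + d') (h * h')" using W W' by (intro hmg_mult)
  moreover have "\<forall>Q\<in>W \<inter> W'. h * h' \<in> Dn Q" using W D' pts_of[OF W(1)] by (auto intro: Dn_mult)
  ultimately show ?case using W W' openin_Int
    by (intro exI[of _ "W \<inter> W'"] exI[of _ "d + d'"] exI[of _ "h * h'"] exI[of _ c]) auto
qed

lemma sec_family2:
  assumes V: "openin T V" and "s \<in> carrier (sec V)" "t \<in> carrier (sec V)" "P \<in> V"
  shows "\<exists>W d h a b. openin T W \<and> P \<in> W \<and> W \<subseteq> V \<and> hmg d h \<and> hmg d a \<and> hmg d b \<and>
    (\<forall>Q\<in>W. isf Q (s Q) a h \<and> isf Q (t Q) b h)"
proof -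
  have "\<exists>W d h a. openin T W \<and> P \<in> W \<and> W \<subseteq> V \<and> hmg d h \<and> (\<forall>Q\<in>W. h \<in> Dn Q) \<and>
    (\<forall>j\<in>{True, False}. hmg d (a j) \<and> (\<forall>Q\<in>W. isf Q ((if j then s else t) Q) (a j) h))"
    by (rule sec_family[OF V]) (use assms in \<open>simp_all split: if_splits\<close>)
  then obtain W d h a where "openin T W" "P \<in> W" "W \<subseteq> V" "hmg d h"
    "\<forall>j\<in>{True, False}. hmg d (a j) \<and> (\<forall>Q\<in>W. isf Q ((if j then s else t) Q) (a j) h)"
    by (elim exE conjE) blast
  thus ?thesis by (intro exI[of _ W] exI[of _ d] exI[of _ h] exI[of _ "a True"] exI[of _ "a False"]) simp
qed

lemma sec_cring:
  assumes V: "openin T V"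
  shows "cring (sec V)"
proof -
  note pt = pts_of[OF V] and L = cring.cring_simprules[OF L_cring[OF pts_of[OF V]]] and cl = sec_closed[OF V]
  have add: "s \<oplus>\<^bsub>sec V\<^esub> t \<in> carrier (sec V)" if st: "s \<in> carrier (sec V)" "t \<in> carrier (sec V)" for s t
    unfolding sec_carrier[OF V]
  proof (intro conjI ballI)
    fix P assume "P \<in> V"
    from sec_family2[OF V st this]
    obtain W d h a b where W: "openin T W" "P \<in> W" "W \<subseteq> V" "hmg d h" "hmg d a" "hmg d b"
      "\<forall>Q\<in>W. isf Q (s Q) a h \<and> isf Q (t Q) b h" by (elim exE conjE)
    have "isf Q ((s \<oplus>\<^bsub>sec V\<^esub> t) Q) (a + b) h" if "Q \<in> W" for Q
      using W that pts_of[OF W(1)] isf_add[of Q "s Q" a h "t Q" b] by (auto simp: sec_add)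
    thus "\<exists>W d a h. openin T W \<and> P \<in> W \<and> W \<subseteq> V \<and> hmg d a \<and> hmg d h \<and> (\<forall>Q\<in>W. isf Q ((s \<oplus>\<^bsub>sec V\<^esub> t) Q) a h)"
      using W hmg_add[of d a b] by (intro exI[of _ W] exI[of _ d] exI[of _ "a + b"] exI[of _ h]) simp
  qed (simp add: sec_add)
  have mult: "s \<otimes>\<^bsub>sec V\<^esub> t \<in> carrier (sec V)" if st: "s \<in> carrier (sec V)" "t \<in> carrier (sec V)" for s t
    unfolding sec_carrier[OF V]
  proof (intro conjI ballI)
    fix P assume "P \<in> V"
    from sec_family2[OF V st this]
    obtain W d h a b where W: "openin T W" "P \<in> W" "W \<subseteq> V" "hmg d h" "hmg d a" "hmg d b"
      "\<forall>Q\<in>W. isf Q (s Q) a h \<and> isf Q (t Q) b h" by (elim exE conjE)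
    have "isf Q ((s \<otimes>\<^bsub>sec V\<^esub> t) Q) (a * b) (h * h)" if "Q \<in> W" for Q
      using W that pts_of[OF W(1)] isf_mult[of Q "s Q" a h "t Q" b h] by (auto simp: sec_mult)
    thus "\<exists>W d a h. openin T W \<and> P \<in> W \<and> W \<subseteq> V \<and> hmg d a \<and> hmg d h \<and> (\<forall>Q\<in>W. isf Q ((s \<otimes>\<^bsub>sec V\<^esub> t) Q) a h)"
      using W hmg_mult[of d a d b] hmg_mult[of d h d h]
      by (intro exI[of _ W] exI[of _ "d + d"] exI[of _ "a * b"] exI[of _ "h * h"]) simp
  qed (simp add: sec_mult)
  have const: "(\<lambda>P\<in>V. c P) \<in> carrier (sec V)" if "hmg 0 a" "\<And>P. P \<in> V \<Longrightarrow> isf P (c P) a 1" for c a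
    by (rule secI[OF V], simp, intro exI[of _ V] exI[of _ 0] exI[of _ a] exI[of _ 1]) (use that V hmg_1 in auto)
  have zero: "\<zero>\<^bsub>sec V\<^esub> \<in> carrier (sec V)" unfolding sec_zero
    by (rule const[of 0]) (auto intro: hmg_0 isf_0 Dn_1 pt)
  have one: "\<one>\<^bsub>sec V\<^esub> \<in> carrier (sec V)" unfolding sec_one
    by (rule const[of 1]) (auto intro: hmg_1 isf_1 Dn_1 pt)
  have neg: "(\<lambda>P\<in>V. \<ominus>\<^bsub>L P\<^esub> s P) \<in> carrier (sec V)" if s: "s \<in> carrier (sec V)" for s
    unfolding sec_carrier[OF V]
  proof (intro conjI ballI)
    fix P assume "P \<in> V"
    then obtain W d a h where W: "openin T W" "P \<in> W" "W \<subseteq> V" "hmg d a" "hmg d h" "\<And>Q. Q \<in> W \<Longrightarrow> isf Q (s Q) a h"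
      by (rule secE[OF V s]) blast
    have "isf Q ((\<lambda>P\<in>V. \<ominus>\<^bsub>L P\<^esub> s P) Q) (- a) h" if "Q \<in> W" for Q
      using W that pts_of[OF W(1)] isf_uminus[of Q "s Q" a h] by auto
    thus "\<exists>W d a h. openin T W \<and> P \<in> W \<and> W \<subseteq> V \<and> hmg d a \<and> hmg d h \<and> (\<forall>Q\<in>W. isf Q ((\<lambda>P\<in>V. \<ominus>\<^bsub>L P\<^esub> s P) Q) a h)"
      using W hmg_uminus[of d a] by (intro exI[of _ W] exI[of _ d] exI[of _ "- a"] exI[of _ h]) simp
  qed simp
  have ext: "s = t" if "s \<in> carrier (sec V)" "t \<in> carrier (sec V)" "\<And>P. P \<in> V \<Longrightarrow> s P = t P" for s t
    using that unfolding sec_carrier[OF V] by (elim conjE) (rule extensionalityI)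
  show ?thesis
  proof (rule cringI)
    show "abelian_group (sec V)"
    proof (rule abelian_groupI)
      fix s assume s: "s \<in> carrier (sec V)"
      have "(\<lambda>P\<in>V. \<ominus>\<^bsub>L P\<^esub> s P) \<oplus>\<^bsub>sec V\<^esub> s = \<zero>\<^bsub>sec V\<^esub>"
        by (rule ext, intro add neg s, rule zero, simp add: sec_add sec_zero L cl s)
      thus "\<exists>t\<in>carrier (sec V). t \<oplus>\<^bsub>sec V\<^esub> s = \<zero>\<^bsub>sec V\<^esub>" using neg[OF s] by blast
      show "\<zero>\<^bsub>sec V\<^esub> \<oplus>\<^bsub>sec V\<^esub> s = s"
        by (rule ext, intro add zero s, rule s, simp add: sec_add sec_zero L cl s)
      fix t assume t: "t \<in> carrier (sec V)"
      show "s \<oplus>\<^bsub>sec V\<^esub> t \<in> carrier (sec V)" by (rule add[OF s t])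
      show "s \<oplus>\<^bsub>sec V\<^esub> t = t \<oplus>\<^bsub>sec V\<^esub> s"
        by (rule ext, intro add s t, intro add s t, simp add: sec_add L cl s t)
      fix r assume r: "r \<in> carrier (sec V)"
      show "s \<oplus>\<^bsub>sec V\<^esub> t \<oplus>\<^bsub>sec V\<^esub> r = s \<oplus>\<^bsub>sec V\<^esub> (t \<oplus>\<^bsub>sec V\<^esub> r)"
        by (rule ext, intro add s t r, intro add s t r, simp add: sec_add L cl s t r)
    qed (rule zero)
    show "comm_monoid (sec V)"
    proof (rule comm_monoidI)
      fix s assume s: "s \<in> carrier (sec V)"
      show "\<one>\<^bsub>sec V\<^esub> \<otimes>\<^bsub>sec V\<^esub> s = s"
        by (rule ext, intro mult one s, rule s, simp add: sec_mult sec_one cl s monoid.l_one[OF ring.is_monoid[OF cring.axioms(1)[OF L_cring[OF pt]]]])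
      fix t assume t: "t \<in> carrier (sec V)"
      show "s \<otimes>\<^bsub>sec V\<^esub> t \<in> carrier (sec V)" by (rule mult[OF s t])
      show "s \<otimes>\<^bsub>sec V\<^esub> t = t \<otimes>\<^bsub>sec V\<^esub> s"
        by (rule ext, intro mult s t, intro mult s t, simp add: sec_mult L cl s t)
      fix r assume r: "r \<in> carrier (sec V)"
      show "s \<otimes>\<^bsub>sec V\<^esub> t \<otimes>\<^bsub>sec V\<^esub> r = s \<otimes>\<^bsub>sec V\<^esub> (t \<otimes>\<^bsub>sec V\<^esub> r)"
        by (rule ext, intro mult s t r, intro mult s t r, simp add: sec_mult L cl s t r)
    qed (rule one)
    show "(s \<oplus>\<^bsub>sec V\<^esub> t) \<otimes>\<^bsub>sec V\<^esub> r = s \<otimes>\<^bsub>sec V\<^esub> r \<oplus>\<^bsub>sec V\<^esub> t \<otimes>\<^bsub>sec V\<^esub> r"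
      if "s \<in> carrier (sec V)" "t \<in> carrier (sec V)" "r \<in> carrier (sec V)" for s t r
      by (rule ext, intro add mult that, intro add mult that, simp add: sec_mult sec_add L cl that)
  qed
qed

lemma sec_ext: "openin T V \<Longrightarrow> s \<in> carrier (sec V) \<Longrightarrow> t \<in> carrier (sec V) \<Longrightarrow> (\<And>P. P \<in> V \<Longrightarrow> s P = t P) \<Longrightarrow> s = t"
  unfolding sec_carrier by (elim conjE) (rule extensionalityI)

lemma sec_eval_hom:
  assumes V: "openin T V" and "P \<in> V"
  shows "ring_hom_cring (sec V) (L P) (\<lambda>s. s P)"
  by (rule ring_hom_cringI[OF sec_cring[OF V] L_cring[OF pts_of[OF assms]]], rule ring_hom_memI)
    (use assms sec_closed in \<open>auto simp: sec_mult sec_add sec_one\<close>)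

abbreviation Wr :: "nat \<Rightarrow> 'x set \<Rightarrow> (nat \<Rightarrow> 'x \<Rightarrow> 's) ring" where
  "Wr n V \<equiv> witt_ring p n (sec V)"

lemma Wr_carrier: "a \<in> carrier (Wr n V) \<longleftrightarrow> a \<in> (\<Pi>\<^sub>E i\<in>{..<n}. carrier (sec V))"
  by (simp add: witt_ring_def)

lemma Wr_comp: "a \<in> carrier (Wr n V) \<Longrightarrow> i < n \<Longrightarrow> a i \<in> carrier (sec V)"
  by (auto simp: Wr_carrier)

lemma sec_poly_eval_closed:
  assumes V: "openin T V" and "\<And>j. j \<le> i \<Longrightarrow> a j \<in> carrier (sec V)" "\<And>j. j \<le> i \<Longrightarrow> b j \<in> carrier (sec V)"
    and vars: "\<And>m v. m \<in> keys R \<Longrightarrow> v \<in> keys m \<Longrightarrow> case_sum id id v \<le> i"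
  shows "witt_poly_eval (sec V) (case_sum a b) R \<in> carrier (sec V)"
    "P \<in> V \<Longrightarrow> witt_poly_eval (sec V) (case_sum a b) R P = witt_poly_eval (L P) (case_sum (\<lambda>j. a j P) (\<lambda>j. b j P)) R"
proof -
  interpret cring "sec V" by (rule sec_cring[OF V])
  define v where "v = (\<lambda>x. if case_sum id id x \<le> i then case_sum a b x else \<zero>\<^bsub>sec V\<^esub>)"
  have v: "v x \<in> carrier (sec V)" for x using assms by (auto simp: v_def split: sum.split)
  have vx: "case_sum a b x = v x" if "m \<in> keys R" "x \<in> keys m" for m x
    using vars[OF that] by (simp add: v_def)
  have e: "witt_poly_eval (sec V) (case_sum a b) R = witt_poly_eval (sec V) v R"
    by (rule witt_poly_eval_cong) (simp add: vx v)
  show "witt_poly_eval (sec V) (case_sum a b) R \<in> carrier (sec V)"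
    unfolding e by (rule witt_poly_eval_closed) (rule v)
  assume "P \<in> V"
  then interpret E: ring_hom_cring "sec V" "L P" "\<lambda>s. s P" by (rule sec_eval_hom[OF V])
  have vxP: "case_sum (\<lambda>j. a j P) (\<lambda>j. b j P) x = v x P" if "m \<in> keys R" "x \<in> keys m" for m x
    using vx[OF that] by (metis (no_types, lifting) old.sum.simps(5) old.sum.simps(6) sum.exhaust)
  have "witt_poly_eval (L P) (case_sum (\<lambda>j. a j P) (\<lambda>j. b j P)) R = witt_poly_eval (L P) (\<lambda>x. v x P) R"
    by (rule E.S.witt_poly_eval_cong) (simp add: vxP E.hom_closed[OF v])
  thus "witt_poly_eval (sec V) (case_sum a b) R P = witt_poly_eval (L P) (case_sum (\<lambda>j. a j P) (\<lambda>j. b j P)) R"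
    unfolding e using E.hom_witt_poly_eval[of v R, OF v] by simp
qed

lemma Wr_add:
  assumes V: "openin T V" and "a \<in> carrier (Wr n V)" "b \<in> carrier (Wr n V)"
  shows "a \<oplus>\<^bsub>Wr n V\<^esub> b \<in> carrier (Wr n V)"
    "P \<in> V \<Longrightarrow> i < n \<Longrightarrow> (a \<oplus>\<^bsub>Wr n V\<^esub> b) i P = witt_poly_eval (L P) (case_sum (\<lambda>j. a j P) (\<lambda>j. b j P)) (witt_add_poly p i)"
proof -
  have e: "a \<oplus>\<^bsub>Wr n V\<^esub> b = (\<lambda>i\<in>{..<n}. witt_poly_eval (sec V) (case_sum a b) (witt_add_poly p i))"
    by (simp add: witt_ring_def)
  have c: "witt_poly_eval (sec V) (case_sum a b) (witt_add_poly p i) \<in> carrier (sec V)"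
    "P \<in> V \<Longrightarrow> witt_poly_eval (sec V) (case_sum a b) (witt_add_poly p i) P
      = witt_poly_eval (L P) (case_sum (\<lambda>j. a j P) (\<lambda>j. b j P)) (witt_add_poly p i)" if "i < n" for i P
    using that Wr_comp[OF assms(2)] Wr_comp[OF assms(3)] witt_add_poly_vars[OF prime_p]
    by (intro sec_poly_eval_closed[OF V, of i]; auto)+
  show "a \<oplus>\<^bsub>Wr n V\<^esub> b \<in> carrier (Wr n V)" by (auto simp: e Wr_carrier intro!: c)
  show "P \<in> V \<Longrightarrow> i < n \<Longrightarrow> (a \<oplus>\<^bsub>Wr n V\<^esub> b) i P = witt_poly_eval (L P) (case_sum (\<lambda>j. a j P) (\<lambda>j. b j P)) (witt_add_poly p i)"
    using c(2)[of i P] by (simp add: e)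
qed

lemma Wr_mult:
  assumes V: "openin T V" and "a \<in> carrier (Wr n V)" "b \<in> carrier (Wr n V)"
  shows "a \<otimes>\<^bsub>Wr n V\<^esub> b \<in> carrier (Wr n V)"
    "P \<in> V \<Longrightarrow> i < n \<Longrightarrow> (a \<otimes>\<^bsub>Wr n V\<^esub> b) i P = witt_poly_eval (L P) (case_sum (\<lambda>j. a j P) (\<lambda>j. b j P)) (witt_mult_poly p i)"
proof -
  have e: "a \<otimes>\<^bsub>Wr n V\<^esub> b = (\<lambda>i\<in>{..<n}. witt_poly_eval (sec V) (case_sum a b) (witt_mult_poly p i))"
    by (simp add: witt_ring_def)
  have c: "witt_poly_eval (sec V) (case_sum a b) (witt_mult_poly p i) \<in> carrier (sec V)"
    "P \<in> V \<Longrightarrow> witt_poly_eval (sec V) (case_sum a b) (witt_mult_poly p i) P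
      = witt_poly_eval (L P) (case_sum (\<lambda>j. a j P) (\<lambda>j. b j P)) (witt_mult_poly p i)" if "i < n" for i P
    using that Wr_comp[OF assms(2)] Wr_comp[OF assms(3)] witt_mult_poly_vars[OF prime_p]
    by (intro sec_poly_eval_closed[OF V, of i]; auto)+
  show "a \<otimes>\<^bsub>Wr n V\<^esub> b \<in> carrier (Wr n V)" by (auto simp: e Wr_carrier intro!: c)
  show "P \<in> V \<Longrightarrow> i < n \<Longrightarrow> (a \<otimes>\<^bsub>Wr n V\<^esub> b) i P = witt_poly_eval (L P) (case_sum (\<lambda>j. a j P) (\<lambda>j. b j P)) (witt_mult_poly p i)"
    using c(2)[of i P] by (simp add: e)
qed

lemma sec_pow: "openin T V \<Longrightarrow> s \<in> carrier (sec V) \<Longrightarrow> P \<in> V \<Longrightarrow> (s [^]\<^bsub>sec V\<^esub> (k::nat)) P = s P [^]\<^bsub>L P\<^esub> k"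
  using ring_hom_cring.hom_nat_pow_cring[OF sec_eval_hom] by fast

lemma Wr_frob:
  assumes V: "openin T V" and a: "a \<in> carrier (Wr n V)"
  shows "witt_frob p n (sec V) a \<in> carrier (Wr n V)"
    "P \<in> V \<Longrightarrow> i < n \<Longrightarrow> witt_frob p n (sec V) a i P = a i P [^]\<^bsub>L P\<^esub> p"
proof -
  interpret cring "sec V" by (rule sec_cring[OF V])
  show "witt_frob p n (sec V) a \<in> carrier (Wr n V)"
    using Wr_comp[OF a] by (auto simp: witt_frob_def witt_map_def Wr_carrier)
  show "P \<in> V \<Longrightarrow> i < n \<Longrightarrow> witt_frob p n (sec V) a i P = a i P [^]\<^bsub>L P\<^esub> p"
    using Wr_comp[OF a] sec_pow[OF V] by (simp add: witt_frob_def witt_map_def)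
qed

end

section \<open>From a functional on W(S) to a splitting\<close>

context frac_space
begin

lemma cmp_diff: "cmp d (a - b) = cmp d a - cmp d b"
  using cmp_add[of d "a - b" b] by simp

text \<open>The vector \<open>s\<close> is given at \<open>P\<close> by \<open>z\<^sub>i / h^(p^(i+1))\<close>; multiplying it by the
  Frobenius of the Teichmueller lift of \<open>h\<close> clears the denominators.\<close>

definition rep :: "nat \<Rightarrow> 'x \<Rightarrow> (nat \<Rightarrow> 'x \<Rightarrow> 's) \<Rightarrow> ('n, 'k) wittS \<Rightarrow> ('n, 'k) mpoly \<Rightarrow> nat \<Rightarrow> bool" where
  "rep n P s z h d \<longleftrightarrow> h \<in> Dn P \<and> hmg d h \<and> (\<forall>i. hmg (d * p ^ Suc i) (wcomp z i)) \<and>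
    (\<forall>i<n. isf P (s i P) (wcomp z i) (h ^ p ^ Suc i))"

lemma rep_exists2:
  assumes V: "openin T V" and s: "s \<in> carrier (Wr n V)" and t: "t \<in> carrier (Wr n V)" and P: "P \<in> V"
  shows "\<exists>W h d z y. openin T W \<and> P \<in> W \<and> W \<subseteq> V \<and> (\<forall>Q\<in>W. rep n Q s z h d \<and> rep n Q t y h d)"
proof -
  have c: "(case j of Inl i \<Rightarrow> s i | Inr i \<Rightarrow> t i) \<in> carrier (sec V)" if "j \<in> {..<n} <+> {..<n}" for j
    using that Wr_comp[OF s] Wr_comp[OF t] by auto
  have "\<exists>W d h a. openin T W \<and> P \<in> W \<and> W \<subseteq> V \<and> hmg d h \<and> (\<forall>Q\<in>W. h \<in> Dn Q) \<and>
    (\<forall>j\<in>{..<n} <+> {..<n}. hmg d (a j) \<and> (\<forall>Q\<in>W. isf Q ((case j of Inl i \<Rightarrow> s i | Inr i \<Rightarrow> t i) Q) (a j) h))"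
    by (rule sec_family[OF V _ c P]) (simp_all only: finite_Plus_iff finite_lessThan simp_thms)
  then obtain W d h a where W: "openin T W" "P \<in> W" "W \<subseteq> V" "hmg d h" "\<forall>Q\<in>W. h \<in> Dn Q"
    "\<forall>j\<in>{..<n} <+> {..<n}. hmg d (a j) \<and> (\<forall>Q\<in>W. isf Q ((case j of Inl i \<Rightarrow> s i | Inr i \<Rightarrow> t i) Q) (a j) h)"
    by (elim exE conjE) blast
  \<comment> \<open>A fraction over h is expanded by h^(p^(i+1) - 1) to one over h^(p^(i+1));
    components from n on are set to 0.\<close>
  define z where "z = (\<lambda>g. mkW (\<lambda>i. if i < n then a (g i) * h ^ (p ^ Suc i - 1) else 0) :: ('n, 'k) wittS)"
  have zr: "rep n Q r (z g) h d" if Q: "Q \<in> W" and g: "\<And>i. i < n \<Longrightarrow> g i \<in> {..<n} <+> {..<n} \<and> r i = (case g i of Inl i \<Rightarrow> s i | Inr i \<Rightarrow> t i)"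
    for Q r g
    unfolding rep_def
  proof (intro conjI allI impI)
    show "h \<in> Dn Q" "hmg d h" using W Q by auto
    have e: "p ^ Suc i = Suc (p ^ Suc i - 1)" for i using q_pos[of "Suc i"] by simp
    fix i
    show "hmg (d * p ^ Suc i) (wcomp (z g) i)"
    proof (cases "i < n")
      case True
      have "d * p ^ Suc i = d + (p ^ Suc i - 1) * d" by (subst e) simp
      moreover have "hmg (d + (p ^ Suc i - 1) * d) (a (g i) * h ^ (p ^ Suc i - 1))"
        using W(4,6) g[OF True] by (intro hmg_mult hmg_power) auto
      ultimately show ?thesis using True by (simp add: z_def)
    qed (simp add: z_def hmg_0)
    assume i: "i < n"
    have "isf Q (r i Q) (a (g i) * h ^ (p ^ Suc i - 1)) (h * h ^ (p ^ Suc i - 1))"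
      using W g[OF i] Q pts_of[OF W(1) Q] by (intro isf_scale Dn_power) auto
    thus "isf Q (r i Q) (wcomp (z g) i) (h ^ p ^ Suc i)"
      using i e[of i] by (simp add: z_def flip: power_Suc)
  qed
  have "rep n Q s (z Inl) h d" "rep n Q t (z Inr) h d" if "Q \<in> W" for Q
    by (rule zr[OF that], auto)+
  thus ?thesis using W(1-3) by (intro exI[of _ W] exI[of _ h] exI[of _ d] exI[of _ "z Inl"] exI[of _ "z Inr"]) simp
qed

lemma rep_add:
  assumes V: "openin T V" and s: "s \<in> carrier (Wr n V)" and t: "t \<in> carrier (Wr n V)" and P: "P \<in> V"
    and r: "rep n P s z h d" "rep n P t y h d"
  shows "rep n P (s \<oplus>\<^bsub>Wr n V\<^esub> t) (z + y) h d"
  unfolding rep_def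
proof (intro conjI allI impI)
  show "h \<in> Dn P" "hmg d h" using r by (auto simp: rep_def)
  fix i
  have "hmg (d * p * p ^ i) (peval (case_sum (wcomp z) (wcomp y)) (witt_add_poly p i))"
    by (rule hmg_peval[OF whom_witt_add_poly[OF prime_p]]) (use r in \<open>auto simp: rep_def mult.assoc split: sum.split\<close>)
  thus "hmg (d * p ^ Suc i) (wcomp (z + y) i)" by (simp add: wcomp_add wchar_p mult.assoc)
  assume i: "i < n"
  have "witt_poly_eval (L P) (case_sum (\<lambda>j. s j P) (\<lambda>j. t j P)) (witt_add_poly p i) \<otimes>\<^bsub>L P\<^esub> \<iota> P (h ^ (p * p ^ i))
      = \<iota> P (wcomp (z + y) i)"
    by (rule eval_add_scaled[OF pts_of[OF V P]]) (use r i in \<open>auto simp: rep_def isf_def\<close>)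
  moreover have "h ^ p ^ Suc i \<in> Dn P" using r pts_of[OF V P] by (intro Dn_power) (auto simp: rep_def)
  moreover have "(s \<oplus>\<^bsub>Wr n V\<^esub> t) i P \<in> carrier (L P)"
    using sec_closed[OF V Wr_comp[OF Wr_add(1)[OF V s t] i] P] .
  ultimately show "isf P ((s \<oplus>\<^bsub>Wr n V\<^esub> t) i P) (wcomp (z + y) i) (h ^ p ^ Suc i)"
    using Wr_add(2)[OF V s t P i] by (simp add: isf_def)
qed

text \<open>Frobenius replaces the denominator g^(p^(i+1)) by its p-th power, which is
  (g^p)^(p^(i+1)). Hence the product is represented over g^p h.\<close>

lemma rep_frob_mult:
  assumes V: "openin T V" and s: "s \<in> carrier (Wr n V)" and t: "t \<in> carrier (Wr n V)" and P: "P \<in> V"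
    and r: "rep n P s z g e" "rep n P t y h d"
  shows "rep n P (witt_frob p n (sec V) s \<otimes>\<^bsub>Wr n V\<^esub> t) (wfrob z * y) (g ^ p * h) (e * p + d)"
  unfolding rep_def
proof (intro conjI allI impI)
  have pt: "P \<in> pts" by (rule pts_of[OF V P])
  have D: "g \<in> Dn P" "h \<in> Dn P" using r by (auto simp: rep_def)
  show D': "g ^ p * h \<in> Dn P" using D pt by (intro Dn_mult Dn_power)
  show "hmg (e * p + d) (g ^ p * h)" using r by (auto intro!: hmg_mult hmg_power[of e g p, unfolded mult.commute[of p e]] simp: rep_def)
  fix i
  have "hmg ((e * p * p + d * p) * p ^ i) (peval (case_sum (wcomp (wfrob z)) (wcomp y)) (witt_mult_poly p i))"
  proof (rule hmg_peval[OF whom_witt_mult_poly[OF prime_p]])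
    fix x show "hmg (case x of Inl j \<Rightarrow> e * p * p * p ^ j | Inr j \<Rightarrow> d * p * p ^ j) (case_sum (wcomp (wfrob z)) (wcomp y) x)"
    proof (cases x)
      case (Inl j)
      have "hmg (p * (e * p ^ Suc j)) (wcomp z j ^ p)" using r by (intro hmg_power) (auto simp: rep_def)
      thus ?thesis using Inl by (simp add: wcomp_frob wchar_p mult_ac)
    next
      case (Inr j)
      have "hmg (d * p ^ Suc j) (wcomp y j)" using r by (auto simp: rep_def)
      thus ?thesis using Inr by (simp add: mult_ac)
    qed
  qed
  moreover have "(e * p * p + d * p) * p ^ i = (e * p + d) * p ^ Suc i" by (simp add: algebra_simps)
  ultimately show "hmg ((e * p + d) * p ^ Suc i) (wcomp (wfrob z * y) i)" unfolding wcomp_mult wchar_p by simp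
  assume i: "i < n"
  note fs = Wr_frob[OF V s]
  have "witt_poly_eval (L P) (case_sum (\<lambda>j. witt_frob p n (sec V) s j P) (\<lambda>j. t j P)) (witt_mult_poly p i) \<otimes>\<^bsub>L P\<^esub>
      \<iota> P ((g ^ (p * p) * h ^ p) ^ p ^ i) = \<iota> P (wcomp (wfrob z * y) i)"
  proof (rule eval_mult_scaled[OF pt])
    fix j assume j: "j \<le> i"
    have "isf P (s j P [^]\<^bsub>L P\<^esub> p) (wcomp z j ^ p) ((g ^ p ^ Suc j) ^ p)"
      using r i j by (intro isf_power[OF pt]) (auto simp: rep_def)
    moreover have "(g ^ p ^ Suc j) ^ p = (g ^ (p * p)) ^ p ^ j" by (simp add: mult_ac flip: power_mult)
    ultimately show "witt_frob p n (sec V) s j P \<in> carrier (L P) \<and>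
        witt_frob p n (sec V) s j P \<otimes>\<^bsub>L P\<^esub> \<iota> P ((g ^ (p * p)) ^ p ^ j) = \<iota> P (wcomp (wfrob z) j)"
      using i j fs(2)[OF P, of j] by (simp add: isf_def wcomp_frob wchar_p)
    have "isf P (t j P) (wcomp y j) (h ^ p ^ Suc j)" using r i j by (auto simp: rep_def)
    thus "t j P \<in> carrier (L P) \<and> t j P \<otimes>\<^bsub>L P\<^esub> \<iota> P ((h ^ p) ^ p ^ j) = \<iota> P (wcomp y j)"
      by (simp add: isf_def flip: power_mult)
  qed
  moreover have "(g ^ (p * p) * h ^ p) ^ p ^ i = (g ^ p * h) ^ p ^ Suc i"
    by (simp add: power_mult_distrib mult_ac flip: power_mult)
  moreover have "(g ^ p * h) ^ p ^ Suc i \<in> Dn P" using D' pt by (intro Dn_power)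
  moreover have "(witt_frob p n (sec V) s \<otimes>\<^bsub>Wr n V\<^esub> t) i P \<in> carrier (L P)"
    using sec_closed[OF V Wr_comp[OF Wr_mult(1)[OF V fs(1) t] i] P] .
  ultimately show "isf P ((witt_frob p n (sec V) s \<otimes>\<^bsub>Wr n V\<^esub> t) i P) (wcomp (wfrob z * y) i) ((g ^ p * h) ^ p ^ Suc i)"
    using Wr_mult(2)[OF V fs(1) t P i] by (simp only: isf_def)
qed

lemma rep_frob:
  assumes V: "openin T V" and s: "s \<in> carrier (Wr n V)" and P: "P \<in> V" and r: "rep n P s z h d"
  shows "rep n P (witt_frob p n (sec V) s) (wfrob z) (h ^ p) (d * p)"
  unfolding rep_def
proof (intro conjI allI impI)
  have pt: "P \<in> pts" by (rule pts_of[OF V P])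
  show "h ^ p \<in> Dn P" using r pt by (auto intro: Dn_power simp: rep_def)
  show "hmg (d * p) (h ^ p)" using r hmg_power[of d h p] by (simp add: rep_def mult.commute)
  fix i
  have "hmg (p * (d * p ^ Suc i)) (wcomp z i ^ p)" using r by (intro hmg_power) (auto simp: rep_def)
  thus "hmg (d * p * p ^ Suc i) (wcomp (wfrob z) i)" by (simp add: wcomp_frob wchar_p mult_ac)
  assume i: "i < n"
  have "isf P (s i P [^]\<^bsub>L P\<^esub> p) (wcomp z i ^ p) ((h ^ p ^ Suc i) ^ p)"
    using r i by (intro isf_power[OF pt]) (auto simp: rep_def)
  moreover have "(h ^ p ^ Suc i) ^ p = (h ^ p) ^ p ^ Suc i" by (simp add: mult_ac flip: power_mult)
  ultimately show "isf P (witt_frob p n (sec V) s i P) (wcomp (wfrob z) i) ((h ^ p) ^ p ^ Suc i)"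
    using Wr_frob(2)[OF V s P i] by (simp add: wcomp_frob wchar_p)
qed

text \<open>A vector represented by \<open>z\<close> over \<open>h\<close> of degree d is sent to
  the degree d part of \<Psi>(z) divided by v h. Passing to degree d makes the value a fraction of
  degree 0, as \<Psi> need not respect degrees, and dividing by v = cmp_0(\<Psi>(1)) turns the value
  at 1 into 1.\<close>

theorem quasi_F_split_if_psi:
  fixes \<Psi> :: "('n, 'k) wittS \<Rightarrow> ('n, 'k) mpoly"
  assumes n: "n \<ge> 1"
    and add: "\<And>w z. \<Psi> (w + z) = \<Psi> w + \<Psi> z"
    and lin: "\<And>y w. \<Psi> (wfrob y * w) = wcomp y 0 * \<Psi> w"
    and cong: "\<And>w z. (\<And>i. i < n \<Longrightarrow> f dvd wcomp w i - wcomp z i) \<Longrightarrow> f dvd \<Psi> w - \<Psi> z"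
    and unit: "\<And>P. P \<in> pts \<Longrightarrow> cmp 0 (\<Psi> 1) \<in> Dn P"
  shows "quasi_F_split p n Y"
proof -
  define v where "v = cmp 0 (\<Psi> 1)"
  have hv: "hmg 0 v" unfolding v_def by (rule cmp_hmg)
  have Dv: "v \<in> Dn P" if "P \<in> pts" for P using unit[OF that] by (simp add: v_def)
  \<comment> \<open>Two representations become congruent modulo f below n after multiplication by
    F[r h'] and F[r h]. By linearity \<Psi> turns these factors into r h' and r h, which is the
    equality of the two fractions.\<close>
  have uniq: "y = y'" if P: "P \<in> pts" and r: "rep n P s z h d" "rep n P s z' h' d'"
    and i: "isf P y (cmp d (\<Psi> z)) (v * h)" "isf P y' (cmp d' (\<Psi> z')) (v * h')" for P s z h d z' h' d' y y'
  proof -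
    have "\<exists>r\<in>Dn P. f dvd r * (wcomp z i * h' ^ p ^ Suc i - wcomp z' i * h ^ p ^ Suc i)" if "i < n" for i
      using r that by (intro isf_conv[OF P, of "s i P"]) (auto simp: rep_def)
    from common_ker[OF P finite_lessThan[of n], of "\<lambda>i. wcomp z i * h' ^ p ^ Suc i - wcomp z' i * h ^ p ^ Suc i"] this
    obtain r where r': "r \<in> Dn P" "\<And>i. i < n \<Longrightarrow> f dvd r * (wcomp z i * h' ^ p ^ Suc i - wcomp z' i * h ^ p ^ Suc i)"
      by auto
    obtain e where e: "hmg e r" using Dn_hmg[OF P r'(1)] by blast
    have hh: "hmg d h" "hmg d' h'" using r by (auto simp: rep_def)
    have "f dvd \<Psi> (wfrob (teich (r * h')) * z) - \<Psi> (wfrob (teich (r * h)) * z')"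
    proof (rule cong)
      fix i assume i: "i < n"
      have "wcomp (wfrob (teich (r * c)) * w) i = r ^ p ^ Suc i * (wcomp w i * c ^ p ^ Suc i)"
        for c and w :: "('n, 'k) wittS"
        unfolding wfrob_teich wcomp_teich_mult wchar_p
        by (simp add: power_mult_distrib mult_ac flip: power_mult)
      hence "wcomp (wfrob (teich (r * h')) * z) i - wcomp (wfrob (teich (r * h)) * z') i
          = r ^ (p ^ Suc i - 1) * (r * (wcomp z i * h' ^ p ^ Suc i - wcomp z' i * h ^ p ^ Suc i))"
        using q_pos[of "Suc i"] by (simp add: right_diff_distrib flip: mult.assoc power_Suc2)
      thus "f dvd wcomp (wfrob (teich (r * h')) * z) i - wcomp (wfrob (teich (r * h)) * z') i"
        using r'(2)[OF i] by (metis dvd_mult)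
    qed
    hence "f dvd r * h' * \<Psi> z - r * h * \<Psi> z'" by (simp add: lin)
    hence "f dvd cmp ((e + d') + d) (r * h' * \<Psi> z) - cmp ((e + d) + d') (r * h * \<Psi> z')"
      using cmp_dvd[of "r * h' * \<Psi> z - r * h * \<Psi> z'" "e + d' + d"] by (simp add: cmp_diff add_ac)
    hence "f dvd r * h' * cmp d (\<Psi> z) - r * h * cmp d' (\<Psi> z')"
      using e hh by (simp only: cmp_mult hmg_mult)
    hence "f dvd v * (r * h' * cmp d (\<Psi> z) - r * h * cmp d' (\<Psi> z'))" by (rule dvd_mult)
    hence "f dvd r * (cmp d (\<Psi> z) * (v * h')) - r * (cmp d' (\<Psi> z') * (v * h))"
      by (simp add: algebra_simps)
    thus "y = y'" by (rule isf_eqI[OF P i r'(1)])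
  qed
  \<comment> \<open>The choice of a representation is harmless by \<open>uniq\<close>; since psv
    depends on the germs alone, compatibility with restriction is immediate.\<close>
  define psv where "psv = (\<lambda>P s. SOME y. \<exists>z h d. rep n P s z h d \<and> isf P y (cmp d (\<Psi> z)) (v * h))"
  have psv: "isf P (psv P s) (cmp d (\<Psi> z)) (v * h)" if P: "P \<in> pts" and r: "rep n P s z h d" for P s z h d
  proof -
    have "v * h \<in> Dn P" using Dv[OF P] r P by (intro Dn_mult) (auto simp: rep_def)
    hence i: "isf P (fracv P (cmp d (\<Psi> z)) (v * h)) (cmp d (\<Psi> z)) (v * h)" by (rule isf_fracv[OF P])
    hence ex: "\<exists>y z h d. rep n P s z h d \<and> isf P y (cmp d (\<Psi> z)) (v * h)" using r by blast
    from someI_ex[OF this] obtain z' h' d' where "rep n P s z' h' d'" "isf P (psv P s) (cmp d' (\<Psi> z')) (v * h')"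
      unfolding psv_def by blast
    from uniq[OF P this(1) r this(2) i] show ?thesis using i by simp
  qed
  have psv_eq: "psv P s = psv P t" if "\<And>i. i < n \<Longrightarrow> s i P = t i P" for P s t
  proof -
    have "rep n P s = rep n P t" using that by (auto simp: rep_def fun_eq_iff)
    thus ?thesis by (simp add: psv_def)
  qed
  define \<psi> where "\<psi> = (\<lambda>V s. \<lambda>P\<in>V. psv P s)"
  have closed: "\<psi> V s \<in> carrier (sec V)" if V: "openin T V" and s: "s \<in> carrier (Wr n V)" for V s
  proof (rule secI[OF V])
    show "\<psi> V s \<in> extensional V" by (simp add: \<psi>_def)
    fix P assume P: "P \<in> V"
    from rep_exists2[OF V s s P] obtain W h d z where W: "openin T W" "P \<in> W" "W \<subseteq> V" "\<forall>Q\<in>W. rep n Q s z h d"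
      by (elim exE conjE) blast
    have "isf Q (\<psi> V s Q) (cmp d (\<Psi> z)) (v * h)" if "Q \<in> W" for Q
      using psv[OF pts_of[OF W(1) that], of s z h d] W that by (auto simp: \<psi>_def)
    moreover have "hmg d h" using W by (auto simp: rep_def)
    hence "hmg d (v * h)" using hmg_mult[OF hv, of d h] by simp
    ultimately show "\<exists>W d a h. openin T W \<and> P \<in> W \<and> W \<subseteq> V \<and> hmg d a \<and> hmg d h \<and> (\<forall>Q\<in>W. isf Q (\<psi> V s Q) a h)"
      using W cmp_hmg[of d "\<Psi> z"] by (intro exI[of _ W] exI[of _ d] exI[of _ "cmp d (\<Psi> z)"] exI[of _ "v * h"]) simp
  qed
  have psi_add: "\<psi> V (a \<oplus>\<^bsub>Wr n V\<^esub> b) = \<psi> V a \<oplus>\<^bsub>sec V\<^esub> \<psi> V b"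
    if V: "openin T V" and a: "a \<in> carrier (Wr n V)" and b: "b \<in> carrier (Wr n V)" for V a b
  proof -
    have "psv P (a \<oplus>\<^bsub>Wr n V\<^esub> b) = psv P a \<oplus>\<^bsub>L P\<^esub> psv P b" if P: "P \<in> V" for P
    proof -
      note pt = pts_of[OF V P]
      from rep_exists2[OF V a b P] obtain h d z y where r: "rep n P a z h d" "rep n P b y h d" by blast
      from isf_add[OF pt psv[OF pt r(1)] psv[OF pt r(2)]]
      have "isf P (psv P a \<oplus>\<^bsub>L P\<^esub> psv P b) (cmp d (\<Psi> (z + y))) (v * h)" by (simp add: add cmp_add)
      thus ?thesis using isf_uniq[OF pt psv[OF pt rep_add[OF V a b P r]]] by simp
    qed
    thus ?thesis by (auto simp: \<psi>_def sec_add fun_eq_iff)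
  qed
  have res: "isf P (witt_res a P) (wcomp z 0) (h ^ p)" if "rep n P a z h d" for P a z h d
    using that n by (auto simp: rep_def witt_res_def)
  have psi_mult: "\<psi> V (witt_frob p n (sec V) a \<otimes>\<^bsub>Wr n V\<^esub> b) = witt_res a \<otimes>\<^bsub>sec V\<^esub> \<psi> V b"
    if V: "openin T V" and a: "a \<in> carrier (Wr n V)" and b: "b \<in> carrier (Wr n V)" for V a b
  proof -
    have "psv P (witt_frob p n (sec V) a \<otimes>\<^bsub>Wr n V\<^esub> b) = witt_res a P \<otimes>\<^bsub>L P\<^esub> psv P b" if P: "P \<in> V" for P
    proof -
      note pt = pts_of[OF V P]
      from rep_exists2[OF V a b P] obtain h d z y where r: "rep n P a z h d" "rep n P b y h d" by blast
      have hz: "hmg (d * p) (wcomp z 0)" using r by (auto simp: rep_def dest: spec[of _ 0])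
      from isf_mult[OF pt res[OF r(1)] psv[OF pt r(2)]]
      have "isf P (witt_res a P \<otimes>\<^bsub>L P\<^esub> psv P b) (cmp (d * p + d) (\<Psi> (wfrob z * y))) (v * (h ^ p * h))"
        unfolding lin cmp_mult[OF hz] by (simp add: mult_ac)
      thus ?thesis using isf_uniq[OF pt psv[OF pt rep_frob_mult[OF V a b P r]]] by simp
    qed
    thus ?thesis by (auto simp: \<psi>_def sec_mult fun_eq_iff)
  qed
  have psi_frob: "\<psi> V (witt_frob p n (sec V) a) = witt_res a"
    if V: "openin T V" and a: "a \<in> carrier (Wr n V)" for V a
  proof (rule sec_ext[OF V])
    show "\<psi> V (witt_frob p n (sec V) a) \<in> carrier (sec V)" by (rule closed[OF V Wr_frob(1)[OF V a]])
    show "witt_res a \<in> carrier (sec V)" using Wr_comp[OF a, of 0] n by (simp add: witt_res_def)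
    fix P assume P: "P \<in> V"
    note pt = pts_of[OF V P]
    from rep_exists2[OF V a a P] obtain h d z where r: "rep n P a z h d" by blast
    have hz: "hmg (d * p) (wcomp z 0)" using r by (auto simp: rep_def dest: spec[of _ 0])
    have "isf P (witt_res a P) (wcomp z 0 * v) (h ^ p * v)" by (rule isf_scale[OF pt res[OF r] Dv[OF pt]])
    moreover have "cmp (d * p) (\<Psi> (wfrob z)) = wcomp z 0 * v"
      using cmp_mult[OF hz, of 0 "\<Psi> 1"] lin[of z 1] by (simp add: v_def)
    ultimately have "isf P (witt_res a P) (cmp (d * p) (\<Psi> (wfrob z))) (v * h ^ p)" by (simp add: mult.commute)
    thus "\<psi> V (witt_frob p n (sec V) a) P = witt_res a P"
      using isf_uniq[OF pt psv[OF pt rep_frob[OF V a P r]]] P by (simp add: \<psi>_def)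
  qed
  have Y: "zariski Y = T" "restr Y V W s = restrict s W" for V W s by (simp_all add: function_sheaf_def)
  have psi_restr: "\<psi> W (witt_map n (restr Y V W) a) = restr Y V W (\<psi> V a)" if "W \<subseteq> V" for V W a
  proof
    fix P show "\<psi> W (witt_map n (restr Y V W) a) P = restr Y V W (\<psi> V a) P"
    proof (cases "P \<in> W")
      case True
      have "psv P (witt_map n (restr Y V W) a) = psv P a"
        by (rule psv_eq) (use True in \<open>simp add: witt_map_def Y\<close>)
      thus ?thesis using True that by (auto simp: \<psi>_def Y)
    qed (simp add: \<psi>_def Y)
  qed
  have "witt_module_hom p n Y \<psi>"
    unfolding witt_module_hom_def Let_def Y(1)
    using closed psi_add psi_mult psi_restr by (intro allI impI conjI) (auto simp del: mult_Suc)
  thus ?thesis unfolding quasi_F_split_def Y(1) using psi_frob by blast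
qed

end

section \<open>Graded Witt vectors\<close>

lemma whom_Delta1:
  fixes a :: "('n, 'k::field) mpoly"
  assumes "whom wt d a"
  shows "whom wt (p * d) (Delta1 p a)"
  unfolding Delta1_def
proof (intro whom_sum whom_of_nat_mult)
  fix \<alpha> assume "\<alpha> \<in> {\<alpha>. \<alpha> \<in> (\<Pi>\<^sub>E m\<in>keys a. {0..p - 1}) \<and> (\<Sum>m\<in>keys a. \<alpha> m) = p}"
  hence s: "(\<Sum>m\<in>keys a. \<alpha> m) = p" by simp
  have "whom wt (\<Sum>m\<in>keys a. \<alpha> m * d) (\<Prod>m\<in>keys a. single m (lookup a m) ^ \<alpha> m)"
    using assms by (intro whom_prod whom_power whom_single) (simp add: whom_def)
  thus "whom wt (p * d) (\<Prod>m\<in>keys a. single m (lookup a m) ^ \<alpha> m)"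
    using s by (simp flip: sum_distrib_right)
qed

definition witt_graded :: "('v \<Rightarrow> nat) \<Rightarrow> nat \<Rightarrow> ('q::semiring_1, ('v \<Rightarrow>\<^sub>0 nat) \<Rightarrow>\<^sub>0 'c::comm_ring_1) witt \<Rightarrow> bool" where
  "witt_graded wt d w \<longleftrightarrow> (\<forall>i. whom wt (d * wchar TYPE('q) ^ i) (wcomp w i))"

lemma witt_graded_add: "witt_graded wt d w \<Longrightarrow> witt_graded wt d z \<Longrightarrow> witt_graded wt d (w + z)"
  for w z :: "('q::semiring_1, ('v \<Rightarrow>\<^sub>0 nat) \<Rightarrow>\<^sub>0 'c::comm_ring_1) witt"
  unfolding witt_graded_def wcomp_add
  by (intro allI whom_peval[OF whom_witt_add_poly[OF wchar_prime]]) (auto split: sum.split)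

lemma witt_graded_mult: "witt_graded wt d w \<Longrightarrow> witt_graded wt e z \<Longrightarrow> witt_graded wt (d + e) (w * z)"
  for w z :: "('q::semiring_1, ('v \<Rightarrow>\<^sub>0 nat) \<Rightarrow>\<^sub>0 'c::comm_ring_1) witt"
  unfolding witt_graded_def wcomp_mult
  by (intro allI whom_peval[OF whom_witt_mult_poly[OF wchar_prime]]) (auto split: sum.split)

lemma witt_graded_0 [simp]: "witt_graded wt d 0"
  by (simp add: witt_graded_def)

lemma witt_graded_teich: "whom wt d c \<Longrightarrow> witt_graded wt d (teich c)"
  by (simp add: witt_graded_def wcomp_teich)

lemma witt_graded_uminus: "witt_graded wt d w \<Longrightarrow> witt_graded wt d (- w)"
  for w :: "('q::semiring_1, ('v \<Rightarrow>\<^sub>0 nat) \<Rightarrow>\<^sub>0 'c::comm_ring_1) witt"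
proof -
  assume w: "witt_graded wt d w"
  have "whom wt 0 (peval (wcomp (1 :: ('q, ('v \<Rightarrow>\<^sub>0 nat) \<Rightarrow>\<^sub>0 'c) witt)) (witt_neg_poly (wchar TYPE('q)) i))" for i
    by (rule whom_peval[where wt = "\<lambda>_. 0"]) (auto simp: whom_def wdeg_def wcomp_1 one_poly_mapping.rep_eq in_keys_iff when_def split: if_splits)
  hence "witt_graded wt 0 (- 1 :: ('q, ('v \<Rightarrow>\<^sub>0 nat) \<Rightarrow>\<^sub>0 'c) witt)"
    by (simp add: witt_graded_def uminus_witt_def wneg_def)
  from witt_graded_mult[OF this w] show ?thesis by simp
qed

lemma witt_graded_diff: "witt_graded wt d w \<Longrightarrow> witt_graded wt d z \<Longrightarrow> witt_graded wt d (w - z)"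
  for w z :: "('q::semiring_1, ('v \<Rightarrow>\<^sub>0 nat) \<Rightarrow>\<^sub>0 'c::comm_ring_1) witt"
  using witt_graded_add[of wt d w "- z"] witt_graded_uminus[of wt d z] by simp

lemma witt_graded_sum:
  "(\<And>x. x \<in> A \<Longrightarrow> witt_graded wt d (g x)) \<Longrightarrow> witt_graded wt d (sum g A :: ('q::semiring_1, ('v \<Rightarrow>\<^sub>0 nat) \<Rightarrow>\<^sub>0 'c::comm_ring_1) witt)"
  by (induction A rule: infinite_finite_induct) (auto intro: witt_graded_add)

lemma wcomp_verpow: "wcomp ((ver ^^ k) w) i = (if i < k then 0 else wcomp w (i - k))"
  by (induction k arbitrary: i) (auto simp: wcomp_ver)

lemma verpow_add: "(ver ^^ k) (w + z) = (ver ^^ k) w + (ver ^^ k) (z :: ('q::semiring_1, 'a::comm_ring_1) witt)"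
  by (induction k) (simp_all add: ver_add)

lemma verpow_0 [simp]: "(ver ^^ k) 0 = 0"
  by (induction k) simp_all

context perfect_poly
begin

lemma witt_graded_ver: "witt_graded wt (d * p) (w :: ('n, 'k) wittS) \<Longrightarrow> witt_graded wt d (ver w)"
  unfolding witt_graded_def wchar_p
proof
  fix i assume "\<forall>i. whom wt (d * p * p ^ i) (wcomp w i)"
  thus "whom wt (d * p ^ i) (wcomp (ver w) i)" by (cases i) (simp_all add: mult.assoc)
qed

lemma witt_graded_ver_imp: "witt_graded wt d (ver w) \<Longrightarrow> witt_graded wt (d * p) (w :: ('n, 'k) wittS)"
  unfolding witt_graded_def wchar_p
proof
  fix i assume "\<forall>i. whom wt (d * p ^ i) (wcomp (ver w) i)"
  from spec[OF this, of "Suc i"] show "whom wt (d * p * p ^ i) (wcomp w i)" by (simp add: mult.assoc)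
qed

lemma witt_graded_verpow: "witt_graded wt (d * p ^ k) (w :: ('n, 'k) wittS) \<Longrightarrow> witt_graded wt d ((ver ^^ k) w)"
  by (induction k arbitrary: d) (auto intro: witt_graded_ver simp: mult_ac)

lemma lookup_frob: "lookup (a ^ p) (expo (\<lambda>i. p * lookup m i)) = lookup (a :: ('n, 'k) mpoly) m ^ p"
proof (induction a rule: poly_mapping_induct_add)
  case (single l c)
  have "expo (\<lambda>i. p * lookup l i) = expo (\<lambda>i. p * lookup m i) \<longleftrightarrow> l = m"
    using p_gt_0 by (auto simp: expo_eq_iff poly_mapping_eq_iff fun_eq_iff)
  thus ?case using zero_power[OF p_gt_0, where 'a = 'k] by (simp add: single_power lookup_single when_def)
next
  case (add a b)
  have "(lookup a m + lookup b m) ^ p = lookup a m ^ p + lookup b m ^ p"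
    using frob_add_k[of "lookup a m" "lookup b m" 1] by simp
  thus ?case using add by (simp add: frob_add lookup_add)
qed (use zero_power[OF p_gt_0, where 'a = 'k] zero_power_p p_gt_0 in simp)

lemma whom_frob_imp: "whom wt (d * p) (a ^ p) \<Longrightarrow> whom wt d (a :: ('n, 'k) mpoly)"
  unfolding whom_def
proof
  fix m assume k: "\<forall>m\<in>keys (a ^ p). wdeg wt m = d * p" and m: "m \<in> keys a"
  have "expo (\<lambda>i. p * lookup m i) \<in> keys (a ^ p)"
    using m by (simp add: in_keys_iff lookup_frob)
  hence "wdeg wt (expo (\<lambda>i. p * lookup m i)) = d * p" using k by blast
  moreover have "wdeg wt (expo (\<lambda>i. p * lookup m i)) = p * wdeg wt m"
    by (simp add: wdeg_superset[of UNIV] sum_distrib_left mult.assoc)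
  ultimately show "wdeg wt m = d" using p_gt_0 by simp
qed

lemma witt_graded_wfrob_imp: "witt_graded wt (d * p) (wfrob w) \<Longrightarrow> witt_graded wt d (w :: ('n, 'k) wittS)"
  unfolding witt_graded_def wcomp_frob wchar_p
proof
  fix i assume "\<forall>i. whom wt (d * p * p ^ i) (wcomp w i ^ p)"
  hence "whom wt (d * p * p ^ i) (wcomp w i ^ p)" by blast
  moreover have "d * p * p ^ i = d * p ^ i * p" by simp
  ultimately show "whom wt (d * p ^ i) (wcomp w i)" by (metis whom_frob_imp)
qed

text \<open>Component i+1 of p w = V F w is w_i^p, and the exponents of a p-th power are p times
  those of its base. This lets functionals be applied to a quotient by p.\<close>

lemma witt_graded_p_imp: "witt_graded wt d (of_nat p * w) \<Longrightarrow> witt_graded wt d (w :: ('n, 'k) wittS)"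
  unfolding p_mult by (rule witt_graded_wfrob_imp[OF witt_graded_ver_imp])

lemma witt_graded_tau: "whom wt d a \<Longrightarrow> witt_graded wt d (tau a)"
  unfolding tau_def by (intro witt_graded_sum witt_graded_teich whom_single) (auto simp: whom_def)

lemma witt_graded_Delta: "whom wt d a \<Longrightarrow> witt_graded wt (d * p) (Delta a)"
  by (rule witt_graded_ver_imp) (auto simp: ver_Delta intro: witt_graded_diff witt_graded_teich witt_graded_tau)

lemma wcomp_dvd_diff':
  fixes w z :: "('n, 'k) wittS"
  assumes "\<And>i. d dvd wcomp w i" "\<And>i. d dvd wcomp z i"
  shows "d dvd wcomp (w - z) i"
proof (rule wcomp_dvd_diff)
  fix i show "d dvd wcomp w i - wcomp z i" using assms[of i] by (rule dvd_diff)
qed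

lemma single_frob_pow: "\<exists>l d. single m c ^ k = (single l d :: ('n, 'k) mpoly)"
  by (metis single_power)

end

text \<open>What a splitting yields in both geometric settings. \<open>\<nu> d\<close> takes vectors
  whose component i has degree d p^(i+1), so that dividing by F[h] with h of degree d leaves degree
  0; \<open>nu_scale\<close> is linearity over F[c].\<close>

locale graded_functional = frac_target p ty f L \<iota>
  for p :: nat and ty :: "('n::finite \<times> 'k::field) itself" and f :: "('n, 'k) mpoly"
    and L :: "('b, 'c) ring_scheme" (structure) and \<iota> +
  fixes wt :: "'n \<Rightarrow> nat" and \<delta> n :: nat and \<nu> :: "nat \<Rightarrow> ('n, 'k) wittS \<Rightarrow> 'b"
  assumes n_pos: "n \<ge> 1" and f_hom: "whom wt \<delta> f"
    and nu_closed: "witt_graded wt (d * p) w \<Longrightarrow> \<nu> d w \<in> carrier L"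
    and nu_add: "witt_graded wt (d * p) w \<Longrightarrow> witt_graded wt (d * p) z \<Longrightarrow> \<nu> d (w + z) = \<nu> d w \<oplus> \<nu> d z"
    and nu_scale: "whom wt e c \<Longrightarrow> witt_graded wt (d * p) w \<Longrightarrow> \<nu> (e + d) (teich (c ^ p) * w) = \<iota> c \<otimes> \<nu> d w"
    and nu_cong: "witt_graded wt (d * p) w \<Longrightarrow> witt_graded wt (d * p) z \<Longrightarrow>
      (\<And>i. i < n \<Longrightarrow> f dvd wcomp w i - wcomp z i) \<Longrightarrow> \<nu> d w = \<nu> d z"
    and nu_one: "\<nu> 0 1 = \<one>"
begin

lemma nu_0: "\<nu> d 0 = \<zero>"
  using nu_add[of d 0 0] nu_closed[of d 0] by simp

lemma nu_cong_0: "witt_graded wt (d * p) w \<Longrightarrow> (\<And>i. i < n \<Longrightarrow> f dvd wcomp w i) \<Longrightarrow> \<nu> d w = \<zero>"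
  using nu_cong[of d w 0] by (simp add: nu_0)

lemma char_p: "x \<in> carrier L \<Longrightarrow> [p] \<cdot> x = \<zero>"
proof -
  assume x: "x \<in> carrier L"
  have "\<iota> (of_nat k) \<otimes> x = [k] \<cdot> x" for k :: nat
    using x by (induction k) (simp_all add: iota_0 iota_add iota_1 iota_closed L.l_distr L.add.nat_pow_Suc L.a_comm)
  from this[of p] show ?thesis using x by (simp add: of_nat_p iota_0)
qed

lemma nu_p_mult: "witt_graded wt (d * p) w \<Longrightarrow> \<nu> d (of_nat p * w) = \<zero>"
proof -
  assume w: "witt_graded wt (d * p) w"
  have "witt_graded wt (d * p) (of_nat k * w) \<and> \<nu> d (of_nat k * w) = [k] \<cdot> \<nu> d w" for k :: nat
  proof (induction k)
    case (Suc k)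
    have "of_nat (Suc k) * w = of_nat k * w + w" by (simp add: algebra_simps)
    thus ?case using Suc w nu_closed[OF w] by (simp only: witt_graded_add nu_add L.add.nat_pow_Suc simp_thms)
  qed (simp add: nu_0)
  thus ?thesis using char_p[OF nu_closed[OF w]] by simp
qed

text \<open>The functional on \<open>V\<^sup>i w\<close> for \<open>w\<close> of degree \<open>e\<close>; it can be nonzero only if \<open>V\<^sup>i w\<close> has an
  integral degree \<open>d\<close>, in the normalization in which \<open>w\<^sub>j\<close> has degree \<open>d p\<^sup>j\<^sup>+\<^sup>1\<close>.\<close>

definition N :: "nat \<Rightarrow> nat \<Rightarrow> ('n, 'k) wittS \<Rightarrow> 'b" where
  "N i e w = (if p ^ Suc i dvd e then \<nu> (e div p ^ Suc i) ((ver ^^ i) w) else \<zero>)"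

lemma N_graded:
  fixes w :: "('n, 'k) wittS"
  assumes "witt_graded wt e w" "p ^ Suc i dvd e"
  shows "witt_graded wt (e div p ^ Suc i * p) ((ver ^^ i) w)"
proof -
  have "e div p ^ Suc i * p * p ^ i = e div p ^ Suc i * p ^ Suc i" by simp
  also have "\<dots> = e" using assms(2) by (rule dvd_div_mult_self)
  finally have "witt_graded wt (e div p ^ Suc i * p * p ^ i) w" using assms(1) by (simp only:)
  thus ?thesis by (rule witt_graded_verpow)
qed

lemma N_closed: "witt_graded wt e w \<Longrightarrow> N i e w \<in> carrier L"
  unfolding N_def using nu_closed N_graded by simp

lemma N_add: "witt_graded wt e w \<Longrightarrow> witt_graded wt e z \<Longrightarrow> N i e (w + z) = N i e w \<oplus> N i e z"
  unfolding N_def using nu_add N_graded by (simp add: verpow_add)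

lemma N_0: "N i e 0 = \<zero>"
  by (simp add: N_def nu_0)

lemma N_cong_0: "witt_graded wt e w \<Longrightarrow> (\<And>j. f dvd wcomp w j) \<Longrightarrow> N i e w = \<zero>"
  unfolding N_def using nu_cong_0 N_graded by (simp add: wcomp_verpow)

lemma N_top: "witt_graded wt e w \<Longrightarrow> N n e w = \<zero>"
  unfolding N_def using nu_cong_0 N_graded[of e w n] by (simp add: wcomp_verpow)

lemma N_pcong:
  assumes "witt_graded wt e w" "witt_graded wt e z" "of_nat p dvd w - z"
  shows "N i e w = N i e z"
proof -
  obtain x where x: "w - z = of_nat p * x" using assms(3) by (auto elim: dvdE)
  have px: "witt_graded wt e (of_nat p * x)" unfolding x[symmetric] using assms by (intro witt_graded_diff)
  have "N i e (of_nat p * x) = \<zero>"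
  proof (cases "p ^ Suc i dvd e")
    case True
    have "(ver ^^ k) (of_nat p * x) = of_nat p * (ver ^^ k) x" for k
      by (induction k) (simp_all add: p_mult_ver)
    thus ?thesis using nu_p_mult[OF N_graded[OF witt_graded_p_imp[OF px] True]] True by (simp add: N_def)
  qed (simp add: N_def)
  moreover have "w = of_nat p * x + z" using x by (metis diff_add_cancel)
  ultimately show ?thesis using N_add[OF px assms(2)] N_closed[OF assms(2)] by simp
qed

lemma N_ver: "N i e (ver w) = N (Suc i) (e * p) w"
proof -
  have e: "p ^ Suc (Suc i) = p ^ Suc i * p" by simp
  have "(ver ^^ i) (ver w) = (ver ^^ Suc i) w" by (simp only: funpow_Suc_right o_apply)
  moreover have "p ^ Suc (Suc i) dvd e * p \<longleftrightarrow> p ^ Suc i dvd e"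
    unfolding e using p_gt_0 by (simp del: power_Suc)
  moreover have "e * p div p ^ Suc (Suc i) = e div p ^ Suc i"
    unfolding e using p_gt_0 by (simp del: power_Suc)
  ultimately show ?thesis unfolding N_def by simp
qed

lemma N_scale:
  assumes "whom wt e c" "witt_graded wt d w"
  shows "N i (e * p ^ Suc i + d) (teich (c ^ p ^ Suc i) * w) = \<iota> c \<otimes> N i d w"
proof (cases "p ^ Suc i dvd d")
  case True
  have t: "(ver ^^ k) (teich (a ^ p ^ k) * w) = teich a * (ver ^^ k) w" for k a
  proof (induction k arbitrary: a w)
    case (Suc k)
    have "(ver ^^ Suc k) (teich (a ^ p ^ Suc k) * w) = ver ((ver ^^ k) (teich ((a ^ p) ^ p ^ k) * w))"
      by (simp add: power_mult)
    also have "\<dots> = teich a * ver ((ver ^^ k) w)" unfolding Suc teich_ver ..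
    finally show ?case by simp
  qed simp
  have "c ^ p ^ Suc i = (c ^ p) ^ p ^ i" by (simp add: power_mult)
  hence "(ver ^^ i) (teich (c ^ p ^ Suc i) * w) = teich (c ^ p) * (ver ^^ i) w" by (simp only: t)
  moreover have "(e * p ^ Suc i + d) div p ^ Suc i = e + d div p ^ Suc i"
    using q_pos[of "Suc i"] by (subst div_mult_self3) auto
  moreover have "p ^ Suc i dvd e * p ^ Suc i + d" using True by simp
  ultimately show ?thesis using True nu_scale[OF assms(1) N_graded[OF assms(2) True]] by (simp only: N_def if_True)
next
  case False
  hence "\<not> p ^ Suc i dvd e * p ^ Suc i + d" by (metis dvd_add_right_iff dvd_triv_right)
  thus ?thesis using False iota_closed by (simp add: N_def)
qed

text \<open>Defined monomial by monomial because \<open>N\<close> is additive only within one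
  degree. For homogeneous \<open>a\<close> it is the value on V^i tau(a), by
  \<open>Lam_hom\<close>.\<close>

definition Lam :: "nat \<Rightarrow> ('n, 'k) mpoly \<Rightarrow> 'b" where
  "Lam i a = (\<Oplus>m\<in>keys a. N i (wdeg wt m) (teich (single m (lookup a m))))"

lemma single_graded: "witt_graded wt (wdeg wt m) (teich (single m c) :: ('n, 'k) wittS)"
  by (intro witt_graded_teich whom_single) simp

lemma Lam_superset:
  assumes "finite A" "keys a \<subseteq> A"
  shows "Lam i a = (\<Oplus>m\<in>A. N i (wdeg wt m) (teich (single m (lookup a m))))"
  unfolding Lam_def using assms
  by (intro L.add.finprod_mono_neutral_cong_left) (auto simp: N_0 in_keys_iff intro: N_closed single_graded)

lemma Lam_closed: "Lam i a \<in> carrier L"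
  unfolding Lam_def by (intro L.finsum_closed) (auto intro: N_closed single_graded)

lemma Lam_single: "Lam i (single m c) = N i (wdeg wt m) (teich (single m c))"
  using N_closed[OF single_graded[of m c], of i] by (subst Lam_superset[of "{m}"]) (simp_all add: L.finsum_insert)

lemma Lam_add: "Lam i (a + b) = Lam i a \<oplus> Lam i b"
proof -
  let ?A = "keys a \<union> keys b"
  have g: "(\<lambda>m. N i (wdeg wt m) (teich (single m (lookup c m)))) \<in> ?A \<rightarrow> carrier L" for c
    by (auto intro: N_closed single_graded)
  have e: "N i (wdeg wt m) (teich (single m (x + y))) = N i (wdeg wt m) (teich (single m x)) \<oplus> N i (wdeg wt m) (teich (single m y))" for m x y
    using N_pcong[OF single_graded witt_graded_add[OF single_graded single_graded] teich_single_add]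
      N_add[OF single_graded single_graded] by metis
  have "Lam i (a + b) = (\<Oplus>m\<in>?A. N i (wdeg wt m) (teich (single m (lookup a m))) \<oplus> N i (wdeg wt m) (teich (single m (lookup b m))))"
    by (subst Lam_superset[OF _ Poly_Mapping.keys_add]) (simp_all add: lookup_add e)
  also have "\<dots> = Lam i a \<oplus> Lam i b"
    using Lam_superset[of ?A a i] Lam_superset[of ?A b i] by (simp add: L.finsum_addf[OF g g])
  finally show ?thesis .
qed

lemma Lam_0: "Lam i 0 = \<zero>"
  by (simp add: Lam_def)

lemma Lam_hom:
  assumes "whom wt e a"
  shows "Lam i a = N i e (tau a)"
proof -
  have "finite A \<Longrightarrow> A \<subseteq> keys a \<Longrightarrow> N i e (\<Sum>m\<in>A. teich (single m (lookup a m)))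
      = (\<Oplus>m\<in>A. N i e (teich (single m (lookup a m))))" for A
  proof (induction A rule: finite_induct)
    case (insert m A)
    have g: "witt_graded wt e (teich (single l (lookup a l)) :: ('n, 'k) wittS)" if "l \<in> insert m A" for l
      using insert.prems assms that by (intro witt_graded_teich whom_single) (auto simp: whom_def)
    have "N i e (\<Sum>m\<in>insert m A. teich (single m (lookup a m))) = N i e (teich (single m (lookup a m))) \<oplus>
        N i e (\<Sum>m\<in>A. teich (single m (lookup a m)))"
      using insert.hyps g by (simp add: N_add witt_graded_sum)
    also have "\<dots> = (\<Oplus>m\<in>insert m A. N i e (teich (single m (lookup a m))))"
      using insert g by (subst L.finsum_insert) (auto intro: N_closed)
    finally show ?case .
  qed (simp add: N_0)
  from this[of "keys a"] have "N i e (tau a) = (\<Oplus>m\<in>keys a. N i e (teich (single m (lookup a m))))"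
    by (simp add: tau_def)
  also have "\<dots> = Lam i a" unfolding Lam_def
    using assms by (intro L.finsum_cong') (auto simp: whom_def intro: N_closed single_graded)
  finally show ?thesis ..
qed

lemma Lam_mult: "Lam i (c ^ p ^ Suc i * a) = \<iota> c \<otimes> Lam i a"
proof (induction a rule: poly_mapping_induct_add)
  case (single m d)
  show ?case
  proof (induction c rule: poly_mapping_induct_add)
    case (single l g)
    obtain l' g' where lg: "single l g ^ p ^ Suc i = (single l' g' :: ('n, 'k) mpoly)"
      using single_frob_pow by blast
    have h: "whom wt (p ^ Suc i * wdeg wt l + wdeg wt m) (single l g ^ p ^ Suc i * single m d)"
      by (intro whom_mult whom_power whom_single) simp_all
    have "Lam i (single l g ^ p ^ Suc i * single m d) = N i (p ^ Suc i * wdeg wt l + wdeg wt m) (tau (single l g ^ p ^ Suc i * single m d))"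
      by (rule Lam_hom[OF h])
    also have "tau (single l g ^ p ^ Suc i * single m d) = teich (single l g ^ p ^ Suc i) * teich (single m d)"
      unfolding lg by (simp add: tau_single_mult tau_single)
    also have "N i (p ^ Suc i * wdeg wt l + wdeg wt m) \<dots> = \<iota> (single l g) \<otimes> N i (wdeg wt m) (teich (single m d))"
      unfolding mult.commute[of "p ^ Suc i"] by (rule N_scale[OF whom_single[OF refl] single_graded])
    finally show ?case by (simp only: Lam_single)
  next
    case zero
    show ?case using zero_power[OF q_pos[of "Suc i"], where 'a = "('n, 'k) mpoly"] Lam_closed by (simp add: Lam_0 iota_0)
  next
    case (add a b)
    thus ?case using Lam_closed iota_closed
      by (simp only: frob_add_S distrib_right Lam_add iota_add L.l_distr)
  qed
next
  case (add a b)
  thus ?case using Lam_closed iota_closed by (simp only: distrib_left Lam_add L.r_distr)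
qed (use iota_closed in \<open>simp add: Lam_0\<close>)

text \<open>For a monomial m one has V[m^p] = V F[m] = p [m]. So the value at level i on [m^p] is
  the value at level i-1 on a multiple of p, which is zero.\<close>

lemma Lam_frob: "i \<ge> 1 \<Longrightarrow> Lam i (c ^ p) = \<zero>"
proof (induction c rule: poly_mapping_induct_add)
  case (single m c)
  then obtain j where j: "i = Suc j" by (cases i) auto
  obtain m' c' where mc: "single m c ^ p = (single m' c' :: ('n, 'k) mpoly)" using single_frob_pow by blast
  have h: "whom wt (wdeg wt m * p) (single m c ^ p)"
    unfolding mult.commute[of "wdeg wt m"] by (intro whom_power whom_single refl)
  have pm: "of_nat p * teich (single m c) = (ver (teich (single m c ^ p)) :: ('n, 'k) wittS)"
    by (simp add: p_mult wfrob_teich wchar_p)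
  have "Lam i (single m c ^ p) = N j (wdeg wt m) (ver (tau (single m c ^ p)))"
    unfolding Lam_hom[OF h] j N_ver ..
  also have "ver (tau (single m c ^ p)) = of_nat p * teich (single m c)"
    unfolding pm unfolding mc tau_single ..
  also have "N j (wdeg wt m) \<dots> = N j (wdeg wt m) 0"
  proof (rule N_pcong)
    show "witt_graded wt (wdeg wt m) (of_nat p * teich (single m c) :: ('n, 'k) wittS)"
      unfolding pm using h by (intro witt_graded_ver witt_graded_teich)
  qed simp_all
  finally show ?case by (simp add: N_0)
qed (simp_all add: zero_power_p Lam_0 frob_add Lam_add)

text \<open>In the expansion of [m f] both [m f] and the tail \<open>y\<close> have components
  divisible by f, so their difference has value zero; modulo p it equals tau(m f) + V tau(m^p
  D).\<close>

lemma Lam_rel: "Lam i (f * a) \<oplus> Lam (Suc i) (a ^ p * D) = \<zero>"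
proof (induction a rule: poly_mapping_induct_add)
  case (single m c)
  let ?M = "single m c :: ('n, 'k) mpoly" and ?e = "wdeg wt m + \<delta>"
  obtain z where z: "teich (?M * f) = tau (?M * f) + ver (tau (?M ^ p * D) +
      ver (teich (?M ^ p ^ 2 * f ^ (p * (p - 1))) * Delta f) + wfrob z)"
    using teich_single_mult_expansion by blast
  define x where "x = tau (?M * f) + ver (tau (?M ^ p * D))"
  define y where "y = (ver (ver (teich (?M ^ p ^ 2 * f ^ (p * (p - 1))) * Delta f)) :: ('n, 'k) wittS)"
  have M: "whom wt (wdeg wt m) ?M" by (simp add: whom_single)
  have h1: "whom wt ?e (?M * f)" by (intro whom_mult M f_hom)
  have h2: "whom wt (?e * p) (?M ^ p * D)"
    using whom_mult[OF whom_power[OF M, of p] whom_Delta1[OF f_hom, of p]]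
    unfolding mult.commute[of _ p] distrib_left .
  have h3: "witt_graded wt (p ^ 2 * wdeg wt m + p * (p - 1) * \<delta> + \<delta> * p) (teich (?M ^ p ^ 2 * f ^ (p * (p - 1))) * Delta f)"
    by (intro witt_graded_mult witt_graded_teich whom_mult whom_power M f_hom witt_graded_Delta)
  have "p ^ 2 * wdeg wt m + p * (p - 1) * \<delta> + \<delta> * p = ?e * p * p"
    using p_gt_0 by (cases p) (simp_all add: power2_eq_square algebra_simps)
  with h3 have gy: "witt_graded wt ?e y" unfolding y_def by (intro witt_graded_ver) simp
  have g1: "witt_graded wt ?e (tau (?M * f))" by (rule witt_graded_tau[OF h1])
  have g2: "witt_graded wt ?e (ver (tau (?M ^ p * D)))" by (intro witt_graded_ver witt_graded_tau h2)
  have gx: "witt_graded wt ?e x" unfolding x_def by (rule witt_graded_add[OF g1 g2])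
  have gt: "witt_graded wt ?e (teich (?M * f) - y)" by (intro witt_graded_diff witt_graded_teich h1 gy)
  have eq: "teich (?M * f) - y - x = of_nat p * z"
    unfolding z p_mult x_def y_def by (simp add: ver_add)
  have "N i ?e (teich (?M * f) - y) = N i ?e x"
    by (rule N_pcong[OF gt gx]) (simp add: eq)
  moreover have "N i ?e (teich (?M * f) - y) = \<zero>"
  proof (rule N_cong_0[OF gt wcomp_dvd_diff'])
    fix j show "f dvd wcomp (teich (?M * f) :: ('n, 'k) wittS) j" by (simp add: wcomp_teich)
    have "p * (p - 1) > 0" using p_ge_2 by simp
    hence "f dvd f ^ (p * (p - 1))" by (simp add: dvd_power)
    hence "f dvd (?M ^ p ^ 2 * f ^ (p * (p - 1))) ^ p ^ k" for k
      using dvd_mult[THEN dvd_trans[OF _ dvd_power[of "p ^ k"]]] q_pos[of k] by blast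
    thus "f dvd wcomp y j" by (auto simp: y_def wcomp_ver wcomp_teich_mult wchar_p intro: dvd_mult2)
  qed
  ultimately have "N i ?e (tau (?M * f)) \<oplus> N i ?e (ver (tau (?M ^ p * D))) = \<zero>"
    unfolding x_def N_add[OF g1 g2] by simp
  thus ?case using Lam_hom[OF h1, of i] Lam_hom[OF h2, of "Suc i"] by (simp only: N_ver mult.commute[of f])
next
  case (add a b)
  have "Lam i (f * (a + b)) \<oplus> Lam (Suc i) ((a + b) ^ p * D) =
      (Lam i (f * a) \<oplus> Lam i (f * b)) \<oplus> (Lam (Suc i) (a ^ p * D) \<oplus> Lam (Suc i) (b ^ p * D))"
    by (simp only: distrib_left distrib_right frob_add Lam_add)
  also have "\<dots> = (Lam i (f * a) \<oplus> Lam (Suc i) (a ^ p * D)) \<oplus> (Lam i (f * b) \<oplus> Lam (Suc i) (b ^ p * D))"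
    using Lam_closed by (simp add: L.a_ac)
  finally show ?case using add by simp
qed (simp add: zero_power_p Lam_0)

theorem not_subset: "\<not> I_seq p f n \<subseteq> frob_power p max_ideal"
proof (rule forward[OF n_pos Lam_closed Lam_add Lam_mult Lam_frob Lam_rel])
  show "Lam n a = \<zero>" for a
    unfolding Lam_def by (rule L.add.finprod_one_eqI) (simp add: N_top single_graded)
  have "Lam 0 1 = N 0 0 (tau 1)" by (rule Lam_hom[OF whom_1])
  thus "Lam 0 1 = \<one>" by (simp add: N_def nu_one)
qed

end

section \<open>From a splitting to functionals on graded Witt vectors\<close>

locale frac_split = frac_space p ty f hmg T st L \<iota> Dn Lp cmp
  for p :: nat and ty :: "('n::finite \<times> 'k::field) itself" and f :: "('n, 'k) mpoly"
    and hmg :: "nat \<Rightarrow> ('n, 'k) mpoly \<Rightarrow> bool"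
    and T :: "'x topology" and st L :: "'x \<Rightarrow> 's ring" and \<iota> :: "'x \<Rightarrow> ('n, 'k) mpoly \<Rightarrow> 's"
    and Dn :: "'x \<Rightarrow> ('n, 'k) mpoly set" and Lp :: "'x set \<Rightarrow> ('x \<Rightarrow> 's) \<Rightarrow> bool"
    and cmp :: "nat \<Rightarrow> ('n, 'k) mpoly \<Rightarrow> ('n, 'k) mpoly" +
  fixes n :: nat and \<psi> :: "'x set \<Rightarrow> (nat \<Rightarrow> 'x \<Rightarrow> 's) \<Rightarrow> 'x \<Rightarrow> 's"
  assumes n_pos: "n \<ge> 1" and psi_hom: "witt_module_hom p n Y \<psi>"
    and psi_split: "openin T V \<Longrightarrow> s \<in> carrier (Wr n V) \<Longrightarrow> \<psi> V (witt_frob p n (sec V) s) = witt_res s"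
begin

lemma zariski_Y: "zariski Y = T" and restr_Y: "restr Y V W s = restrict s W"
  by (simp_all add: function_sheaf_def)

lemma
  assumes V: "openin T V" and s: "s \<in> carrier (Wr n V)"
  shows psi_closed: "\<psi> V s \<in> carrier (sec V)"
    and psi_add: "t \<in> carrier (Wr n V) \<Longrightarrow> \<psi> V (s \<oplus>\<^bsub>Wr n V\<^esub> t) = \<psi> V s \<oplus>\<^bsub>sec V\<^esub> \<psi> V t"
    and psi_mult: "t \<in> carrier (Wr n V) \<Longrightarrow>
      \<psi> V (witt_frob p n (sec V) s \<otimes>\<^bsub>Wr n V\<^esub> t) = witt_res s \<otimes>\<^bsub>sec V\<^esub> \<psi> V t"
    and psi_restr: "openin T W \<Longrightarrow> W \<subseteq> V \<Longrightarrow> \<psi> W (witt_map n (restr Y V W) s) = restrict (\<psi> V s) W"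
proof -
  note h = psi_hom[unfolded witt_module_hom_def Let_def zariski_Y, rule_format, OF V]
  show "\<psi> V s \<in> carrier (sec V)" by (rule funcset_mem[OF conjunct1[OF h] s])
  show "t \<in> carrier (Wr n V) \<Longrightarrow> \<psi> V (s \<oplus>\<^bsub>Wr n V\<^esub> t) = \<psi> V s \<oplus>\<^bsub>sec V\<^esub> \<psi> V t"
    by (rule bspec[OF bspec[OF conjunct1[OF conjunct2[OF h]] s]])
  show "t \<in> carrier (Wr n V) \<Longrightarrow> \<psi> V (witt_frob p n (sec V) s \<otimes>\<^bsub>Wr n V\<^esub> t) = witt_res s \<otimes>\<^bsub>sec V\<^esub> \<psi> V t"
    by (rule bspec[OF bspec[OF conjunct1[OF conjunct2[OF conjunct2[OF h]]] s]])
  show "openin T W \<Longrightarrow> W \<subseteq> V \<Longrightarrow> \<psi> W (witt_map n (restr Y V W) s) = restrict (\<psi> V s) W"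
    using bspec[OF mp[OF spec[OF conjunct2[OF conjunct2[OF conjunct2[OF h]]]]] s, of W] by (simp add: restr_Y)
qed

definition adm :: "'x set \<Rightarrow> nat \<Rightarrow> ('n, 'k) wittS \<Rightarrow> ('n, 'k) mpoly \<Rightarrow> bool" where
  "adm V d w c \<longleftrightarrow> openin T V \<and> hmg d c \<and> (\<forall>P\<in>V. c \<in> Dn P) \<and> (\<forall>i. hmg (d * p ^ Suc i) (wcomp w i))"

text \<open>The vector \<open>w\<close> divided by F[c], as a section over \<open>V\<close>.\<close>

definition swit :: "'x set \<Rightarrow> ('n, 'k) wittS \<Rightarrow> ('n, 'k) mpoly \<Rightarrow> nat \<Rightarrow> 'x \<Rightarrow> 's" where
  "swit V w c = (\<lambda>i\<in>{..<n}. \<lambda>P\<in>V. fracv P (wcomp w i) (c ^ p ^ Suc i))"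

lemma swit_closed:
  assumes "adm V d w c"
  shows "swit V w c \<in> carrier (Wr n V)"
  unfolding Wr_carrier
proof (rule PiE_I)
  have V: "openin T V" using assms by (simp add: adm_def)
  fix i assume i: "i \<in> {..<n}"
  show "swit V w c i \<in> carrier (sec V)"
  proof (rule secI[OF V])
    show "swit V w c i \<in> extensional V" using i by (simp add: swit_def)
    have "hmg (d * p ^ Suc i) (c ^ p ^ Suc i)"
      using assms unfolding mult.commute[of d] by (intro hmg_power) (simp add: adm_def)
    moreover have "isf Q (swit V w c i Q) (wcomp w i) (c ^ p ^ Suc i)" if "Q \<in> V" for Q
    proof -
      have "c ^ p ^ Suc i \<in> Dn Q" using assms pts_of[OF V that] that by (intro Dn_power) (auto simp: adm_def)
      thus ?thesis using i that isf_fracv[OF pts_of[OF V that]] by (simp add: swit_def)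
    qed
    ultimately show "\<exists>W e a h. openin T W \<and> P \<in> W \<and> W \<subseteq> V \<and> hmg e a \<and> hmg e h \<and> (\<forall>Q\<in>W. isf Q (swit V w c i Q) a h)"
      if "P \<in> V" for P
      using that V assms unfolding adm_def
      by (intro exI[of _ V] exI[of _ "d * p ^ Suc i"] exI[of _ "wcomp w i"] exI[of _ "c ^ p ^ Suc i"]) simp
  qed
qed (simp add: swit_def)

lemma swit_rep:
  assumes "adm V d w c" "P \<in> V"
  shows "rep n P (swit V w c) w c d"
proof -
  have "P \<in> pts" "c \<in> Dn P" using assms pts_of by (auto simp: adm_def)
  thus ?thesis using assms isf_fracv[OF _ Dn_power] by (simp add: rep_def adm_def swit_def del: power_Suc)
qed

lemma rep_swit:
  assumes a: "adm V d w c" and s: "s \<in> carrier (Wr n V)" and r: "\<And>P. P \<in> V \<Longrightarrow> rep n P s w c d"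
  shows "s = swit V w c"
proof -
  have V: "openin T V" using a by (simp add: adm_def)
  have "s i = swit V w c i" if i: "i < n" for i
  proof (rule sec_ext[OF V Wr_comp[OF s i] Wr_comp[OF swit_closed[OF a] i]])
    fix P assume P: "P \<in> V"
    show "s i P = swit V w c i P"
      using r[OF P] swit_rep[OF a P] i isf_uniq[OF pts_of[OF V P]] unfolding rep_def by blast
  qed
  moreover have "s \<in> extensional {..<n}" "swit V w c \<in> extensional {..<n}"
    using s swit_closed[OF a] unfolding Wr_carrier PiE_def by blast+
  ultimately show ?thesis by (intro extensionalityI[where A = "{..<n}"]) auto
qed

lemma isf_cancel:
  assumes "P \<in> pts" "isf P y (a * r) (h * r)" "h \<in> Dn P" "r \<in> Dn P"
  shows "isf P y a h"
proof -
  have "y = fracv P a h"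
    by (rule isf_eqI[OF assms(1,2) isf_fracv[OF assms(1,3)] assms(4)]) (simp add: mult_ac)
  thus ?thesis using isf_fracv[OF assms(1,3)] by simp
qed

text \<open>Clearing the denominators \<open>c^(p^(i+1))\<close> of a Witt vector makes the value of \<open>\<psi>\<close> independent of \<open>c\<close>.\<close>

definition pv :: "'x set \<Rightarrow> ('n, 'k) wittS \<Rightarrow> ('n, 'k) mpoly \<Rightarrow> 'x \<Rightarrow> 's" where
  "pv V w c P = \<iota> P c \<otimes>\<^bsub>L P\<^esub> \<psi> V (swit V w c) P"

lemma psi_swit_closed: "adm V d w c \<Longrightarrow> P \<in> V \<Longrightarrow> \<psi> V (swit V w c) P \<in> carrier (L P)"
  using psi_closed[OF _ swit_closed] sec_closed by (meson adm_def)

lemma pv_closed: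
  assumes "adm V d w c" "P \<in> V"
  shows "pv V w c P \<in> carrier (L P)"
proof -
  have "P \<in> pts" using assms pts_of by (auto simp: adm_def)
  then interpret cring "L P" by (rule L_cring)
  show ?thesis using psi_swit_closed[OF assms] iota_simps(1)[OF \<open>P \<in> pts\<close>] by (simp add: pv_def)
qed

lemma adm_add: "adm V d w c \<Longrightarrow> adm V d z c \<Longrightarrow> adm V d (w + z) c"
proof -
  assume a: "adm V d w c" "adm V d z c"
  have "hmg (d * p * p ^ i) (peval (case_sum (wcomp w) (wcomp z)) (witt_add_poly p i))" for i
    by (rule hmg_peval[OF whom_witt_add_poly[OF prime_p]]) (use a in \<open>auto simp: adm_def mult.assoc split: sum.split\<close>)
  thus ?thesis using a by (simp add: adm_def wcomp_add wchar_p mult.assoc)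
qed

lemma pv_add:
  assumes a: "adm V d w c" "adm V d z c" and P: "P \<in> V"
  shows "pv V (w + z) c P = pv V w c P \<oplus>\<^bsub>L P\<^esub> pv V z c P"
proof -
  have V: "openin T V" using a by (simp add: adm_def)
  note s = swit_closed[OF a(1)] swit_closed[OF a(2)] and pt = pts_of[OF V P]
  interpret cring "L P" by (rule L_cring[OF pt])
  have "swit V w c \<oplus>\<^bsub>Wr n V\<^esub> swit V z c = swit V (w + z) c"
    by (rule rep_swit[OF adm_add[OF a] Wr_add(1)[OF V s]]) (intro rep_add[OF V s] swit_rep a)
  hence "\<psi> V (swit V (w + z) c) P = \<psi> V (swit V w c) P \<oplus>\<^bsub>L P\<^esub> \<psi> V (swit V z c) P"
    using psi_add[OF V s] P by (simp add: sec_add)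
  thus ?thesis using psi_swit_closed[OF a(1) P] psi_swit_closed[OF a(2) P] iota_simps(1)[OF pt]
    by (simp add: pv_def r_distr)
qed

lemma adm_scale:
  assumes "adm V d w c" "hmg e a" "hmg e b" "\<And>P. P \<in> V \<Longrightarrow> b \<in> Dn P"
  shows "adm V (e + d) (teich (a ^ p) * w) (b * c)"
proof -
  have "hmg ((e + d) * p ^ Suc i) (wcomp (teich (a ^ p) * w) i)" for i
  proof -
    have "hmg (p ^ Suc i * e + d * p ^ Suc i) (a ^ p ^ Suc i * wcomp w i)"
      using assms by (intro hmg_mult hmg_power) (auto simp: adm_def)
    moreover have "p ^ Suc i * e + d * p ^ Suc i = (e + d) * p ^ Suc i" by (simp add: algebra_simps)
    moreover have "a ^ p ^ Suc i * wcomp w i = wcomp (teich (a ^ p) * w) i"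
      by (simp add: wcomp_teich_mult wchar_p power_mult)
    ultimately show ?thesis by metis
  qed
  moreover have "b * c \<in> Dn P" if "P \<in> V" for P
    using assms that pts_of[of V P] by (intro Dn_mult) (auto simp: adm_def)
  ultimately show ?thesis using assms by (simp add: adm_def hmg_mult)
qed

lemma pv_scale:
  assumes a: "adm V d w c" and ab: "hmg e a" "hmg e b" "\<And>P. P \<in> V \<Longrightarrow> b \<in> Dn P" and P: "P \<in> V"
  shows "pv V (teich (a ^ p) * w) (b * c) P = \<iota> P a \<otimes>\<^bsub>L P\<^esub> pv V w c P"
proof -
  have V: "openin T V" using a by (simp add: adm_def)
  note pt = pts_of[OF V]
  interpret cring "L P" by (rule L_cring[OF pt[OF P]])
  \<comment> \<open>Over the denominator \<open>b\<close> this represents [a/b]: component 0 is a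
    b^(p-1) divided by b^p. Frobenius linearity is applied to this section.\<close>
  define y where "y = (teich (a * b ^ (p - 1)) :: ('n, 'k) wittS)"
  have "hmg (e + (p - 1) * e) (a * b ^ (p - 1))" using ab by (intro hmg_mult hmg_power)
  moreover have pe: "e + (p - 1) * e = e * p" using p_gt_0 by (cases p) simp_all
  ultimately have ay: "adm V e y b"
    using V ab hmg_0 by (auto simp: adm_def y_def wcomp_teich)
  define s where "s = witt_frob p n (sec V) (swit V y b) \<otimes>\<^bsub>Wr n V\<^esub> swit V w c"
  have s: "s \<in> carrier (Wr n V)" unfolding s_def
    by (intro Wr_mult(1)[OF V] Wr_frob(1)[OF V] swit_closed[OF a] swit_closed[OF ay])
  have "s = swit V (teich (a ^ p) * w) (b * c)"
  proof (rule rep_swit[OF adm_scale[OF a ab] s], assumption)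
    fix Q assume Q: "Q \<in> V"
    have D: "b \<in> Dn Q" "c \<in> Dn Q" using a ab Q by (auto simp: adm_def)
    have r: "rep n Q s (wfrob y * w) (b ^ p * c) (e * p + d)"
      unfolding s_def by (intro rep_frob_mult[OF V _ _ Q] swit_closed[OF a] swit_closed[OF ay] swit_rep[OF a Q] swit_rep[OF ay Q])
    have "isf Q (s i Q) (wcomp (teich (a ^ p) * w) i) ((b * c) ^ p ^ Suc i)" if i: "i < n" for i
    proof (rule isf_cancel[OF pt[OF Q], where r = "(b ^ (p - 1)) ^ p ^ Suc i"])
      have "b ^ p = b * b ^ (p - 1)" using p_gt_0 by (cases p) simp_all
      hence h: "(b ^ p * c) ^ p ^ Suc i = (b * c) ^ p ^ Suc i * (b ^ (p - 1)) ^ p ^ Suc i"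
        by (simp add: mult_ac flip: power_mult_distrib)
      have z: "wcomp (wfrob y * w) i = wcomp (teich (a ^ p) * w) i * (b ^ (p - 1)) ^ p ^ Suc i"
      proof -
        have alg: "((A * B) ^ p) ^ q * C = (A ^ p) ^ q * C * B ^ (p * q)" for A B C :: "('n, 'k) mpoly" and q
          by (simp add: power_mult_distrib power_mult)
        have "wcomp (wfrob y * w) i = ((a * b ^ (p - 1)) ^ p) ^ p ^ i * wcomp w i"
          by (simp only: y_def wfrob_teich wcomp_teich_mult wchar_p)
        also have "\<dots> = (a ^ p) ^ p ^ i * wcomp w i * (b ^ (p - 1)) ^ p ^ Suc i"
          by (simp only: alg power_Suc)
        finally show ?thesis by (simp only: wcomp_teich_mult wchar_p)
      qed
      show "isf Q (s i Q) (wcomp (teich (a ^ p) * w) i * (b ^ (p - 1)) ^ p ^ Suc i) ((b * c) ^ p ^ Suc i * (b ^ (p - 1)) ^ p ^ Suc i)"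
      proof -
        have "\<forall>i<n. isf Q (s i Q) (wcomp (wfrob y * w) i) ((b ^ p * c) ^ p ^ Suc i)"
          using r unfolding rep_def by (elim conjE)
        from mp[OF spec[OF this] i] show ?thesis unfolding h z .
      qed
      show "(b * c) ^ p ^ Suc i \<in> Dn Q" "(b ^ (p - 1)) ^ p ^ Suc i \<in> Dn Q"
        using D pt[OF Q] by (auto simp del: power_Suc intro!: Dn_power Dn_mult)
    qed
    thus "rep n Q s (teich (a ^ p) * w) (b * c) (e + d)"
      using adm_scale[OF a ab] Q unfolding rep_def adm_def by blast
  qed
  hence "\<psi> V (swit V (teich (a ^ p) * w) (b * c)) P = witt_res (swit V y b) P \<otimes>\<^bsub>L P\<^esub> \<psi> V (swit V w c) P"
    using psi_mult[OF V swit_closed[OF ay] swit_closed[OF a]] P by (simp add: s_def sec_mult)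
  moreover have i0: "isf P (witt_res (swit V y b) P) a b"
  proof (rule isf_cancel[OF pt[OF P], where r = "b ^ (p - 1)"])
    have "isf P (swit V y b 0 P) (a * b ^ (p - 1)) (b ^ p ^ Suc 0)"
      using swit_rep[OF ay P] n_pos by (auto simp: rep_def y_def dest: spec[of _ 0])
    moreover have "b ^ p ^ Suc 0 = b * b ^ (p - 1)" using p_gt_0 by (cases p) simp_all
    ultimately show "isf P (witt_res (swit V y b) P) (a * b ^ (p - 1)) (b * b ^ (p - 1))"
      by (simp only: witt_res_def)
  qed (use ab(3)[OF P] Dn_power[OF pt[OF P]] in auto)
  ultimately show ?thesis
  proof -
    assume e: "\<psi> V (swit V (teich (a ^ p) * w) (b * c)) P = witt_res (swit V y b) P \<otimes>\<^bsub>L P\<^esub> \<psi> V (swit V w c) P"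
    have "witt_res (swit V y b) P \<otimes>\<^bsub>L P\<^esub> \<iota> P b = \<iota> P a" "witt_res (swit V y b) P \<in> carrier (L P)"
      using i0 by (auto simp: isf_def)
    thus ?thesis unfolding pv_def e using psi_swit_closed[OF a P] iota_simps(1)[OF pt[OF P]]
      by (simp add: iota_simps(3)[OF pt[OF P]] m_ac flip: \<open>_ = \<iota> P a\<close>)
  qed
qed

text \<open>Both sides are compared over b c: w divided by F[b] equals F[c] w divided by F[b c], and
  \<open>pv_scale\<close> evaluates the latter.\<close>

lemma pv_change:
  assumes a: "adm V d w c" and b: "adm V d w b" and P: "P \<in> V"
  shows "pv V w b P = pv V w c P"
proof -
  have V: "openin T V" using a by (simp add: adm_def)
  note pt = pts_of[OF V]
  interpret cring "L P" by (rule L_cring[OF pt[OF P]])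
  have h: "hmg d c" "hmg d b" and D: "\<And>P. P \<in> V \<Longrightarrow> c \<in> Dn P" "\<And>P. P \<in> V \<Longrightarrow> b \<in> Dn P"
    using a b by (auto simp: adm_def)
  have "swit V w b = swit V (teich (c ^ p) * w) (b * c)"
  proof (rule rep_swit[OF adm_scale[OF a h D(2)] swit_closed[OF b]], assumption)
    fix Q assume Q: "Q \<in> V"
    have "isf Q (swit V w b i Q) (wcomp (teich (c ^ p) * w) i) ((b * c) ^ p ^ Suc i)" if "i < n" for i
    proof -
      have "isf Q (swit V w b i Q) (wcomp w i * c ^ p ^ Suc i) (b ^ p ^ Suc i * c ^ p ^ Suc i)"
        using swit_rep[OF b Q] that D Q by (intro isf_scale[OF pt[OF Q]] Dn_power[OF pt[OF Q]]) (auto simp: rep_def)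
      thus ?thesis unfolding wcomp_teich_mult wchar_p power_Suc power_mult power_mult_distrib by (simp only: mult.commute)
    qed
    thus "rep n Q (swit V w b) (teich (c ^ p) * w) (b * c) (d + d)"
      using adm_scale[OF a h D(2)] Q unfolding rep_def adm_def by blast
  qed
  hence "\<iota> P (b * c) \<otimes>\<^bsub>L P\<^esub> \<psi> V (swit V w b) P = \<iota> P c \<otimes>\<^bsub>L P\<^esub> pv V w c P"
    using pv_scale[OF a h D(2) P] by (simp add: pv_def)
  hence "pv V w b P \<otimes>\<^bsub>L P\<^esub> \<iota> P c = pv V w c P \<otimes>\<^bsub>L P\<^esub> \<iota> P c"
    using psi_swit_closed[OF b P] pv_closed[OF a P] iota_simps(1)[OF pt[OF P]]
    by (simp add: pv_def iota_simps(3)[OF pt[OF P]] m_ac)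
  thus ?thesis using cancel[OF pt[OF P] D(1)[OF P] pv_closed[OF b P] pv_closed[OF a P]] by simp
qed

lemma pv_restr:
  assumes a: "adm V d w c" and W: "openin T W" "W \<subseteq> V" and P: "P \<in> W"
  shows "pv W w c P = pv V w c P"
proof -
  have V: "openin T V" using a by (simp add: adm_def)
  have "witt_map n (restr Y V W) (swit V w c) = swit W w c"
    using W by (auto simp: witt_map_def swit_def restr_Y fun_eq_iff)
  hence "\<psi> W (swit W w c) = restrict (\<psi> V (swit V w c)) W"
    using psi_restr[OF V swit_closed[OF a] W] by simp
  thus ?thesis using P by (simp add: pv_def)
qed

lemma pv_cong:
  assumes a: "adm V d w c" "adm V d z c" and fd: "\<And>i. i < n \<Longrightarrow> f dvd wcomp w i - wcomp z i"
  shows "pv V w c P = pv V z c P"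
proof -
  have "fracv Q (wcomp w i) h = fracv Q (wcomp z i) h" if "i < n" "Q \<in> V" for i Q h
    using iota_dvd[OF pts_of fd[OF that(1)]] a(1) that(2) by (auto simp: fracv_def adm_def)
  hence "swit V w c = swit V z c" by (auto simp: swit_def fun_eq_iff)
  thus ?thesis by (simp add: pv_def)
qed

lemma pv_one:
  assumes V: "openin T V" and P: "P \<in> V"
  shows "pv V 1 1 P = \<one>\<^bsub>L P\<^esub>"
proof -
  note pt = pts_of[OF V]
  interpret cring "L P" by (rule L_cring[OF pt[OF P]])
  have a: "adm V 0 1 1" using V pt Dn_1 hmg_1 hmg_0 by (auto simp: adm_def wcomp_1)
  note s = swit_closed[OF a]
  have "witt_frob p n (sec V) (swit V 1 1) = swit V 1 1"
    by (rule rep_swit[OF a Wr_frob(1)[OF V s]]) (use rep_frob[OF V s _ swit_rep[OF a]] in simp)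
  hence "\<psi> V (swit V 1 1) P = swit V 1 1 0 P" using psi_split[OF V s] by (simp add: witt_res_def)
  also have "isf P (swit V 1 1 0 P) 1 1"
    using swit_rep[OF a P] n_pos by (auto simp: rep_def wcomp_1 dest: spec[of _ 0])
  hence "swit V 1 1 0 P = \<one>\<^bsub>L P\<^esub>"
    using isf_uniq[OF pt[OF P] _ isf_1[OF pt[OF P] Dn_1[OF pt[OF P]]]] by simp
  finally show ?thesis by (simp add: pv_def iota_simps(4)[OF pt[OF P]])
qed

lemma pv_frac:
  assumes a: "adm V d w c" and P: "P \<in> V"
  shows "\<exists>W e b h. openin T W \<and> P \<in> W \<and> W \<subseteq> V \<and> hmg (d + e) b \<and> hmg e h \<and> (\<forall>Q\<in>W. isf Q (pv V w c Q) b h)"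
proof -
  have V: "openin T V" using a by (simp add: adm_def)
  obtain W e b h where W: "openin T W" "P \<in> W" "W \<subseteq> V" "hmg e b" "hmg e h" "\<And>Q. Q \<in> W \<Longrightarrow> isf Q (\<psi> V (swit V w c) Q) b h"
    using secE[OF V psi_closed[OF V swit_closed[OF a]] P] by metis
  have "isf Q (pv V w c Q) (c * b) h" if "Q \<in> W" for Q
  proof -
    note pt = pts_of[OF W(1) that]
    have "isf Q (\<iota> Q c) c 1"
      using Dn_1[OF pt] iota_simps[OF pt] cring.cring_simprules(12)[OF L_cring[OF pt]] monoid.r_one[OF ring.is_monoid[OF cring.axioms(1)[OF L_cring[OF pt]]]] by (simp add: isf_def)
    from isf_mult[OF pt this W(6)[OF that]] show ?thesis by (simp add: pv_def)
  qed
  moreover have "hmg (d + e) (c * b)" using a W by (intro hmg_mult) (auto simp: adm_def)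
  ultimately show ?thesis using W by (intro exI[of _ W] exI[of _ e] exI[of _ "c * b"] exI[of _ h]) simp
qed

end

section \<open>The spectrum of the local ring\<close>

definition wpart :: "('v \<Rightarrow> nat) \<Rightarrow> nat \<Rightarrow> (('v \<Rightarrow>\<^sub>0 nat) \<Rightarrow>\<^sub>0 'c::comm_ring_1) \<Rightarrow> ('v \<Rightarrow>\<^sub>0 nat) \<Rightarrow>\<^sub>0 'c" where
  "wpart wt d a = (\<Sum>m\<in>{m \<in> keys a. wdeg wt m = d}. single m (lookup a m))"

lemma lookup_wpart: "lookup (wpart wt d a) m = (if wdeg wt m = d then lookup a m else 0)"
  by (auto simp: wpart_def lookup_sum lookup_single when_def in_keys_iff)

lemma wpart_add: "wpart wt d (a + b) = wpart wt d a + wpart wt d b"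
  by (rule poly_mapping_eqI) (simp add: lookup_wpart lookup_add)

lemma wpart_0 [simp]: "wpart wt d 0 = 0"
  by (simp add: wpart_def)

lemma whom_wpart: "whom wt d (wpart wt d a)"
  by (auto simp: whom_def in_keys_iff lookup_wpart split: if_splits)

lemma wpart_whom: "whom wt e a \<Longrightarrow> wpart wt d a = (if d = e then a else 0)"
  by (rule poly_mapping_eqI) (auto simp: whom_def in_keys_iff lookup_wpart)

lemma wpart_decompose: "\<exists>D. finite D \<and> a = (\<Sum>d\<in>D. wpart wt d a)"
proof (intro exI conjI)
  show "a = (\<Sum>d\<in>wdeg wt ` keys a. wpart wt d a)"
    by (rule poly_mapping_eqI) (auto simp: lookup_sum lookup_wpart in_keys_iff)
qed simp

lemma wpart_mult:
  fixes c a :: "('v \<Rightarrow>\<^sub>0 nat) \<Rightarrow>\<^sub>0 'c::comm_ring_1"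
  assumes "whom wt e c"
  shows "wpart wt (e + d) (c * a) = c * wpart wt d a"
proof (induction a rule: poly_mapping_induct_add)
  case (single m x)
  have h: "whom wt (e + wdeg wt m) (c * single m x)" by (intro whom_mult assms whom_single refl)
  show ?case by (auto simp: wpart_whom[OF h] wpart_whom[OF whom_single[OF refl]])
qed (simp_all add: distrib_left wpart_add)

lemma wpart_mult_lt:
  fixes c a :: "('v \<Rightarrow>\<^sub>0 nat) \<Rightarrow>\<^sub>0 'c::comm_ring_1"
  assumes "whom wt e c" "d < e"
  shows "wpart wt d (c * a) = 0"
proof (induction a rule: poly_mapping_induct_add)
  case (single m x)
  have h: "whom wt (e + wdeg wt m) (c * single m x)" by (intro whom_mult assms whom_single refl)
  show ?case using assms(2) by (simp add: wpart_whom[OF h])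
qed (simp_all add: distrib_left wpart_add)

lemma wpart_dvd:
  fixes c a :: "('v \<Rightarrow>\<^sub>0 nat) \<Rightarrow>\<^sub>0 'c::comm_ring_1"
  assumes "whom wt e c" "c dvd a"
  shows "c dvd wpart wt d a"
proof -
  obtain b where b: "a = c * b" using assms(2) by (auto elim: dvdE)
  show ?thesis
  proof (cases "d < e")
    case False
    hence "wpart wt (e + (d - e)) (c * b) = c * wpart wt (d - e) b" by (intro wpart_mult assms)
    thus ?thesis using False b by simp
  qed (simp add: b wpart_mult_lt[OF assms(1)])
qed

lemma whom_trivial: "whom (\<lambda>_. 0) 0 a"
  by (simp add: whom_def wdeg_def)

lemma homogeneity_whom: "homogeneity (whom wt :: nat \<Rightarrow> ('n::finite, 'k::field) mpoly \<Rightarrow> bool)"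
  by unfold_locales (auto intro: whom_add whom_uminus whom_1 whom_mult)

context mult_subset
begin

lemma loc_eq_fr:
  assumes "y \<in> carrier loc" "a \<in> carrier R" "s \<in> T" "y \<otimes>\<^bsub>loc\<^esub> inc s = inc a"
  shows "y = fr a s"
proof -
  interpret L: cring loc by (rule loc_cring)
  have i: "inc s \<in> Units loc" by (rule inc_Units[OF assms(3)])
  have "y \<otimes>\<^bsub>loc\<^esub> inc s = fr a s \<otimes>\<^bsub>loc\<^esub> inc s" using fr_inc[of a s] assms by simp
  hence "inc s \<otimes>\<^bsub>loc\<^esub> y = inc s \<otimes>\<^bsub>loc\<^esub> fr a s"
    using L.m_comm L.Units_closed[OF i] assms(1) fr_closed[OF assms(2,3)] by simp
  thus ?thesis using L.Units_l_cancel[OF i assms(1) fr_closed[OF assms(2,3)]] by simp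
qed

end

lemma mult_subset_prime:
  assumes "primeideal P B"
  shows "mult_subset B (carrier B - P)"
proof -
  interpret primeideal P B by (rule assms)
  show ?thesis
    by unfold_locales (use I_prime one_imp_carrier I_notcarr in auto)
qed

text \<open>An axiomatic form of S_m/(f): every element is a fraction with denominator of nonzero
  constant term, and the kernel is (f) up to such denominators. It avoids cosets of fractions in the
  treatment of the spectrum.\<close>

locale local_presentation = hypersurface p ty f + K: ring_hom_cring ring_of_type_algebra B \<kappa>
  for p :: nat and ty :: "('n::finite \<times> 'k::field) itself" and f :: "('n, 'k) mpoly"
    and B :: "('b, 'c) ring_scheme" (structure) and \<kappa> +
  assumes kap_f: "\<kappa> f = \<zero>"
    and kap_frac: "y \<in> carrier B \<Longrightarrow> \<exists>a t. lookup t 0 \<noteq> 0 \<and> y \<otimes> \<kappa> t = \<kappa> a"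
    and kap_ker: "\<kappa> a = \<zero> \<Longrightarrow> \<exists>t. lookup t 0 \<noteq> 0 \<and> f dvd t * a"
    and kap_Units: "lookup t 0 \<noteq> 0 \<Longrightarrow> \<kappa> t \<in> Units B"
begin

lemma kap_simps: "\<kappa> a \<in> carrier B" "\<kappa> (a + b) = \<kappa> a \<oplus> \<kappa> b" "\<kappa> (a * b) = \<kappa> a \<otimes> \<kappa> b" "\<kappa> 1 = \<one>" "\<kappa> 0 = \<zero>"
  using K.hom_closed[of a] K.hom_add[of a b] K.hom_mult[of a b] K.hom_one K.hom_zero by simp_all

abbreviation sp where "sp \<equiv> topology_generated_by {{P. primeideal P B \<and> h \<notin> P} | h. h \<in> carrier B}"
abbreviation st where "st \<equiv> (\<lambda>P. localization B (carrier B - P))"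
abbreviation io where "io \<equiv> (\<lambda>P a. mult_subset.inc B (carrier B - P) (\<kappa> a))"
abbreviation den where "den \<equiv> (\<lambda>P. {h. \<kappa> h \<notin> P})"
abbreviation frp where "frp \<equiv> (\<lambda>V s. \<exists>a\<in>carrier B. \<exists>h\<in>carrier B. \<forall>P\<in>V. h \<notin> P \<and> s P = loc_frac B (carrier B - P) a h)"

lemma unit_notin: "primeideal P B \<Longrightarrow> x \<in> Units B \<Longrightarrow> x \<notin> P"
proof
  assume P: "primeideal P B" and x: "x \<in> Units B" "x \<in> P"
  interpret primeideal P B by (rule P)
  have "inv x \<otimes> x \<in> P" using x by (intro I_l_closed) auto
  hence "\<one> \<in> P" using x by simp
  thus False using one_imp_carrier I_notcarr by blast
qed

lemma topspace_sp: "topspace sp = {P. primeideal P B}"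
proof -
  have "P \<in> \<Union>{{P. primeideal P B \<and> h \<notin> P} | h. h \<in> carrier B}" if "primeideal P B" for P
    using unit_notin[OF that K.S.Units_one_closed] K.S.one_closed that by blast
  thus ?thesis by auto
qed

lemma prime_mult:
  assumes "primeideal P B" "x \<in> carrier B" "y \<in> carrier B"
  shows "x \<otimes> y \<in> P \<longleftrightarrow> x \<in> P \<or> y \<in> P"
proof -
  interpret primeideal P B by (rule assms)
  show ?thesis using I_prime assms I_l_closed I_r_closed by blast
qed

lemma kap_frac2:
  assumes "x \<in> carrier B" "y \<in> carrier B"
  shows "\<exists>a b t. lookup t 0 \<noteq> 0 \<and> x \<otimes> \<kappa> t = \<kappa> a \<and> y \<otimes> \<kappa> t = \<kappa> b"
proof -
  obtain a t b s where t: "lookup t 0 \<noteq> 0" "x \<otimes> \<kappa> t = \<kappa> a" "lookup s 0 \<noteq> 0" "y \<otimes> \<kappa> s = \<kappa> b"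
    using kap_frac[OF assms(1)] kap_frac[OF assms(2)] by blast
  have "x \<otimes> \<kappa> (t * s) = (x \<otimes> \<kappa> t) \<otimes> \<kappa> s" "y \<otimes> \<kappa> (t * s) = (y \<otimes> \<kappa> s) \<otimes> \<kappa> t"
    using assms kap_simps(1) by (simp_all add: kap_simps(3) K.S.m_ac)
  hence "x \<otimes> \<kappa> (t * s) = \<kappa> (a * s)" "y \<otimes> \<kappa> (t * s) = \<kappa> (b * t)"
    by (simp_all only: t kap_simps)
  moreover have "lookup (t * s) 0 \<noteq> 0" using t by (simp add: lookup_0_mult)
  ultimately show ?thesis by blast
qed

lemma io_hom:
  assumes "primeideal P B"
  shows "ring_hom_cring ring_of_type_algebra (st P) (io P)"
proof -
  interpret M: mult_subset B "carrier B - P" by (rule mult_subset_prime[OF assms])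
  interpret H: ring_hom_cring B "st P" M.inc by (rule M.inc_hom)
  show ?thesis
  proof (rule ring_hom_cringI[OF K.R.is_cring M.loc_cring])
    show "io P \<in> ring_hom ring_of_type_algebra (st P)"
      using ring_hom_trans[OF K.homh H.homh] by (simp add: o_def)
  qed
qed

lemma frac_form:
  assumes P: "primeideal P B" and ah: "a \<in> carrier B" "h \<in> carrier B" "h \<notin> P"
    and t: "lookup t 0 \<noteq> 0" "a \<otimes> \<kappa> t = \<kappa> a'" "h \<otimes> \<kappa> t = \<kappa> h'"
  shows "loc_frac B (carrier B - P) a h \<in> carrier (st P)"
    "loc_frac B (carrier B - P) a h \<otimes>\<^bsub>st P\<^esub> io P h' = io P a'" "h' \<in> den P"
proof -
  interpret M: mult_subset B "carrier B - P" by (rule mult_subset_prime[OF P])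
  interpret H: ring_hom_cring B "st P" M.inc by (rule M.inc_hom)
  show c: "M.fr a h \<in> carrier (st P)" using ah by (intro M.fr_closed) auto
  have "M.fr a h \<otimes>\<^bsub>st P\<^esub> io P h' = (M.fr a h \<otimes>\<^bsub>st P\<^esub> M.inc h) \<otimes>\<^bsub>st P\<^esub> M.inc (\<kappa> t)"
    using c ah kap_simps(1)[of t] by (simp add: H.S.m_assoc flip: t)
  also have "M.fr a h \<otimes>\<^bsub>st P\<^esub> M.inc h = M.inc a" using ah by (intro M.fr_inc) auto
  also have "M.inc a \<otimes>\<^bsub>st P\<^esub> M.inc (\<kappa> t) = io P a'" using ah kap_simps(1)[of t] by (simp flip: t)
  finally show "M.fr a h \<otimes>\<^bsub>st P\<^esub> io P h' = io P a'" .
  show "h' \<in> den P" using ah prime_mult[OF P, of h "\<kappa> t"] unit_notin[OF P kap_Units[OF t(1)]] kap_simps(1)[of t]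
    by (metis Diff_iff kap_simps(1) mem_Collect_eq t(3))
qed

text \<open>For the trivial weight every polynomial is homogeneous of degree \<open>0\<close>.\<close>

lemma frac_space_spec: "frac_space p f (whom (\<lambda>_. 0)) sp st st io den frp (wpart (\<lambda>_. 0))"
proof -
  interpret G: homogeneity "whom (\<lambda>_::'n. 0) :: nat \<Rightarrow> ('n, 'k) mpoly \<Rightarrow> bool" by (rule homogeneity_whom)
  have h0: "\<exists>d. whom (\<lambda>_. 0) d h" for h :: "('n, 'k) mpoly" using whom_trivial by blast
  show ?thesis
  proof (intro frac_space.intro frac_space_axioms.intro hypersurface_axioms homogeneity_whom, unfold topspace_sp)
    fix P assume "P \<in> {P. primeideal P B}"
    hence P: "primeideal P B" by simp
    interpret M: mult_subset B "carrier B - P" by (rule mult_subset_prime[OF P])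
    interpret H: ring_hom_cring B "st P" M.inc by (rule M.inc_hom)
    show "ring_hom_cring ring_of_type_algebra (st P) (io P)" by (rule io_hom[OF P])
    show "io P h \<in> Units (st P)" if "h \<in> den P" for h
      using that kap_simps(1) by (intro M.inc_Units) auto
    show "1 \<in> den P" using unit_notin[OF P K.S.Units_one_closed] by (simp add: kap_simps)
    show "h * h' \<in> den P" if "h \<in> den P" "h' \<in> den P" for h h'
      using that prime_mult[OF P] kap_simps by simp
    show "\<exists>r\<in>den P. f dvd r * a" if z: "io P a = \<zero>\<^bsub>st P\<^esub>" for a
    proof -
      obtain r where r: "r \<in> carrier B - P" "r \<otimes> \<kappa> a = \<zero>"
        using z M.inc_zero_iff[OF kap_simps(1)] by blast
      obtain t b where t: "lookup t 0 \<noteq> 0" "r \<otimes> \<kappa> t = \<kappa> b" using kap_frac r by blast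
      have "\<kappa> (b * a) = (r \<otimes> \<kappa> a) \<otimes> \<kappa> t"
        using r(1) kap_simps(1)[of a] kap_simps(1)[of t] by (simp add: kap_simps(3) K.S.m_ac flip: t(2))
      also have "\<dots> = \<zero>" unfolding r(2) using kap_simps(1)[of t] by simp
      finally have "\<kappa> (b * a) = \<zero>" .
      from kap_ker[OF this] obtain s where s: "lookup s 0 \<noteq> 0" "f dvd s * (b * a)" by blast
      have "\<kappa> s \<notin> P" "\<kappa> t \<notin> P" using unit_notin[OF P] kap_Units s t by blast+
      hence "\<kappa> (s * b) \<notin> P" using r prime_mult[OF P] kap_simps(1) t(2) by (simp add: kap_simps(3) flip: t(2))
      thus ?thesis using s(2) by (intro bexI[of _ "s * b"]) (simp_all add: mult.assoc)
    qed
    show "io P f = \<zero>\<^bsub>st P\<^esub>" by (simp add: kap_f)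
    show "carrier (st P) = {y \<in> carrier (st P). \<exists>d a h. whom (\<lambda>_. 0) d a \<and> whom (\<lambda>_. 0) d h \<and> h \<in> den P \<and>
        y \<otimes>\<^bsub>st P\<^esub> io P h = io P a}"
    proof -
      have "\<exists>d a h. whom (\<lambda>_. 0) d a \<and> whom (\<lambda>_. 0) d h \<and> h \<in> den P \<and> y \<otimes>\<^bsub>st P\<^esub> io P h = io P a"
        if y: "y \<in> carrier (st P)" for y
      proof -
        obtain a h where ah: "y = M.fr a h" "a \<in> carrier B" "h \<in> carrier B" "h \<notin> P"
          using M.locE[OF y] by blast
        obtain a' h' t where t: "lookup t 0 \<noteq> 0" "a \<otimes> \<kappa> t = \<kappa> a'" "h \<otimes> \<kappa> t = \<kappa> h'"
          using kap_frac2[OF ah(2,3)] by blast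
        show ?thesis unfolding ah(1) using frac_form[OF P ah(2-4) t] whom_trivial by blast
      qed
      thus ?thesis by blast
    qed
  next
    fix V :: "'b set set" and s assume V: "V \<subseteq> {P. primeideal P B}"
    show "frp V s \<longleftrightarrow> (\<exists>d a h. whom (\<lambda>_. 0) d a \<and> whom (\<lambda>_. 0) d h \<and>
      (\<forall>P\<in>V. h \<in> den P \<and> s P \<in> carrier (st P) \<and> s P \<otimes>\<^bsub>st P\<^esub> io P h = io P a))"
    proof
      assume "frp V s"
      then obtain a h where ah: "a \<in> carrier B" "h \<in> carrier B" "\<forall>P\<in>V. h \<notin> P \<and> s P = loc_frac B (carrier B - P) a h"
        by blast
      obtain a' h' t where t: "lookup t 0 \<noteq> 0" "a \<otimes> \<kappa> t = \<kappa> a'" "h \<otimes> \<kappa> t = \<kappa> h'"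
        using kap_frac2[OF ah(1,2)] by blast
      have "h' \<in> den P \<and> s P \<in> carrier (st P) \<and> s P \<otimes>\<^bsub>st P\<^esub> io P h' = io P a'" if "P \<in> V" for P
        using frac_form[OF _ ah(1,2) _ t, of P] ah(3) V that by auto
      thus "\<exists>d a h. whom (\<lambda>_. 0) d a \<and> whom (\<lambda>_. 0) d h \<and>
          (\<forall>P\<in>V. h \<in> den P \<and> s P \<in> carrier (st P) \<and> s P \<otimes>\<^bsub>st P\<^esub> io P h = io P a)"
        using whom_trivial by blast
    next
      assume "\<exists>d a h. whom (\<lambda>_. 0) d a \<and> whom (\<lambda>_. 0) d h \<and>
        (\<forall>P\<in>V. h \<in> den P \<and> s P \<in> carrier (st P) \<and> s P \<otimes>\<^bsub>st P\<^esub> io P h = io P a)"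
      then obtain a h where ah: "\<forall>P\<in>V. h \<in> den P \<and> s P \<in> carrier (st P) \<and> s P \<otimes>\<^bsub>st P\<^esub> io P h = io P a"
        by blast
      have "\<kappa> h \<notin> P \<and> s P = loc_frac B (carrier B - P) (\<kappa> a) (\<kappa> h)" if P: "P \<in> V" for P
      proof -
        interpret M: mult_subset B "carrier B - P" using V P by (intro mult_subset_prime) auto
        have "\<kappa> h \<notin> P" using bspec[OF ah P] by simp
        moreover have "s P = M.fr (\<kappa> a) (\<kappa> h)"
          using bspec[OF ah P] kap_simps(1) by (intro M.loc_eq_fr) simp_all
        ultimately show ?thesis ..
      qed
      thus "frp V s" using kap_simps(1) by blast
    qed
  qed (auto simp: wpart_add whom_wpart wpart_mult h0 intro: wpart_dvd[OF whom_trivial])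
qed

lemma Spec_eq: "Spec B = function_sheaf sp st frp"
  by (simp add: Spec_def)

text \<open>The maximal ideal of \<open>B\<close>, that is, the closed point of the
  spectrum.\<close>

definition cpt where
  "cpt = {y \<in> carrier B. \<exists>a t. lookup t 0 \<noteq> 0 \<and> lookup a 0 = 0 \<and> y \<otimes> \<kappa> t = \<kappa> a}"

text \<open>Two numerators of one element agree modulo f after cross multiplication, and f has no
  constant term; so the vanishing of the constant term does not depend on the fraction.\<close>

lemma cpt_uniq:
  assumes "y \<in> carrier B" "y \<otimes> \<kappa> t = \<kappa> a" "y \<otimes> \<kappa> s = \<kappa> b" "lookup s 0 \<noteq> 0" "lookup b 0 = 0"
  shows "lookup a 0 = 0"
proof -
  have "\<kappa> (a * s) = (y \<otimes> \<kappa> s) \<otimes> \<kappa> t"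
    using assms(1) kap_simps(1) by (simp add: kap_simps(3) K.S.m_ac flip: assms(2))
  hence "\<kappa> (a * s) = \<kappa> (b * t)" unfolding assms(3) by (simp add: kap_simps)
  hence "\<kappa> (a * s - b * t) = \<zero>"
    using K.hom_a_inv[of "b * t"] kap_simps(1)
    by (simp add: kap_simps(2) K.S.r_neg flip: add_uminus_conv_diff)
  from kap_ker[OF this] obtain r where r: "lookup r 0 \<noteq> 0" "f dvd r * (a * s - b * t)" by blast
  then obtain c where "r * (a * s - b * t) = f * c" by (auto elim: dvdE)
  hence "lookup (r * (a * s - b * t)) 0 = 0" by (simp add: lookup_0_mult f_const)
  thus ?thesis using r assms by (simp add: lookup_0_mult lookup_minus)
qed

lemma kap_cpt: "\<kappa> a \<in> cpt \<longleftrightarrow> lookup a 0 = 0"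
proof -
  have "\<kappa> a \<otimes> \<kappa> 1 = \<kappa> a" "lookup 1 (0::'n \<Rightarrow>\<^sub>0 nat) \<noteq> (0::'k)" using kap_simps(1) by (simp_all add: kap_simps(4))
  thus ?thesis using cpt_uniq[OF kap_simps(1)] kap_simps(1) unfolding cpt_def by blast
qed

lemma cpt_prime: "primeideal cpt B"
proof (rule primeidealI)
  have mem: "y \<in> cpt \<longleftrightarrow> lookup a 0 = 0" if "y \<in> carrier B" "lookup t 0 \<noteq> 0" "y \<otimes> \<kappa> t = \<kappa> a" for y t a
    using cpt_uniq[OF that(1,3)] that unfolding cpt_def by blast
  have l: "x \<otimes> y \<in> cpt \<longleftrightarrow> x \<in> cpt \<or> y \<in> cpt" if xy: "x \<in> carrier B" "y \<in> carrier B" for x y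
  proof -
    obtain a b t where t: "lookup t 0 \<noteq> 0" "x \<otimes> \<kappa> t = \<kappa> a" "y \<otimes> \<kappa> t = \<kappa> b" using kap_frac2[OF xy] by blast
    have "(x \<otimes> y) \<otimes> \<kappa> (t * t) = \<kappa> (a * b)"
      using xy kap_simps(1)[of t] by (simp add: kap_simps(3) K.S.m_ac flip: t)
    moreover have "lookup (t * t) 0 \<noteq> 0" using t by (simp add: lookup_0_mult)
    ultimately have "x \<otimes> y \<in> cpt \<longleftrightarrow> lookup (a * b) 0 = 0" using xy by (intro mem) auto
    thus ?thesis using mem[OF xy(1) t(1,2)] mem[OF xy(2) t(1,3)] by (simp add: lookup_0_mult)
  qed
  have sub: "cpt \<subseteq> carrier B" by (auto simp: cpt_def)
  show "cring B" by (rule K.S.is_cring)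
  show "ideal cpt B"
  proof (rule idealI[OF K.S.ring_axioms])
    show "subgroup cpt (add_monoid B)"
    proof (rule K.S.add.subgroupI)
      show "cpt \<subseteq> carrier B" by (rule sub)
      have "\<zero> \<in> cpt" using kap_cpt[of 0] by (simp add: kap_simps)
      thus "cpt \<noteq> {}" by blast
      fix x y assume x: "x \<in> cpt" and y: "y \<in> cpt"
      hence c: "x \<in> carrier B" "y \<in> carrier B" using sub by auto
      obtain a b t where t: "lookup t 0 \<noteq> 0" "x \<otimes> \<kappa> t = \<kappa> a" "y \<otimes> \<kappa> t = \<kappa> b" using kap_frac2[OF c] by blast
      have ab: "lookup a 0 = 0" "lookup b 0 = 0" using mem[OF c(1) t(1,2)] mem[OF c(2) t(1,3)] x y by auto
      have "(x \<oplus> y) \<otimes> \<kappa> t = \<kappa> (a + b)" using c kap_simps(1)[of t] by (simp add: K.S.l_distr t kap_simps(2))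
      thus "x \<oplus> y \<in> cpt" using mem[of "x \<oplus> y" t "a + b"] c t ab by (simp add: lookup_add)
      have "(\<ominus> x) \<otimes> \<kappa> t = \<kappa> (- a)" using c kap_simps(1)[of t] K.hom_a_inv[of a] by (simp add: K.S.l_minus t)
      thus "\<ominus> x \<in> cpt" using mem[of "\<ominus> x" t "- a"] c t ab by simp
    qed
  qed (use l sub in auto)
  show "carrier B \<noteq> cpt"
  proof
    assume "carrier B = cpt"
    hence "\<kappa> 1 \<in> cpt" using kap_simps(1) by simp
    thus False unfolding kap_cpt by simp
  qed
  show "a \<in> cpt \<or> b \<in> cpt" if "a \<in> carrier B" "b \<in> carrier B" "a \<otimes> b \<in> cpt" for a b
    using l[OF that(1,2)] that(3) by blast
qed

lemma den_cpt: "h \<in> den cpt \<longleftrightarrow> lookup h 0 \<noteq> 0"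
  by (simp add: kap_cpt)

theorem quasi_F_split_Spec_iff:
  assumes n: "n \<ge> 1"
  shows "quasi_F_split p n (Spec B) \<longleftrightarrow> \<not> I_seq p f n \<subseteq> frob_power p max_ideal"
proof
  interpret F: frac_space p ty f "whom (\<lambda>_. 0)" sp st st io den frp "wpart (\<lambda>_. 0)"
    by (rule frac_space_spec)
  assume "\<not> I_seq p f n \<subseteq> frob_power p max_ideal"
  from psi_exists[OF n this] obtain \<Psi> :: "('n, 'k) wittS \<Rightarrow> ('n, 'k) mpoly" where
    P: "\<And>w z. \<Psi> (w + z) = \<Psi> w + \<Psi> z" "\<And>y w. \<Psi> (wfrob y * w) = wcomp y 0 * \<Psi> w"
      "\<And>w z. (\<forall>i<n. f dvd wcomp w i - wcomp z i) \<longrightarrow> f dvd \<Psi> w - \<Psi> z" "lookup (\<Psi> 1) 0 \<noteq> 0"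
    by blast
  have "quasi_F_split p n (function_sheaf sp st frp)"
  proof (rule F.quasi_F_split_if_psi[OF n P(1,2)])
    show "f dvd \<Psi> w - \<Psi> z" if "\<And>i. i < n \<Longrightarrow> f dvd wcomp w i - wcomp z i" for w z using P(3) that by blast
    show "wpart (\<lambda>_. 0) 0 (\<Psi> 1) \<in> den P" if "P \<in> topspace sp" for P
      using unit_notin[of P, OF _ kap_Units[OF P(4)]] that unfolding topspace_sp
      by (simp add: wpart_whom[OF whom_trivial])
  qed
  thus "quasi_F_split p n (Spec B)" unfolding Spec_eq .
next
  assume "quasi_F_split p n (Spec B)"
  then obtain \<psi> where psi: "witt_module_hom p n (function_sheaf sp st frp) \<psi>"
    "\<And>V s. openin sp V \<Longrightarrow> s \<in> carrier (witt_ring p n (sheaf (function_sheaf sp st frp) V)) \<Longrightarrow>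
      \<psi> V (witt_frob p n (sheaf (function_sheaf sp st frp) V) s) = witt_res s"
    unfolding quasi_F_split_def Spec_eq by (auto simp: function_sheaf_def)
  interpret F: frac_split p ty f "whom (\<lambda>_. 0)" sp st st io den frp "wpart (\<lambda>_. 0)" n \<psi>
    by (intro frac_split.intro frac_split_axioms.intro frac_space_spec n psi)
  \<comment> \<open>Over the whole spectrum every polynomial Witt vector is a section with
    denominator 1; its value is read off in the stalk at the closed point.\<close>
  define V where "V = topspace sp"
  have V: "openin sp V" unfolding V_def by (rule openin_topspace)
  have pt: "cpt \<in> topspace sp" unfolding topspace_sp using cpt_prime by simp
  hence c: "cpt \<in> V" by (simp only: V_def)
  have adm: "F.adm V 0 w 1" for w
    using V F.Dn_1 by (simp add: F.adm_def whom_trivial V_def)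
  interpret C: cring "st cpt" by (rule F.L_cring[OF pt])
  note io = F.iota_simps[OF pt]
  \<comment> \<open>With zero weights everything has degree 0. Other degrees contain only zero,
    which is why the value there is set to zero.\<close>
  define \<nu> where "\<nu> = (\<lambda>(d::nat) w. if d = 0 then F.pv V w 1 cpt else \<zero>\<^bsub>st cpt\<^esub>)"
  have "graded_functional p f (st cpt) (io cpt) (\<lambda>_. 0) 0 n \<nu>"
  proof (intro graded_functional.intro frac_target.intro frac_target_axioms.intro graded_functional_axioms.intro
      hypersurface_axioms C.is_cring io n whom_trivial)
    show "io cpt f = \<zero>\<^bsub>st cpt\<^esub>" by (rule F.iota_f[OF pt])
    show "\<exists>t a. lookup t 0 \<noteq> 0 \<and> io cpt t \<otimes>\<^bsub>st cpt\<^esub> y = io cpt a" if y: "y \<in> carrier (st cpt)" for y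
    proof -
      obtain a h where "h \<in> den cpt" "y \<otimes>\<^bsub>st cpt\<^esub> io cpt h = io cpt a"
        using F.st_carrier[OF pt] y by blast
      thus ?thesis using C.m_comm[OF y io(1)[of h]] unfolding den_cpt by metis
    qed
    show "\<exists>t. lookup t 0 \<noteq> 0 \<and> f dvd t * a" if "io cpt a = \<zero>\<^bsub>st cpt\<^esub>" for a
      using F.ker[OF pt that] unfolding Bex_def den_cpt .
    show "\<nu> d w \<in> carrier (st cpt)" for d w
      using F.pv_closed[OF adm c] by (simp add: \<nu>_def)
    show "\<nu> d (w + z) = \<nu> d w \<oplus>\<^bsub>st cpt\<^esub> \<nu> d z" for d w z
      using F.pv_add[OF adm adm c] by (simp add: \<nu>_def)
    show "\<nu> (e + d) (teich (a ^ p) * w) = io cpt a \<otimes>\<^bsub>st cpt\<^esub> \<nu> d w" if h: "whom (\<lambda>_. 0) e a" for e a d w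
    proof (cases "e = 0")
      case True
      have "F.pv V (teich (a ^ p) * w) (1 * 1) cpt = io cpt a \<otimes>\<^bsub>st cpt\<^esub> F.pv V w 1 cpt"
        using F.Dn_1 by (intro F.pv_scale[OF adm whom_trivial whom_trivial _ c]) (simp add: V_def)
      thus ?thesis using True io(1) by (simp add: \<nu>_def)
    next
      case False
      have "a = 0" using wpart_whom[OF h, of 0] wpart_whom[OF whom_trivial, of 0 a] False by simp
      thus ?thesis using False io(5) F.pv_closed[OF adm c] by (simp add: \<nu>_def)
    qed
    show "\<nu> d w = \<nu> d z" if "\<And>i. i < n \<Longrightarrow> f dvd wcomp w i - wcomp z i" for d w z
      using F.pv_cong[OF adm adm that] by (simp add: \<nu>_def)
    show "\<nu> 0 1 = \<one>\<^bsub>st cpt\<^esub>" using F.pv_one[OF V c] by (simp add: \<nu>_def)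
  qed
  then interpret G: graded_functional p ty f "st cpt" "io cpt" "\<lambda>_. 0" 0 n \<nu> .
  show "\<not> I_seq p f n \<subseteq> frob_power p max_ideal" by (rule G.not_subset)
qed

end

lemma FactRing_carrierE:
  assumes "y \<in> carrier (R Quot I)"
  obtains x where "x \<in> carrier R" "y = I +>\<^bsub>R\<^esub> x"
  using assms by (auto simp: FactRing_def A_RCOSETS_def')

lemma mult_subset_local: "mult_subset ring_of_type_algebra (UNIV - max_ideal :: ('n::finite, 'k::field) mpoly set)"
proof -
  interpret cring "ring_of_type_algebra :: ('n, 'k) mpoly ring" by (rule cring_from_type_algebra)
  show ?thesis by unfold_locales (auto simp: max_ideal_eq lookup_0_mult)
qed

context hypersurface
begin

lemma local_presentation_local_quotient:
  "\<exists>\<kappa>. local_presentation p f (local_quotient f) \<kappa>"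
proof -
  interpret M: mult_subset "ring_of_type_algebra :: ('n, 'k) mpoly ring" "UNIV - max_ideal"
    by (rule mult_subset_local)
  interpret R: cring M.loc by (rule M.loc_cring)
  interpret H: ring_hom_cring "ring_of_type_algebra :: ('n, 'k) mpoly ring" M.loc M.inc by (rule M.inc_hom)
  define I where "I = PIdl\<^bsub>M.loc\<^esub> (M.inc f)"
  have incf: "M.inc a \<in> carrier M.loc" for a using H.hom_closed[of a] by simp
  have tM: "t \<in> UNIV - max_ideal \<longleftrightarrow> lookup t 0 \<noteq> 0" for t :: "('n, 'k) mpoly" by (simp add: max_ideal_eq)
  interpret I: ideal I M.loc unfolding I_def by (rule R.cgenideal_ideal[OF incf])
  interpret Q: ring_hom_cring M.loc "M.loc Quot I" "(+>\<^bsub>M.loc\<^esub>) I" by (rule I.rcos_ring_hom_cring[OF R.is_cring])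
  have B: "local_quotient f = M.loc Quot I"
    by (simp add: local_quotient_def I_def M.inc_def)
  define \<kappa> where "\<kappa> = (\<lambda>a. I +>\<^bsub>M.loc\<^esub> M.inc a)"
  have "local_presentation p f (M.loc Quot I) \<kappa>"
  proof (intro local_presentation.intro local_presentation_axioms.intro hypersurface_axioms)
    show "ring_hom_cring ring_of_type_algebra (M.loc Quot I) \<kappa>"
    proof (rule ring_hom_cringI[OF M.is_cring Q.S.is_cring])
      show "\<kappa> \<in> ring_hom ring_of_type_algebra (M.loc Quot I)"
        using ring_hom_trans[OF H.homh Q.homh] by (simp add: o_def \<kappa>_def)
    qed
    have z: "\<zero>\<^bsub>M.loc Quot I\<^esub> = I" unfolding FactRing_def by (simp only: ring.select_convs)
    have "M.inc f \<in> I" unfolding I_def by (rule R.cgenideal_self[OF incf])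
    thus "\<kappa> f = \<zero>\<^bsub>M.loc Quot I\<^esub>" unfolding \<kappa>_def z by (rule I.a_rcos_const)
    show "\<exists>a t. lookup t 0 \<noteq> 0 \<and> y \<otimes>\<^bsub>M.loc Quot I\<^esub> \<kappa> t = \<kappa> a" if "y \<in> carrier (M.loc Quot I)" for y
    proof -
      from that obtain x where x: "x \<in> carrier M.loc" "y = I +>\<^bsub>M.loc\<^esub> x"
        by (rule FactRing_carrierE)
      obtain a s where s: "x = M.fr a s" "s \<in> UNIV - max_ideal" using M.locE[OF x(1)] by blast
      have "y \<otimes>\<^bsub>M.loc Quot I\<^esub> \<kappa> s = \<kappa> a"
        using Q.hom_mult[OF x(1) incf[of s]] M.fr_inc[of a s] s unfolding \<kappa>_def x(2) by simp
      thus ?thesis using s(2) unfolding tM by blast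
    qed
    show "\<exists>t. lookup t 0 \<noteq> 0 \<and> f dvd t * a" if "\<kappa> a = \<zero>\<^bsub>M.loc Quot I\<^esub>" for a
    proof -
      have "M.inc a \<in> I" using that unfolding \<kappa>_def z by (intro I.rcos_const_imp_mem incf)
      then obtain x where x: "x \<in> carrier M.loc" "M.inc a = x \<otimes>\<^bsub>M.loc\<^esub> M.inc f"
        unfolding I_def cgenideal_def by blast
      obtain b s where s: "x = M.fr b s" "s \<in> UNIV - max_ideal" using M.locE[OF x(1)] by blast
      have "M.fr a 1 = M.fr (b * f) s"
        using x(2) s M.loc_mult[of b f s 1] M.T_one by (simp add: M.inc_def)
      then obtain r where "r \<in> UNIV - max_ideal" "r * (a * s) = r * (b * f)"
        using M.fr_eq_iff[of a "b * f" 1 s] s M.T_one by auto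
      moreover from this(2) have "(r * s) * a = f * (r * b)" by (simp add: mult_ac)
      ultimately show ?thesis using s(2) unfolding tM
        by (intro exI[of _ "r * s"]) (simp add: lookup_0_mult)
    qed
    show "\<kappa> t \<in> Units (M.loc Quot I)" if "lookup t 0 \<noteq> 0" for t
    proof -
      have t: "M.inc t \<in> Units M.loc" using that tM M.inc_Units by blast
      define x where "x = I +>\<^bsub>M.loc\<^esub> inv\<^bsub>M.loc\<^esub> M.inc t"
      have c: "\<kappa> t \<in> carrier (M.loc Quot I)" "x \<in> carrier (M.loc Quot I)"
        unfolding \<kappa>_def x_def by (intro Q.hom_closed incf R.Units_inv_closed t)+
      have "\<kappa> t \<otimes>\<^bsub>M.loc Quot I\<^esub> x = I +>\<^bsub>M.loc\<^esub> (M.inc t \<otimes>\<^bsub>M.loc\<^esub> inv\<^bsub>M.loc\<^esub> M.inc t)"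
        unfolding \<kappa>_def x_def by (rule Q.hom_mult[symmetric, OF incf R.Units_inv_closed[OF t]])
      also have "\<dots> = \<one>\<^bsub>M.loc Quot I\<^esub>" unfolding R.Units_r_inv[OF t] by (rule Q.hom_one)
      finally have e: "\<kappa> t \<otimes>\<^bsub>M.loc Quot I\<^esub> x = \<one>\<^bsub>M.loc Quot I\<^esub>" .
      hence "x \<otimes>\<^bsub>M.loc Quot I\<^esub> \<kappa> t = \<one>\<^bsub>M.loc Quot I\<^esub>" using Q.S.m_comm[OF c] by (rule_tac trans) (rule sym)
      thus ?thesis unfolding Units_def using c e by (simp only: mem_Collect_eq simp_thms) (rule bexI[OF _ c(2)], simp)
    qed
  qed
  thus ?thesis unfolding B by blast
qed

theorem quasi_F_split_local_iff:
  assumes "n \<ge> 1"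
  shows "quasi_F_split p n (Spec (local_quotient f)) \<longleftrightarrow> \<not> I_seq p f n \<subseteq> frob_power p max_ideal"
proof -
  obtain \<kappa> where "local_presentation p f (local_quotient f) \<kappa>"
    using local_presentation_local_quotient by blast
  then interpret local_presentation p ty f "local_quotient f" \<kappa> .
  show ?thesis by (rule quasi_F_split_Spec_iff[OF assms])
qed

end

section \<open>The projective scheme\<close>

locale graded_presentation = hypersurface p ty f + K: ring_hom_cring ring_of_type_algebra B \<kappa>
  for p :: nat and ty :: "('n::finite \<times> 'k::field) itself" and f :: "('n, 'k) mpoly"
    and B :: "('b, 'c) ring_scheme" (structure) and \<kappa> +
  fixes wt :: "'n \<Rightarrow> nat" and \<delta> :: nat
  assumes wt_1: "wt j = 1" and f_hom: "whom wt \<delta> f"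
    and kap_surj: "y \<in> carrier B \<Longrightarrow> \<exists>a. y = \<kappa> a"
    and kap_ker: "\<kappa> a = \<zero> \<longleftrightarrow> f dvd a"
begin

lemma kap_simps: "\<kappa> a \<in> carrier B" "\<kappa> (a + b) = \<kappa> a \<oplus> \<kappa> b" "\<kappa> (a * b) = \<kappa> a \<otimes> \<kappa> b" "\<kappa> 1 = \<one>" "\<kappa> 0 = \<zero>"
    "\<kappa> (- a) = \<ominus> \<kappa> a"
  using K.hom_closed[of a] K.hom_add[of a b] K.hom_mult[of a b] K.hom_one K.hom_zero K.hom_a_inv[of a] by simp_all

lemma kap_eq_iff: "\<kappa> a = \<kappa> b \<longleftrightarrow> f dvd a - b"
proof -
  have "\<kappa> a = \<kappa> b \<longleftrightarrow> \<kappa> a \<oplus> \<ominus> \<kappa> b = \<zero>"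
    using kap_simps(1) K.S.minus_equality K.S.r_neg by (metis K.S.a_inv_closed K.S.minus_minus K.S.a_comm)
  thus ?thesis unfolding kap_ker[symmetric] by (simp add: kap_simps flip: add_uminus_conv_diff)
qed

abbreviation G where "G \<equiv> (\<lambda>d. {\<kappa> g | g. whom wt d g})"
abbreviation pp where "pp \<equiv> proj_points B G"
abbreviation pt where "pt \<equiv> topology_generated_by {{P \<in> pp. h \<notin> P} | h. h \<in> (\<Union>d. G d)}"
abbreviation Lo where "Lo \<equiv> (\<lambda>P. localization B ((\<Union>d. G d) - P))"
abbreviation io where "io \<equiv> (\<lambda>P a. mult_subset.inc B ((\<Union>d. G d) - P) (\<kappa> a))"
abbreviation den where "den \<equiv> (\<lambda>P. {h. (\<exists>d. whom wt d h) \<and> \<kappa> h \<notin> P})"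
abbreviation frp where "frp \<equiv> (\<lambda>V s. \<exists>d. \<exists>a\<in>G d. \<exists>h\<in>G d. \<forall>P\<in>V. h \<notin> P \<and> s P = loc_frac B ((\<Union>d. G d) - P) a h)"

lemma G_mem: "whom wt d g \<Longrightarrow> \<kappa> g \<in> G d"
  by blast

lemma pp_prime: "P \<in> pp \<Longrightarrow> primeideal P B"
  by (simp add: proj_points_def)

lemma unit_notin: "primeideal P B \<Longrightarrow> x \<in> Units B \<Longrightarrow> x \<notin> P"
proof
  assume P: "primeideal P B" and x: "x \<in> Units B" "x \<in> P"
  interpret primeideal P B by (rule P)
  have "inv x \<otimes> x \<in> P" using x by (intro I_l_closed) auto
  hence "\<one> \<in> P" using x by simp
  thus False using one_imp_carrier I_notcarr by blast
qed

lemma prime_mult: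
  assumes "primeideal P B"
  shows "\<kappa> (a * b) \<in> P \<longleftrightarrow> \<kappa> a \<in> P \<or> \<kappa> b \<in> P"
proof -
  interpret primeideal P B by (rule assms)
  show ?thesis unfolding kap_simps(3)
    using I_prime[OF kap_simps(1) kap_simps(1)] I_l_closed[OF _ kap_simps(1)] I_r_closed[OF _ kap_simps(1)] by blast
qed

lemma one_notin: "primeideal P B \<Longrightarrow> \<kappa> 1 \<notin> P"
  using unit_notin[OF _ K.S.Units_one_closed] by (simp add: kap_simps)

lemma topspace_pt: "topspace pt = pp"
proof -
  have "P \<in> \<Union>{{P \<in> pp. h \<notin> P} | h. h \<in> (\<Union>d. G d)}" if "P \<in> pp" for P
  proof (rule UnionI)
    show "{P \<in> pp. \<kappa> 1 \<notin> P} \<in> {{P \<in> pp. h \<notin> P} | h. h \<in> (\<Union>d. G d)}"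
      using G_mem[OF whom_1] by blast
    show "P \<in> {P \<in> pp. \<kappa> 1 \<notin> P}" using that one_notin[OF pp_prime] by simp
  qed
  thus ?thesis unfolding topology_generated_by_topspace by blast
qed

lemma mult_subset_G:
  assumes "primeideal P B"
  shows "mult_subset B ((\<Union>d. G d) - P)"
proof (intro mult_subset.intro mult_subset_axioms.intro K.S.is_cring)
  show "(\<Union>d. G d) - P \<subseteq> carrier B" using kap_simps(1) by auto
  show "\<one> \<in> (\<Union>d. G d) - P" using one_notin[OF assms] G_mem[OF whom_1] by (auto simp: kap_simps)
  fix s t assume "s \<in> (\<Union>d. G d) - P" "t \<in> (\<Union>d. G d) - P"
  then obtain a b d e where ab: "s = \<kappa> a" "t = \<kappa> b" "whom wt d a" "whom wt e b" "\<kappa> a \<notin> P" "\<kappa> b \<notin> P"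
    by auto
  hence "\<kappa> (a * b) \<notin> P" "\<kappa> (a * b) \<in> G (d + e)" using prime_mult[OF assms] by (auto intro!: whom_mult)
  thus "s \<otimes> t \<in> (\<Union>d. G d) - P" unfolding ab kap_simps(3) by blast
qed

lemma io_hom:
  assumes "primeideal P B"
  shows "ring_hom_cring ring_of_type_algebra (Lo P) (io P)"
proof -
  interpret M: mult_subset B "(\<Union>d. G d) - P" by (rule mult_subset_G[OF assms])
  interpret H: ring_hom_cring B "Lo P" M.inc by (rule M.inc_hom)
  show ?thesis
  proof (rule ring_hom_cringI[OF K.R.is_cring M.loc_cring])
    show "io P \<in> ring_hom ring_of_type_algebra (Lo P)"
      using ring_hom_trans[OF K.homh H.homh] by (simp add: o_def)
  qed
qed

lemma frac_form:
  assumes P: "primeideal P B" and h: "h \<in> den P"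
  shows "loc_frac B ((\<Union>d. G d) - P) (\<kappa> a) (\<kappa> h) \<in> carrier (Lo P)"
    "y \<in> carrier (Lo P) \<Longrightarrow> y \<otimes>\<^bsub>Lo P\<^esub> io P h = io P a \<longleftrightarrow> y = loc_frac B ((\<Union>d. G d) - P) (\<kappa> a) (\<kappa> h)"
proof -
  interpret M: mult_subset B "(\<Union>d. G d) - P" by (rule mult_subset_G[OF P])
  have t: "\<kappa> h \<in> (\<Union>d. G d) - P" using h by blast
  show "M.fr (\<kappa> a) (\<kappa> h) \<in> carrier (Lo P)" by (rule M.fr_closed[OF kap_simps(1) t])
  show "y \<otimes>\<^bsub>Lo P\<^esub> io P h = io P a \<longleftrightarrow> y = M.fr (\<kappa> a) (\<kappa> h)" if "y \<in> carrier (Lo P)"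
    using M.loc_eq_fr[OF that kap_simps(1) t] M.fr_inc[OF kap_simps(1) t] by blast
qed

lemma frac_space_proj: "frac_space p f (whom wt) pt (proj_stalk B G) Lo io den frp (wpart wt)"
proof (intro frac_space.intro frac_space_axioms.intro hypersurface_axioms homogeneity_whom, unfold topspace_pt)
  fix P assume "P \<in> pp"
  hence P: "primeideal P B" by (rule pp_prime)
  interpret M: mult_subset B "(\<Union>d. G d) - P" by (rule mult_subset_G[OF P])
  interpret H: ring_hom_cring B "Lo P" M.inc by (rule M.inc_hom)
  show "ring_hom_cring ring_of_type_algebra (Lo P) (io P)" by (rule io_hom[OF P])
  show "io P h \<in> Units (Lo P)" if "h \<in> den P" for h using that by (intro M.inc_Units) blast
  show "1 \<in> den P" using one_notin[OF P] whom_1 by blast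
  show "h * h' \<in> den P" if "h \<in> den P" "h' \<in> den P" for h h'
    using that prime_mult[OF P] whom_mult by blast
  show "\<exists>d. whom wt d h" if "h \<in> den P" for h using that by blast
  show "\<exists>r\<in>den P. f dvd r * a" if z: "io P a = \<zero>\<^bsub>Lo P\<^esub>" for a
  proof -
    obtain r where r: "r \<in> (\<Union>d. G d) - P" "r \<otimes> \<kappa> a = \<zero>"
      using z M.inc_zero_iff[OF kap_simps(1)] by blast
    then obtain g d where g: "r = \<kappa> g" "whom wt d g" "\<kappa> g \<notin> P" by blast
    have "f dvd g * a" using r(2) unfolding g kap_simps(3)[symmetric] kap_ker .
    thus ?thesis using g by blast
  qed
  have "\<kappa> f = \<zero>" unfolding kap_ker by simp
  thus "io P f = \<zero>\<^bsub>Lo P\<^esub>" by simp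
  show "carrier (proj_stalk B G P) = {y \<in> carrier (Lo P). \<exists>d a h. whom wt d a \<and> whom wt d h \<and> h \<in> den P \<and>
      y \<otimes>\<^bsub>Lo P\<^esub> io P h = io P a}"
  proof -
    have e1: "y \<in> carrier (proj_stalk B G P) \<longleftrightarrow> (\<exists>d a h. whom wt d a \<and> whom wt d h \<and> h \<in> den P \<and> y = M.fr (\<kappa> a) (\<kappa> h))" for y
      unfolding proj_stalk_def by auto
    have e2: "y \<in> carrier (Lo P) \<and> (\<exists>d a h. whom wt d a \<and> whom wt d h \<and> h \<in> den P \<and> y \<otimes>\<^bsub>Lo P\<^esub> io P h = io P a) \<longleftrightarrow>
        (\<exists>d a h. whom wt d a \<and> whom wt d h \<and> h \<in> den P \<and> y = M.fr (\<kappa> a) (\<kappa> h))" (is "?l y \<longleftrightarrow> ?r y") for y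
    proof
      assume "?l y"
      then obtain d a h where y: "y \<in> carrier (Lo P)" "whom wt d a" "whom wt d h" "h \<in> den P" "y \<otimes>\<^bsub>Lo P\<^esub> io P h = io P a"
        by (elim conjE exE) simp
      have "y = M.fr (\<kappa> a) (\<kappa> h)" using frac_form(2)[OF P y(4,1)] y(5) by (rule iffD1)
      thus "?r y" using y(2-4) by (intro exI conjI)
    next
      assume "?r y"
      then obtain d a h where y: "whom wt d a" "whom wt d h" "h \<in> den P" "y = M.fr (\<kappa> a) (\<kappa> h)"
        by (elim conjE exE) simp
      have c: "y \<in> carrier (Lo P)" unfolding y(4) by (rule frac_form(1)[OF P y(3)])
      have "y \<otimes>\<^bsub>Lo P\<^esub> io P h = io P a" using frac_form(2)[OF P y(3) c] y(4) by (rule iffD2)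
      thus "?l y" using y(1-3) c by (intro exI conjI)
    qed
    show ?thesis by (rule Set.set_eqI, unfold mem_Collect_eq[of _ "\<lambda>y. y \<in> carrier (Lo P) \<and> _ y"], rule trans[OF e1 e2[symmetric]])
  qed
next
  fix V :: "'b set set" and s assume V: "V \<subseteq> pp"
  have e: "h \<in> den P \<and> s P \<in> carrier (Lo P) \<and> s P \<otimes>\<^bsub>Lo P\<^esub> io P h = io P a \<longleftrightarrow>
      \<kappa> h \<notin> P \<and> s P = loc_frac B ((\<Union>d. G d) - P) (\<kappa> a) (\<kappa> h)" if "P \<in> V" "whom wt d h" for P a h d
  proof -
    have pr: "primeideal P B" using V that by (intro pp_prime) auto
    show ?thesis
    proof
      assume a: "h \<in> den P \<and> s P \<in> carrier (Lo P) \<and> s P \<otimes>\<^bsub>Lo P\<^esub> io P h = io P a"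
      have "s P = loc_frac B ((\<Union>d. G d) - P) (\<kappa> a) (\<kappa> h)"
        using frac_form(2)[OF pr conjunct1[OF a] conjunct1[OF conjunct2[OF a]]] conjunct2[OF conjunct2[OF a]] by (rule iffD1)
      thus "\<kappa> h \<notin> P \<and> s P = loc_frac B ((\<Union>d. G d) - P) (\<kappa> a) (\<kappa> h)" using conjunct1[OF a] by simp
    next
      assume a: "\<kappa> h \<notin> P \<and> s P = loc_frac B ((\<Union>d. G d) - P) (\<kappa> a) (\<kappa> h)"
      hence h: "h \<in> den P" using that(2) by blast
      have c: "s P \<in> carrier (Lo P)" unfolding conjunct2[OF a] by (rule frac_form(1)[OF pr h])
      have "s P \<otimes>\<^bsub>Lo P\<^esub> io P h = io P a" using frac_form(2)[OF pr h c] conjunct2[OF a] by (rule iffD2)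
      thus "h \<in> den P \<and> s P \<in> carrier (Lo P) \<and> s P \<otimes>\<^bsub>Lo P\<^esub> io P h = io P a" using h c by (intro conjI)
    qed
  qed
  have "frp V s \<longleftrightarrow> (\<exists>d a h. whom wt d a \<and> whom wt d h \<and>
      (\<forall>P\<in>V. \<kappa> h \<notin> P \<and> s P = loc_frac B ((\<Union>d. G d) - P) (\<kappa> a) (\<kappa> h)))"
    by blast
  also have "\<dots> \<longleftrightarrow> (\<exists>d a h. whom wt d a \<and> whom wt d h \<and>
      (\<forall>P\<in>V. h \<in> den P \<and> s P \<in> carrier (Lo P) \<and> s P \<otimes>\<^bsub>Lo P\<^esub> io P h = io P a))"
    by (intro ex_cong1 conj_cong[OF refl] ball_cong[OF refl], rule e[symmetric])
  finally show "frp V s \<longleftrightarrow> (\<exists>d a h. whom wt d a \<and> whom wt d h \<and>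
      (\<forall>P\<in>V. h \<in> den P \<and> s P \<in> carrier (Lo P) \<and> s P \<otimes>\<^bsub>Lo P\<^esub> io P h = io P a))" .
qed (auto simp: proj_stalk_def wpart_add whom_wpart wpart_mult intro: wpart_dvd[OF f_hom])

lemma Proj_eq: "Proj B G = function_sheaf pt (proj_stalk B G) frp"
  by (simp add: Proj_def)

lemma wdeg_0_iff: "wdeg wt m = 0 \<longleftrightarrow> m = 0"
proof -
  have "wdeg wt m = 0 \<longleftrightarrow> (\<forall>i. lookup m i = 0)" by (auto simp: wdeg_def wt_1 in_keys_iff)
  thus ?thesis by (auto intro: poly_mapping_eqI)
qed

theorem quasi_F_split_Proj:
  assumes n: "n \<ge> 1" and I: "\<not> I_seq p f n \<subseteq> frob_power p max_ideal"
  shows "quasi_F_split p n (Proj B G)"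
proof -
  interpret F: frac_space p ty f "whom wt" pt "proj_stalk B G" Lo io den frp "wpart wt"
    by (rule frac_space_proj)
  from psi_exists[OF n I] obtain \<Psi> :: "('n, 'k) wittS \<Rightarrow> ('n, 'k) mpoly" where
    P: "\<And>w z. \<Psi> (w + z) = \<Psi> w + \<Psi> z" "\<And>y w. \<Psi> (wfrob y * w) = wcomp y 0 * \<Psi> w"
      "\<And>w z. (\<forall>i<n. f dvd wcomp w i - wcomp z i) \<longrightarrow> f dvd \<Psi> w - \<Psi> z" "lookup (\<Psi> 1) 0 \<noteq> 0"
    by blast
  define c where "c = lookup (\<Psi> 1) 0"
  \<comment> \<open>All weights are 1, so the part of degree 0 is the constant term, a nonzero
    scalar and therefore outside every prime.\<close>
  have w: "wpart wt 0 (\<Psi> 1) = single 0 c"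
    by (rule poly_mapping_eqI) (auto simp: lookup_wpart wdeg_0_iff c_def lookup_single when_def)
  have "single 0 (inverse c) * single 0 c = (1 :: ('n, 'k) mpoly)"
    using P(4) by (simp add: mult_single c_def)
  hence u: "\<kappa> (single 0 (inverse c)) \<otimes> \<kappa> (single 0 c) = \<one>" by (simp flip: kap_simps)
  have unit: "wpart wt 0 (\<Psi> 1) \<in> den P" if "P \<in> topspace pt" for P
  proof -
    have pr: "primeideal P B" using that unfolding topspace_pt by (rule pp_prime)
    have "\<kappa> (single 0 c) \<notin> P"
      using prime_mult[OF pr, of "single 0 (inverse c)" "single 0 c"] one_notin[OF pr] u by (simp add: kap_simps)
    thus ?thesis using whom_wpart[of wt 0 "\<Psi> 1"] unfolding w by blast
  qed
  have "quasi_F_split p n (function_sheaf pt (proj_stalk B G) frp)"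
    by (rule F.quasi_F_split_if_psi[OF n P(1,2) _ unit]) (use P(3) in blast)+
  thus ?thesis unfolding Proj_eq .
qed

end

section \<open>Prime ideals avoiding powers\<close>

definition is_ideal :: "'a::comm_ring_1 set \<Rightarrow> bool" where
  "is_ideal I \<longleftrightarrow> 0 \<in> I \<and> (\<forall>a\<in>I. \<forall>b\<in>I. a + b \<in> I) \<and> (\<forall>a. \<forall>b\<in>I. a * b \<in> I)"

lemma is_ideal_sum: "is_ideal I \<Longrightarrow> (\<And>x. x \<in> A \<Longrightarrow> g x \<in> I) \<Longrightarrow> sum g A \<in> I"
  by (induction A rule: infinite_finite_induct) (auto simp: is_ideal_def)

lemma is_ideal_mult2: "is_ideal I \<Longrightarrow> a \<in> I \<Longrightarrow> a * b \<in> I"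
  by (metis is_ideal_def mult.commute)

lemma is_ideal_uminus: "is_ideal I \<Longrightarrow> a \<in> I \<Longrightarrow> - a \<in> I"
  using is_ideal_mult2[of I a "- 1"] by simp

lemma is_ideal_span:
  fixes h :: "'u \<Rightarrow> 'a::comm_ring_1" and H :: "'u set"
  shows "is_ideal {g. \<exists>F c c0. finite F \<and> F \<subseteq> H \<and> g = c0 * f + (\<Sum>u\<in>F. c u * h u)}" (is "is_ideal ?J")
  unfolding is_ideal_def
proof (intro conjI ballI allI)
  show "0 \<in> ?J" by (intro CollectI exI[of _ "{}"] exI[of _ "\<lambda>u. 0"] exI[of _ 0]) simp
  fix a assume "a \<in> ?J"
  then obtain F c c0 where F: "finite F" "F \<subseteq> H" "a = c0 * f + (\<Sum>u\<in>F. c u * h u)" by blast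
  show "x * a \<in> ?J" for x
  proof -
    have "x * a = (x * c0) * f + (\<Sum>u\<in>F. (x * c u) * h u)"
      by (simp add: F(3) distrib_left sum_distrib_left mult.assoc)
    thus ?thesis using F(1,2) by (intro CollectI exI[of _ F] exI[of _ "\<lambda>u. x * c u"] exI[of _ "x * c0"]) simp
  qed
  fix b assume "b \<in> ?J"
  then obtain F' c' c0' where F': "finite F'" "F' \<subseteq> H" "b = c0' * f + (\<Sum>u\<in>F'. c' u * h u)" by blast
  define e where "e = (\<lambda>(A :: 'u set) (c :: 'u \<Rightarrow> 'a) u. if u \<in> A then c u else 0)"
  have s: "(\<Sum>u\<in>A. c u * h u) = (\<Sum>u\<in>F \<union> F'. e A c u * h u)" if "A \<subseteq> F \<union> F'" for A c
    using that F(1) F'(1) by (intro sum.mono_neutral_cong_left) (auto simp: e_def)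
  have "a + b = (c0 + c0') * f + (\<Sum>u\<in>F \<union> F'. (e F c u + e F' c' u) * h u)"
    using s[of F c] s[of F' c'] by (simp add: F(3) F'(3) distrib_right sum.distrib)
  thus "a + b \<in> ?J" using F F'
    by (intro CollectI exI[of _ "F \<union> F'"] exI[of _ "\<lambda>u. e F c u + e F' c' u"] exI[of _ "c0 + c0'"]) simp
qed

text \<open>Zorn's lemma gives an ideal maximal among those containing \<open>J\<close> and avoiding
  the powers of \<open>h\<close>. If a and b lie outside it, adjoining either one captures a power
  of h; multiplying the two expressions shows that a b lies outside as well.\<close>

lemma prime_avoiding:
  fixes h :: "'a::comm_ring_1"
  assumes J: "is_ideal J" and h: "\<And>m. h ^ m \<notin> J"
  shows "\<exists>Q. is_ideal Q \<and> J \<subseteq> Q \<and> h \<notin> Q \<and> 1 \<notin> Q \<and> (\<forall>a b. a * b \<in> Q \<longrightarrow> a \<in> Q \<or> b \<in> Q)"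
proof -
  define A where "A = {I. is_ideal I \<and> J \<subseteq> I \<and> (\<forall>m. h ^ m \<notin> I)}"
  obtain M where M: "M \<in> A" "\<And>I. I \<in> A \<Longrightarrow> M \<subseteq> I \<Longrightarrow> I = M"
  proof (rule bexE[OF subset_Zorn_nonempty[of A]])
    show "A \<noteq> {}" using J h by (auto simp: A_def)
    fix C assume C: "C \<noteq> {}" "subset.chain A C"
    have tot: "Y \<subseteq> Y' \<or> Y' \<subseteq> Y" if "Y \<in> C" "Y' \<in> C" for Y Y'
      using C(2) that by (auto simp: subset_chain_def)
    have CA: "Y \<in> A" if "Y \<in> C" for Y using C(2) that by (auto simp: subset_chain_def)
    have "is_ideal (\<Union>C)" unfolding is_ideal_def
    proof (intro conjI ballI allI)
      show "0 \<in> \<Union>C" using C(1) CA by (auto simp: A_def is_ideal_def)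
      fix a assume "a \<in> \<Union>C"
      then obtain Y where Y: "Y \<in> C" "a \<in> Y" by blast
      hence "x * a \<in> Y" for x using CA[OF Y(1)] by (auto simp: A_def is_ideal_def)
      thus "x * a \<in> \<Union>C" for x using Y(1) by (rule_tac UnionI)
      fix b assume "b \<in> \<Union>C"
      then obtain Y' where Y': "Y' \<in> C" "b \<in> Y'" by blast
      from tot[OF Y(1) Y'(1)] show "a + b \<in> \<Union>C"
      proof
        assume "Y \<subseteq> Y'"
        hence "a + b \<in> Y'" using Y Y' CA[OF Y'(1)] by (auto simp: A_def is_ideal_def)
        thus ?thesis using Y' by blast
      next
        assume "Y' \<subseteq> Y"
        hence "a + b \<in> Y" using Y Y' CA[OF Y(1)] by (auto simp: A_def is_ideal_def)
        thus ?thesis using Y by blast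
      qed
    qed
    moreover have "J \<subseteq> \<Union>C" using C(1) CA by (auto simp: A_def)
    moreover have "h ^ m \<notin> \<Union>C" for m using CA by (auto simp: A_def)
    ultimately show "\<Union>C \<in> A" by (simp add: A_def)
  qed blast
  hence iM: "is_ideal M" and JM: "J \<subseteq> M" and hM: "\<And>m. h ^ m \<notin> M" by (auto simp: A_def)
  have ext: "\<exists>m r x. x \<in> M \<and> h ^ m = x + r * a" if a: "a \<notin> M" for a
  proof (rule ccontr)
    assume n: "\<not> ?thesis"
    define Y where "Y = {x + r * a | x r. x \<in> M}"
    have xX: "x \<in> Y" if "x \<in> M" for x
    proof -
      have "x = x + 0 * a" by simp
      thus ?thesis using that unfolding Y_def by blast
    qed
    have "is_ideal Y" unfolding is_ideal_def
    proof (intro conjI ballI allI)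
      show "0 \<in> Y" using xX iM by (simp add: is_ideal_def)
      fix y assume "y \<in> Y"
      then obtain x r where x: "x \<in> M" "y = x + r * a" by (auto simp: Y_def)
      have "c * y = c * x + (c * r) * a" for c by (simp add: x distrib_left mult.assoc)
      moreover have "c * x \<in> M" for c using iM x by (simp add: is_ideal_def)
      ultimately show "c * y \<in> Y" for c unfolding Y_def by blast
      fix z assume "z \<in> Y"
      then obtain x' r' where x': "x' \<in> M" "z = x' + r' * a" by (auto simp: Y_def)
      have "y + z = (x + x') + (r + r') * a" by (simp add: x x' distrib_right)
      moreover have "x + x' \<in> M" using iM x x' by (simp add: is_ideal_def)
      ultimately show "y + z \<in> Y" unfolding Y_def by blast
    qed
    moreover have "h ^ m \<notin> Y" for m using n by (auto simp: Y_def)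
    ultimately have "Y \<in> A" using JM xX by (auto simp: A_def)
    hence "Y = M" using xX by (intro M(2)) auto
    moreover have "0 + 1 * a \<in> Y" using iM unfolding Y_def is_ideal_def by blast
    ultimately show False using a by simp
  qed
  have "a \<in> M \<or> b \<in> M" if ab: "a * b \<in> M" for a b
  proof (rule ccontr)
    assume "\<not> (a \<in> M \<or> b \<in> M)"
    then obtain m r x k s y where x: "x \<in> M" "h ^ m = x + r * a" and y: "y \<in> M" "h ^ k = y + s * b"
      using ext by meson
    have "h ^ (m + k) = x * (y + s * b) + (r * a) * y + (r * s) * (a * b)"
      by (simp add: power_add x y algebra_simps)
    moreover have "x * (y + s * b) \<in> M" "(r * a) * y \<in> M" "(r * s) * (a * b) \<in> M"
      using iM x(1) y(1) ab by (auto simp: is_ideal_def intro: is_ideal_mult2[OF iM])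
    ultimately have "h ^ (m + k) \<in> M" using iM by (simp add: is_ideal_def)
    thus False using hM by blast
  qed
  moreover have "h \<notin> M" "1 \<notin> M" using hM[of 1] hM[of 0] by auto
  ultimately show ?thesis using iM JM by blast
qed

lemma wpart_times:
  fixes a b :: "('v \<Rightarrow>\<^sub>0 nat) \<Rightarrow>\<^sub>0 'c::comm_ring_1"
  shows "wpart wt k (a * b) = (\<Sum>i\<le>k. wpart wt i a * wpart wt (k - i) b)"
proof (induction a rule: poly_mapping_induct_add)
  case (single m c)
  let ?d = "wdeg wt m"
  have h: "whom wt ?d (single m c)" by (simp add: whom_single)
  have "(\<Sum>i\<le>k. wpart wt i (single m c) * wpart wt (k - i) b) = (\<Sum>i\<le>k. if i = ?d then single m c * wpart wt (k - ?d) b else 0)"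
    by (intro sum.cong) (auto simp: wpart_whom[OF h])
  also have "\<dots> = (if ?d \<le> k then single m c * wpart wt (k - ?d) b else 0)" by simp
  also have "\<dots> = wpart wt k (single m c * b)"
    using wpart_mult[OF h, of "k - ?d" b] wpart_mult_lt[OF h, of k b] by auto
  finally show ?case ..
qed (simp_all add: distrib_right wpart_add sum.distrib)

text \<open>Take the components of a and b of least degrees d and e lying outside \<open>Q\<close>.
  Modulo Q their product is the component of a b of degree d + e, which contradicts
  primality.\<close>

lemma homogeneous_core_prime:
  fixes Q :: "(('v \<Rightarrow>\<^sub>0 nat) \<Rightarrow>\<^sub>0 'c::comm_ring_1) set"
  assumes Q: "is_ideal Q" "\<And>a b. a * b \<in> Q \<Longrightarrow> a \<in> Q \<or> b \<in> Q"
    and ab: "\<And>d. wpart wt d (a * b) \<in> Q"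
  shows "(\<forall>d. wpart wt d a \<in> Q) \<or> (\<forall>d. wpart wt d b \<in> Q)"
proof (rule ccontr)
  assume n: "\<not> ?thesis"
  define d e where "d = (LEAST d. wpart wt d a \<notin> Q)" and "e = (LEAST e. wpart wt e b \<notin> Q)"
  have de: "wpart wt d a \<notin> Q" "wpart wt e b \<notin> Q"
    unfolding d_def e_def using n by (metis (mono_tags, lifting) LeastI_ex)+
  have less: "wpart wt i a \<in> Q" if "i < d" for i using not_less_Least[of i "\<lambda>d. wpart wt d a \<notin> Q"] that by (auto simp: d_def)
  have less': "wpart wt i b \<in> Q" if "i < e" for i using not_less_Least[of i "\<lambda>d. wpart wt d b \<notin> Q"] that by (auto simp: e_def)
  have "(\<Sum>i\<in>{..d + e} - {d}. wpart wt i a * wpart wt (d + e - i) b) \<in> Q"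
  proof (rule is_ideal_sum[OF Q(1)])
    fix i assume i: "i \<in> {..d + e} - {d}"
    show "wpart wt i a * wpart wt (d + e - i) b \<in> Q"
    proof (cases "i < d")
      case True
      thus ?thesis using less is_ideal_mult2[OF Q(1)] by blast
    next
      case False
      hence "d + e - i < e" using i by auto
      thus ?thesis using less' Q(1) by (simp add: is_ideal_def)
    qed
  qed
  moreover have "wpart wt (d + e) (a * b) = wpart wt d a * wpart wt e b + (\<Sum>i\<in>{..d + e} - {d}. wpart wt i a * wpart wt (d + e - i) b)"
    unfolding wpart_times by (subst sum.remove[of _ d]) simp_all
  moreover have add: "x + - y \<in> Q" if "x \<in> Q" "y \<in> Q" for x y
    using Q(1) is_ideal_uminus[OF Q(1) that(2)] that(1) by (simp add: is_ideal_def del: add_uminus_conv_diff)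
  ultimately have "wpart wt d a * wpart wt e b \<in> Q"
    using add[OF ab[of "d + e"]] by fastforce
  thus False using Q(2) de by metis
qed

section \<open>Powers of variables\<close>

lemma lookup_single_1_mult: "lookup (single m 1 * a) (m + n) = lookup (a :: ('n, 'k::field) mpoly) n"
  by (induction a rule: poly_mapping_induct_add) (auto simp: mult_single lookup_single when_def distrib_left lookup_add)

lemma keys_single_1_mult: "l \<in> keys (single m 1 * (a :: ('n, 'k::field) mpoly)) \<Longrightarrow> \<exists>n\<in>keys a. l = m + n"
  using Poly_Mapping.keys_mult[of "single m 1" a] by (auto split: if_splits)

lemma mvar_power: "mvar i ^ M = (single (single i M) 1 :: ('n, 'k::field) mpoly)"
proof (induction M)
  case (Suc M)
  have "single i 1 + single i M = (single i (Suc M) :: 'n \<Rightarrow>\<^sub>0 nat)" by (simp flip: single_add)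
  thus ?case unfolding power_Suc Suc unfolding mvar_def mult_single by simp
qed simp

lemma mvar_power_dvd_iff: "mvar i ^ M dvd (a :: ('n, 'k::field) mpoly) \<longleftrightarrow> (\<forall>m\<in>keys a. M \<le> lookup m i)"
proof
  assume "mvar i ^ M dvd a"
  then obtain b where b: "a = single (single i M) 1 * b" by (auto elim: dvdE simp: mvar_power)
  show "\<forall>m\<in>keys a. M \<le> lookup m i"
  proof
    fix m assume "m \<in> keys a"
    then obtain l where "m = single i M + l" using keys_single_1_mult unfolding b by blast
    thus "M \<le> lookup m i" by (simp add: lookup_add)
  qed
next
  assume *: "\<forall>m\<in>keys a. M \<le> lookup m i"
  have "mvar i ^ M dvd (\<Sum>m\<in>keys a. single m (lookup a m))"
  proof (rule dvd_sum)
    fix m assume "m \<in> keys a"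
    hence "m = single i M + (m - single i M)"
      using * by (intro poly_mapping_eqI) (auto simp: lookup_add lookup_minus lookup_single when_def)
    hence "single m (lookup a m) = mvar i ^ M * single (m - single i M) (lookup a m)"
      by (simp add: mvar_power mult_single)
    thus "mvar i ^ M dvd single m (lookup a m)" by simp
  qed
  thus "mvar i ^ M dvd a" by (simp flip: poly_mapping_sum_singles)
qed

lemma mvar_power_dvd_mult:
  assumes "i \<noteq> j" "mvar i ^ M dvd mvar j ^ K * (a :: ('n, 'k::field) mpoly)"
  shows "mvar i ^ M dvd a"
  unfolding mvar_power_dvd_iff
proof
  fix m assume "m \<in> keys a"
  hence "single j K + m \<in> keys (mvar j ^ K * a)" by (simp add: in_keys_iff mvar_power lookup_single_1_mult)
  hence "M \<le> lookup (single j K + m) i" using assms(2) unfolding mvar_power_dvd_iff by blast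
  thus "M \<le> lookup m i" using assms(1) by (simp add: lookup_add lookup_single)
qed

text \<open>Powers of x_k are nonzerodivisors modulo (x_i^M, x_j^M): this ideal is spanned by
  monomials, and x_k changes neither relevant exponent, so \<open>c\<close> can be split monomial by
  monomial.\<close>

lemma mvar_power_colon:
  assumes "i \<noteq> k" "j \<noteq> k" "mvar k ^ K * c = mvar i ^ M * u + mvar j ^ M * (v :: ('n, 'k::field) mpoly)"
  shows "\<exists>u v. c = mvar i ^ M * u + mvar j ^ M * v"
proof -
  define r where "r = (\<lambda>B. \<Sum>m\<in>{m \<in> keys c. B m}. single m (lookup c m))"
  have lr: "lookup (r B) m = (if B m then lookup c m else 0)" for B m
    by (auto simp: r_def lookup_sum lookup_single when_def in_keys_iff)
  define c1 c2 where "c1 = r (\<lambda>m. M \<le> lookup m i)" and "c2 = r (\<lambda>m. \<not> M \<le> lookup m i)"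
  have c: "c = c1 + c2" by (rule poly_mapping_eqI) (simp add: c1_def c2_def lookup_add lr)
  have "mvar i ^ M dvd c1" by (auto simp: mvar_power_dvd_iff c1_def in_keys_iff lr split: if_splits)
  moreover have "mvar j ^ M dvd c2" unfolding mvar_power_dvd_iff
  proof
    fix m assume "m \<in> keys c2"
    hence m: "\<not> M \<le> lookup m i" "lookup c m \<noteq> 0" by (auto simp: c2_def in_keys_iff lr split: if_splits)
    let ?n = "single k K + m"
    have ni: "lookup ?n i = lookup m i" "lookup ?n j = lookup m j"
      using assms(1,2) by (auto simp: lookup_add lookup_single)
    have "lookup (mvar k ^ K * c) ?n \<noteq> 0" using m by (simp add: mvar_power lookup_single_1_mult)
    hence "lookup (mvar i ^ M * u) ?n + lookup (mvar j ^ M * v) ?n \<noteq> 0" by (simp add: assms(3) lookup_add)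
    moreover have "lookup (mvar i ^ M * u) ?n = 0"
    proof (rule ccontr)
      assume "lookup (mvar i ^ M * u) ?n \<noteq> 0"
      hence "?n \<in> keys (mvar i ^ M * u)" by (simp add: in_keys_iff)
      moreover have "\<forall>m\<in>keys (mvar i ^ M * u). M \<le> lookup m i" unfolding mvar_power_dvd_iff[symmetric] by simp
      ultimately show False using m(1) ni by auto
    qed
    ultimately have "?n \<in> keys (mvar j ^ M * v)" by (simp add: in_keys_iff)
    thus "M \<le> lookup m j" using mvar_power_dvd_iff[of j M "mvar j ^ M * v"] ni by auto
  qed
  ultimately show ?thesis unfolding c by (auto elim!: dvdE)
qed

lemma mvar_nonzero: "mvar i ^ M \<noteq> (0 :: ('n::finite, 'k::field) mpoly)"
  by (metis mvar_power lookup_single_eq lookup_zero zero_neq_one)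

text \<open>The first cohomology of the structure sheaf of a projective space of dimension at least two
  vanishes in every twist; three of the standard open sets suffice.\<close>

lemma glue_three:
  fixes b :: "'n \<Rightarrow> ('n::finite, 'k::field) mpoly"
  assumes ijk: "i \<noteq> j" "i \<noteq> k" "j \<noteq> k" and f: "f \<noteq> 0"
    and ov: "\<And>r s. r \<in> {i, j, k} \<Longrightarrow> s \<in> {i, j, k} \<Longrightarrow> f dvd mvar s ^ M * b r - mvar r ^ M * b s"
  shows "\<exists>a. f dvd b i - mvar i ^ M * a \<and> f dvd b j - mvar j ^ M * a"
proof -
  let ?x = "\<lambda>i. mvar i ^ M :: ('n, 'k) mpoly"
  obtain cij cik cjk where c: "?x j * b i - ?x i * b j = f * cij" "?x k * b i - ?x i * b k = f * cik"
      "?x k * b j - ?x j * b k = f * cjk"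
    using ov[of i j] ov[of i k] ov[of j k] by (auto elim!: dvdE)
  have "f * (?x k * cij) = ?x k * (?x j * b i - ?x i * b j)" unfolding c by (simp add: mult_ac)
  also have "\<dots> = ?x j * (?x k * b i - ?x i * b k) - ?x i * (?x k * b j - ?x j * b k)" by (simp add: algebra_simps)
  also have "\<dots> = f * (?x i * (- cjk) + ?x j * cik)" unfolding c by (simp add: algebra_simps)
  finally have "?x k * cij = ?x i * (- cjk) + ?x j * cik" using mpoly_cancel[OF _ f] by blast
  from mvar_power_colon[OF ijk(2,3) this] obtain u v where uv: "cij = ?x i * u + ?x j * v" by blast
  have "?x j * b i - ?x i * b j = f * (?x i * u + ?x j * v)" using c(1) uv by simp
  hence eq: "?x j * (b i - f * v) = ?x i * (b j + f * u)" by (simp add: algebra_simps)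
  hence "?x i dvd ?x j * (b i - f * v)" by simp
  from mvar_power_dvd_mult[OF ijk(1) this] obtain a where a: "b i - f * v = ?x i * a" by (auto elim: dvdE)
  have "?x i * (?x j * a) = ?x i * (b j + f * u)" using eq unfolding a by (simp add: mult_ac)
  hence a': "?x j * a = b j + f * u" using mpoly_cancel[OF _ mvar_nonzero] by blast
  have "b i - ?x i * a = f * v" "b j - ?x j * a = f * (- u)" using a a' by (simp_all add: algebra_simps)
  thus ?thesis by (metis dvd_triv_left)
qed

text \<open>Cross multiplying the two quotients and cancelling f gives x_j^M c = x_i^M d. As x_i and
  x_j are coprime, x_i^M divides c, and it cancels.\<close>

lemma dvd_two_variables:
  fixes b :: "('n::finite, 'k::field) mpoly"
  assumes ij: "i \<noteq> j" and f: "f \<noteq> 0" and b: "f dvd mvar i ^ M * b" "f dvd mvar j ^ M * b"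
  shows "f dvd b"
proof -
  obtain c d where c: "mvar i ^ M * b = f * c" "mvar j ^ M * b = f * d" using b by (auto elim!: dvdE)
  have "f * (mvar j ^ M * c) = mvar i ^ M * (mvar j ^ M * b)"
    using c(1) by (metis mult.left_commute)
  also have "\<dots> = f * (mvar i ^ M * d)" unfolding c(2) by (simp add: mult_ac)
  finally have "mvar j ^ M * c = mvar i ^ M * d" using mpoly_cancel[OF _ f] by blast
  hence "mvar i ^ M dvd mvar j ^ M * c" by simp
  from mvar_power_dvd_mult[OF ij this] obtain e where "c = mvar i ^ M * e" by (auto elim: dvdE)
  hence "mvar i ^ M * b = mvar i ^ M * (f * e)" using c(1) by (simp add: mult_ac)
  hence "b = f * e" using mpoly_cancel[OF _ mvar_nonzero] by blast
  thus ?thesis by simp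
qed

context graded_presentation
begin

interpretation F: frac_space p ty f "whom wt" pt "proj_stalk B G" Lo io den frp "wpart wt"
  by (rule frac_space_proj)

text \<open>A prime containing \<open>J\<close> and avoiding \<open>h\<close> is replaced by its
  homogeneous core, which still avoids h because h is homogeneous. The point is admissible because h
  has positive degree.\<close>

lemma point_exists:
  assumes J: "is_ideal J" "f \<in> J" and h: "whom wt e h" "e > 0" "\<And>m. h ^ m \<notin> J"
  shows "\<exists>P\<in>pp. \<kappa> h \<notin> P \<and> (\<forall>g d. whom wt d g \<longrightarrow> g \<in> J \<longrightarrow> \<kappa> g \<in> P)"
proof -
  obtain Q where Q: "is_ideal Q" "J \<subseteq> Q" "h \<notin> Q" "1 \<notin> Q" "\<And>a b. a * b \<in> Q \<Longrightarrow> a \<in> Q \<or> b \<in> Q"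
    using prime_avoiding[OF J(1) h(3)] by blast
  define Qs where "Qs = {g. \<forall>d. wpart wt d g \<in> Q}"
  have Q0: "0 \<in> Q" using Q(1) by (simp add: is_ideal_def)
  have hom: "g \<in> Qs \<longleftrightarrow> g \<in> Q" if "whom wt d g" for g d
    using Q0 by (auto simp: Qs_def wpart_whom[OF that])
  have Qs: "is_ideal Qs" unfolding is_ideal_def
  proof (intro conjI ballI allI)
    show "0 \<in> Qs" using Q0 by (simp add: Qs_def)
    show "a + b \<in> Qs" if "a \<in> Qs" "b \<in> Qs" for a b
      using that Q(1) by (simp add: Qs_def wpart_add is_ideal_def)
    show "a * b \<in> Qs" if "b \<in> Qs" for a b
    proof -
      have "wpart wt d (a * b) \<in> Q" for d
        unfolding wpart_times
        by (rule is_ideal_sum[OF Q(1)]) (use that Q(1) in \<open>simp add: Qs_def is_ideal_def\<close>)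
      thus ?thesis by (simp add: Qs_def)
    qed
  qed
  have fQ: "f \<in> Qs" using hom[OF f_hom] J(2) Q(2) by blast
  define P where "P = \<kappa> ` Qs"
  have mem: "\<kappa> g \<in> P \<longleftrightarrow> g \<in> Qs" for g
  proof
    assume "\<kappa> g \<in> P"
    then obtain g' where g': "g' \<in> Qs" "\<kappa> g = \<kappa> g'" by (auto simp: P_def)
    then obtain c where "g - g' = f * c" unfolding kap_eq_iff by (auto elim: dvdE)
    hence "g = g' + f * c" by (simp add: algebra_simps)
    moreover have "f * c \<in> Qs" by (rule is_ideal_mult2[OF Qs fQ])
    ultimately show "g \<in> Qs" using Qs g'(1) by (simp add: is_ideal_def)
  qed (simp add: P_def)
  have prime: "primeideal P B"
  proof (rule primeidealI)
    show "ideal P B"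
    proof (rule idealI[OF K.S.ring_axioms])
      show "subgroup P (add_monoid B)"
      proof (rule K.S.add.subgroupI)
        show "P \<subseteq> carrier B" using kap_simps(1) by (auto simp: P_def)
        show "P \<noteq> {}" using fQ by (auto simp: P_def)
        fix x y assume "x \<in> P" "y \<in> P"
        then obtain a b where ab: "x = \<kappa> a" "y = \<kappa> b" "a \<in> Qs" "b \<in> Qs" by (auto simp: P_def)
        have "\<kappa> (a + b) \<in> P" "\<kappa> (- a) \<in> P" unfolding mem using ab Qs is_ideal_uminus[OF Qs] by (auto simp: is_ideal_def)
        thus "x \<oplus> y \<in> P" "\<ominus> x \<in> P" by (simp_all add: ab kap_simps)
      qed
      fix a x assume "a \<in> P" "x \<in> carrier B"
      then obtain c where c: "a = \<kappa> c" "c \<in> Qs" by (auto simp: P_def)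
      obtain d where d: "x = \<kappa> d" using kap_surj[OF \<open>x \<in> carrier B\<close>] by blast
      note cd = c d
      have "\<kappa> (d * c) \<in> P" unfolding mem using cd Qs by (simp add: is_ideal_def)
      thus "x \<otimes> a \<in> P" "a \<otimes> x \<in> P" using K.S.m_comm[OF kap_simps(1) kap_simps(1)] by (simp_all add: cd kap_simps)
    qed
    show "cring B" by (rule K.S.is_cring)
    have "\<kappa> 1 \<notin> P" unfolding mem hom[OF whom_1] by (rule Q(4))
    thus "carrier B \<noteq> P" using kap_simps(1) by blast
    fix x y assume xy: "x \<in> carrier B" "y \<in> carrier B" "x \<otimes> y \<in> P"
    obtain a b where ab: "x = \<kappa> a" "y = \<kappa> b" using kap_surj xy by blast
    have "a * b \<in> Qs" using xy(3) unfolding ab by (simp add: mem flip: kap_simps)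
    hence "a \<in> Qs \<or> b \<in> Qs"
      using homogeneous_core_prime[OF Q(1,5), of wt a b] by (simp add: Qs_def)
    thus "x \<in> P \<or> y \<in> P" by (simp add: ab mem)
  qed
  have hP: "\<kappa> h \<notin> P" unfolding mem hom[OF h(1)] by (rule Q(3))
  have "P = Idl\<^bsub>B\<^esub> (P \<inter> (\<Union>d. G d))"
  proof
    interpret P: primeideal P B by (rule prime)
    have sub: "P \<inter> (\<Union>d. G d) \<subseteq> carrier B" using kap_simps(1) by auto
    show "Idl\<^bsub>B\<^esub> (P \<inter> (\<Union>d. G d)) \<subseteq> P" by (rule K.S.genideal_minimal[OF P.is_ideal]) simp
    interpret I: ideal "Idl\<^bsub>B\<^esub> (P \<inter> (\<Union>d. G d))" B by (rule K.S.genideal_ideal[OF sub])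
    show "P \<subseteq> Idl\<^bsub>B\<^esub> (P \<inter> (\<Union>d. G d))"
    proof
      fix x assume "x \<in> P"
      then obtain g where g: "x = \<kappa> g" "g \<in> Qs" by (auto simp: P_def)
      obtain E where E: "finite E" "g = (\<Sum>d\<in>E. wpart wt d g)" using wpart_decompose by blast
      have c: "\<kappa> (wpart wt d g) \<in> Idl\<^bsub>B\<^esub> (P \<inter> (\<Union>d. G d))" for d
      proof -
        have "\<kappa> (wpart wt d g) \<in> P" unfolding mem hom[OF whom_wpart] using g(2) by (simp add: Qs_def)
        moreover have "\<kappa> (wpart wt d g) \<in> G d" using whom_wpart by blast
        ultimately show ?thesis using K.S.genideal_self[OF sub] by blast
      qed
      have "\<kappa> (\<Sum>d\<in>E. wpart wt d g) \<in> Idl\<^bsub>B\<^esub> (P \<inter> (\<Union>d. G d))"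
        using E(1) by (induction E rule: finite_induct) (simp_all add: kap_simps c I.zero_closed I.a_closed)
      thus "x \<in> Idl\<^bsub>B\<^esub> (P \<inter> (\<Union>d. G d))" unfolding g(1) using E(2) by simp
    qed
  qed
  moreover have "\<not> G e \<subseteq> P" using hP h(1) by blast
  ultimately have "P \<in> pp" using prime h(2) unfolding proj_points_def by blast
  moreover have "\<kappa> g \<in> P" if "whom wt d g" "g \<in> J" for g d
    unfolding mem hom[OF that(1)] using that(2) Q(2) by blast
  ultimately show ?thesis using hP by blast
qed

text \<open>Consider the annihilator of z modulo f. If it contained no power of h, there would be a
  point of D_+(h) containing all its homogeneous elements, although one of them is a denominator
  there because z vanishes in the local ring.\<close>

lemma vanish:
  assumes h: "whom wt e h" "e > 0" and z: "\<And>P. P \<in> pp \<Longrightarrow> \<kappa> h \<notin> P \<Longrightarrow> io P z = \<zero>\<^bsub>Lo P\<^esub>"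
  shows "\<exists>N. f dvd h ^ N * z"
proof (rule ccontr)
  assume n: "\<not> ?thesis"
  define J where "J = {g. f dvd g * z}"
  have J: "is_ideal J" "f \<in> J" by (auto simp: J_def is_ideal_def distrib_right mult.assoc)
  have "h ^ m \<notin> J" for m using n by (simp add: J_def)
  from point_exists[OF J h this] obtain P where P: "P \<in> pp" "\<kappa> h \<notin> P" "\<And>g d. whom wt d g \<Longrightarrow> g \<in> J \<Longrightarrow> \<kappa> g \<in> P"
    by blast
  have "P \<in> topspace pt" using P(1) unfolding topspace_pt .
  from F.ker[OF this z[OF P(1,2)]] obtain r where "r \<in> den P" "f dvd r * z" by blast
  thus False using P(3)[of _ r] by (auto simp: J_def)
qed

lemma basis:
  assumes "openin pt W" "P \<in> W"
  shows "\<exists>s d. whom wt d s \<and> \<kappa> s \<notin> P \<and> {Q \<in> pp. \<kappa> s \<notin> Q} \<subseteq> W"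
proof -
  have "generate_topology_on {{P \<in> pp. h \<notin> P} | h. h \<in> (\<Union>d. G d)} W"
    using assms(1) by (rule openin_topology_generated_by)
  thus ?thesis using assms(2)
  proof (induction rule: generate_topology_on.induct)
    case (Int A C)
    then obtain s d s' d' where s: "whom wt d s" "\<kappa> s \<notin> P" "{Q \<in> pp. \<kappa> s \<notin> Q} \<subseteq> A"
      "whom wt d' s'" "\<kappa> s' \<notin> P" "{Q \<in> pp. \<kappa> s' \<notin> Q} \<subseteq> C" by blast
    have "openin pt A" "P \<in> A" using Int by (auto simp: openin_topology_generated_by_iff)
    hence "P \<in> pp" using openin_subset topspace_pt by blast
    hence "\<kappa> (s * s') \<notin> P" using s prime_mult[OF pp_prime] by blast
    moreover have "{Q \<in> pp. \<kappa> (s * s') \<notin> Q} \<subseteq> A \<inter> C" using s(3,6) prime_mult[OF pp_prime] by blast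
    ultimately show ?case using whom_mult[OF s(1,4)] by blast
  next
    case (UN K)
    then obtain A where A: "A \<in> K" "P \<in> A" by blast
    from UN.IH[OF this] show ?case using A(1) by blast
  next
    case (Basis A)
    then obtain h where h: "h \<in> (\<Union>d. G d)" "A = {P \<in> pp. h \<notin> P}" by blast
    then obtain g d where "h = \<kappa> g" "whom wt d g" by blast
    thus ?case using h(2) Basis.prems by blast
  qed simp
qed

lemma prime_pull: "primeideal P B \<Longrightarrow> is_ideal {g. \<kappa> g \<in> P} \<and> \<kappa> f \<in> P"
proof -
  assume P: "primeideal P B"
  interpret primeideal P B by (rule P)
  have "\<kappa> f = \<zero>" unfolding kap_ker by simp
  thus ?thesis using zero_closed a_closed prime_mult[OF P] by (auto simp: is_ideal_def kap_simps(2,5))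
qed

lemma prime_power: "primeideal P B \<Longrightarrow> \<kappa> (a ^ m) \<in> P \<Longrightarrow> \<kappa> a \<in> P"
proof (induction m)
  case (Suc m)
  thus ?case using prime_mult[of P a "a ^ m"] by auto
next
  case 0
  thus ?case using one_notin[of P] by simp
qed

lemma common_exponent:
  assumes "finite A" "\<And>q. q \<in> A \<Longrightarrow> \<exists>N. R q N" "\<And>q N N'. R q N \<Longrightarrow> N \<le> N' \<Longrightarrow> R q (N' :: nat)"
  shows "\<exists>N. \<forall>q\<in>A. R q N"
  using assms(1,2)
proof (induction A rule: finite_induct)
  case (insert a A)
  obtain N where N: "\<forall>q\<in>A. R q N" using insert by auto
  obtain N' where N': "R a N'" using insert.prems by blast
  have "\<forall>q\<in>insert a A. R q (max N N')"
    using assms(3)[OF N', of "max N N'"] assms(3)[of _ N "max N N'"] N by auto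
  thus ?case by blast
qed simp

lemma dvd_power_mono: "f dvd a ^ N * z \<Longrightarrow> N \<le> N' \<Longrightarrow> f dvd a ^ N' * z"
proof -
  assume "f dvd a ^ N * z" "N \<le> N'"
  moreover have "a ^ N' * z = a ^ (N' - N) * (a ^ N * z)"
    using \<open>N \<le> N'\<close> by (simp only: mult.assoc[symmetric] power_add[symmetric]) simp
  ultimately show ?thesis by (simp only: dvd_mult)
qed

text \<open>The sets where a given fraction represents the section \<open>y\<close> cover \<open>D\<^sub>+(x)\<close>, so finitely many of their equations generate an ideal that
  contains a power of \<open>x\<close>; after raising them to a common power the numerators are compatible.\<close>

lemma denominator_power:
  assumes x: "whom wt e x" "e > 0"
    and y: "\<And>P. P \<in> pp \<Longrightarrow> \<kappa> x \<notin> P \<Longrightarrow> \<exists>W b h. openin pt W \<and> P \<in> W \<and> (\<forall>Q\<in>W. F.isf Q (y Q) b h)"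
  shows "\<exists>M b. \<forall>Q\<in>pp. \<kappa> x \<notin> Q \<longrightarrow> F.isf Q (y Q) b (x ^ M)"
proof -
  have top: "Q \<in> topspace pt" if "Q \<in> pp" for Q using that unfolding topspace_pt .
  \<comment> \<open>Pairs of numerator and denominator that represent y on all of D_+(denominator),
    a set contained in D_+(x).\<close>
  define H where "H = {u. (\<exists>d>0. whom wt d (snd u)) \<and> (\<forall>Q\<in>pp. \<kappa> (snd u) \<notin> Q \<longrightarrow> \<kappa> x \<notin> Q \<and> F.isf Q (y Q) (fst u) (snd u))}"
  define span where "span = (\<lambda>(H :: (('n, 'k) mpoly \<times> ('n, 'k) mpoly) set) (h :: ('n, 'k) mpoly \<times> ('n, 'k) mpoly \<Rightarrow> ('n, 'k) mpoly). {g. \<exists>E c c0. finite E \<and> E \<subseteq> H \<and> g = c0 * f + (\<Sum>u\<in>E. c u * h u)})"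
  have span: "is_ideal (span A h)" for A h unfolding span_def by (rule is_ideal_span)
  have f_span: "f \<in> span A h" for A h
    unfolding span_def by (intro CollectI exI[of _ "{}"] exI[of _ "\<lambda>u. 0"] exI[of _ 1]) simp
  have gen_span: "h u \<in> span A h" if "u \<in> A" for u A h
    unfolding span_def by (intro CollectI exI[of _ "{u}"] exI[of _ "\<lambda>u. 1"] exI[of _ 0]) (use that in simp)
  have span_prime: "\<kappa> g \<in> P" if g: "g \<in> span A h" and P: "P \<in> pp" "\<And>u. u \<in> A \<Longrightarrow> \<kappa> (h u) \<in> P" for g A h P
  proof -
    obtain E c c0 where E: "E \<subseteq> A" "g = c0 * f + (\<Sum>u\<in>E. c u * h u)" using g unfolding span_def by blast
    note I = prime_pull[OF pp_prime[OF P(1)]]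
    have "(\<Sum>u\<in>E. c u * h u) \<in> {g. \<kappa> g \<in> P}"
      by (rule is_ideal_sum[OF conjunct1[OF I]]) (use P(2) E(1) I in \<open>auto simp: is_ideal_def\<close>)
    moreover have "c0 * f \<in> {g. \<kappa> g \<in> P}" using I by (simp add: is_ideal_def)
    ultimately have "c0 * f + (\<Sum>u\<in>E. c u * h u) \<in> {g. \<kappa> g \<in> P}" using I unfolding is_ideal_def by blast
    thus ?thesis unfolding E(2) by simp
  qed
  have "\<exists>M. x ^ M \<in> span H snd"
  proof (rule ccontr)
    assume "\<not> ?thesis"
    hence "x ^ M \<notin> span H snd" for M by blast
    from point_exists[OF span f_span x this] obtain P where P: "P \<in> pp" "\<kappa> x \<notin> P"
      "\<And>g d. whom wt d g \<Longrightarrow> g \<in> span H snd \<Longrightarrow> \<kappa> g \<in> P" by blast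
    obtain W b h where W: "openin pt W" "P \<in> W" "\<And>Q. Q \<in> W \<Longrightarrow> F.isf Q (y Q) b h" using y[OF P(1,2)] by blast
    obtain s d where s: "whom wt d s" "\<kappa> s \<notin> P" "{Q \<in> pp. \<kappa> s \<notin> Q} \<subseteq> W" using basis[OF W(1,2)] by blast
    obtain d' where h: "whom wt d' h" "\<kappa> h \<notin> P" using W(3)[OF W(2)] by (auto simp: F.isf_def)
    \<comment> \<open>The factor s restricts the fraction to D_+(s) inside W; the factor x places it
      inside D_+(x) and makes the degree positive.\<close>
    have "(b * (s * x), h * (s * x)) \<in> H" unfolding H_def
    proof (intro CollectI conjI ballI impI)
      show "\<exists>d>0. whom wt d (snd (b * (s * x), h * (s * x)))"
        using whom_mult[OF h(1) whom_mult[OF s(1) x(1)]] x(2) by (intro exI[of _ "d' + (d + e)"]) simp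
      fix Q assume Q: "Q \<in> pp" "\<kappa> (snd (b * (s * x), h * (s * x))) \<notin> Q"
      hence n: "\<kappa> s \<notin> Q" "\<kappa> x \<notin> Q" using prime_mult[OF pp_prime[OF Q(1)]] by auto
      thus "\<kappa> x \<notin> Q" by simp
      have "Q \<in> W" using n s(3) Q(1) by blast
      moreover have "s * x \<in> den Q" using n prime_mult[OF pp_prime[OF Q(1)]] whom_mult[OF s(1) x(1)] by blast
      ultimately show "F.isf Q (y Q) (fst (b * (s * x), h * (s * x))) (snd (b * (s * x), h * (s * x)))"
        using F.isf_scale[OF top[OF Q(1)] W(3)] by simp
    qed
    from gen_span[OF this, of snd] have "h * (s * x) \<in> span H snd" by simp
    hence "\<kappa> (h * (s * x)) \<in> P" by (rule P(3)[OF whom_mult[OF h(1) whom_mult[OF s(1) x(1)]]])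
    thus False using prime_mult[OF pp_prime[OF P(1)]] P(2) s(2) h(2) by blast
  qed
  then obtain M E c c0 where E: "finite E" "E \<subseteq> H" "x ^ M = c0 * f + (\<Sum>u\<in>E. c u * snd u)"
    unfolding span_def by blast
  have "x ^ M \<in> span E snd" unfolding span_def using E by blast
  hence cover: "\<kappa> x \<in> P" if "P \<in> pp" "\<And>u. u \<in> E \<Longrightarrow> \<kappa> (snd u) \<in> P" for P
    using span_prime[of "x ^ M" E snd P] that prime_power[OF pp_prime] by blast
  have rep: "F.isf Q (y Q) (fst u) (snd u)" if "u \<in> E" "Q \<in> pp" "\<kappa> (snd u) \<notin> Q" for u Q
    using E(2) that unfolding H_def by blast
  have deg: "\<exists>d>0. whom wt d (snd u)" if "u \<in> E" for u using E(2) that unfolding H_def by blast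
  have "\<exists>N. f dvd (snd u * snd v) ^ N * (snd v * fst u - snd u * fst v)" if uv: "u \<in> E" "v \<in> E" for u v
  proof -
    obtain d d' where d: "d > 0" "whom wt d (snd u)" "whom wt d' (snd v)" using deg uv by blast
    have z: "io P (snd v * fst u - snd u * fst v) = \<zero>\<^bsub>Lo P\<^esub>" if P: "P \<in> pp" "\<kappa> (snd u * snd v) \<notin> P" for P
    proof -
      have n: "\<kappa> (snd u) \<notin> P" "\<kappa> (snd v) \<notin> P" using P prime_mult[OF pp_prime] by blast+
      hence D: "snd u \<in> den P" "snd v \<in> den P" using d by blast+
      note i = F.isf_scale[OF top[OF P(1)] rep[OF uv(1) P(1) n(1)] D(2)] F.isf_scale[OF top[OF P(1)] rep[OF uv(2) P(1) n(2)] D(1)]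
      have "io P (fst u * snd v) = io P (fst v * snd u)"
        using i unfolding F.isf_def mult.commute[of "snd v" "snd u"] by metis
      hence eq: "io P (snd v * fst u) = io P (snd u * fst v)" by (simp only: mult.commute)
      interpret Lc: cring "Lo P" by (rule F.L_cring[OF top[OF P(1)]])
      show ?thesis unfolding diff_conv_add_uminus F.iota_simps(2,7)[OF top[OF P(1)]] eq
        by (rule Lc.r_neg[OF F.iota_simps(1)[OF top[OF P(1)]]])
    qed
    show ?thesis by (rule vanish[OF whom_mult[OF d(2,3)] _ z]) (use d(1) in simp)
  qed
  hence "\<exists>N. \<forall>q\<in>E \<times> E. f dvd (snd (fst q) * snd (snd q)) ^ N * (snd (snd q) * fst (fst q) - snd (fst q) * fst (snd q))"
    using E(1) by (intro common_exponent) (auto intro: dvd_power_mono)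
  then obtain N where N: "\<And>u v. u \<in> E \<Longrightarrow> v \<in> E \<Longrightarrow> f dvd (snd u * snd v) ^ N * (snd v * fst u - snd u * fst v)"
    by (metis fst_conv mem_Sigma_iff snd_conv)
  \<comment> \<open>Two fractions agree modulo f after multiplication by the N-th power of both
    denominators. Expanding each by the N-th power of its own denominator absorbs this
    factor.\<close>
  define b' h' where "b' = (\<lambda>u. fst u * snd u ^ N :: ('n, 'k) mpoly)" and "h' = (\<lambda>u :: ('n, 'k) mpoly \<times> ('n, 'k) mpoly. snd u ^ Suc N)"
  have comp: "f dvd b' u * h' v - b' v * h' u" if "u \<in> E" "v \<in> E" for u v
  proof -
    have "b' u * h' v - b' v * h' u = (snd u * snd v) ^ N * (snd v * fst u - snd u * fst v)"
      by (simp add: b'_def h'_def power_mult_distrib algebra_simps)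
    thus ?thesis using N[OF that] by simp
  qed
  have "\<exists>M. x ^ M \<in> span E h'"
  proof (rule ccontr)
    assume "\<not> ?thesis"
    hence "x ^ M \<notin> span E h'" for M by blast
    from point_exists[OF span f_span x this] obtain P where P: "P \<in> pp" "\<kappa> x \<notin> P"
      "\<And>g d. whom wt d g \<Longrightarrow> g \<in> span E h' \<Longrightarrow> \<kappa> g \<in> P" by blast
    have "\<kappa> (snd u) \<in> P" if u: "u \<in> E" for u
    proof -
      obtain d where "whom wt d (snd u)" using deg[OF u] by blast
      hence "whom wt (Suc N * d) (h' u)" unfolding h'_def by (rule whom_power)
      hence "\<kappa> (snd u ^ Suc N) \<in> P" using P(3) gen_span[OF u, of h'] unfolding h'_def by blast
      thus ?thesis by (rule prime_power[OF pp_prime[OF P(1)]])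
    qed
    thus False using cover[OF P(1)] P(2) by blast
  qed
  then obtain M' E' c' c0' where E': "finite E'" "E' \<subseteq> E" "x ^ M' = c0' * f + (\<Sum>u\<in>E'. c' u * h' u)"
    unfolding span_def by blast
  \<comment> \<open>A partition of unity: modulo f a power of x is a combination of the
    denominators, and the same coefficients combine the numerators.\<close>
  define b where "b = (\<Sum>u\<in>E'. c' u * b' u)"
  have "F.isf Q (y Q) b (x ^ M')" if Q: "Q \<in> pp" "\<kappa> x \<notin> Q" for Q
  proof -
    obtain u where u: "u \<in> E" "\<kappa> (snd u) \<notin> Q" using cover[OF Q(1)] Q(2) by blast
    have "snd u \<in> den Q" using deg[OF u(1)] u(2) by blast
    hence "snd u ^ N \<in> den Q" by (rule F.Dn_power[OF top[OF Q(1)]])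
    from F.isf_scale[OF top[OF Q(1)] rep[OF u(1) Q(1) u(2)] this]
    have i: "F.isf Q (y Q) (b' u) (h' u)" by (simp add: b'_def h'_def)
    have "x \<in> den Q" using x(1) Q(2) by blast
    hence "x ^ M' \<in> den Q" by (rule F.Dn_power[OF top[OF Q(1)]])
    note i' = F.isf_fracv[OF top[OF Q(1)] this, of b]
    have "b' u * x ^ M' - b * h' u = f * (c0' * b' u) + (\<Sum>v\<in>E'. c' v * (b' u * h' v - b' v * h' u))"
      by (simp add: E'(3) b_def distrib_left sum_distrib_left sum_distrib_right right_diff_distrib sum_subtractf mult_ac)
    moreover have "f dvd (\<Sum>v\<in>E'. c' v * (b' u * h' v - b' v * h' u))"
      by (intro dvd_sum dvd_mult comp[OF u(1)]) (rule subsetD[OF E'(2)])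
    ultimately have "f dvd 1 * (b' u * x ^ M') - 1 * (b * h' u)" by simp
    from F.isf_eqI[OF top[OF Q(1)] i i' F.Dn_1[OF top[OF Q(1)]] this] show ?thesis using i' by simp
  qed
  thus ?thesis by blast
qed

end

section \<open>Gluing over the standard open sets\<close>

context graded_presentation
begin

theorem not_subset_if_quasi_F_split_Proj:
  assumes n: "n \<ge> 1" and qf: "quasi_F_split p n (Proj B G)" and card: "CARD('n) \<ge> 3"
  shows "\<not> I_seq p f n \<subseteq> frob_power p max_ideal"
proof -
  obtain S :: "'n set" where "card S = 3" using obtain_subset_with_card_n[OF card] by blast
  then obtain i j k :: 'n where ijk: "i \<noteq> j" "i \<noteq> k" "j \<noteq> k" by (auto simp: card_3_iff)
  obtain \<psi> where psi: "witt_module_hom p n (function_sheaf pt (proj_stalk B G) frp) \<psi>"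
    "\<And>V s. openin pt V \<Longrightarrow> s \<in> carrier (witt_ring p n (sheaf (function_sheaf pt (proj_stalk B G) frp) V)) \<Longrightarrow>
      \<psi> V (witt_frob p n (sheaf (function_sheaf pt (proj_stalk B G) frp) V) s) = witt_res s"
    using qf unfolding quasi_F_split_def Proj_eq by (auto simp: function_sheaf_def)
  interpret F: frac_split p ty f "whom wt" pt "proj_stalk B G" Lo io den frp "wpart wt" n \<psi>
    by (intro frac_split.intro frac_split_axioms.intro frac_space_proj n psi)
  have top: "Q \<in> topspace pt" if "Q \<in> pp" for Q using that unfolding topspace_pt .
  define x where "x = (\<lambda>r. mvar r :: ('n, 'k) mpoly)"
  define V where "V = (\<lambda>r. {P \<in> pp. \<kappa> (x r) \<notin> P})"
  have x1: "whom wt 1 (x r)" for r unfolding x_def mvar_def by (intro whom_single) (simp add: wt_1)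
  have xd: "whom wt d (x r ^ d)" for r d using whom_power[OF x1, of d r] by simp
  have V: "openin pt (V r)" for r unfolding V_def
    by (rule topology_generated_by_Basis) (use x1 in blast)
  have Vpp: "Q \<in> pp" if "Q \<in> V r" for Q r using that by (simp add: V_def)
  have xD: "x r ^ d \<in> den Q" if "Q \<in> V r" for r d Q
    using that xd prime_power[OF pp_prime[OF Vpp[OF that]]] unfolding V_def by blast
  have adm: "F.adm W d w (x r ^ d)" if "openin pt W" "W \<subseteq> V r" "witt_graded wt (d * p) w" for W d w r
    unfolding F.adm_def
  proof (intro conjI ballI allI that(1) xd)
    show "x r ^ d \<in> den P" if "P \<in> W" for P using xD that \<open>W \<subseteq> V r\<close> by blast
    show "whom wt (d * p ^ Suc m) (wcomp w m)" for m
      using that(3) by (simp add: witt_graded_def wchar_p mult.assoc)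
  qed
  define y where "y = (\<lambda>r d w. F.pv (V r) w (x r ^ d))"
  have adV: "F.adm (V r) d w (x r ^ d)" if "witt_graded wt (d * p) w" for d w r
    by (rule adm[OF V order_refl that])
  have overlap: "y r d w Q = y s d w Q" if w: "witt_graded wt (d * p) w" and Q: "Q \<in> V r" "Q \<in> V s" for r s d w Q
  proof -
    have W: "openin pt (V r \<inter> V s)" using V by (rule openin_Int[OF V])
    have "y r d w Q = F.pv (V r \<inter> V s) w (x r ^ d) Q"
      unfolding y_def using Q by (intro F.pv_restr[symmetric, OF adV[OF w] W]) auto
    also have "\<dots> = F.pv (V r \<inter> V s) w (x s ^ d) Q"
      using Q by (intro F.pv_change[OF adm[OF W _ w] adm[OF W _ w]]) auto
    also have "\<dots> = y s d w Q"
      unfolding y_def using Q by (intro F.pv_restr[OF adV[OF w] W]) auto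
    finally show ?thesis .
  qed
  \<comment> \<open>Two charts determine \<open>a\<close> modulo f, by
    \<open>dvd_two_variables\<close>; the third variable is used to construct it.\<close>
  define val where "val = (\<lambda>d w a. \<forall>r\<in>{i, j}. \<forall>Q\<in>V r. io Q a = y r d w Q)"
  have y_closed: "y r d w Q \<in> carrier (Lo Q)" if "witt_graded wt (d * p) w" "Q \<in> V r" for r d w Q
    unfolding y_def by (rule F.pv_closed[OF adV[OF that(1)] that(2)])
  have io0: "io Q (a - b) = \<zero>\<^bsub>Lo Q\<^esub>" if "Q \<in> pp" "io Q a = io Q b" for Q a b
  proof -
    interpret Lc: cring "Lo Q" by (rule F.L_cring[OF top[OF that(1)]])
    show ?thesis unfolding diff_conv_add_uminus F.iota_simps(2,7)[OF top[OF that(1)]] that(2)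
      by (rule Lc.r_neg[OF F.iota_simps(1)[OF top[OF that(1)]]])
  qed
  have val_ex: "\<exists>a. val d w a" if w: "witt_graded wt (d * p) w" for d w
  proof -
    have "\<exists>M b. \<forall>Q\<in>pp. \<kappa> (x r) \<notin> Q \<longrightarrow> F.isf Q (y r d w Q) b (x r ^ M)" for r
    proof (rule denominator_power[OF x1])
      fix P assume "P \<in> pp" "\<kappa> (x r) \<notin> P"
      hence "P \<in> V r" by (simp add: V_def)
      from F.pv_frac[OF adV[OF w] this] show "\<exists>W b h. openin pt W \<and> P \<in> W \<and> (\<forall>Q\<in>W. F.isf Q (y r d w Q) b h)"
        unfolding y_def by blast
    qed simp
    hence "\<exists>u. \<forall>Q\<in>V r. F.isf Q (y r d w Q) (snd u) (x r ^ fst u)" for r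
      unfolding V_def by fastforce
    from choice[OF allI[OF this]] obtain u where "\<forall>r. \<forall>Q\<in>V r. F.isf Q (y r d w Q) (snd (u r)) (x r ^ fst (u r))" ..
    moreover define M b where "M = (\<lambda>r. fst (u r))" and "b = (\<lambda>r. snd (u r))"
    ultimately have Mb: "F.isf Q (y r d w Q) (b r) (x r ^ M r)" if "Q \<in> V r" for r Q
      using that by simp
    define M1 where "M1 = M i + M j + M k"
    define b1 where "b1 = (\<lambda>r. b r * x r ^ (M1 - M r))"
    have isf1: "F.isf Q (y r d w Q) (b1 r) (x r ^ M1)" if "r \<in> {i, j, k}" "Q \<in> V r" for r Q
    proof -
      have "M1 = M r + (M1 - M r)" using that(1) by (auto simp: M1_def)
      hence e: "x r ^ M1 = x r ^ M r * x r ^ (M1 - M r)" by (metis power_add)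
      show ?thesis unfolding b1_def e by (rule F.isf_scale[OF top[OF Vpp[OF that(2)]] Mb[OF that(2)] xD[OF that(2)]])
    qed
    have "\<exists>N. f dvd (x r * x s) ^ N * (x s ^ M1 * b1 r - x r ^ M1 * b1 s)" if rs: "r \<in> {i, j, k}" "s \<in> {i, j, k}" for r s
    proof (rule vanish[OF whom_mult[OF x1 x1]])
      fix P assume P: "P \<in> pp" "\<kappa> (x r * x s) \<notin> P"
      hence PV: "P \<in> V r" "P \<in> V s" using prime_mult[OF pp_prime[OF P(1)]] by (auto simp: V_def)
      note i1 = F.isf_scale[OF top[OF P(1)] isf1[OF rs(1) PV(1)] xD[OF PV(2), of M1]]
        F.isf_scale[OF top[OF P(1)] isf1[OF rs(2) PV(2)] xD[OF PV(1), of M1]]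
      have "io P (b1 r * x s ^ M1) = y r d w P \<otimes>\<^bsub>Lo P\<^esub> io P (x r ^ M1 * x s ^ M1)"
        using i1(1) unfolding F.isf_def by simp
      also have "\<dots> = io P (b1 s * x r ^ M1)"
        using i1(2) unfolding F.isf_def overlap[OF w PV] mult.commute[of "x r ^ M1" "x s ^ M1"] by simp
      finally have "io P (b1 r * x s ^ M1) = io P (b1 s * x r ^ M1)" .
      hence "io P (x s ^ M1 * b1 r) = io P (x r ^ M1 * b1 s)" by (simp only: mult.commute)
      thus "io P (x s ^ M1 * b1 r - x r ^ M1 * b1 s) = \<zero>\<^bsub>Lo P\<^esub>" by (rule io0[OF P(1)])
    qed simp
    hence "\<exists>N. \<forall>q\<in>{i, j, k} \<times> {i, j, k}. f dvd (x (fst q) * x (snd q)) ^ N * (x (snd q) ^ M1 * b1 (fst q) - x (fst q) ^ M1 * b1 (snd q))"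
      by (intro common_exponent) (auto intro: dvd_power_mono)
    then obtain N where N: "\<And>r s. r \<in> {i, j, k} \<Longrightarrow> s \<in> {i, j, k} \<Longrightarrow> f dvd (x r * x s) ^ N * (x s ^ M1 * b1 r - x r ^ M1 * b1 s)"
      by (metis fst_conv mem_Sigma_iff snd_conv)
    \<comment> \<open>Expanding each numerator by x_r^N absorbs the factor (x_r x_s)^N, so the
      numerators become compatible modulo f over the common exponent M1 + N.\<close>
    define b2 where "b2 = (\<lambda>r. b1 r * x r ^ N)"
    have "f dvd mvar s ^ (M1 + N) * b2 r - mvar r ^ (M1 + N) * b2 s" if "r \<in> {i, j, k}" "s \<in> {i, j, k}" for r s
    proof -
      have "x s ^ (M1 + N) * b2 r - x r ^ (M1 + N) * b2 s = (x r * x s) ^ N * (x s ^ M1 * b1 r - x r ^ M1 * b1 s)"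
        by (simp add: b2_def power_add power_mult_distrib algebra_simps)
      thus ?thesis using N[OF that] by (simp add: x_def)
    qed
    from glue_three[OF ijk f_nonzero this] obtain a where
      a: "f dvd b2 i - x i ^ (M1 + N) * a" "f dvd b2 j - x j ^ (M1 + N) * a" unfolding x_def by blast
    have "io Q a = y r d w Q" if r: "r \<in> {i, j}" and Q: "Q \<in> V r" for r Q
    proof -
      note tQ = top[OF Vpp[OF Q]]
      have "F.isf Q (y r d w Q) (b2 r) (x r ^ (M1 + N))"
        unfolding b2_def power_add using r by (intro F.isf_scale[OF tQ isf1[OF _ Q] xD[OF Q]]) auto
      hence "y r d w Q \<otimes>\<^bsub>Lo Q\<^esub> io Q (x r ^ (M1 + N)) = io Q (b2 r)" by (simp add: F.isf_def)
      also have "\<dots> = io Q (a * x r ^ (M1 + N))"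
        using r a by (intro F.iota_dvd[OF tQ]) (auto simp: mult.commute)
      also have "\<dots> = io Q a \<otimes>\<^bsub>Lo Q\<^esub> io Q (x r ^ (M1 + N))" by (rule F.iota_simps(3)[OF tQ])
      finally show ?thesis
        by (rule F.cancel[OF tQ xD[OF Q] y_closed[OF w Q] F.iota_simps(1)[OF tQ], symmetric])
    qed
    thus ?thesis unfolding val_def by blast
  qed
  have val_uniq: "\<kappa> a = \<kappa> b" if "val d w a" "val d w b" for d w a b
  proof -
    have "\<exists>N. f dvd x r ^ N * (a - b)" if "r \<in> {i, j}" for r
    proof (rule vanish[OF x1])
      fix P assume P: "P \<in> pp" "\<kappa> (x r) \<notin> P"
      hence "P \<in> V r" by (simp add: V_def)
      thus "io P (a - b) = \<zero>\<^bsub>Lo P\<^esub>"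
        using \<open>val d w a\<close> \<open>val d w b\<close> that by (intro io0[OF P(1)]) (simp only: val_def)
    qed simp
    hence "\<exists>N. \<forall>r\<in>{i, j}. f dvd x r ^ N * (a - b)"
      by (intro common_exponent) (auto intro: dvd_power_mono)
    then obtain N where "f dvd x i ^ N * (a - b)" "f dvd x j ^ N * (a - b)" by blast
    thus ?thesis unfolding kap_eq_iff x_def by (rule dvd_two_variables[OF ijk(1) f_nonzero])
  qed
  define \<nu> where "\<nu> = (\<lambda>d w. \<kappa> (SOME a. val d w a))"
  have nu: "\<nu> d w = \<kappa> a" if "val d w a" for d w a
    unfolding \<nu>_def by (rule val_uniq[OF someI[of "val d w", OF that] that])
  have nu_ex: "\<exists>a. val d w a \<and> \<nu> d w = \<kappa> a" if "witt_graded wt (d * p) w" for d w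
    using val_ex[OF that] nu by blast
  have io: "io Q (a + b) = io Q a \<oplus>\<^bsub>Lo Q\<^esub> io Q b" "io Q (a * b) = io Q a \<otimes>\<^bsub>Lo Q\<^esub> io Q b"
    "io Q 1 = \<one>\<^bsub>Lo Q\<^esub>" if "Q \<in> V r" for Q r a b
    using F.iota_simps(2-4)[OF top[OF Vpp[OF that]]] by auto
  have "graded_functional p f B \<kappa> wt \<delta> n \<nu>"
  proof (intro graded_functional.intro frac_target.intro frac_target_axioms.intro graded_functional_axioms.intro
      hypersurface_axioms K.S.is_cring kap_simps n f_hom)
    show "\<kappa> f = \<zero>" unfolding kap_ker by simp
    have one: "lookup 1 (0 :: 'n \<Rightarrow>\<^sub>0 nat) \<noteq> (0 :: 'k)" by simp
    show "\<exists>t a. lookup t 0 \<noteq> 0 \<and> \<kappa> t \<otimes> z = \<kappa> a" if z: "z \<in> carrier B" for z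
    proof -
      have "\<kappa> 1 \<otimes> z = z" using z by (simp add: kap_simps)
      thus ?thesis using kap_surj[OF z] one by metis
    qed
    show "\<exists>t. lookup t 0 \<noteq> 0 \<and> f dvd t * a" if "\<kappa> a = \<zero>" for a
      using that one unfolding kap_ker by (metis mult_1)
    show "\<nu> d w \<in> carrier B" for d w unfolding \<nu>_def by (rule kap_simps(1))
    show "\<nu> d (w + z) = \<nu> d w \<oplus> \<nu> d z" if w: "witt_graded wt (d * p) w" and z: "witt_graded wt (d * p) z" for d w z
    proof -
      obtain a b where ab: "val d w a" "\<nu> d w = \<kappa> a" "val d z b" "\<nu> d z = \<kappa> b" using nu_ex[OF w] nu_ex[OF z] by blast
      have "val d (w + z) (a + b)" unfolding val_def
      proof (intro ballI)
        fix r Q assume r: "r \<in> {i, j}" "Q \<in> V r"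
        have "io Q a = y r d w Q" "io Q b = y r d z Q" using ab(1,3) r by (simp_all only: val_def)
        thus "io Q (a + b) = y r d (w + z) Q"
          unfolding io(1)[OF r(2)] y_def F.pv_add[OF adV[OF w] adV[OF z] r(2)] by simp
      qed
      thus ?thesis by (simp only: nu ab kap_simps)
    qed
    show "\<nu> (e + d) (teich (c ^ p) * w) = \<kappa> c \<otimes> \<nu> d w" if c: "whom wt e c" and w: "witt_graded wt (d * p) w" for e c d w
    proof -
      obtain a where a: "val d w a" "\<nu> d w = \<kappa> a" using nu_ex[OF w] by blast
      have "val (e + d) (teich (c ^ p) * w) (c * a)" unfolding val_def
      proof (intro ballI)
        fix r Q assume r: "r \<in> {i, j}" "Q \<in> V r"
        have "io Q a = y r d w Q" using a(1) r by (simp only: val_def)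
        moreover have "F.pv (V r) (teich (c ^ p) * w) (x r ^ e * x r ^ d) Q = io Q c \<otimes>\<^bsub>Lo Q\<^esub> F.pv (V r) w (x r ^ d) Q"
          by (rule F.pv_scale[OF adV[OF w] c xd _ r(2)]) (rule xD)
        ultimately show "io Q (c * a) = y r (e + d) (teich (c ^ p) * w) Q"
          unfolding io(2)[OF r(2)] y_def power_add by simp
      qed
      thus ?thesis by (simp only: nu a kap_simps)
    qed
    show "\<nu> d w = \<nu> d z" if w: "witt_graded wt (d * p) w" and z: "witt_graded wt (d * p) z"
      and fd: "\<And>m. m < n \<Longrightarrow> f dvd wcomp w m - wcomp z m" for d w z
    proof -
      have "y r d w = y r d z" for r unfolding y_def using F.pv_cong[OF adV[OF w] adV[OF z] fd] by blast
      thus ?thesis by (simp add: \<nu>_def val_def)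
    qed
    have "val 0 1 1" unfolding val_def
    proof (intro ballI)
      fix r Q assume r: "r \<in> {i, j}" "Q \<in> V r"
      show "io Q 1 = y r 0 1 Q" unfolding io(3)[OF r(2)] y_def power_0 F.pv_one[OF V r(2)] ..
    qed
    thus "\<nu> 0 1 = \<one>" by (simp only: nu kap_simps)
  qed (rule wt_1)?
  then interpret N: graded_functional p ty f B \<kappa> wt \<delta> n \<nu> .
  show ?thesis by (rule N.not_subset)
qed

end

lemma whom_homogeneous: "whom (\<lambda>_. 1) d g \<longleftrightarrow> homogeneous d g"
  by (simp add: whom_def homogeneous_def wdeg_superset[of UNIV])

context hypersurface
begin

lemma graded_presentation_graded_quotient:
  assumes "homogeneous \<delta> f"
  shows "graded_presentation p f (graded_quotient f) (\<lambda>a. PIdl\<^bsub>S_ring\<^esub> f +>\<^bsub>S_ring\<^esub> a) (\<lambda>_. 1) \<delta>"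
proof -
  interpret S: cring "S_ring :: ('n, 'k) mpoly ring" by (rule cring_from_type_algebra)
  interpret I: ideal "PIdl\<^bsub>S_ring\<^esub> f" "S_ring :: ('n, 'k) mpoly ring" by (rule S.cgenideal_ideal) simp
  interpret Q: ring_hom_cring S_ring "graded_quotient f" "\<lambda>a. PIdl\<^bsub>S_ring\<^esub> f +>\<^bsub>S_ring\<^esub> a"
    unfolding graded_quotient_def by (rule I.rcos_ring_hom_cring[OF S.is_cring])
  show ?thesis
  proof (intro graded_presentation.intro graded_presentation_axioms.intro hypersurface_axioms Q.ring_hom_cring_axioms)
    show "whom (\<lambda>_. 1) \<delta> f" unfolding whom_homogeneous by (rule assms)
    show "\<exists>a. y = PIdl\<^bsub>S_ring\<^esub> f +>\<^bsub>S_ring\<^esub> a" if "y \<in> carrier (graded_quotient f)" for y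
      using that unfolding graded_quotient_def by (rule FactRing_carrierE) blast
    have z: "\<zero>\<^bsub>graded_quotient f\<^esub> = PIdl\<^bsub>S_ring\<^esub> f"
      unfolding graded_quotient_def FactRing_def by (simp only: ring.select_convs)
    show "PIdl\<^bsub>S_ring\<^esub> f +>\<^bsub>S_ring\<^esub> a = \<zero>\<^bsub>graded_quotient f\<^esub> \<longleftrightarrow> f dvd a" for a
    proof -
      have "PIdl\<^bsub>S_ring\<^esub> f +>\<^bsub>S_ring\<^esub> a = PIdl\<^bsub>S_ring\<^esub> f \<longleftrightarrow> a \<in> PIdl\<^bsub>S_ring\<^esub> f"
        using I.rcos_const_imp_mem[of a] I.a_rcos_const[of a] by auto
      thus ?thesis unfolding z by (simp add: PIdl_ring_of_type)
    qed
  qed simp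
qed

theorem quasi_F_split_graded_iff:
  assumes "homogeneous \<delta> f" "CARD('n) \<ge> 3" "n \<ge> 1"
  shows "quasi_F_split p n (Proj (graded_quotient f) (quotient_grading f)) \<longleftrightarrow> \<not> I_seq p f n \<subseteq> frob_power p max_ideal"
proof -
  interpret P: graded_presentation p ty f "graded_quotient f" "\<lambda>a. PIdl\<^bsub>S_ring\<^esub> f +>\<^bsub>S_ring\<^esub> a" "\<lambda>_. 1" \<delta>
    by (rule graded_presentation_graded_quotient[OF assms(1)])
  have "quotient_grading f = P.G" unfolding quotient_grading_def whom_homogeneous ..
  thus ?thesis
    using P.quasi_F_split_Proj[OF assms(3)] P.not_subset_if_quasi_F_split_Proj[OF assms(3) _ assms(2)] by metis
qed

lemma ht_eq:
  assumes "\<And>n. n \<ge> 1 \<Longrightarrow> quasi_F_split p n Z \<longleftrightarrow> \<not> I_seq p f n \<subseteq> frob_power p max_ideal"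
  shows "ht p Z = I_height p f"
  unfolding ht_def I_height_def using assms by (intro arg_cong[where f = Inf] Collect_cong) blast

end

theorem theorem1:
  fixes p :: nat and f :: "('n::finite, 'k::field) mpoly"
  assumes "CHAR('k) = p" and "p > 0"
    and "surj (\<lambda>c::'k. c ^ p)"
    and "f \<in> max_ideal" and "f \<noteq> 0"
  shows "ht p (Spec (local_quotient f)) = I_height p f \<and>
    ((\<exists>d. homogeneous d f) \<and> CARD('n) \<ge> 3 \<longrightarrow>
      ht p (Proj (graded_quotient f) (quotient_grading f)) = I_height p f)"
proof -
  interpret hypersurface p "TYPE('n \<times> 'k)" f
    by unfold_locales (use assms in \<open>simp_all add: max_ideal_eq\<close>)
  show ?thesis
  proof (intro conjI impI)
    show "ht p (Spec (local_quotient f)) = I_height p f"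
      by (rule ht_eq[OF quasi_F_split_local_iff])
    assume "(\<exists>d. homogeneous d f) \<and> CARD('n) \<ge> 3"
    then obtain d where d: "homogeneous d f" "CARD('n) \<ge> 3" by blast
    show "ht p (Proj (graded_quotient f) (quotient_grading f)) = I_height p f"
      by (rule ht_eq[OF quasi_F_split_graded_iff[OF d]])
  qed
qed

end
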